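(* Let $T>0$, $d\ge 1$, let $g:\mathbb{R}^d\to[0,1]$ be a measurable function and let $(\mu_n)_{n\ge1}$ be a sequence of probability measures on $\Omega=\{0,1\}^{\mathbb{Z}^d}$ associated to the profile $g$. Let $R_0:=([1,\infty)\times\{2\})\cup((1,\infty)\times(2,\infty))$, and let $\kappa_\gamma:=c_2/d$ if $\gamma=2$ and $\kappa_\gamma:=\sigma^2/(2d)$ if $\gamma>2$. Assume that either (i) $(\alpha,\beta)=(1,0)$ and $\gamma\ge2$; or (ii) $\alpha>0$ and $(\beta,\gamma)\in R_0$. Then, for every $t\in[0,T]$, every continuous compactly supported $G:\mathbb{R}^d\to\mathbb{R}$ and every $\delta>0$, $$\lim_{n\to\infty}\mathbb{P}_{\mu_n}\Big(\eta^n_\cdot\in\mathcal{D}([0,T],\Omega):\Big|\langle\pi^n_t,G\rangle-\int_{\mathbb{R}^d}G(\hat u)\rho_t(\hat u)\,d\hat u\Big|>\delta\Big)=0,$$ where $\rho$ is, in case (i), the unique weak solution of the heat equation on $\mathbb{R}^d$ with diffusion coefficient $\kappa=\kappa_\gamma$ and initial condition $g$ and, in case (ii), the unique weak solution of the heat equation with (homogeneous) Neumann boundary conditions on both sides of $\mathbb{R}^{d-1}\times\{0\}$, with $\kappa=\kappa_\gamma$ and initial condition $g$.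
   Context: Model. Fix $T>0$, $d\ge1$, $\gamma\ge2$, $\alpha>0$, $\beta\ge0$. $|\cdot|$ is the maximum norm, $\hat e_1,\dots,\hat e_d$ is the canonical basis of $\mathbb{R}^d$, $\mathbb{N}=\{0,1,2,\dots\}$, and we write $\hat u=(\hat u_\star,u_d)$ with $\hat u_\star\in\mathbb{R}^{d-1}$. The transition probability $p:\mathbb{Z}^d\to[0,1]$ is $p(\hat x)=\frac{c_\gamma}{d}|\hat x|^{-\gamma-1}$ if $\hat x\ne\hat 0$ and $\hat x=\pm|\hat x|\hat e_j$ for some $j$, and $p(\hat x)=0$ otherwise; $c_\gamma$ is the constant making $p$ a probability. For $\gamma>2$, $\sigma^2:=2\sum_{r\ge1}c_\gamma r^{1-\gamma}$. For $\eta\in\Omega=\{0,1\}^{\mathbb{Z}^d}$, $\eta^{\hat x,\hat y}$ is $\eta$ with the values at $\hat x$ and $\hat y$ exchanged. A pair $\{\hat x,\hat y\}$ of distinct sites is a slow bond if one of the sites lies in $\mathbb{Z}^{d-1}\times\{-1,-2,\dots\}$ and the other in $\mathbb{Z}^{d-1}\times\mathbb{N}$. Put $r^n_{\hat x,\hat y}=\alpha n^{-\beta}$ for slow bonds and $r^n_{\hat x,\hat y}=1$ otherwise. The exclusion process has generator, on local functions $f$, $(\mathcal{L}_nf)(\eta)=\frac12\sum_{\hat x,\hat y\in\mathbb{Z}^d}p(\hat y-\hat x)\,r^n_{\hat x,\hat y}\,[f(\eta^{\hat x,\hat y})-f(\eta)]$. Let $\Theta(n)=n^2$ if $\gamma>2$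 and $\Theta(n)=n^2/\log n$ if $\gamma=2$. $(\eta^n_t)_{t\in[0,T]}$ is the Markov process with generator $\Theta(n)\mathcal{L}_n$, and $\mathbb{P}_{\mu_n}$ is its law on the Skorohod space $\mathcal{D}([0,T],\Omega)$ when the initial law is $\mu_n$. The empirical measure is $\pi^n_t=n^{-d}\sum_{\hat x}\eta^n_t(\hat x)\delta_{\hat x/n}$ and $\langle\pi^n_t,G\rangle=n^{-d}\sum_{\hat x}\eta^n_t(\hat x)G(\hat x/n)$. Associated sequence. $(\mu_n)$ is associated to $g$ if for every $\delta>0$ and every $G$ continuous with compact support, $\lim_n\mu_n\big(\eta:|n^{-d}\sum_{\hat x}\eta(\hat x)G(\hat x/n)-\int_{\mathbb{R}^d}gG\,d\hat u|>\delta\big)=0$. Test functions. $\mathcal{S}_{\mathrm{Dif}}=C^{1,2}_c([0,\infty)\times\mathbb{R}^d)$: functions with compact support in $[0,\infty)\times\mathbb{R}^d$, $C^1$ in time and $C^2$ in space. $\mathcal{S}_{\mathrm{Disc}}$: functions $G=\mathbb{1}_{[0,\infty)\times\mathbb{R}^{d-1}\times(-\infty,0)}G^-+\mathbb{1}_{[0,\infty)\times\mathbb{R}^{d-1}\times[0,\infty)}G^+$ with $G^\pm\in\mathcal{S}_{\mathrm{Dif}}$. $\mathcal{S}_{\mathrm{Neu}}$: those $G\in\mathcal{S}_{\mathrm{Disc}}$ with $\partial_{\hat e_d}G^-_s(\hat u_\star,0)=\partial_{\hat e_d}G^+_s(\hat u_\star,0)=0$ for all $s\in[0,T]$, $\hat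 u_\star\in\mathbb{R}^{d-1}$. For $G\in\mathcal{S}_{\mathrm{Disc}}$, $\mathbb{L}_\Delta G:=\Delta G^-$ where $u_d<0$ and $\mathbb{L}_\Delta G:=\Delta G^+$ where $u_d\ge0$ (so $\mathbb{L}_\Delta G=\Delta G$ if $G\in\mathcal{S}_{\mathrm{Dif}}$). Weak solutions. Write $f_s=f(s,\cdot)$. For bounded measurable $\rho$ on $[0,T]\times\mathbb{R}^d$ put $$F_{\mathrm{Dif}}(t,\rho,G,g,\kappa)=\int_{\mathbb{R}^d}\rho_tG_t\,d\hat u-\int_{\mathbb{R}^d}gG_0\,d\hat u-\int_0^t\int_{\mathbb{R}^d}\rho_s\,[\kappa\mathbb{L}_\Delta+\partial_s]G_s\,d\hat u\,ds.$$ A (measurable) $\rho:[0,T]\times\mathbb{R}^d\to[0,1]$ is a weak solution of the heat equation $\partial_t\rho=\kappa\Delta\rho$ with initial condition $g$ if $F_{\mathrm{Dif}}(t,\rho,G,g,\kappa)=0$ for all $t\in[0,T]$ and all $G\in\mathcal{S}_{\mathrm{Dif}}$. It is a weak solution of the heat equation with Neumann boundary conditions ($\partial_t\rho=\kappa\Delta\rho$ off $\mathbb{R}^{d-1}\times\{0\}$, $\partial_{\hat e_d}\rho_t(\hat u_\star,0^\pm)=0$) and initial condition $g$ if $F_{\mathrm{Dif}}(t,\rho,G,g,\kappa)=0$ for all $t\in[0,T]$ and all $G\in\mathcal{S}_{\mathrm{Neu}}$. *)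

theory Defs
  imports "HOL-Probability.Probability"
begin

text \<open>
  Coordinates of \<open>\<real>\<^sup>d\<close> and \<open>\<int>\<^sup>d\<close> are indexed by a finite type \<open>'d\<close>, so that \<open>d = CARD('d) \<ge> 1\<close>.
  The parameter \<open>k :: 'd\<close> occurring below is the index of the distinguished (last) coordinate
  \<open>u\<^sub>d\<close>, the one orthogonal to the slow barrier.
\<close>

section \<open>Jump rates\<close>

definition maxnorm :: "int^'d \<Rightarrow> real" where
  "maxnorm x = real_of_int (Max (range (\<lambda>i. \<bar>x $ i\<bar>)))"

definition on_axis :: "int^'d \<Rightarrow> bool" where
  "on_axis x \<longleftrightarrow> (\<exists>j. real_of_int (x $ j) \<in> {maxnorm x, - maxnorm x} \<and> x = axis j (x $ j))"

definition jump_weight :: "real \<Rightarrow> int^'d \<Rightarrow> real" where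
  "jump_weight \<gamma> x =
     (if x \<noteq> 0 \<and> on_axis x then maxnorm x powr (- \<gamma> - 1) / real CARD('d) else 0)"

text \<open>The constant \<open>c\<^sub>\<gamma>\<close> normalizes the total mass to one. It is taken in the dimension given by
  the type argument, although its value \<open>1 / (2 \<zeta>(\<gamma> + 1))\<close> does not depend on that dimension.\<close>

definition jump_const :: "'d::finite itself \<Rightarrow> real \<Rightarrow> real" where
  "jump_const _ \<gamma> = 1 / (\<Sum>\<^sub>\<infinity>x\<in>(UNIV :: (int^'d) set). jump_weight \<gamma> x)"

definition jump_prob :: "real \<Rightarrow> int^'d \<Rightarrow> real" where
  "jump_prob \<gamma> x = jump_const TYPE('d) \<gamma> * jump_weight \<gamma> x"

definition sigma_sq :: "'d::finite itself \<Rightarrow> real \<Rightarrow> real" where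
  "sigma_sq d \<gamma> = 2 * (\<Sum>r. jump_const d \<gamma> * real (Suc r) powr (1 - \<gamma>))"

definition diff_coeff :: "'d::finite itself \<Rightarrow> real \<Rightarrow> real" where
  "diff_coeff d \<gamma> =
     (if \<gamma> = 2 then jump_const d 2 / real CARD('d) else sigma_sq d \<gamma> / (2 * real CARD('d)))"

definition slow_bond :: "'d::finite \<Rightarrow> int^'d \<Rightarrow> int^'d \<Rightarrow> bool" where
  "slow_bond k x y \<longleftrightarrow> (x $ k < 0 \<and> y $ k \<ge> 0) \<or> (y $ k < 0 \<and> x $ k \<ge> 0)"

definition bond_rate ::
    "'d::finite \<Rightarrow> real \<Rightarrow> real \<Rightarrow> nat \<Rightarrow> int^'d \<Rightarrow> int^'d \<Rightarrow> real" where
  "bond_rate k \<alpha> \<beta> n x y = (if slow_bond k x y then \<alpha> * real n powr (- \<beta>) else 1)"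

text \<open>For \<open>\<gamma> = 2\<close> and \<open>n = 1\<close> the logarithm vanishes; division by zero gives \<open>time_scale 2 1 = 0\<close>.\<close>

definition time_scale :: "real \<Rightarrow> nat \<Rightarrow> real" where
  "time_scale \<gamma> n = (if \<gamma> = 2 then (real n)\<^sup>2 / ln (real n) else (real n)\<^sup>2)"


section \<open>The exclusion process\<close>

text \<open>A site is occupied iff the configuration is \<open>True\<close> there. The configuration space carries
  the product topology of the discrete spaces \<open>bool\<close>.\<close>

type_synonym 'd config = "(int, 'd) vec \<Rightarrow> bool"

definition exchange :: "('d::finite) config \<Rightarrow> int^'d \<Rightarrow> int^'d \<Rightarrow> 'd config" where
  "exchange \<eta> x y = \<eta>(x := \<eta> y, y := \<eta> x)"

definition local_fun :: "(('d::finite) config \<Rightarrow> real) \<Rightarrow> bool" where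
  "local_fun f \<longleftrightarrow> (\<exists>A. finite A \<and> (\<forall>\<eta> \<xi>. (\<forall>x\<in>A. \<eta> x = \<xi> x) \<longrightarrow> f \<eta> = f \<xi>))"

definition excl_gen :: "'d::finite \<Rightarrow> real \<Rightarrow> real \<Rightarrow> real \<Rightarrow> nat \<Rightarrow>
    ('d config \<Rightarrow> real) \<Rightarrow> 'd config \<Rightarrow> real" where
  "excl_gen k \<alpha> \<beta> \<gamma> n f \<eta> =
     1/2 * (\<Sum>\<^sub>\<infinity>(x, y)\<in>UNIV.
        jump_prob \<gamma> (y - x) * bond_rate k \<alpha> \<beta> n x y * (f (exchange \<eta> x y) - f \<eta>))"

text \<open>Graph of the accelerated pregenerator, acting on local functions, inside
  \<open>C(\<Omega>) \<times> C(\<Omega>)\<close> with the supremum norm (\<open>\<Omega>\<close> being compact, every continuous function is bounded).\<close>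

definition excl_pregenerator :: "'d::finite \<Rightarrow> real \<Rightarrow> real \<Rightarrow> real \<Rightarrow> nat \<Rightarrow>
    (('d config \<Rightarrow>\<^sub>C real) \<times> ('d config \<Rightarrow>\<^sub>C real)) set" where
  "excl_pregenerator k \<alpha> \<beta> \<gamma> n =
     {(f, h). local_fun (apply_bcontfun f) \<and>
        (\<forall>\<eta>. apply_bcontfun h \<eta> = time_scale \<gamma> n * excl_gen k \<alpha> \<beta> \<gamma> n (apply_bcontfun f) \<eta>)}"

definition markov_semigroup ::
    "(real \<Rightarrow> ('a::topological_space \<Rightarrow>\<^sub>C real) \<Rightarrow> ('a \<Rightarrow>\<^sub>C real)) \<Rightarrow> bool" where
  "markov_semigroup S \<longleftrightarrow>
     (\<forall>t\<ge>0. linear (S t)) \<and>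
     (\<forall>f. S 0 f = f) \<and>
     (\<forall>s\<ge>0. \<forall>t\<ge>0. \<forall>f. S (s + t) f = S s (S t f)) \<and>
     (\<forall>t\<ge>0. \<forall>f. continuous (at_right t) (\<lambda>r. S r f)) \<and>
     (\<forall>t\<ge>0. S t (const_bcontfun 1) = const_bcontfun 1) \<and>
     (\<forall>t\<ge>0. \<forall>f. (\<forall>\<eta>. apply_bcontfun f \<eta> \<ge> 0) \<longrightarrow> (\<forall>\<eta>. apply_bcontfun (S t f) \<eta> \<ge> 0))"

definition semigroup_generator ::
    "(real \<Rightarrow> ('a::topological_space \<Rightarrow>\<^sub>C real) \<Rightarrow> ('a \<Rightarrow>\<^sub>C real)) \<Rightarrow>
     (('a \<Rightarrow>\<^sub>C real) \<times> ('a \<Rightarrow>\<^sub>C real)) set" where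
  "semigroup_generator S = {(f, h). ((\<lambda>t. (1 / t) *\<^sub>R (S t f - f)) \<longlongrightarrow> h) (at_right 0)}"

definition cadlag_on :: "real \<Rightarrow> (real \<Rightarrow> 'a::topological_space) \<Rightarrow> bool" where
  "cadlag_on T \<omega> \<longleftrightarrow>
     (\<forall>t\<in>{0..<T}. continuous (at_right t) \<omega>) \<and> (\<forall>t\<in>{0<..T}. \<exists>l. (\<omega> \<longlongrightarrow> l) (at_left t))"

text \<open>\<open>\<D>([0,T],\<Omega>)\<close> as a measurable space: its Borel \<open>\<sigma>\<close>-algebra (for the Skorohod topology) is the
  one generated by the evaluations at the times in \<open>[0,T]\<close>. Only the space and the
  \<open>\<sigma>\<close>-algebra of \<open>skorohod_space\<close> are used. Paths are \<open>undefined\<close> outside \<open>[0,T]\<close>.\<close>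

definition skorohod_space :: "real \<Rightarrow> (real \<Rightarrow> 'a::topological_space) measure" where
  "skorohod_space T = restrict_space (PiM {0..T} (\<lambda>_. borel)) {\<omega>. cadlag_on T \<omega>}"

definition past_algebra ::
    "(real \<Rightarrow> 'a::topological_space) measure \<Rightarrow> real \<Rightarrow> (real \<Rightarrow> 'a) measure" where
  "past_algebra P s =
     vimage_algebra (space P) (\<lambda>\<omega>. restrict \<omega> {0..s}) (PiM {0..s} (\<lambda>_. borel))"

definition markov_law ::
    "real \<Rightarrow> (real \<Rightarrow> ('a::topological_space \<Rightarrow>\<^sub>C real) \<Rightarrow> ('a \<Rightarrow>\<^sub>C real)) \<Rightarrow> 'a measure \<Rightarrow>
     (real \<Rightarrow> 'a) measure \<Rightarrow> bool" where
  "markov_law T S \<mu> P \<longleftrightarrow>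
     prob_space P \<and> sets P = sets (skorohod_space T) \<and>
     distr P borel (\<lambda>\<omega>. \<omega> 0) = \<mu> \<and>
     (\<forall>s t. 0 \<le> s \<and> s \<le> t \<and> t \<le> T \<longrightarrow> (\<forall>f.
        AE \<omega> in P. real_cond_exp P (past_algebra P s) (\<lambda>\<omega>'. apply_bcontfun f (\<omega>' t)) \<omega>
                   = apply_bcontfun (S (t - s) f) (\<omega> s)))"

text \<open>\<open>P\<close> is the law \<open>\<P>\<^sub>\<mu>\<close> of the Markov process with generator \<open>\<Theta>(n) \<L>\<^sub>n\<close> and initial law \<open>\<mu>\<close>. As usual for
  interacting particle systems, the generator of the Feller semigroup is the closure
  of its restriction to local functions.\<close>

definition exclusion_law :: "'d::finite \<Rightarrow> real \<Rightarrow> real \<Rightarrow> real \<Rightarrow> real \<Rightarrow> nat \<Rightarrow>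
    'd config measure \<Rightarrow> (real \<Rightarrow> 'd config) measure \<Rightarrow> bool" where
  "exclusion_law k T \<alpha> \<beta> \<gamma> n \<mu> P \<longleftrightarrow>
     (\<exists>S. markov_semigroup S \<and>
        semigroup_generator S = closure (excl_pregenerator k \<alpha> \<beta> \<gamma> n) \<and>
        markov_law T S \<mu> P)"


section \<open>Empirical measure and associated profiles\<close>

definition test_fun :: "(real^'d \<Rightarrow> real) \<Rightarrow> bool" where
  "test_fun G \<longleftrightarrow> continuous_on UNIV G \<and> (\<exists>K. compact K \<and> (\<forall>u. u \<notin> K \<longrightarrow> G u = 0))"

definition empirical :: "nat \<Rightarrow> ('d::finite) config \<Rightarrow> (real^'d \<Rightarrow> real) \<Rightarrow> real" where
  "empirical n \<eta> G =
     (1 / real n ^ CARD('d)) *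
     (\<Sum>\<^sub>\<infinity>x\<in>UNIV. of_bool (\<eta> x) * G (\<chi> i. real_of_int (x $ i) / real n))"

definition associated ::
    "(nat \<Rightarrow> ('d::finite) config measure) \<Rightarrow> (real^'d \<Rightarrow> real) \<Rightarrow> bool" where
  "associated \<mu> g \<longleftrightarrow>
     (\<forall>\<delta>>0. \<forall>G. test_fun G \<longrightarrow>
        (\<lambda>n. measure (\<mu> n) {\<eta> \<in> space (\<mu> n).
            \<bar>empirical n \<eta> G - (LINT u|lborel. g u * G u)\<bar> > \<delta>}) \<longlonglongrightarrow> 0)"


section \<open>Weak solutions\<close>

text \<open>Only times \<open>s \<ge> 0\<close> are relevant; the time derivative at \<open>s = 0\<close> is one-sided.\<close>

definition time_deriv :: "(real \<Rightarrow> 'a \<Rightarrow> real) \<Rightarrow> real \<Rightarrow> 'a \<Rightarrow> real" where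
  "time_deriv G s u = vector_derivative (\<lambda>r. G r u) (at s within {0..})"

definition partial_deriv :: "'d::finite \<Rightarrow> (real^'d \<Rightarrow> real) \<Rightarrow> real^'d \<Rightarrow> real" where
  "partial_deriv i f u = deriv (\<lambda>h. f (u + h *\<^sub>R axis i 1)) 0"

definition partially_differentiable :: "'d::finite \<Rightarrow> (real^'d \<Rightarrow> real) \<Rightarrow> bool" where
  "partially_differentiable i f \<longleftrightarrow>
     (\<forall>u. (\<lambda>h. f (u + h *\<^sub>R axis i 1)) differentiable (at 0))"

definition laplacian :: "(real^'d \<Rightarrow> real) \<Rightarrow> real^'d \<Rightarrow> real" where
  "laplacian f u = (\<Sum>i\<in>UNIV. partial_deriv i (partial_deriv i f) u)"

text \<open>\<open>C\<^sub>c\<^sup>1\<^sup>,\<^sup>2([0,\<infinity>) \<times> \<real>\<^sup>d)\<close>: all derivatives are jointly continuous in time and space.\<close>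

definition S_Dif :: "(real \<Rightarrow> real^'d \<Rightarrow> real) set" where
  "S_Dif = {G.
     (\<exists>K. compact K \<and> K \<subseteq> {0..} \<times> UNIV \<and> (\<forall>s\<ge>0. \<forall>u. (s, u) \<notin> K \<longrightarrow> G s u = 0)) \<and>
     continuous_on ({0..} \<times> UNIV) (\<lambda>(s, u). G s u) \<and>
     (\<forall>s\<ge>0. \<forall>u. (\<lambda>r. G r u) differentiable (at s within {0..})) \<and>
     continuous_on ({0..} \<times> UNIV) (\<lambda>(s, u). time_deriv G s u) \<and>
     (\<forall>i. (\<forall>s\<ge>0. partially_differentiable i (G s)) \<and>
          continuous_on ({0..} \<times> UNIV) (\<lambda>(s, u). partial_deriv i (G s) u)) \<and>
     (\<forall>i j. (\<forall>s\<ge>0. partially_differentiable j (partial_deriv i (G s))) \<and>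
            continuous_on ({0..} \<times> UNIV) (\<lambda>(s, u). partial_deriv j (partial_deriv i (G s)) u))}"

text \<open>An element \<open>G\<close> of \<open>S_Disc\<close> is given by its two pieces \<open>(G\<^sup>-, G\<^sup>+)\<close>, from which it is recovered by
  \<open>glue\<close>; an element \<open>G\<close> of \<open>S_Dif\<close> corresponds to the pair \<open>(G, G)\<close>.\<close>

definition glue :: "'d::finite \<Rightarrow> (real \<Rightarrow> real^'d \<Rightarrow> real) \<times> (real \<Rightarrow> real^'d \<Rightarrow> real) \<Rightarrow>
    real \<Rightarrow> real^'d \<Rightarrow> real" where
  "glue k G s u = (if u $ k < 0 then fst G s u else snd G s u)"

definition S_Neu :: "'d::finite \<Rightarrow> real \<Rightarrow>
    ((real \<Rightarrow> real^'d \<Rightarrow> real) \<times> (real \<Rightarrow> real^'d \<Rightarrow> real)) set" where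
  "S_Neu k T = {(Gm, Gp). Gm \<in> S_Dif \<and> Gp \<in> S_Dif \<and>
     (\<forall>s\<in>{0..T}. \<forall>u. u $ k = 0 \<longrightarrow>
        partial_deriv k (Gm s) u = 0 \<and> partial_deriv k (Gp s) u = 0)}"

definition L_Delta :: "'d::finite \<Rightarrow> (real \<Rightarrow> real^'d \<Rightarrow> real) \<times> (real \<Rightarrow> real^'d \<Rightarrow> real) \<Rightarrow>
    real \<Rightarrow> real^'d \<Rightarrow> real" where
  "L_Delta k G s u = (if u $ k < 0 then laplacian (fst G s) u else laplacian (snd G s) u)"

definition F_Dif :: "'d::finite \<Rightarrow> real \<Rightarrow> (real \<Rightarrow> real^'d \<Rightarrow> real) \<Rightarrow>
    (real \<Rightarrow> real^'d \<Rightarrow> real) \<times> (real \<Rightarrow> real^'d \<Rightarrow> real) \<Rightarrow> (real^'d \<Rightarrow> real) \<Rightarrow> real \<Rightarrow> real" where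
  "F_Dif k t \<rho> G g \<kappa> =
     (LINT u|lborel. \<rho> t u * glue k G t u) - (LINT u|lborel. g u * glue k G 0 u)
     - (LINT s:{0..t}|lborel. LINT u|lborel.
          \<rho> s u * (\<kappa> * L_Delta k G s u + time_deriv (glue k G) s u))"

definition profile :: "real \<Rightarrow> (real \<Rightarrow> real^'d \<Rightarrow> real) \<Rightarrow> bool" where
  "profile T \<rho> \<longleftrightarrow>
     (\<lambda>(t, u). \<rho> t u) \<in> borel_measurable (restrict_space borel ({0..T} \<times> UNIV)) \<and>
     (\<forall>t\<in>{0..T}. \<forall>u. \<rho> t u \<in> {0..1})"

definition heat_weak_solution :: "'d::finite \<Rightarrow> real \<Rightarrow> real \<Rightarrow> (real^'d \<Rightarrow> real) \<Rightarrow>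
    (real \<Rightarrow> real^'d \<Rightarrow> real) \<Rightarrow> bool" where
  "heat_weak_solution k T \<kappa> g \<rho> \<longleftrightarrow>
     profile T \<rho> \<and> (\<forall>t\<in>{0..T}. \<forall>G\<in>S_Dif. F_Dif k t \<rho> (G, G) g \<kappa> = 0)"

definition neumann_weak_solution :: "'d::finite \<Rightarrow> real \<Rightarrow> real \<Rightarrow> (real^'d \<Rightarrow> real) \<Rightarrow>
    (real \<Rightarrow> real^'d \<Rightarrow> real) \<Rightarrow> bool" where
  "neumann_weak_solution k T \<kappa> g \<rho> \<longleftrightarrow>
     profile T \<rho> \<and> (\<forall>t\<in>{0..T}. \<forall>G\<in>S_Neu k T. F_Dif k t \<rho> G g \<kappa> = 0)"

text \<open>A weak solution is only determined up to Lebesgue-null sets of space points at each time.\<close>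

definition unique_solution :: "real \<Rightarrow> ((real \<Rightarrow> real^'d \<Rightarrow> real) \<Rightarrow> bool) \<Rightarrow>
    (real \<Rightarrow> real^'d \<Rightarrow> real) \<Rightarrow> bool" where
  "unique_solution T sol \<rho> \<longleftrightarrow>
     sol \<rho> \<and> (\<forall>\<rho>'. sol \<rho>' \<longrightarrow> (\<forall>t\<in>{0..T}. AE u in lborel. \<rho>' t u = \<rho> t u))"

definition hydrodynamic_limit :: "real \<Rightarrow> (nat \<Rightarrow> (real \<Rightarrow> ('d::finite) config) measure) \<Rightarrow>
    (real \<Rightarrow> real^'d \<Rightarrow> real) \<Rightarrow> bool" where
  "hydrodynamic_limit T P \<rho> \<longleftrightarrow>
     (\<forall>t\<in>{0..T}. \<forall>G. test_fun G \<longrightarrow> (\<forall>\<delta>>0.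
        (\<lambda>n. measure (P n) {\<omega> \<in> space (P n).
            \<bar>empirical n (\<omega> t) G - (LINT u|lborel. G u * \<rho> t u)\<bar> > \<delta>}) \<longlonglongrightarrow> 0))"

definition R0 :: "(real \<times> real) set" where
  "R0 = ({1..} \<times> {2}) \<union> ({1<..} \<times> {2<..})"

end

theory Submission
 imports Defs "HOL-Real_Asymp.Real_Asymp"
begin

text \<open>Only one time \<open>t\<close> matters, so no tightness is needed: test functions are evolved backwards by the
 limiting equation. Let \<open>H\<close> be a product of one-dimensional Gaussian families solving the heat equation,
 symmetrised in the coordinate \<open>k\<close> on each side of the barrier when its bonds are slow, so that the normal
 derivative vanishes there. The averages of \<open>H\<^sub>t\<^sub>-\<^sub>s\<close> over the occupied sites at time \<open>s\<close>, and their squares,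
 are almost conserved by the Feller semigroup: the accelerated generator acts on \<open>H\<close> like \<open>\<kappa>\<Delta>\<close> up to an error that
 vanishes in \<open>l\<^sup>1\<close>, and on squares there is an extra carre du champ term of order \<open>n\<^sup>-\<^sup>d\<close>. A second moment
 bound then compares the average of \<open>H\<^sub>0\<close> at time \<open>t\<close> with that of \<open>H\<^sub>t\<close> at time \<open>0\<close>, which tends to \<open>\<integral> g H\<^sub>t\<close>.
 Testing a weak solution with \<open>H\<^sub>t\<^sub>-\<^sub>s\<close>, cut off in space, gives \<open>\<integral> \<rho>\<^sub>t H\<^sub>0 = \<integral> g H\<^sub>t\<close> as well. By the
 Stone-Weierstrass theorem the functions \<open>H\<^sub>0\<close> span a dense set, which yields both uniqueness and convergence.
 A solution is the heat evolution of \<open>g\<close>, or, with Neumann conditions, on each side that of the even extension of \<open>g\<close>.\<close>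

section \<open>Infinite sums\<close>

text \<open>Since the exchange rates are symmetric, products of two occupation variables cancel in
  the generator: a linear functional of the configuration is mapped to the linear functional of its
  one-particle walk, so the evolution closes and all depends on an estimate for that walk. Two
  obstacles shape it. At \<open>\<gamma> = 2\<close> the variance of the jumps diverges
  logarithmically; jumps are therefore split at length \<open>n\<close>, the short ones are Taylor
  expanded, and their truncated variance times \<open>n^2 / log n\<close> converges. Jumps across
  the barrier may be long, but a displacement \<open>r\<close> crosses it from only
  \<open>\<bar>r\<bar>\<close> positions, so the slow bonds cost the first moment of the jump law
  times \<open>\<Theta>(n) n^(-\<beta>) / n\<close>, which vanishes exactly on \<open>R0\<close>;
  flatness of the test function makes the lost part of the expansion equally harmless. Gaussians
  serve because their heat evolution is explicit, their products are again Gaussian, as an algebra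
  requires, and they are bounded by the square of a summable weight: one factor pays for summation,
  the other for cutoffs at infinity.\<close>

lemma infsum_le_bound:
 fixes f g :: "'a => real"
 assumes "g summable_on A" "\<And>x. x \<in> A ==> abs (f x) <= g x"
 shows "f summable_on A" "(\<lambda>x. abs (f x)) summable_on A" (is ?A) "abs (infsum f A) <= infsum g A"
proof -
 show 1: ?A
  by (rule summable_on_comparison_test[OF assms(1)]) (use assms in auto)
 show 2: "f summable_on A"
  by (rule abs_summable_summable) (use 1 in simp)
 have "abs (infsum f A) <= (\<Sum>\<^sub>\<infinity>x\<in>A. abs (f x))"
  using norm_infsum_bound[of f A] 1 by simp
 also have "\<dots> <= infsum g A"
  by (rule infsum_mono) (use 1 assms in auto)
 finally show "abs (infsum f A) <= infsum g A" .
qed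

text \<open>Tonelli for \<open>infsum\<close>: nonnegativity upgrades iterated summability to
  summability over pairs, after which the swap rules for Banach-valued sums apply.\<close>

lemma infsum_swap_nonneg:
 fixes f :: "'a => 'b => real"
 assumes "\<And>x y. f x y >= 0" "\<And>x. f x summable_on UNIV"
  and "(\<lambda>x. INFSUM y. f x y) summable_on UNIV"
 shows "(\<lambda>(x, y). f x y) summable_on UNIV" (is ?A)
  and "(\<lambda>y. INFSUM x. f x y) summable_on UNIV" (is ?B)
  and "\<And>y. (\<lambda>x. f x y) summable_on UNIV"
  and "(INFSUM y. INFSUM x. f x y) = (INFSUM x. INFSUM y. f x y)" (is ?C)
  and "(\<Sum>\<^sub>\<infinity>(x, y)\<in>UNIV. f x y) = (INFSUM x. INFSUM y. f x y)" (is ?D)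
proof -
 have *: "(\<lambda>(x, y). f x y) summable_on (UNIV \<times> UNIV)"
  by (rule summable_on_SigmaI[where g = "\<lambda>x. INFSUM y. f x y"]) (use assms in auto)
 thus 1: ?A by simp
 have **: "(\<lambda>(y, x). f x y) summable_on (UNIV \<times> UNIV)"
  using summable_on_swap[of "\<lambda>(y, x). f x y" UNIV UNIV] * by (simp add: case_prod_unfold prod.swap_def)
 show ?B
  using summable_on_Sigma_banach[OF **] by simp
 show "(\<lambda>x. f x y) summable_on UNIV" for y
  using summable_on_SigmaD1[OF **, of y] assms(1) by auto
 show ?C
  using infsum_swap_banach[OF *] by simp
 show ?D
  using infsum_Sigma'_banach[OF *] by simp
qed

text \<open>The M-test makes the finite partial sums converge uniformly in the parameter, so the
  limit along \<open>F\<close> can be exchanged with the limit over finite sets. A general filter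
  covers both large \<open>n\<close> and one-sided limits in time.\<close>

lemma infsum_tendsto_dominated:
 fixes f :: "'b => 'a => real"
 assumes M: "M summable_on UNIV" and bd: "\<And>t x. t \<in> S ==> abs (f t x) <= M x"
  and ev: "eventually (\<lambda>t. t \<in> S) F"
  and lim: "\<And>x. ((\<lambda>t. f t x) \<longlongrightarrow> g x) F"
 shows "((\<lambda>t. INFSUM x. f t x) \<longlongrightarrow> (INFSUM x. g x)) F"
proof (cases "F = bot")
 case True thus ?thesis by simp
next
 case False
 have gM: "abs (g x) <= M x" for x
 proof (rule tendsto_upperbound[OF tendsto_rabs[OF lim] _ False])
  show "\<forall>\<^sub>F t in F. abs (f t x) <= M x" using ev by eventually_elim (use bd in auto)
 qed
 have gs: "g summable_on UNIV" by (rule infsum_le_bound(1)[OF M gM])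
 show ?thesis
 proof (rule swap_uniform_limit')
  show "uniform_limit S (\<lambda>X t. \<Sum>x\<in>X. f t x) (\<lambda>t. INFSUM x. f t x) (finite_subsets_at_top UNIV)"
   by (rule Weierstrass_m_test_general[where M = M]) (use bd M in auto)
  show "((\<lambda>X. \<Sum>x\<in>X. g x) \<longlongrightarrow> (INFSUM x. g x)) (finite_subsets_at_top UNIV)"
   by (rule infsum_tendsto[OF gs])
  show "\<forall>\<^sub>F X in finite_subsets_at_top UNIV. ((\<lambda>t. \<Sum>x\<in>X. f t x) \<longlongrightarrow> (\<Sum>x\<in>X. g x)) F"
   by (intro always_eventually allI tendsto_sum lim)
 qed (use ev in auto)
qed

lemma continuous_on_infsum:
 fixes f :: "'b::topological_space => 'a => real"
 assumes M: "M summable_on UNIV" and bd: "\<And>t x. t \<in> S ==> abs (f t x) <= M x"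
  and cont: "\<And>x. continuous_on S (\<lambda>t. f t x)"
 shows "continuous_on S (\<lambda>t. INFSUM x. f t x)"
 unfolding continuous_on_def
proof
 fix t assume "t \<in> S"
 show "((\<lambda>t. INFSUM x. f t x) \<longlongrightarrow> (INFSUM x. f t x)) (at t within S)"
 proof (rule infsum_tendsto_dominated[OF M bd])
  show "\<forall>\<^sub>F t in at t within S. t \<in> S" by (simp add: eventually_at_filter)
  show "((\<lambda>t. f t x) \<longlongrightarrow> f t x) (at t within S)" for x
   using cont[of x] \<open>t \<in> S\<close> by (auto simp: continuous_on_def)
 qed
qed

text \<open>The positive and the negative integers contribute \<open>s\<close> each;
  \<open>f 0 = 0\<close> keeps the origin from spoiling the factor 2.\<close>

lemma has_sum_even_int:
 fixes f :: "nat => real"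
 assumes f: "(f has_sum s) UNIV" and f0: "f 0 = 0"
 shows "((\<lambda>r::int. f (nat (abs r))) has_sum 2 * s) UNIV"
proof -
 have s1: "(f has_sum s) {1..}"
  by (rule iffD1[OF has_sum_cong_neutral f]) (use f0 in \<open>auto simp: not_le\<close>)
 have p: "((\<lambda>r::int. f (nat (abs r))) has_sum s) {1..}"
  by (rule iffD2[OF has_sum_reindex_bij_witness[where j = nat and i = int] s1]) auto
 have m: "((\<lambda>r::int. f (nat (abs r))) has_sum s) {..-1}"
  by (rule iffD2[OF has_sum_reindex_bij_witness[where j = uminus and i = uminus] p]) auto
 have "((\<lambda>r::int. f (nat (abs r))) has_sum s + s) ({1..} \<union> {..-1})"
  by (rule has_sum_Un_disjoint[OF p m]) auto
 hence "((\<lambda>r::int. f (nat (abs r))) has_sum s + s) UNIV"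
  by (rule iffD1[OF has_sum_cong_neutral, rotated -1]) (use f0 in \<open>auto simp: not_le\<close>)
 thus ?thesis by simp
qed

lemma infsum_even_int:
 fixes f :: "nat => real"
 assumes "summable f" "\<And>n. f n >= 0" and f0: "f 0 = 0"
 shows "(\<lambda>r::int. f (nat (abs r))) summable_on UNIV" (is ?A) "(\<Sum>\<^sub>\<infinity>r::int. f (nat (abs r))) = 2 * suminf f"
proof -
 have "(f has_sum suminf f) UNIV"
  by (rule sums_nonneg_imp_has_sum) (use assms in \<open>auto simp: summable_sums\<close>)
 from has_sum_even_int[OF this f0]
 show ?A "(\<Sum>\<^sub>\<infinity>r::int. f (nat (abs r))) = 2 * suminf f"
  by (auto simp: has_sum_iff)
qed

section \<open>Lattice sums in one dimension\<close>

text \<open>The derivative of \<open>arctan\<close>: lattice sums are compared with a telescoping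
  sum of \<open>arctan\<close>, and the integral is known.\<close>

definition wt :: "real => real" where "wt u = 1 / (1 + u\<^sup>2)"

lemma wt_pos [simp]: "wt u > 0" and wt_nonneg [simp]: "wt u >= 0" and wt_le_1 [simp]: "wt u <= 1"
 and wt_minus [simp]: "wt (- u) = wt u"
 by (auto simp: wt_def add_pos_nonneg divide_simps)

text \<open>Mean value theorem for \<open>arctan\<close> on one lattice cell; on the nonnegative
  axis \<open>wt\<close> is smallest at the right end of the cell.\<close>

lemma wt_lattice_step:
 fixes n :: nat assumes n: "n >= 1"
 shows "wt (real (Suc m) / n) <= n * (arctan (real (Suc m) / n) - arctan (real m / n))"
proof -
 have lt: "real m / n < real (Suc m) / n" using n by (simp add: divide_simps)
 obtain z where z: "real m / n < z" "z < real (Suc m) / n"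
  "arctan (real (Suc m) / n) - arctan (real m / n) = (real (Suc m) / n - real m / n) * inverse (1 + z\<^sup>2)"
  using MVT2[OF lt, of arctan "\<lambda>x. inverse (1 + x\<^sup>2)"] DERIV_arctan by blast
 have "z\<^sup>2 <= (real (Suc m) / n)\<^sup>2"
  using z by (intro power_mono) (auto intro: order_trans[OF _ less_imp_le[OF z(1)]])
 hence "wt (real (Suc m) / n) <= inverse (1 + z\<^sup>2)"
  unfolding wt_def inverse_eq_divide by (intro divide_left_mono) (auto intro!: mult_pos_pos add_pos_nonneg)
 also have "\<dots> = n * (arctan (real (Suc m) / n) - arctan (real m / n))"
  using n by (simp only: z(3)) (simp add: diff_divide_distrib[symmetric])
 finally show ?thesis .
qed

text \<open>Telescoping bounds each half-line by \<open>n * pi / 2 < 2 * n\<close>; with the origin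
  the constant is \<open>2 + 2 + 1\<close>, using \<open>n \<ge> 1\<close>.\<close>

lemma wt_lattice_sum:
 fixes n :: nat assumes n: "n >= 1"
 shows "(\<lambda>m::int. wt (m / n)) summable_on UNIV" (is ?A) "(\<Sum>\<^sub>\<infinity>m::int. wt (m / n)) <= 5 * n"
proof -
 define f where "f k = (if k = 0 then 0 else wt (real k / n))" for k
 have part: "(\<Sum>k<N. f k) <= 2 * n" for N
 proof -
  have "(\<Sum>k<Suc M. f k) <= n * arctan (real M / n)" for M
  proof (induction M)
   case 0 thus ?case by (simp add: f_def)
  next
   case (Suc M)
   have "(\<Sum>k<Suc (Suc M). f k) = (\<Sum>k<Suc M. f k) + wt (real (Suc M) / n)"
    by (simp add: f_def)
   also have "\<dots> <= n * arctan (real M / n) + n * (arctan (real (Suc M) / n) - arctan (real M / n))"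
    using Suc wt_lattice_step[OF n, of M] by linarith
   finally show ?case by (simp add: algebra_simps)
  qed
  also have "n * arctan (real M / n) <= real n * 2" for M
   using arctan_ubound[of "real M / n"] pi_less_4 by (intro mult_left_mono) auto
  finally have *: "(\<Sum>k<Suc M. f k) <= real n * 2" for M .
  show ?thesis by (cases N) (use *  in \<open>auto simp: mult.commute\<close>)
 qed
 have f0: "f k >= 0" for k by (simp add: f_def)
 have sm: "summable f"
  by (rule summableI_nonneg_bounded[OF f0 part])
 have le: "suminf f <= 2 * n" by (rule suminf_le_const[OF sm part])
 have eq: "wt (real_of_int m / n) = f (nat (abs m)) + (if m = 0 then 1 else 0)" for m :: int
  by (auto simp: f_def wt_def power_divide)
 have h1: "((\<lambda>m::int. f (nat (abs m))) has_sum 2 * suminf f) UNIV"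
  by (rule has_sum_even_int[OF sums_nonneg_imp_has_sum[OF summable_sums[OF sm] f0]]) (simp add: f_def)
 have h2: "((\<lambda>m::int. if m = 0 then 1 else 0) has_sum (1::real)) UNIV"
  by (rule has_sum_finite_neutralI[where B = "{0}"]) auto
 have "((\<lambda>m::int. wt (m / n)) has_sum 2 * suminf f + 1) UNIV"
  unfolding eq by (rule has_sum_add[OF h1 h2])
 thus ?A "(\<Sum>\<^sub>\<infinity>m::int. wt (m / n)) <= 5 * n"
  using le n by (auto simp: has_sum_iff)
qed

text \<open>Writing \<open>u = (u + z) - z\<close> gives
  \<open>1 + u^2 \<le> 1 + 2 (u + z)^2 + 2\<close>. It lets a Taylor remainder evaluated within
  distance 1 of \<open>u\<close> be charged to the weight at \<open>u\<close>.\<close>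

lemma wt_shift: "abs z <= 1 ==> wt (u + z) <= 3 * wt u"
proof -
 assume z: "abs z <= 1"
 have "u\<^sup>2 <= 2 * (u + z)\<^sup>2 + 2 * z\<^sup>2"
  using zero_le_power2[of "u + 2 * z"] by (simp add: power2_eq_square algebra_simps)
 moreover have "z\<^sup>2 <= 1" using z by (simp add: abs_square_le_1)
 ultimately have "1 + u\<^sup>2 <= 3 * (1 + (u + z)\<^sup>2)" by (smt (verit) zero_le_power2)
 thus ?thesis unfolding wt_def by (simp add: divide_simps add_pos_nonneg)
qed

text \<open>The kernel along one axis without its constants; the value \<open>0 powr _ = 0\<close>
  takes out the trivial jump.\<close>

definition jump_w :: "real => int => real" where
 "jump_w \<gamma> r = abs (real_of_int r) powr (- \<gamma> - 1)"

lemma jump_w_0 [simp]: "jump_w \<gamma> 0 = 0" and jump_w_nonneg [simp]: "jump_w \<gamma> r >= 0"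
 and jump_w_minus [simp]: "jump_w \<gamma> (- r) = jump_w \<gamma> r"
 by (auto simp: jump_w_def)

lemma jump_w_pow:
 "jump_w \<gamma> r * abs (real_of_int r) ^ j = real (nat (abs r)) powr (real j - \<gamma> - 1)"
proof (cases "r = 0")
 case False
 hence "abs (real_of_int r) > 0" by simp
 hence "jump_w \<gamma> r * abs (real_of_int r) ^ j = abs (real_of_int r) powr (real j + (- \<gamma> - 1))"
  by (simp add: jump_w_def powr_add powr_realpow)
 also have "real j + (- \<gamma> - 1) = real j - \<gamma> - 1" by simp
 finally show ?thesis by simp
qed simp

lemma jump_w_pow_sums:
 assumes "real j < \<gamma>"
 shows "(\<lambda>r. jump_w \<gamma> r * abs (real_of_int r) ^ j) summable_on UNIV" (is ?A)
  "(INFSUM r. jump_w \<gamma> r * abs (real_of_int r) ^ j) = 2 * (\<Sum>k. real (Suc k) powr (real j - \<gamma> - 1))" (is ?B)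
proof -
 have s: "summable (\<lambda>k. real k powr (real j - \<gamma> - 1))"
  using assms by (simp add: summable_real_powr_iff)
 show ?A
  unfolding jump_w_pow by (rule infsum_even_int(1)[OF s]) auto
 have "(INFSUM r. jump_w \<gamma> r * abs (real_of_int r) ^ j) = 2 * (\<Sum>k. real k powr (real j - \<gamma> - 1))"
  unfolding jump_w_pow by (rule infsum_even_int(2)[OF s]) auto
 also have "(\<Sum>k. real k powr (real j - \<gamma> - 1)) = (\<Sum>k. real (Suc k) powr (real j - \<gamma> - 1))"
  using suminf_split_head[OF s] by simp
 finally show ?B .
qed

section \<open>Scaling of the jump kernel\<close>

text \<open>Rescaled moments of the jumps, cut at macroscopic length 1: \<open>S1\<close> weighs the
  Taylor remainder of short jumps, \<open>S2\<close> the long jumps, and \<open>S3\<close> is the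
  truncated second moment from which the diffusion coefficient comes.\<close>

definition S1 :: "real => nat => real" where
 "S1 \<gamma> n = (INFSUM r. jump_w \<gamma> r * (if abs r <= int n then (abs (real_of_int r) / n) ^ 3 else 0))"
definition S2 :: "real => nat => real" where
 "S2 \<gamma> n = (INFSUM r. jump_w \<gamma> r * (if abs r <= int n then 0 else abs (real_of_int r) / n))"
definition S3 :: "real => nat => real" where
 "S3 \<gamma> n = (INFSUM r. jump_w \<gamma> r * (if abs r <= int n then (abs (real_of_int r) / n)\<^sup>2 else 0))"

lemma time_scale_nonneg: "n >= 1 ==> time_scale \<gamma> n >= 0"
 by (auto simp: time_scale_def)

text \<open>For \<gamma> > 2 the jump law has a finite second moment, which dominates the summands
  once the factor \<open>n^2\<close> is brought under the sum.\<close>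

lemma time_scale_dominated:
 fixes \<phi> :: "nat => int => real"
 assumes g: "\<gamma> > 2" and b: "\<And>n r. n >= 1 ==> abs ((real n)\<^sup>2 * \<phi> n r) <= abs (real_of_int r) ^ 2"
  and l: "\<And>r. (\<lambda>n. (real n)\<^sup>2 * \<phi> n r) \<longlonglongrightarrow> L r"
 shows "(\<lambda>n. time_scale \<gamma> n * (INFSUM r. jump_w \<gamma> r * \<phi> n r)) \<longlonglongrightarrow> (INFSUM r. jump_w \<gamma> r * L r)"
proof -
 have "(\<lambda>n. INFSUM r. jump_w \<gamma> r * ((real n)\<^sup>2 * \<phi> n r)) \<longlonglongrightarrow> (INFSUM r. jump_w \<gamma> r * L r)"
 proof (rule infsum_tendsto_dominated[where S = "{1..}"])
  show "(\<lambda>r. jump_w \<gamma> r * abs (real_of_int r) ^ 2) summable_on UNIV" by (rule jump_w_pow_sums) (use g in simp)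
  show "abs (jump_w \<gamma> r * ((real n)\<^sup>2 * \<phi> n r)) <= jump_w \<gamma> r * abs (real_of_int r) ^ 2" if "n \<in> {1..}" for n r
   unfolding abs_mult[of "jump_w \<gamma> r"] using b[of n r] that by (simp add: mult_left_mono)
 qed (simp_all add: eventually_ge_at_top tendsto_mult_left l)
 moreover have "(INFSUM r. jump_w \<gamma> r * ((real n)\<^sup>2 * \<phi> n r)) = time_scale \<gamma> n * (INFSUM r. jump_w \<gamma> r * \<phi> n r)" for n
  using g unfolding mult.left_commute[of "jump_w \<gamma> _"] by (simp add: time_scale_def infsum_cmult_right')
 ultimately show ?thesis by simp
qed

text \<open>The margin at \<open>\<gamma> = 2\<close> is only the logarithm in the time scale: a
  bound \<open>c / n^2\<close> leaves \<open>c / ln n\<close>.\<close>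

lemma time_scale_2_null:
 assumes s: "\<And>n. n >= 2 ==> 0 <= s n \<and> s n <= c / (real n)\<^sup>2"
 shows "(\<lambda>n. time_scale 2 n * s n) \<longlonglongrightarrow> 0"
proof (rule Lim_null_comparison)
 have "abs (time_scale 2 n * s n) <= c / ln n" if n: "n >= 2" for n
 proof -
  have "(real n)\<^sup>2 / ln n * s n <= (real n)\<^sup>2 / ln n * (c / (real n)\<^sup>2)"
   by (rule mult_left_mono) (use s[OF n] n in auto)
  thus ?thesis using s[OF n] n by (simp add: time_scale_def)
 qed
 thus "\<forall>\<^sub>F n in sequentially. norm (time_scale 2 n * s n) <= c / ln (real n)"
  by (auto simp: eventually_sequentially)
 have "(\<lambda>n. c * (1 / ln (real n))) \<longlonglongrightarrow> 0" by (rule tendsto_mult_right_zero) real_asymp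
 thus "(\<lambda>n. c / ln (real n)) \<longlonglongrightarrow> 0" by simp
qed

text \<open>At \<open>\<gamma> = 2\<close> the exponent \<open>3 - \<gamma> - 1\<close> vanishes, so
  \<open>S1\<close> is at most the number of integers in \<open>{-n..n}\<close> divided by
  \<open>n^3\<close>. For \<gamma> > 2 the summand
  \<open>n^2 (\<bar>r\<bar> / n)^3 = r^2 (\<bar>r\<bar> / n)\<close> is dominated by
  \<open>r^2\<close> and tends to 0 for fixed \<open>r\<close>.\<close>

lemma time_scale_S1: assumes "\<gamma> >= 2" shows "(\<lambda>n. time_scale \<gamma> n * S1 \<gamma> n) \<longlonglongrightarrow> 0"
proof (cases "\<gamma> = 2")
 case False
 have "(\<lambda>n. time_scale \<gamma> n * S1 \<gamma> n) \<longlonglongrightarrow> (INFSUM r. jump_w \<gamma> r * 0)"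
  unfolding S1_def
 proof (rule time_scale_dominated)
  show "abs ((real n)\<^sup>2 * (if abs r <= int n then (abs (real_of_int r) / n) ^ 3 else 0)) <= abs (real_of_int r) ^ 2" if "n >= 1" for n r
  proof (cases "abs r <= int n")
   case True
   have "(real n)\<^sup>2 * (abs (real_of_int r) / n) ^ 3 = (abs (real_of_int r))\<^sup>2 * (abs (real_of_int r) / n)"
    using that by (simp add: power2_eq_square power3_eq_cube)
   also have "\<dots> <= (abs (real_of_int r))\<^sup>2 * 1" using True that by (intro mult_left_mono) (auto simp: divide_simps)
   finally show ?thesis using True by (simp add: abs_mult)
  qed simp
  show "(\<lambda>n. (real n)\<^sup>2 * (if abs r <= int n then (abs (real_of_int r) / n) ^ 3 else 0)) \<longlonglongrightarrow> 0" for r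
  proof (rule Lim_null_comparison)
   show "(\<lambda>n. abs (real_of_int r) ^ 3 * inverse (real n)) \<longlonglongrightarrow> 0" by (rule tendsto_mult_right_zero) real_asymp
   show "\<forall>\<^sub>F n in sequentially. norm ((real n)\<^sup>2 * (if abs r <= int n then (abs (real_of_int r) / n) ^ 3 else 0)) <= abs (real_of_int r) ^ 3 * inverse (real n)"
    using eventually_gt_at_top[of 0] by eventually_elim (auto simp: power2_eq_square power3_eq_cube divide_simps abs_mult)
  qed
 qed (use assms False in simp)
 thus ?thesis by simp
next
 case True
 have "0 <= S1 \<gamma> n \<and> S1 \<gamma> n <= 3 / (real n)\<^sup>2" if n: "n >= 2" for n
 proof -
  have "S1 \<gamma> n = (\<Sum>\<^sub>\<infinity>r\<in>{- int n..int n}. jump_w \<gamma> r * (abs (real_of_int r) / n) ^ 3)"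
   unfolding S1_def by (rule infsum_cong_neutral) auto
  hence eq: "S1 \<gamma> n = (\<Sum>r\<in>{- int n..int n}. (jump_w \<gamma> r * abs (real_of_int r) ^ 3) / n ^ 3)"
   by (simp add: power_divide)
  have "S1 \<gamma> n <= (\<Sum>r\<in>{- int n..int n}. 1 / n ^ 3)"
   unfolding eq jump_w_pow using True by (intro sum_mono divide_right_mono) auto
  also have "\<dots> = (2 * real n + 1) / n ^ 3" by simp
  also have "\<dots> <= (3 * real n) / n ^ 3" using n by (intro divide_right_mono) auto
  also have "\<dots> = 3 / (real n)\<^sup>2" using n by (simp add: power2_eq_square power3_eq_cube)
  finally show ?thesis unfolding eq by (auto intro!: sum_nonneg)
 qed
 thus ?thesis unfolding True by (rule time_scale_2_null)
qed

text \<open>Telescoping through \<open>1 / N^2 \<le> 1 / (N - 1) - 1 / N\<close>; the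
  \<open>max\<close> in the induction claim makes it read \<open>0 \<le> 0\<close> as long as no
  summand has appeared.\<close>

lemma inverse_square_tail:
 fixes n N :: nat
 assumes n: "n >= 1"
 shows "(\<Sum>k<N. if k <= n then 0 else 1 / (real k)\<^sup>2) <= 1 / n"
proof -
 have "(\<Sum>k<N. if k <= n then 0 else 1 / (real k)\<^sup>2) <= 1 / n - 1 / real (max n (N - 1))"
 proof (induction N)
  case (Suc N)
  show ?case
  proof (cases "N <= n")
   case True
   thus ?thesis using Suc by (simp add: max_def split: if_splits)
  next
   case False
   hence "real N >= 2" using n by simp
   have "1 / (real N)\<^sup>2 <= 1 / (real N * (real N - 1))"
    using \<open>real N >= 2\<close> by (intro divide_left_mono) (auto simp: power2_eq_square)
   also have "\<dots> = 1 / (real N - 1) - 1 / real N"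
    using \<open>real N >= 2\<close> by (simp add: field_simps)
   finally have "1 / (real N)\<^sup>2 <= 1 / (real N - 1) - 1 / real N" .
   moreover have "max n (N - 1) = N - 1" "real (N - 1) = real N - 1" using False by (auto simp: max_def of_nat_diff)
   ultimately show ?thesis using Suc False by (simp add: max_def)
  qed
 qed simp
 also have "\<dots> <= 1 / n" by simp
 finally show ?thesis .
qed

text \<open>At \<open>\<gamma> = 2\<close> the tail of \<open>1 / r^2\<close> beyond
  \<open>n\<close> is at most \<open>1 / n\<close> on each side, and the rescaling of
  \<open>\<bar>r\<bar>\<close> supplies the second factor \<open>1 / n\<close>. For \<gamma> > 2 a
  fixed \<open>r\<close> counts as long for finitely many \<open>n\<close> only, and then
  \<open>n \<bar>r\<bar> \<le> r^2\<close>.\<close>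

lemma time_scale_S2: assumes "\<gamma> >= 2" shows "(\<lambda>n. time_scale \<gamma> n * S2 \<gamma> n) \<longlonglongrightarrow> 0"
proof (cases "\<gamma> = 2")
 case False
 have "(\<lambda>n. time_scale \<gamma> n * S2 \<gamma> n) \<longlonglongrightarrow> (INFSUM r. jump_w \<gamma> r * 0)"
  unfolding S2_def
 proof (rule time_scale_dominated)
  show "abs ((real n)\<^sup>2 * (if abs r <= int n then 0 else abs (real_of_int r) / n)) <= abs (real_of_int r) ^ 2" if "n >= 1" for n r
   using that mult_right_mono[of "real n" "abs (real_of_int r)" "abs (real_of_int r)"] by (auto simp: power2_eq_square abs_mult)
  show "(\<lambda>n. (real n)\<^sup>2 * (if abs r <= int n then 0 else abs (real_of_int r) / n)) \<longlonglongrightarrow> 0" for r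
   by (rule tendsto_eventually) (use eventually_ge_at_top[of "nat (abs r)"] in \<open>eventually_elim, auto\<close>)
 qed (use assms False in simp)
 thus ?thesis by simp
next
 case True
 have "0 <= S2 \<gamma> n \<and> S2 \<gamma> n <= 2 / (real n)\<^sup>2" if n: "n >= 2" for n
 proof -
  define f where "f k = (if k <= n then 0 else 1 / (real k)\<^sup>2)" for k
  have f0: "f k >= 0" for k by (simp add: f_def)
  have part: "(\<Sum>k<N. f k) <= 1 / n" for N
   unfolding f_def using inverse_square_tail[of n N] n by simp
  have sm: "summable f" by (rule summableI_nonneg_bounded[OF f0 part])
  have le: "suminf f <= 1 / n" by (rule suminf_le_const[OF sm part])
  have w: "jump_w \<gamma> r * abs (real_of_int r) = (if r = 0 then 0 else 1 / (real (nat (abs r)))\<^sup>2)" for r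
  proof (cases "r = 0")
   case False
   have "jump_w \<gamma> r * abs (real_of_int r) = real (nat (abs r)) powr - 2"
    using jump_w_pow[of \<gamma> r 1] True by simp
   also have "\<dots> = 1 / (real (nat (abs r)))\<^sup>2"
    using False by (simp add: powr_minus powr_numeral divide_simps)
   finally show ?thesis using False by simp
  qed simp
  have "S2 \<gamma> n = (INFSUM r. f (nat (abs r)) * inverse n)"
  proof -
   have "jump_w \<gamma> r * (if abs r <= int n then 0 else abs (real_of_int r) / n) = f (nat (abs r)) * inverse n" for r
   proof (cases "abs r <= int n")
    case True thus ?thesis by (simp add: f_def nat_le_iff)
   next
    case False
    have "jump_w \<gamma> r * (abs (real_of_int r) / n) = (jump_w \<gamma> r * abs (real_of_int r)) * inverse n"
     by (simp add: divide_inverse)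
    thus ?thesis unfolding w using False by (auto simp: f_def nat_le_iff)
   qed
   thus ?thesis unfolding S2_def by simp
  qed
  also have "\<dots> = (2 * suminf f) * inverse n"
   unfolding infsum_cmult_left' by (subst infsum_even_int(2)[OF sm f0]) (simp_all add: f_def)
  finally have eq: "S2 \<gamma> n = 2 * suminf f / n" by (simp add: divide_inverse)
  have "S2 \<gamma> n <= 2 * (1 / n) / n" unfolding eq using le by (intro divide_right_mono mult_left_mono) auto
  thus ?thesis using suminf_nonneg[OF sm f0] by (simp add: eq power2_eq_square)
 qed
 thus ?thesis unfolding True by (rule time_scale_2_null)
qed

text \<open>At \<open>\<gamma> = 2\<close> the truncated second moment is twice a harmonic number
  over \<open>n^2\<close>; as \<open>harm n - ln n\<close> converges, division by
  \<open>ln n\<close> leaves exactly 2. This is the reason for the time scale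
  \<open>n^2 / ln n\<close>.\<close>

lemma time_scale_S3:
 assumes "\<gamma> >= 2"
 shows "(\<lambda>n. time_scale \<gamma> n * S3 \<gamma> n) \<longlonglongrightarrow>
  (if \<gamma> = 2 then 2 else 2 * (\<Sum>k. real (Suc k) powr (1 - \<gamma>)))"
proof (cases "\<gamma> = 2")
 case False
 have "(\<lambda>n. time_scale \<gamma> n * S3 \<gamma> n) \<longlonglongrightarrow> (INFSUM r. jump_w \<gamma> r * abs (real_of_int r) ^ 2)"
  unfolding S3_def
 proof (rule time_scale_dominated)
  show "abs ((real n)\<^sup>2 * (if abs r <= int n then (abs (real_of_int r) / n)\<^sup>2 else 0)) <= abs (real_of_int r) ^ 2" if "n >= 1" for n r
   using that by (auto simp: power_divide abs_mult)
  show "(\<lambda>n. (real n)\<^sup>2 * (if abs r <= int n then (abs (real_of_int r) / n)\<^sup>2 else 0)) \<longlonglongrightarrow> abs (real_of_int r) ^ 2" for r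
   by (rule tendsto_eventually)
    (use eventually_ge_at_top[of "max 1 (nat (abs r))"] in \<open>eventually_elim, auto simp: power_divide\<close>)
 qed (use assms False in simp)
 thus ?thesis using jump_w_pow_sums(2)[of 2 \<gamma>] False assms by simp
next
 case True
 have eq: "S3 \<gamma> n = 2 * harm n / (real n)\<^sup>2" if n: "n >= 1" for n
 proof -
  define f where "f k = (if k <= n then inverse (real k) / (real n)\<^sup>2 else 0)" for k
  have f0: "f k >= 0" for k by (simp add: f_def)
  have sm: "summable f" by (rule summable_finite[of "{..n}"]) (auto simp: f_def)
  have "suminf f = (\<Sum>k\<in>{..n}. f k)" by (rule suminf_finite) (auto simp: f_def)
  also have "\<dots> = (\<Sum>k\<in>{1..n}. f k)" by (rule sum.mono_neutral_right) (auto simp: f_def not_le)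
  also have "\<dots> = harm n / (real n)\<^sup>2"
   by (simp add: harm_def f_def sum_divide_distrib)
  finally have sf: "suminf f = harm n / (real n)\<^sup>2" .
  have w: "jump_w \<gamma> r * (abs (real_of_int r))\<^sup>2 = inverse (real (nat (abs r)))" for r
   using jump_w_pow[of \<gamma> r 2] True by (cases "r = 0") (simp_all add: powr_minus)
  have "jump_w \<gamma> r * (if abs r <= int n then (abs (real_of_int r) / n)\<^sup>2 else 0) = f (nat (abs r))" for r
  proof -
   have "jump_w \<gamma> r * (abs (real_of_int r) / n)\<^sup>2 = (jump_w \<gamma> r * (abs (real_of_int r))\<^sup>2) / (real n)\<^sup>2"
    by (simp add: power_divide)
   thus ?thesis unfolding w by (auto simp: f_def nat_le_iff)
  qed
  hence "S3 \<gamma> n = (\<Sum>\<^sub>\<infinity>r::int. f (nat (abs r)))" unfolding S3_def by simp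
  also have "\<dots> = 2 * suminf f" by (rule infsum_even_int(2)[OF sm f0]) (simp add: f_def)
  finally show ?thesis by (simp add: sf)
 qed
 have "(\<lambda>n. 2 * ((harm n - ln (real n)) * (1 / ln (real n)) + 1)) \<longlonglongrightarrow> 2 * (euler_mascheroni * 0 + 1)"
 proof (intro tendsto_intros)
  show "(\<lambda>n. harm n - ln (real n)) \<longlonglongrightarrow> (euler_mascheroni :: real)" by (rule euler_mascheroni_LIMSEQ)
  show "(\<lambda>n. 1 / ln (real n)) \<longlonglongrightarrow> 0" by real_asymp
 qed
 hence "(\<lambda>n. time_scale \<gamma> n * S3 \<gamma> n) \<longlonglongrightarrow> 2 * (euler_mascheroni * 0 + 1)"
 proof (rule Lim_transform_eventually)
  show "\<forall>\<^sub>F n in sequentially. 2 * ((harm n - ln (real n)) * (1 / ln (real n)) + 1) = time_scale \<gamma> n * S3 \<gamma> n"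
   using eventually_ge_at_top[of 2]
   by eventually_elim (use True eq in \<open>auto simp: time_scale_def field_simps\<close>)
 qed
 thus ?thesis using True by simp
qed

text \<open>The quantity is \<open>n^(1 - \<beta>)\<close>, divided by \<open>ln n\<close> when
  \<open>\<gamma> = 2\<close>; so the critical value \<open>\<beta> = 1\<close> is included at
  \<open>\<gamma> = 2\<close> and excluded beyond, which is the shape of \<open>R0\<close>.\<close>

lemma time_scale_slow:
 assumes "(\<beta>, \<gamma>) \<in> R0"
 shows "(\<lambda>n. time_scale \<gamma> n * (real n powr - \<beta> / n)) \<longlonglongrightarrow> 0"
proof (cases "\<gamma> = 2")
 case True
 hence b: "\<beta> >= 1" using assms by (auto simp: R0_def)
 show ?thesis
 proof (rule Lim_null_comparison)
  show "\<forall>\<^sub>F n in sequentially. norm (time_scale \<gamma> n * (real n powr - \<beta> / n)) <= 1 / ln (real n)"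
   using eventually_ge_at_top[of 2]
  proof eventually_elim
   case (elim n)
   have "real n powr - \<beta> <= real n powr - 1" using elim b by (intro powr_mono) auto
   hence "real n * real n powr - \<beta> <= 1" using elim by (simp add: powr_minus divide_simps)
   hence "real n * real n powr - \<beta> / ln n <= 1 / ln n" using elim by (intro divide_right_mono) auto
   thus ?case using True elim by (simp add: time_scale_def power2_eq_square)
  qed
  show "(\<lambda>n. 1 / ln (real n)) \<longlonglongrightarrow> 0" by real_asymp
 qed
next
 case False
 hence b: "\<beta> > 1" using assms by (auto simp: R0_def)
 have "(\<lambda>n. real n powr (1 - \<beta>)) \<longlonglongrightarrow> 0"
  by (rule tendsto_neg_powr) (use b in \<open>auto simp: filterlim_real_sequentially\<close>)
 thus ?thesis
 proof (rule Lim_transform_eventually)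
  show "\<forall>\<^sub>F n in sequentially. real n powr (1 - \<beta>) = time_scale \<gamma> n * (real n powr - \<beta> / n)"
   using eventually_ge_at_top[of 1]
   by eventually_elim (use False in \<open>auto simp: time_scale_def power2_eq_square powr_diff powr_minus divide_simps\<close>)
 qed
qed

section \<open>Consistency of the one-dimensional generator\<close>

definition decay3 ::
  "real => (real => real) => (real => real) => (real => real) => (real => real) => bool" where
 "decay3 C h h1 h2 h3 \<longleftrightarrow> C >= 0 \<and>
  (\<forall>u. DERIV h u :> h1 u \<and> DERIV h1 u :> h2 u \<and>
     DERIV h2 u :> h3 u \<and>
     abs (h u) <= C * wt u \<and> abs (h1 u) <= C * wt u \<and> abs (h2 u) <= C * wt u \<and> abs (h3 u) <= C * wt u)"

lemma decay3_bound:
 assumes "decay3 C h h1 h2 h3"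
 shows "abs (h u) <= C * wt u" "abs (h1 u) <= C * wt u" "abs (h2 u) <= C * wt u" "abs (h3 u) <= C * wt u"
  "abs (h u) <= C" "abs (h2 u) <= C"
proof -
 have C: "C >= 0" using assms by (simp add: decay3_def)
 have *: "C * wt u <= C" using mult_left_mono[OF wt_le_1 C] by simp
 show "abs (h u) <= C * wt u" "abs (h1 u) <= C * wt u" "abs (h2 u) <= C * wt u" "abs (h3 u) <= C * wt u"
  using assms by (auto simp: decay3_def)
 thus "abs (h u) <= C" "abs (h2 u) <= C" using * by auto
qed

text \<open>The intermediate point of the Taylor formula is within distance 1 of \<open>u\<close>,
  so \<open>wt_shift\<close> contributes the factor 3; the 1/6 is given away.\<close>

lemma decay3_taylor:
 assumes d: "decay3 C h h1 h2 h3" and z: "abs z <= 1"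
 shows "abs (h (u + z) - h u - (z * h1 u + z\<^sup>2 / 2 * h2 u)) <= 3 * C * abs z ^ 3 * wt u"
proof (cases "z = 0")
 case False
 have C: "C >= 0" using d by (simp add: decay3_def)
 define D where "D m = (if m = 0 then h else if m = 1 then h1 else if m = (2::nat) then h2 else h3)" for m
 have "\<exists>t. (if u + z < u then u + z < t \<and> t < u else u < t \<and> t < u + z) \<and>
   h (u + z) = (\<Sum>m<3. D m u / fact m * (u + z - u) ^ m) + D 3 t / fact 3 * (u + z - u) ^ 3"
 proof (rule Taylor[where a = "u - 1" and b = "u + 1"])
  show "\<forall>m t. m < 3 \<and> u - 1 <= t \<and> t <= u + 1 \<longrightarrow> DERIV (D m) t :> D (Suc m) t"
   using d by (auto simp: D_def decay3_def numeral_3_eq_3 less_Suc_eq)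
 qed (use z False in \<open>auto simp: D_def abs_le_iff\<close>)
 then obtain t where t: "if u + z < u then u + z < t \<and> t < u else u < t \<and> t < u + z"
  and eq: "h (u + z) = (\<Sum>m<3. D m u / fact m * z ^ m) + h3 t / 6 * z ^ 3"
  by (auto simp: D_def fact_numeral)
 have "(\<Sum>m<3. D m u / fact m * z ^ m) = h u + z * h1 u + z\<^sup>2 / 2 * h2 u"
  by (simp add: D_def numeral_3_eq_3 numeral_2_eq_2)
 with eq have e: "h (u + z) - h u - (z * h1 u + z\<^sup>2 / 2 * h2 u) = h3 t / 6 * z ^ 3" by simp
 have "abs (t - u) <= 1" using t z by (auto split: if_splits)
 from wt_shift[OF this, of u] have w: "wt t <= 3 * wt u" by simp
 have "abs (h3 t / 6 * z ^ 3) = abs (h3 t) / 6 * abs z ^ 3" by (simp add: abs_mult power_abs)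
 also have "\<dots> <= (C * (3 * wt u)) * abs z ^ 3"
 proof (rule mult_right_mono)
  have "abs (h3 t) <= C * wt t" by (rule decay3_bound[OF d])
  also have "\<dots> <= C * (3 * wt u)" by (rule mult_left_mono[OF w C])
  finally show "abs (h3 t) / 6 <= C * (3 * wt u)" by simp
 qed simp
 finally show ?thesis unfolding e by (simp add: mult_ac)
qed simp

text \<open>Without a first-order term at the barrier, values near it deviate from the boundary
  value only to second order.\<close>

lemma decay3_flat:
 assumes d: "decay3 C h h1 h2 h3" and 0: "h1 0 = 0"
 shows "abs (h x - h 0) <= C / 2 * x\<^sup>2"
proof (cases "x = 0")
 case False
 have C: "C >= 0" using d by (simp add: decay3_def)
 define D where "D m = (if m = 0 then h else if m = (1::nat) then h1 else h2)" for m
 have "\<exists>t. (if x < 0 then x < t \<and> t < 0 else 0 < t \<and> t < x) \<and>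
   h x = (\<Sum>m<2. D m 0 / fact m * (x - 0) ^ m) + D 2 t / fact 2 * (x - 0) ^ 2"
 proof (rule Taylor[where a = "min x 0" and b = "max x 0"])
  show "\<forall>m t. m < 2 \<and> min x 0 <= t \<and> t <= max x 0 \<longrightarrow> DERIV (D m) t :> D (Suc m) t"
   using d by (auto simp: D_def decay3_def numeral_2_eq_2 less_Suc_eq)
 qed (use False in \<open>auto simp: D_def\<close>)
 then obtain t where "h x = h 0 + h2 t / 2 * x\<^sup>2"
  using 0 by (auto simp: D_def numeral_2_eq_2)
 hence "abs (h x - h 0) = abs (h2 t) / 2 * x\<^sup>2" by (simp add: abs_mult)
 also have "\<dots> <= C / 2 * x\<^sup>2"
  by (intro mult_right_mono divide_right_mono decay3_bound[OF d]) auto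
 finally show ?thesis .
qed (use d in simp)

definition crossing :: "int => int => bool" where
 "crossing m m' \<longleftrightarrow> (m < 0 \<and> m' >= 0) \<or> (m' < 0 \<and> m >= 0)"

text \<open>For fixed displacement the crossing positions form one interval of integers adjacent to
  the barrier. This count is why slow bonds are weighed by the first moment of the jump law.\<close>

lemma crossing_count: "((\<lambda>m. if crossing m (m + r) then 1 else 0) has_sum (abs (real_of_int r))) UNIV"
proof -
 have eq: "{m. crossing m (m + r)} = (if r >= 0 then {-r..-1} else {0..-r-1})"
  by (auto simp: crossing_def)
 have "((\<lambda>m. 1) has_sum (\<Sum>m\<in>{m. crossing m (m + r)}. 1 :: real)) {m. crossing m (m + r)}"
  by (rule has_sum_finite) (simp add: eq)
 moreover have "(\<Sum>m\<in>{m. crossing m (m + r)}. 1 :: real) = abs (real_of_int r)"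
  unfolding eq by simp
 ultimately have "((\<lambda>m. 1) has_sum (abs (real_of_int r))) {m. crossing m (m + r)}" by simp
 thus ?thesis
  by (rule iffD1[OF has_sum_cong_neutral, rotated -1]) auto
qed

definition glue1 :: "(real => real) => (real => real) => real => real" where
 "glue1 hm hp u = (if u < 0 then hm u else hp u)"

lemma glue1_lattice: "n >= 1 ==> glue1 hm hp (real_of_int m / real n) = (if m < 0 then hm (m / n) else hp (m / n))"
 by (simp add: glue1_def divide_less_0_iff)

text \<open>Here \<open>h\<close> is one smooth branch, used on both sides of the barrier. The end
  points have opposite signs, so each lies within \<open>\<bar>r\<bar> / n\<close> of the barrier,
  where \<open>h\<close> is flat.\<close>

lemma cross_bound:
 assumes d: "decay3 C h h1 h2 h3" and 0: "h1 0 = 0" and n: "n >= 1" and cr: "crossing m (m + r)"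
 shows "abs (h (real_of_int (m + r) / real n) - h (m / n)) <= C * (r / n)\<^sup>2"
proof -
 have C: "C >= 0" using d by (simp add: decay3_def)
 have sgn: "real_of_int m * real_of_int (m + r) <= 0"
  using cr by (auto simp: crossing_def mult_nonneg_nonpos mult_nonpos_nonneg)
 have "abs (h (real_of_int (m + r) / real n) - h (m / n)) \<le>
   C / 2 * (real_of_int (m + r) / real n)\<^sup>2 + C / 2 * (m / n)\<^sup>2"
  using decay3_flat[OF d 0, of "real_of_int (m + r) / real n"] decay3_flat[OF d 0, of "m / n"] by linarith
 also have "\<dots> = C / 2 * (((real_of_int (m + r))\<^sup>2 + (real_of_int m)\<^sup>2) / (real n)\<^sup>2)"
  by (simp only: power_divide add_divide_distrib distrib_left)
 also have "\<dots> <= C / 2 * ((2 * (real_of_int r)\<^sup>2) / (real n)\<^sup>2)"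
 proof (intro mult_left_mono divide_right_mono)
  have "(real_of_int r)\<^sup>2 = (real_of_int (m + r))\<^sup>2 + (real_of_int m)\<^sup>2 - 2 * (real_of_int m * real_of_int (m + r))"
   by (simp add: power2_eq_square algebra_simps)
  thus "(real_of_int (m + r))\<^sup>2 + (real_of_int m)\<^sup>2 <= 2 * (real_of_int r)\<^sup>2"
   using sgn by (smt (verit) zero_le_power2)
 qed (use C in auto)
 also have "\<dots> = C * (r / n)\<^sup>2" by (simp add: power_divide)
 finally show ?thesis .
qed

text \<open>The constants collect contributions per lattice length \<open>n\<close>:
  \<open>16 = 3 * 5 + 1\<close> and \<open>12 = 2 * 5 + 2\<close> combine the free error, summed
  with the lattice bound 5, with the expansion lost on crossing pairs; 2 bounds the oscillation of
  the test function over a slow jump; 5 is the lattice bound for the second derivative. The argument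
  \<open>c\<close> is the slow rate, or 0 without barrier.\<close>

definition consistency_error :: "real => real => real => real => nat => real" where
 "consistency_error \<gamma> \<kappa> c \<theta> n = 16 * (\<theta> * S1 \<gamma> n) + 12 * (\<theta> * S2 \<gamma> n)
  + 2 * (c / n * \<theta> * (INFSUM r. jump_w \<gamma> r * abs (real_of_int r))) + 5 * abs (\<theta> * S3 \<gamma> n / 2 - \<kappa>)"

text \<open>Around \<open>m\<close> one expands the branch living on the side of \<open>m\<close>,
  continued across the barrier. The odd first-order term cancels by symmetry of the jumps, the
  second-order term produces \<open>\<theta> * S3 \<gamma> n / 2\<close>, and the rest is estimated
  pair by pair. The flag \<open>b\<close> is 0 if there is no barrier and 1 if there is one with
  flat branches; \<open>a\<close> is the rate across it.\<close>

theorem consistency_1d: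
 fixes n :: nat and a b \<theta> \<gamma> \<kappa> C :: real
 assumes n: "n >= 1" and dm: "decay3 C hm hm1 hm2 hm3" and dp: "decay3 C hp hp1 hp2 hp3"
  and a: "a >= 0" and \<theta>: "\<theta> >= 0" and \<gamma>: "\<gamma> >= 2"
  and b: "b = 0 \<and> a = 1 \<and> hm = hp \<or> b = 1 \<and> hm1 0 = 0 \<and> hp1 0 = 0"
 defines "f \<equiv> \<lambda>m::int. glue1 hm hp (m / n)" and "f2 \<equiv> \<lambda>m::int. glue1 hm2 hp2 (m / n)"
  and "E \<equiv> \<lambda>m. (INFSUM r. \<theta> * jump_w \<gamma> r * (if crossing m (m + r) then a else 1) *
      (glue1 hm hp ((m + r) / n) - glue1 hm hp (m / n))) - \<kappa> * glue1 hm2 hp2 (m / n)"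
 shows "(\<lambda>m. abs (E m)) summable_on UNIV" (is ?A)
  and "(INFSUM m. abs (E m)) <= C * n * consistency_error \<gamma> \<kappa> (b * a) \<theta> n" (is ?B)
proof -
 have C: "C >= 0" using dm by (simp add: decay3_def)
 have b01: "b >= 0" "b <= 1" using b by auto
 define W where "W r = \<theta> * jump_w \<gamma> r" for r
 have W0 [simp]: "W r >= 0" for r using \<theta> by (simp add: W_def)
 have Ws: "W summable_on UNIV"
  unfolding W_def using jump_w_pow_sums(1)[of 0 \<gamma>] \<gamma> by (intro summable_on_cmult_right) auto
 define z where "z r = real_of_int r / n" for r
 define sm where "sm r \<longleftrightarrow> abs r <= int n" for r
 have sm_z: "sm r ==> abs (z r) <= 1" "\<not> sm r ==> abs (z r) >= 1" for r
  using n by (auto simp: sm_def z_def divide_simps)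
 define \<rho> where "\<rho> m r = (if crossing m (m + r) then a else 1)" for m r
 define f1 where "f1 m = glue1 hm1 hp1 (real_of_int m / n)" for m
 \<comment> \<open>Up to the factor \<open>C\<close>, the change of a flat branch over a crossing
   jump: quadratic for short jumps, at most 2 for long ones.\<close>
 define J where "J r = (if sm r then (z r)\<^sup>2 else 2)" for r
 define A where "A r = (if sm r then abs (z r) ^ 3 else 0)" for r
 define B where "B r = (if sm r then 0 else abs (z r))" for r
 define R where "R m r = \<rho> m r * (f (m + r) - f m) - (if sm r then z r * f1 m + (z r)\<^sup>2 / 2 * f2 m else 0)" for m r
 define PP where "PP m r = (if sm r then 3 * C * abs (z r) ^ 3 * wt (m / n) else C * wt ((m + r) / n) + C * wt (m / n))" for m r :: int
 \<comment> \<open>Besides the free error, a crossing pair costs the true jump at rate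
   \<open>a\<close>, at most \<open>2 * C * a\<close>, and the branch increment that the expansion
   assumes but the process does not perform, at most \<open>C * J r\<close>.\<close>
 define G where "G m r = PP m r
   + b * (2 * C * a + C * J r) * (if crossing m (m + r) then 1 else 0)" for m r
 have J0: "J r >= 0" "J r <= 2" for r using sm_z[of r] order_trans[of "(z r)\<^sup>2" 1 2] by (simp_all add: J_def abs_square_le_1)
 have G0: "G m r >= 0" for m r
  unfolding G_def PP_def using C a b01 J0 by (intro add_nonneg_nonneg mult_nonneg_nonneg) auto
 have free: "abs (h (real_of_int (m + r) / n) - h (m / n) - (if sm r then z r * h1 (m / n) + (z r)\<^sup>2 / 2 * h2 (m / n) else 0))
   <= PP m r"
  if d: "decay3 C h h1 h2 h3" for h h1 h2 h3 m r
 proof -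
  have e: "real_of_int (m + r) / n = m / n + z r" by (simp add: z_def add_divide_distrib)
  show ?thesis
  proof (cases "sm r")
   case True
   thus ?thesis using decay3_taylor[OF d sm_z(1)[OF True], of "m / n"] unfolding PP_def e by simp
  next
   case False
   thus ?thesis
    using decay3_bound(1)[OF d, of "(m + r) / n"] decay3_bound(1)[OF d, of "m / n"] by (simp add: PP_def)
  qed
 qed
 have R: "abs (R m r) <= G m r" for m r
 proof -
  \<comment> \<open>\<open>h\<close> is the branch on the side of \<open>m\<close>; the value at the
    target agrees with it unless the jump crosses a barrier.\<close>
  obtain h h1 h2 h3 where d: "decay3 C h h1 h2 h3" and sel: "f m = h (m / n)" "f1 m = h1 (m / n)" "f2 m = h2 (m / n)"
   and same: "\<not> crossing m (m + r) \<or> b = 0 ==> f (m + r) = h ((m + r) / n)"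
   and h10: "b ~= 0 ==> h1 0 = 0"
  proof (cases "m < 0")
   case True
   show ?thesis
    by (rule that[OF dm]) (use True b n in \<open>auto simp: f_def f1_def f2_def glue1_lattice crossing_def glue1_lattice[of n _ _ "m + r", simplified]\<close>)
  next
   case False
   show ?thesis
    by (rule that[OF dp]) (use False b n in \<open>auto simp: f_def f1_def f2_def glue1_lattice crossing_def glue1_lattice[of n _ _ "m + r", simplified]\<close>)
  qed
  show ?thesis
  proof (cases "crossing m (m + r) \<and> b ~= 0")
   case False
   hence "\<rho> m r = 1 \<and> f (m + r) = h ((m + r) / n)"
    using b same by (auto simp: \<rho>_def)
   hence "R m r = h (real_of_int (m + r) / n) - h (m / n) - (if sm r then z r * h1 (m / n) + (z r)\<^sup>2 / 2 * h2 (m / n) else 0)"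
    by (simp add: R_def sel)
   hence "abs (R m r) <= PP m r" using free[OF d, of m r] by simp
   thus ?thesis using False by (auto simp: G_def)
  next
   case True
   hence b1: "b = 1" using b by auto
   have fb: "abs (f j) <= C" for j
    using decay3_bound(5)[OF dm] decay3_bound(5)[OF dp] by (simp add: f_def glue1_def)
   have hd: "abs (h (real_of_int (m + r) / n) - h (m / n)) <= C * J r"
   proof (cases "sm r")
    case T: True
    thus ?thesis using cross_bound[OF d h10 n conjunct1[OF True]] True by (simp add: J_def z_def)
   next
    case False
    thus ?thesis
     using decay3_bound(5)[OF d, of "(m + r) / n"] decay3_bound(5)[OF d, of "m / n"] by (simp add: J_def)
   qed
   have "abs (a * (f (m + r) - f m)) <= a * (2 * C)"
    unfolding abs_mult using fb[of "m + r"] fb[of m] a by (simp add: mult_left_mono)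
   moreover have "R m r = a * (f (m + r) - f m) - (if sm r then z r * h1 (m / n) + (z r)\<^sup>2 / 2 * h2 (m / n) else 0)"
    using True unfolding R_def sel \<rho>_def by simp
   ultimately have "abs (R m r) <= PP m r
     + a * (2 * C) + C * J r"
    using free[OF d, of m r] hd by linarith
   thus ?thesis using True b1 by (simp add: G_def algebra_simps)
  qed
 qed
 define K where "K = 3 * C + 2 * C + (2 * C * a + C * 2)"
 have GK: "G m r <= K" for m r
 proof -
  have Cw: "C * wt x <= C" for x using mult_left_mono[OF wt_le_1 C] by simp
  have "3 * C * abs (z r) ^ 3 * wt (m / n) <= 3 * C * 1 * 1" if "sm r"
   using sm_z(1)[OF that] C by (intro mult_mono) (auto simp: power_le_one)
  hence 1: "PP m r <= 3 * C + 2 * C"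
   using C Cw[of "(m + r) / n"] Cw[of "m / n"] unfolding PP_def by (cases "sm r") auto
  have "b * (2 * C * a + C * J r) <= 1 * (2 * C * a + C * 2)"
   using b01 C a J0 by (intro mult_mono add_mono mult_left_mono) auto
  hence 2: "b * (2 * C * a + C * J r) * (if crossing m (m + r) then 1 else 0) <= 2 * C * a + C * 2"
   using C a by auto
  show ?thesis unfolding G_def K_def using add_mono[OF 1 2] by simp
 qed
 have WG: "(\<lambda>r. W r * G m r) summable_on UNIV" for m
  by (rule infsum_le_bound(1)[OF summable_on_cmult_left[OF Ws, of K]])
   (use G0 GK in \<open>auto simp: abs_mult intro: mult_left_mono\<close>)
 have WR: "(\<lambda>r. W r * R m r) summable_on UNIV" "abs (INFSUM r. W r * R m r) <= (INFSUM r. W r * G m r)" for m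
  using infsum_le_bound[OF WG[of m], of "\<lambda>r. W r * R m r"] mult_left_mono[OF R[of m] W0]
  by (auto simp: abs_mult)
 define O1 where "O1 r = W r * (if sm r then z r else 0)" for r
 define O2 where "O2 r = W r * (if sm r then (z r)\<^sup>2 else 0)" for r
 have O1s: "O1 summable_on UNIV"
  by (rule infsum_le_bound(1)[OF Ws]) (use sm_z in \<open>auto simp: O1_def abs_mult intro: mult_left_le\<close>)
 have O2s: "O2 summable_on UNIV"
  by (rule infsum_le_bound(1)[OF Ws]) (use sm_z in \<open>auto simp: O2_def abs_mult abs_square_le_1 intro!: mult_left_le\<close>)
 have "infsum O1 UNIV = (INFSUM r. O1 (- r))"
  by (rule infsum_reindex_bij_witness[where i = uminus and j = uminus]) auto
 also have "\<dots> = (INFSUM r. - O1 r)" by (rule infsum_cong) (simp add: O1_def W_def sm_def z_def)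
 finally have O1z: "infsum O1 UNIV = 0" by (simp add: infsum_uminus)
 have O2z: "infsum O2 UNIV = \<theta> * S3 \<gamma> n"
  unfolding O2_def S3_def W_def sm_def z_def
  by (simp add: infsum_cmult_right'[symmetric] mult.assoc power_divide cong: if_cong)
 have Eeq: "E m = (INFSUM r. W r * R m r) + (\<theta> * S3 \<gamma> n / 2 - \<kappa>) * f2 m" for m
 proof -
  have "(INFSUM r. \<theta> * jump_w \<gamma> r * (if crossing m (m + r) then a else 1) *
      (glue1 hm hp ((m + r) / n) - glue1 hm hp (m / n)))
    = (INFSUM r. W r * R m r + (f1 m * O1 r + f2 m / 2 * O2 r))"
   by (rule infsum_cong) (auto simp: W_def R_def O1_def O2_def \<rho>_def f_def algebra_simps)
  also have "\<dots> = (INFSUM r. W r * R m r) + ((INFSUM r. f1 m * O1 r) + (INFSUM r. f2 m / 2 * O2 r))"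
   by (simp only: infsum_add WR(1) summable_on_add summable_on_cmult_right O1s O2s)
  also have "\<dots> = (INFSUM r. W r * R m r) + f2 m / 2 * (\<theta> * S3 \<gamma> n)"
   unfolding infsum_cmult_right' O1z O2z by simp
  finally show ?thesis unfolding E_def f2_def by (simp add: algebra_simps)
 qed
 define L where "L = (\<Sum>\<^sub>\<infinity>m::int. wt (m / n))"
 have L: "((\<lambda>m::int. wt (m / n)) has_sum L) UNIV" "L <= 5 * n"
  using wt_lattice_sum[OF n] by (auto simp: L_def)
 have Ls: "((\<lambda>m::int. wt ((m + r) / n)) has_sum L) UNIV" for r
  by (rule iffD2[OF has_sum_reindex_bij_witness[where j = "\<lambda>m. m + r" and i = "\<lambda>m. m - r"] L(1)]) auto
 define g where "g r = (if sm r then 3 * C * abs (z r) ^ 3 * L else C * L + C * L) + b * (2 * C * a + C * J r) * abs (real_of_int r)" for r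
 have Gcol: "((\<lambda>m. G m r) has_sum g r) UNIV" for r
  unfolding G_def g_def
 proof (intro has_sum_add has_sum_cmult_right crossing_count)
  show "((\<lambda>m. PP m r) has_sum (if sm r then 3 * C * abs (z r) ^ 3 * L else C * L + C * L)) UNIV"
   unfolding PP_def using has_sum_cmult_right[OF L(1), of "3 * C * abs (z r) ^ 3"]
    has_sum_add[OF has_sum_cmult_right[OF Ls[of r], of C] has_sum_cmult_right[OF L(1), of C]]
   by (cases "sm r") simp_all
 qed
 have g0: "g r >= 0" for r using has_sum_nonneg[OF Gcol] G0 by auto
 \<comment> \<open>On a short crossing jump the branch increment has order \<open>(z r)^2\<close>,
   and there are \<open>n * \<bar>z r\<bar>\<close> crossing positions: together this is of the same
   order \<open>n * \<bar>z r\<bar>^3\<close> as the Taylor error.\<close>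
 have rN: "abs (real_of_int r) = n * abs (z r)" for r using n by (simp add: z_def)
 define gg where "gg r = (15 * C * n + C * n) * (W r * A r) + (10 * C * n + 2 * C * n) * (W r * B r)
   + 2 * b * C * a * (W r * abs (real_of_int r))" for r
 have ggb: "W r * g r <= gg r" for r
 proof -
  have "g r <= (15 * C * n + C * n) * A r + (10 * C * n + 2 * C * n) * B r + 2 * b * C * a * abs (real_of_int r)"
  proof (cases "sm r")
   case True
   have "3 * C * abs (z r) ^ 3 * L <= 3 * C * abs (z r) ^ 3 * (5 * n)" using L C by (intro mult_left_mono) auto
   moreover have "b * (C * (z r)\<^sup>2) * abs (real_of_int r) <= 1 * (C * (z r)\<^sup>2) * abs (real_of_int r)"
    using b01 C by (intro mult_right_mono) auto
   moreover have "(z r)\<^sup>2 * abs (real_of_int r) = n * abs (z r) ^ 3" unfolding rN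
    by (simp add: power2_eq_square power3_eq_cube mult.assoc[symmetric])
   ultimately show ?thesis using True by (simp add: g_def A_def B_def J_def algebra_simps)
  next
   case False
   have "C * L <= C * (5 * n) * 1" using L C by (simp add: mult_left_mono)
   also have "\<dots> <= C * (5 * n) * abs (z r)" using sm_z(2)[OF False] C by (intro mult_left_mono) auto
   finally have "C * L <= C * (5 * n) * abs (z r)" .
   moreover have "b * (C * 2) * abs (real_of_int r) <= 1 * (C * 2) * abs (real_of_int r)"
    using b01 C by (intro mult_right_mono) auto
   ultimately show ?thesis using False rN[of r] by (simp add: g_def A_def B_def J_def algebra_simps)
  qed
  from mult_left_mono[OF this W0[of r]] show ?thesis by (simp add: gg_def algebra_simps)
 qed
 have Wr: "(\<lambda>r. W r * abs (real_of_int r)) summable_on UNIV"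
  unfolding W_def using summable_on_cmult_right[OF jump_w_pow_sums(1)[of 1 \<gamma>], of \<theta>] \<gamma> by (simp add: mult.assoc)
 have WA: "(\<lambda>r. W r * A r) summable_on UNIV"
  by (rule infsum_le_bound(1)[OF Ws]) (use sm_z in \<open>auto simp: A_def abs_mult power_le_one intro!: mult_left_le\<close>)
 have WB: "(\<lambda>r. W r * B r) summable_on UNIV"
 proof (rule infsum_le_bound(1)[OF Wr])
  fix r
  have "abs (real_of_int r) * 1 <= abs (real_of_int r) * real n" using n by (intro mult_left_mono) auto
  hence "0 <= B r \<and> B r <= abs (real_of_int r)" using n by (simp add: B_def z_def divide_simps)
  thus "abs (W r * B r) <= W r * abs (real_of_int r)" by (simp add: abs_mult mult_left_mono)
 qed
 have ggsum: "(gg has_sum 16 * C * n * (\<theta> * S1 \<gamma> n) + 12 * C * n * (\<theta> * S2 \<gamma> n) + 2 * b * C * a * (\<theta> * (INFSUM r. jump_w \<gamma> r * abs (real_of_int r)))) UNIV"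
 proof -
  have "((\<lambda>r. W r * A r) has_sum \<theta> * S1 \<gamma> n) UNIV"
   unfolding S1_def infsum_cmult_right'[symmetric] using WA
   unfolding W_def A_def sm_def z_def abs_divide abs_of_nat by (simp add: has_sum_iff mult.assoc)
  moreover have "((\<lambda>r. W r * B r) has_sum \<theta> * S2 \<gamma> n) UNIV"
   unfolding S2_def infsum_cmult_right'[symmetric] using WB
   unfolding W_def B_def sm_def z_def abs_divide abs_of_nat by (simp add: has_sum_iff mult.assoc)
  moreover have "((\<lambda>r. W r * abs (real_of_int r)) has_sum \<theta> * (INFSUM r. jump_w \<gamma> r * abs (real_of_int r))) UNIV"
   unfolding infsum_cmult_right'[symmetric] using Wr by (simp add: has_sum_iff W_def mult.assoc)
  ultimately have "(gg has_sum (15 * C * n + C * n) * (\<theta> * S1 \<gamma> n) + (10 * C * n + 2 * C * n) * (\<theta> * S2 \<gamma> n)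
    + 2 * b * C * a * (\<theta> * (INFSUM r. jump_w \<gamma> r * abs (real_of_int r)))) UNIV"
   unfolding gg_def by (intro has_sum_add has_sum_cmult_right)
  thus ?thesis by (simp add: algebra_simps)
 qed
 hence ggs: "gg summable_on UNIV" and ggsum: "infsum gg UNIV = 16 * C * n * (\<theta> * S1 \<gamma> n) + 12 * C * n * (\<theta> * S2 \<gamma> n) + 2 * b * C * a * (\<theta> * (INFSUM r. jump_w \<gamma> r * abs (real_of_int r)))"
  by (auto simp: has_sum_iff)
 have Wg: "(\<lambda>r. W r * g r) summable_on UNIV" "(INFSUM r. W r * g r) <= infsum gg UNIV"
 proof -
  show s: "(\<lambda>r. W r * g r) summable_on UNIV"
   by (rule infsum_le_bound(1)[OF ggs]) (use ggb g0 in \<open>auto simp: abs_mult\<close>)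
  show "(INFSUM r. W r * g r) <= infsum gg UNIV" by (rule infsum_mono[OF s ggs ggb])
 qed
 have col: "(INFSUM m. W r * G m r) = W r * g r" "(\<lambda>m. W r * G m r) summable_on UNIV" for r
  using has_sum_cmult_right[OF Gcol, of "W r"] by (auto simp: has_sum_iff)
 \<comment> \<open>The majorant is nonnegative, so the sum over positions may be taken first, where
   the lattice bound and the crossing count apply.\<close>
 note sw = infsum_swap_nonneg[of "\<lambda>r m. W r * G m r"]
 have S: "(\<lambda>m. INFSUM r. W r * G m r) summable_on UNIV" "(INFSUM m. INFSUM r. W r * G m r) = (INFSUM r. W r * g r)"
  using sw(2) sw(4) G0 col Wg(1) by auto
 define Q where "Q m = (INFSUM r. W r * G m r) + abs (\<theta> * S3 \<gamma> n / 2 - \<kappa>) * C * wt (m / n)" for m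
 have Qs: "Q summable_on UNIV" unfolding Q_def
  by (intro summable_on_add S summable_on_cmult_right) (use L(1) in \<open>auto simp: has_sum_iff\<close>)
 have EQ: "abs (E m) <= Q m" for m
 proof -
  have "abs (f2 m) <= C * wt (m / n)"
   using decay3_bound(3)[OF dm] decay3_bound(3)[OF dp] by (simp add: f2_def glue1_def)
  hence "abs ((\<theta> * S3 \<gamma> n / 2 - \<kappa>) * f2 m) <= abs (\<theta> * S3 \<gamma> n / 2 - \<kappa>) * (C * wt (m / n))"
   unfolding abs_mult by (rule mult_left_mono) simp
  thus ?thesis unfolding Eeq Q_def using WR(2)[of m] by (simp add: mult.assoc)
 qed
 show Es: ?A by (rule infsum_le_bound(2)[OF Qs EQ])
 have "(INFSUM m. abs (E m)) <= infsum Q UNIV" by (rule infsum_mono[OF Es Qs EQ])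
 also have "\<dots> = (INFSUM r. W r * g r) + abs (\<theta> * S3 \<gamma> n / 2 - \<kappa>) * C * L"
  unfolding Q_def by (subst infsum_add[OF S(1) summable_on_cmult_right])
   (use L(1) S(2) in \<open>auto simp: has_sum_iff infsum_cmult_right' L_def\<close>)
 also have "\<dots> <= infsum gg UNIV + abs (\<theta> * S3 \<gamma> n / 2 - \<kappa>) * C * (5 * n)"
  by (intro add_mono Wg mult_left_mono L) (use C in auto)
 also have "\<dots> = C * n * consistency_error \<gamma> \<kappa> (b * a) \<theta> n"
  unfolding ggsum consistency_error_def using n by (simp add: algebra_simps)
 finally show ?B .
qed

section \<open>Generators of exclusion processes on functions of finite variation\<close>

lemma local_fun_continuous:
 fixes f :: "('s => bool) => real"
 assumes A: "finite A" and f: "\<And>\<eta> \<xi>. (\<forall>x\<in>A. \<eta> x = \<xi> x) ==> f \<eta> = f \<xi>"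
 shows "continuous_on UNIV f" "finite (range f)"
proof -
 have "f \<eta> = f (\<lambda>x. x \<in> {x\<in>A. \<eta> x})" for \<eta> by (rule f) auto
 hence "range f \<subseteq> (\<lambda>B. f (\<lambda>x. x \<in> B)) ` Pow A" by (auto intro!: image_eqI[where x = "{x\<in>A. _ x}"])
 thus "finite (range f)" by (rule finite_subset) (use A in simp)
 show "continuous_on UNIV f"
  unfolding continuous_on_def
 proof
  fix \<eta> :: "'s => bool"
  define U where "U = (\<Inter>x\<in>A. {\<xi>. \<xi> x = \<eta> x})"
  have "open {\<xi> :: 's => bool. \<xi> x = \<eta> x}" for x
  proof -
   have "continuous_on UNIV (\<lambda>\<xi> :: 's => bool. \<xi> x)" by (rule continuous_on_product_coordinates)
   hence "open ((\<lambda>\<xi> :: 's => bool. \<xi> x) -` {\<eta> x})"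
    by (rule open_vimage[OF discrete_topology_class.open_discrete])
   thus ?thesis by (simp add: vimage_def)
  qed
  hence U: "open U" unfolding U_def using A by auto
  show "(f \<longlongrightarrow> f \<eta>) (at \<eta>)"
  proof (rule tendsto_eventually)
   have "\<eta> \<in> U" by (simp add: U_def)
   hence "\<forall>\<^sub>F \<xi> in at \<eta>. \<xi> \<in> U" using U by (simp add: eventually_at_topological) blast
   thus "\<forall>\<^sub>F \<xi> in at \<eta>. f \<xi> = f \<eta>"
    by eventually_elim (auto intro!: f simp: U_def)
  qed
 qed
qed

text \<open>\<open>c x\<close> bounds the influence of site \<open>x\<close>. Comparing arbitrary
  pairs of configurations, not only single flips, builds continuity in the product topology into the
  condition.\<close>

definition variation :: "('s => real) => (('s => bool) => real) => bool" where
 "variation c f \<longleftrightarrow> (\<forall>x. c x >= 0) \<and> c summable_on UNIV \<and>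
  (\<forall>\<eta> \<xi>. abs (f \<eta> - f \<xi>) <= (INFSUM x. c x * of_bool (\<eta> x ~= \<xi> x)))"

lemma variationD:
 assumes "variation c f"
 shows "c x >= 0" "c summable_on UNIV" "abs (f \<eta> - f \<xi>) <= (INFSUM x. c x * of_bool (\<eta> x ~= \<xi> x))" (is ?A)
  "(\<lambda>x. c x * of_bool (P x)) summable_on UNIV" "abs (f \<eta> - f \<xi>) <= infsum c UNIV" (is ?B)
proof -
 show c: "c x >= 0" "c summable_on UNIV" for x using assms by (auto simp: variation_def)
 show s: "(\<lambda>x. c x * of_bool (P x)) summable_on UNIV" for P
  by (rule infsum_le_bound(1)[OF c(2)]) (use c in auto)
 show v: ?A using assms by (auto simp: variation_def)
 also have "\<dots> <= infsum c UNIV" by (rule infsum_mono[OF s c(2)]) (use c in auto)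
 finally show ?B .
qed

text \<open>The local approximation of \<open>f\<close>: freezing the sites outside \<open>F\<close>
  as empty does not increase the influence of any site.\<close>

definition restr :: "'s set => (('s => bool) => real) => ('s => bool) => real" where
 "restr F f \<eta> = f (\<lambda>x. x \<in> F \<and> \<eta> x)"

lemma restr_local: "\<forall>x\<in>F. \<eta> x = \<xi> x ==> restr F f \<eta> = restr F f \<xi>"
proof -
 assume "\<forall>x\<in>F. \<eta> x = \<xi> x"
 hence "(\<lambda>x. x \<in> F \<and> \<eta> x) = (\<lambda>x. x \<in> F \<and> \<xi> x)" by auto
 thus ?thesis by (simp add: restr_def)
qed

lemma variation_restr: assumes v: "variation c f" shows "variation c (restr F f)"
 unfolding variation_def
proof (intro conjI allI)
 show "c x >= 0" "c summable_on UNIV" for x using variationD[OF v] by auto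
 fix \<eta> \<xi>
 have "abs (restr F f \<eta> - restr F f \<xi>) <= (INFSUM x. c x * of_bool ((x \<in> F \<and> \<eta> x) ~= (x \<in> F \<and> \<xi> x)))"
  unfolding restr_def by (rule variationD(3)[OF v])
 also have "\<dots> <= (INFSUM x. c x * of_bool (\<eta> x ~= \<xi> x))"
  by (intro infsum_mono variationD(4)[OF v]) (use variationD(1)[OF v] in auto)
 finally show "abs (restr F f \<eta> - restr F f \<xi>) <= (INFSUM x. c x * of_bool (\<eta> x ~= \<xi> x))" .
qed

lemma summable_tail:
 fixes c :: "'s => real"
 assumes c: "c summable_on UNIV" "\<And>x. c x >= 0" and e: "e > 0"
 obtains F where "finite F" "(INFSUM x. c x * of_bool (x \<notin> F)) < e"
proof -
 obtain F where F: "finite F" "dist (sum c F) (infsum c UNIV) <= e / 2"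
  using infsum_finite_approximation[OF c(1), of "e / 2"] e by auto
 have s: "(\<lambda>x. c x * of_bool (x \<in> F)) summable_on UNIV" "(\<lambda>x. c x * of_bool (x \<notin> F)) summable_on UNIV"
  by (rule infsum_le_bound(1)[OF c(1)]; use c in auto)+
 have "infsum c UNIV = (INFSUM x. c x * of_bool (x \<in> F) + c x * of_bool (x \<notin> F))"
  by (rule infsum_cong) auto
 also have "\<dots> = (INFSUM x. c x * of_bool (x \<in> F)) + (INFSUM x. c x * of_bool (x \<notin> F))"
  by (rule infsum_add[OF s])
 also have "(INFSUM x. c x * of_bool (x \<in> F)) = (\<Sum>\<^sub>\<infinity>x\<in>F. c x)"
  by (rule infsum_cong_neutral) auto
 finally have "(INFSUM x. c x * of_bool (x \<notin> F)) = infsum c UNIV - sum c F" using F(1) by simp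
 also have "\<dots> <= e / 2" using F(2) unfolding dist_real_def by linarith
 finally show ?thesis using that[OF F(1)] e by simp
qed

lemma restr_approx:
 assumes v: "variation c f"
 shows "abs (restr F f \<eta> - f \<eta>) <= (INFSUM x. c x * of_bool (x \<notin> F))"
proof -
 have "abs (restr F f \<eta> - f \<eta>) <= (INFSUM x. c x * of_bool ((x \<in> F \<and> \<eta> x) ~= \<eta> x))"
  unfolding restr_def by (rule variationD(3)[OF v])
 also have "\<dots> <= (INFSUM x. c x * of_bool (x \<notin> F))"
  by (intro infsum_mono variationD(4)[OF v]) (use variationD(1)[OF v] in auto)
 finally show ?thesis .
qed

text \<open>A uniform limit of the local functions \<open>restr F f\<close>, with error the tail of
  \<open>c\<close>.\<close>

lemma variation_continuous:
 assumes v: "variation c f"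
 shows "continuous_on UNIV f" "bounded (range f)"
proof -
 have "\<exists>g. continuous_on UNIV g \<and> (\<forall>\<eta>. abs (g \<eta> - f \<eta>) < e)" if e: "e > 0" for e
 proof -
  obtain F where F: "finite F" "(INFSUM x. c x * of_bool (x \<notin> F)) < e"
   using summable_tail[OF variationD(2,1)[OF v] e] .
  have "continuous_on UNIV (restr F f)" by (rule local_fun_continuous(1)[OF F(1) restr_local])
  moreover have "\<forall>\<eta>. abs (restr F f \<eta> - f \<eta>) < e"
   using restr_approx[OF v, of F] F(2) by (auto intro: le_less_trans)
  ultimately show ?thesis by blast
 qed
 hence "\<exists>g. \<forall>k::nat. continuous_on UNIV (g k) \<and> (\<forall>\<eta>. abs (g k \<eta> - f \<eta>) < 1 / Suc k)"
  by (intro choice allI) simp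
 then obtain g where g: "\<And>k. continuous_on UNIV (g k)" "\<And>k \<eta>. abs (g k \<eta> - f \<eta>) < 1 / Suc k" by auto
 have "uniform_limit UNIV g f sequentially"
 proof (rule uniform_limitI)
  fix e :: real assume "e > 0"
  hence "\<forall>\<^sub>F k in sequentially. 1 / real (Suc k) < e" by real_asymp
  thus "\<forall>\<^sub>F k in sequentially. \<forall>\<eta>\<in>UNIV. dist (g k \<eta>) (f \<eta>) < e"
   by eventually_elim (use g(2) in \<open>auto simp: dist_real_def intro: less_trans\<close>)
 qed
 thus "continuous_on UNIV f"
  by (rule uniform_limit_theorem[rotated]) (use g in auto)
 show "bounded (range f)"
 proof (rule boundedI)
  fix y assume "y \<in> range f"
  then obtain \<eta> where "y = f \<eta>" by auto
  thus "norm y <= abs (f (\<lambda>_. False)) + infsum c UNIV"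
   using variationD(5)[OF v, of \<eta> "\<lambda>_. False"] by simp
 qed
qed

section \<open>Symmetric exchange generators with summable rates\<close>

locale exclusion_rates =
 fixes q :: "'s => 's => real" and M :: real
 assumes q_nonneg [simp]: "q x y >= 0" and q_sym: "q x y = q y x"
  and q_summable: "q x summable_on UNIV" and q_bound: "(INFSUM y. q x y) <= M"
begin

definition gen :: "(('s => bool) => real) => ('s => bool) => real" where
 "gen f \<eta> = 1/2 * (\<Sum>\<^sub>\<infinity>(x, y)\<in>UNIV. q x y * (f (\<eta>(x := \<eta> y, y := \<eta> x)) - f \<eta>))"

text \<open>Generator of a single particle jumping with the rates \<open>q\<close>.\<close>

definition walk :: "('s => real) => 's => real" where
 "walk a x = (INFSUM y. q x y * (a y - a x))"

lemma pair_summable_fst: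
 assumes c: "c summable_on UNIV" "\<And>x. c x >= 0"
 shows "(\<lambda>(x, y). q x y * c x) summable_on UNIV"
proof (rule infsum_swap_nonneg(1))
 show "q x y * c x >= 0" for x y using c by simp
 show "(\<lambda>y. q x y * c x) summable_on UNIV" for x by (rule summable_on_cmult_left[OF q_summable])
 have le: "abs (INFSUM y. q x y * c x) <= M * c x" for x
 proof -
  have "0 <= (INFSUM y. q x y)" by (rule infsum_nonneg) simp
  thus ?thesis
   unfolding infsum_cmult_left' abs_mult using q_bound[of x] c(2)[of x] by (simp add: mult_right_mono)
 qed
 show "(\<lambda>x. INFSUM y. q x y * c x) summable_on UNIV"
  by (rule infsum_le_bound(1)[OF summable_on_cmult_right[OF c(1), of M] le])
qed

lemma pair_summable_snd:
 assumes c: "c summable_on UNIV" "\<And>x. c x >= 0"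
 shows "(\<lambda>(x, y). q x y * c y) summable_on UNIV"
proof -
 have "(\<lambda>(x, y). q x y * c y) summable_on UNIV \<longleftrightarrow> (\<lambda>(x, y). q x y * c x) summable_on UNIV"
  by (rule summable_on_reindex_bij_witness[where i = prod.swap and j = prod.swap]) (auto simp: q_sym)
 thus ?thesis using pair_summable_fst[OF c] by simp
qed

lemma pair_summable:
 assumes c: "c summable_on UNIV" "\<And>x. c x >= 0"
 shows "(\<lambda>(x, y). q x y * (c x + c y)) summable_on UNIV"
 using summable_on_add[OF pair_summable_fst[OF c] pair_summable_snd[OF c]]
 by (simp add: case_prod_unfold distrib_left)

lemma variation_exchange:
 assumes v: "variation c f"
 shows "abs (f (\<eta>(x := \<eta> y, y := \<eta> x)) - f \<eta>) <= c x + c y"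
proof -
 note c = variationD(1)[OF v]
 have "abs (f (\<eta>(x := \<eta> y, y := \<eta> x)) - f \<eta>) <= (INFSUM z. c z * of_bool ((\<eta>(x := \<eta> y, y := \<eta> x)) z ~= \<eta> z))"
  by (rule variationD(3)[OF v])
 also have "\<dots> = (\<Sum>\<^sub>\<infinity>z\<in>{x, y}. c z * of_bool ((\<eta>(x := \<eta> y, y := \<eta> x)) z ~= \<eta> z))"
  by (rule infsum_cong_neutral) auto
 also have "\<dots> = (\<Sum>z\<in>{x, y}. c z * of_bool ((\<eta>(x := \<eta> y, y := \<eta> x)) z ~= \<eta> z))" by simp
 also have "\<dots> <= (\<Sum>z\<in>{x, y}. c z)" by (rule sum_mono) (use c in auto)
 also have "\<dots> <= c x + c y" by (cases "x = y") (use c in auto)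
 finally show ?thesis .
qed

lemma gen_term_bound:
 assumes v: "variation c f"
 shows "abs (case p of (x, y) => q x y * (f (\<eta>(x := \<eta> y, y := \<eta> x)) - f \<eta>)) <= (case p of (x, y) => q x y * (c x + c y))"
 by (cases p) (use variation_exchange[OF v] in \<open>auto simp: abs_mult mult_left_mono\<close>)

lemma gen_summable:
 assumes v: "variation c f"
 shows "(\<lambda>(x, y). q x y * (f (\<eta>(x := \<eta> y, y := \<eta> x)) - f \<eta>)) summable_on UNIV"
 by (rule infsum_le_bound(1)[OF pair_summable[OF variationD(2,1)[OF v]] gen_term_bound[OF v]])

lemma gen_continuous:
 assumes v: "variation c f"
 shows "continuous_on UNIV (gen f)" "bounded (range (gen f))"
proof -
 have ex: "continuous_on UNIV (\<lambda>\<eta> :: 's => bool. \<eta>(x := \<eta> y, y := \<eta> x))" for x y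
 proof (rule continuous_on_coordinatewise_then_product)
  show "continuous_on UNIV (\<lambda>\<eta> :: 's => bool. (\<eta>(x := \<eta> y, y := \<eta> x)) i)" for i
   by (cases "i = y"; cases "i = x") (simp_all add: continuous_on_product_coordinates)
 qed
 have "continuous_on UNIV (\<lambda>\<eta>. case p of (x, y) => q x y * (f (\<eta>(x := \<eta> y, y := \<eta> x)) - f \<eta>))" for p
 proof (cases p)
  case (Pair x y)
  have "continuous_on UNIV (\<lambda>\<eta>. f (\<eta>(x := \<eta> y, y := \<eta> x)))"
   by (rule continuous_on_compose2[OF variation_continuous(1)[OF v] ex]) simp
  thus ?thesis unfolding Pair by (auto intro!: continuous_intros variation_continuous(1)[OF v])
 qed
 hence "continuous_on UNIV (\<lambda>\<eta>. INFSUM p. case p of (x, y) => q x y * (f (\<eta>(x := \<eta> y, y := \<eta> x)) - f \<eta>))"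
  by (rule continuous_on_infsum[OF pair_summable[OF variationD(2,1)[OF v]] gen_term_bound[OF v]])
 thus "continuous_on UNIV (gen f)" unfolding gen_def by (intro continuous_intros)
 show "bounded (range (gen f))"
 proof (rule boundedI)
  fix y assume "y \<in> range (gen f)"
  then obtain \<eta> where \<eta>: "y = gen f \<eta>" by auto
  show "norm y <= 1/2 * (\<Sum>\<^sub>\<infinity>(x, y)\<in>UNIV. q x y * (c x + c y))"
   unfolding \<eta> gen_def real_norm_def abs_mult
   using infsum_le_bound(3)[OF pair_summable[OF variationD(2,1)[OF v]] gen_term_bound[OF v, where \<eta> = \<eta>]]
   by simp
 qed
qed

text \<open>One finite restriction approximates \<open>f\<close> and its generator at once. Finitely
  many pairs \<open>P\<close> carry all but little of the majorant of the generator sum; on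
  \<open>P\<close> uniform closeness to \<open>f\<close> suffices since the total rate
  \<open>Q\<close> is finite, off \<open>P\<close> both sums are small whatever \<open>F\<close>
  is.\<close>

lemma gen_approx:
 assumes v: "variation c f" and e: "e > 0"
 obtains F where "finite F" "\<And>\<eta>. abs (restr F f \<eta> - f \<eta>) < e" "\<And>\<eta>. abs (gen (restr F f) \<eta> - gen f \<eta>) < e"
proof -
 note c = variationD(2,1)[OF v]
 define b where "b p = (case p of (x, y) => q x y * (c x + c y))" for p
 have b0: "b p >= 0" for p by (cases p) (simp add: b_def c)
 have bs: "b summable_on UNIV" using pair_summable[OF c] by (simp add: b_def[abs_def])
 obtain P where P: "finite P" "(INFSUM p. b p * of_bool (p \<notin> P)) < e / 2"
  using summable_tail[OF bs b0, of "e / 2"] e by auto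
 define Q where "Q = (\<Sum>(x, y)\<in>P. q x y)"
 have Q0: "Q >= 0" unfolding Q_def by (intro sum_nonneg) auto
 \<comment> \<open>The pairs in \<open>P\<close> then contribute at most
   \<open>2 * e' * Q \<le> e / 2\<close>; the \<open>+ 1\<close> covers
   \<open>Q = 0\<close>.\<close>
 define e' where "e' = min e (e / (4 * (Q + 1)))"
 have e': "e' > 0" "e' <= e" "e' * Q <= e / 4"
 proof -
  show "e' > 0" "e' <= e" using e Q0 by (auto simp: e'_def)
  have "e' * Q <= e / (4 * (Q + 1)) * Q" using Q0 by (intro mult_right_mono) (auto simp: e'_def)
  also have "\<dots> <= e / 4" using Q0 e by (simp add: field_simps)
  finally show "e' * Q <= e / 4" .
 qed
 obtain F where F: "finite F" "(INFSUM x. c x * of_bool (x \<notin> F)) < e'"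
  using summable_tail[OF c e'(1)] .
 have fF: "abs (restr F f \<eta> - f \<eta>) < e'" for \<eta> using restr_approx[OF v, of F \<eta>] F(2) by simp
 have "abs (gen (restr F f) \<eta> - gen f \<eta>) < e" for \<eta>
 proof -
  define u where "u p = (case p of (x, y) => q x y * (restr F f (\<eta>(x := \<eta> y, y := \<eta> x)) - restr F f \<eta>))" for p
  define w where "w p = (case p of (x, y) => q x y * (f (\<eta>(x := \<eta> y, y := \<eta> x)) - f \<eta>))" for p
  define d where "d p = (case p of (x, y) => q x y) * of_bool (p \<in> P) * (2 * e')" for p
  have us: "u summable_on UNIV" "w summable_on UNIV"
   using gen_summable[OF variation_restr[OF v]] gen_summable[OF v] by (auto simp: u_def[abs_def] w_def[abs_def])
  have ub: "abs (u p) <= b p" "abs (w p) <= b p" for p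
   unfolding u_def w_def b_def by (rule gen_term_bound[OF variation_restr[OF v]], rule gen_term_bound[OF v])
  have bP: "(\<lambda>p. b p * of_bool (p \<notin> P)) summable_on UNIV"
   by (rule infsum_le_bound(1)[OF bs]) (use b0 in auto)
  have ds: "(d has_sum 2 * e' * Q) UNIV"
  proof -
   have "(d has_sum (\<Sum>p\<in>P. d p)) UNIV"
    by (rule iffD1[OF has_sum_cong_neutral has_sum_finite[OF P(1)]]) (auto simp: d_def)
   moreover have "(\<Sum>p\<in>P. d p) = 2 * e' * Q"
    unfolding Q_def sum_distrib_left by (rule sum.cong) (auto simp: d_def)
   ultimately show ?thesis by simp
  qed
  have ud: "abs (u p - w p) <= 2 * (b p * of_bool (p \<notin> P)) + d p" for p
  proof (cases "p \<in> P")
   case True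
   obtain x y where p: "p = (x, y)" by (cases p)
   have "abs (u p - w p) = q x y * abs ((restr F f (\<eta>(x := \<eta> y, y := \<eta> x)) - f (\<eta>(x := \<eta> y, y := \<eta> x))) - (restr F f \<eta> - f \<eta>))"
   proof -
    have "u p - w p = q x y * ((restr F f (\<eta>(x := \<eta> y, y := \<eta> x)) - f (\<eta>(x := \<eta> y, y := \<eta> x))) - (restr F f \<eta> - f \<eta>))"
     unfolding u_def w_def p prod.case by (simp only: right_diff_distrib)
    thus ?thesis by (simp only: abs_mult abs_of_nonneg[OF q_nonneg])
   qed
   also have "\<dots> <= q x y * (2 * e')"
    using fF[of "\<eta>(x := \<eta> y, y := \<eta> x)"] fF[of \<eta>] by (intro mult_left_mono) auto
   finally show ?thesis using True by (simp add: d_def p)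
  next
   case False
   thus ?thesis using ub[of p] by (simp add: d_def)
  qed
  have "abs (infsum u UNIV - infsum w UNIV) = abs (INFSUM p. u p - w p)"
   using infsum_add[OF us(1) iffD2[OF summable_on_uminus us(2)]] by (simp add: infsum_uminus)
  also have "\<dots> <= (INFSUM p. 2 * (b p * of_bool (p \<notin> P)) + d p)"
   by (rule infsum_le_bound(3)[OF summable_on_add[OF summable_on_cmult_right[OF bP]] ud])
    (use ds in \<open>auto simp: has_sum_iff\<close>)
  also have "\<dots> = 2 * (INFSUM p. b p * of_bool (p \<notin> P)) + 2 * e' * Q"
   using ds by (subst infsum_add[OF summable_on_cmult_right[OF bP]])
    (auto simp: has_sum_iff infsum_cmult_right')
  \<comment> \<open>The prefactor 1/2 of \<open>gen\<close> brings this down to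
    \<open>e\<close>.\<close>
  also have "\<dots> < 2 * e" using P(2) e'(3) e by (simp add: mult.assoc)
  finally show ?thesis unfolding gen_def u_def[symmetric] w_def[symmetric]
   by (simp add: u_def[abs_def] w_def[abs_def])
 qed
 moreover have "abs (restr F f \<eta> - f \<eta>) < e" for \<eta> using fF[of \<eta>] e' by simp
 ultimately show ?thesis using that F(1) by blast
qed

definition lin :: "('s => real) => ('s => bool) => real" where
 "lin a \<eta> = (INFSUM x. a x * of_bool (\<eta> x))"

lemma lin_summable:
 assumes "(\<lambda>x. abs (a x)) summable_on (UNIV :: 's set)"
 shows "(\<lambda>x. a x * of_bool (\<eta> x) :: real) summable_on UNIV"
 by (rule infsum_le_bound(1)[OF assms]) (simp add: abs_mult)

lemma lin_bound:
 assumes "(\<lambda>x. abs (a x)) summable_on UNIV"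
 shows "abs (lin a \<eta>) <= (INFSUM x. abs (a x))"
 unfolding lin_def by (rule infsum_le_bound(3)[OF assms]) (simp add: abs_mult)

lemma lin_diff: "(\<lambda>x. abs (a x)) summable_on UNIV ==> lin a \<eta> - lin a \<xi> = (INFSUM x. a x * (of_bool (\<eta> x) - of_bool (\<xi> x)))"
 using infsum_add[OF lin_summable iffD2[OF summable_on_uminus lin_summable], of a a \<eta> \<xi>]
 by (simp add: lin_def infsum_uminus right_diff_distrib)

lemma lin_add:
 assumes "(\<lambda>x. abs (a x)) summable_on UNIV" "(\<lambda>x. abs (b x)) summable_on UNIV"
 shows "lin (\<lambda>x. a x + b x) \<eta> = lin a \<eta> + lin b \<eta>"
 using infsum_add[OF lin_summable[OF assms(1)] lin_summable[OF assms(2)], of \<eta> \<eta>] by (simp add: lin_def distrib_right)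

lemma lin_cmult: "lin (\<lambda>x. r * a x) \<eta> = r * lin a \<eta>"
 unfolding lin_def infsum_cmult_right'[symmetric] by (simp add: mult.assoc)

lemma variation_lin: "(\<lambda>x. abs (a x)) summable_on UNIV ==> variation (\<lambda>x. abs (a x)) (lin a)"
 unfolding variation_def
proof (intro conjI allI)
 fix \<eta> \<xi> assume a: "(\<lambda>x. abs (a x)) summable_on UNIV"
 show "abs (lin a \<eta> - lin a \<xi>) <= (INFSUM x. abs (a x) * of_bool (\<eta> x ~= \<xi> x))"
  unfolding lin_diff[OF a]
  by (rule infsum_le_bound(3)[OF infsum_le_bound(1)[OF a]]) (auto simp: abs_mult)
qed auto

lemma variation_lin_sq:
 assumes a: "(\<lambda>x. abs (a x)) summable_on UNIV"
 shows "variation (\<lambda>x. 2 * (INFSUM y. abs (a y)) * abs (a x)) (\<lambda>\<eta>. (lin a \<eta>)\<^sup>2)"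
proof -
 define B where "B = (INFSUM y. abs (a y))"
 have B0: "B >= 0" unfolding B_def by (rule infsum_nonneg) simp
 have "abs ((lin a \<eta>)\<^sup>2 - (lin a \<xi>)\<^sup>2) <= (INFSUM x. 2 * B * abs (a x) * of_bool (\<eta> x ~= \<xi> x))" for \<eta> \<xi>
 proof -
  have "abs ((lin a \<eta>)\<^sup>2 - (lin a \<xi>)\<^sup>2) = abs (lin a \<eta> + lin a \<xi>) * abs (lin a \<eta> - lin a \<xi>)"
   by (simp add: abs_mult[symmetric] power2_eq_square algebra_simps)
  also have "\<dots> <= (2 * B) * (INFSUM x. abs (a x) * of_bool (\<eta> x ~= \<xi> x))"
   using lin_bound[OF a, of \<eta>] lin_bound[OF a, of \<xi>] variationD(3)[OF variation_lin[OF a], of \<eta> \<xi>] B0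
   by (intro mult_mono) (auto simp: B_def)
  also have "\<dots> = (INFSUM x. 2 * B * abs (a x) * of_bool (\<eta> x ~= \<xi> x))"
   unfolding infsum_cmult_right'[symmetric] by (simp add: mult.assoc)
  finally show ?thesis .
 qed
 thus ?thesis
  unfolding variation_def B_def[symmetric] using B0 a by (auto intro!: summable_on_cmult_right)
qed

lemma lin_exchange:
 assumes a: "(\<lambda>x. abs (a x)) summable_on UNIV"
 shows "lin a (\<eta>(x := \<eta> y, y := \<eta> x)) - lin a \<eta> = (a x - a y) * (of_bool (\<eta> y) - of_bool (\<eta> x))"
proof (cases "x = y")
 case False
 have "lin a (\<eta>(x := \<eta> y, y := \<eta> x)) - lin a \<eta> =
   (INFSUM z. a z * (of_bool ((\<eta>(x := \<eta> y, y := \<eta> x)) z) - of_bool (\<eta> z)))"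
  by (rule lin_diff[OF a])
 also have "\<dots> = (\<Sum>\<^sub>\<infinity>z\<in>{x, y}. a z * (of_bool ((\<eta>(x := \<eta> y, y := \<eta> x)) z) - of_bool (\<eta> z)))"
  by (rule infsum_cong_neutral) auto
 also have "\<dots> = (a x - a y) * (of_bool (\<eta> y) - of_bool (\<eta> x))"
  using False by (simp add: algebra_simps)
 finally show ?thesis .
qed simp

text \<open>Absolute summability over pairs justifies the rearrangement; the last two claims follow
  from the first two by exchanging \<open>x\<close> and \<open>y\<close>, using the symmetry of
  \<open>q\<close>. It is applied with \<open>b\<close> the occupation variables and with
  \<open>b = a\<close>.\<close>

lemma walk_pairing:
 assumes a: "(\<lambda>x. abs (a x)) summable_on UNIV" and b: "\<And>x. abs (b x) <= B"
 shows "(\<lambda>(x, y). q x y * (a y - a x) * b x) summable_on UNIV" (is ?A)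
  and "(\<Sum>\<^sub>\<infinity>(x, y)\<in>UNIV. q x y * (a y - a x) * b x) = (INFSUM x. b x * walk a x)" (is ?B)
  and "(\<lambda>(x, y). q x y * (a x - a y) * b y) summable_on UNIV" (is ?C)
  and "(\<Sum>\<^sub>\<infinity>(x, y)\<in>UNIV. q x y * (a x - a y) * b y) = (INFSUM x. b x * walk a x)" (is ?D)
proof -
 have B: "B >= 0" using b[of undefined] by simp
 have ps: "(\<lambda>p. B * (case p of (x, y) => q x y * (abs (a x) + abs (a y)))) summable_on UNIV"
  by (rule summable_on_cmult_right[OF pair_summable[OF a]]) simp
 have bd: "abs (q x y * (a y - a x) * b x) <= B * (q x y * (abs (a x) + abs (a y)))" for x y
 proof -
  have "abs (q x y * (a y - a x) * b x) = (q x y * abs (a y - a x)) * abs (b x)" by (simp add: abs_mult)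
  also have "\<dots> <= (q x y * (abs (a x) + abs (a y))) * B"
   using b[of x] by (intro mult_mono) (auto intro: mult_left_mono)
  finally show ?thesis by (simp add: mult.commute)
 qed
 show s: ?A
  by (rule infsum_le_bound(1)[OF ps]) (use bd in auto)
 hence s': "(\<lambda>(x, y). q x y * (a y - a x) * b x) summable_on UNIV \<times> UNIV" by simp
 have "(\<Sum>\<^sub>\<infinity>(x, y)\<in>UNIV. q x y * (a y - a x) * b x) = (INFSUM x. INFSUM y. q x y * (a y - a x) * b x)"
  using infsum_Sigma'_banach[OF s'] by simp
 also have "\<dots> = (INFSUM x. walk a x * b x)" unfolding infsum_cmult_left' walk_def ..
 finally show e: ?B
  by (simp only: mult.commute[of "walk a _"])
 have "(\<lambda>(x, y). q x y * (a x - a y) * b y) summable_on UNIV \<longleftrightarrow> (\<lambda>(x, y). q x y * (a y - a x) * b x) summable_on UNIV"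
  by (rule summable_on_reindex_bij_witness[where i = prod.swap and j = prod.swap]) (auto simp: q_sym)
 thus ?C using s by simp
 have "(\<Sum>\<^sub>\<infinity>(x, y)\<in>UNIV. q x y * (a x - a y) * b y) = (\<Sum>\<^sub>\<infinity>(x, y)\<in>UNIV. q x y * (a y - a x) * b x)"
  by (rule infsum_reindex_bij_witness[where i = prod.swap and j = prod.swap]) (auto simp: q_sym)
 thus ?D using e by simp
qed

lemma walk_summable:
 assumes a: "(\<lambda>x. abs (a x)) summable_on UNIV"
 shows "(\<lambda>x. abs (walk a x)) summable_on UNIV"
proof -
 have "(\<lambda>(x, y). q x y * (a y - a x) * 1) summable_on UNIV \<times> UNIV"
  using walk_pairing(1)[OF a, of "\<lambda>_. 1" 1] by simp
 from summable_on_Sigma_banach[OF this] have "walk a summable_on UNIV" by (simp add: walk_def[abs_def])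
 hence "(\<lambda>x. norm (walk a x)) summable_on UNIV" by (rule iffD1[OF summable_on_iff_abs_summable_on_real])
 thus ?thesis by simp
qed

text \<open>By \<open>lin_exchange\<close> an exchange changes \<open>lin a\<close> by an expression
  linear in the occupation variables; its two halves agree by symmetry and cancel the factor
  1/2.\<close>

lemma gen_lin:
 assumes a: "(\<lambda>x. abs (a x)) summable_on UNIV"
 shows "gen (lin a) \<eta> = lin (walk a) \<eta>"
proof -
 define b :: "'s => real" where "b x = of_bool (\<eta> x)" for x
 have b: "abs (b x) <= 1" for x by (simp add: b_def)
 have "(\<Sum>\<^sub>\<infinity>(x, y)\<in>UNIV. q x y * (lin a (\<eta>(x := \<eta> y, y := \<eta> x)) - lin a \<eta>))
   = (INFSUM p. (case p of (x, y) => q x y * (a y - a x) * b x) + (case p of (x, y) => q x y * (a x - a y) * b y))"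
  by (rule infsum_cong) (auto simp: lin_exchange[OF a] b_def algebra_simps)
 also have "\<dots> = 2 * (INFSUM x. b x * walk a x)"
  unfolding infsum_add[OF walk_pairing(1)[OF a b] walk_pairing(3)[OF a b]]
   walk_pairing(2)[OF a b] walk_pairing(4)[OF a b] by simp
 finally show ?thesis by (simp add: gen_def lin_def b_def mult.commute)
qed

text \<open>The difference is the carre du champ. Dropping the occupation variables bounds it by the
  Dirichlet form of \<open>a\<close>, which by summation by parts pairs \<open>a\<close> with
  \<open>walk a\<close>; so it is small once \<open>a\<close> is uniformly small and
  \<open>walk a\<close> is bounded in \<open>l^1\<close>.\<close>

lemma gen_lin_sq:
 assumes a: "(\<lambda>x. abs (a x)) summable_on UNIV" and A: "\<And>x. abs (a x) <= A"
 shows "abs (gen (\<lambda>\<eta>. (lin a \<eta>)\<^sup>2) \<eta> - 2 * lin a \<eta> * lin (walk a) \<eta>) <= A * (INFSUM x. abs (walk a x))"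
proof -
 define G where "G p = (case p of (x, y) => q x y * (a x - a y)\<^sup>2)" for p
 define D where "D p = (case p of (x, y) => q x y * (lin a (\<eta>(x := \<eta> y, y := \<eta> x)) - lin a \<eta>)\<^sup>2)" for p
 define w where "w p = (case p of (x, y) => q x y * (lin a (\<eta>(x := \<eta> y, y := \<eta> x)) - lin a \<eta>))" for p
 have Gh: "(G has_sum - 2 * (INFSUM x. a x * walk a x)) UNIV"
 proof -
  have "((\<lambda>p. - ((case p of (x, y) => q x y * (a y - a x) * a x) + (case p of (x, y) => q x y * (a x - a y) * a y)))
    has_sum - ((INFSUM x. a x * walk a x) + (INFSUM x. a x * walk a x))) UNIV"
   by (intro has_sum_uminusI has_sum_add)
    (use walk_pairing[OF a A] in \<open>auto simp: has_sum_iff\<close>)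
  moreover have "- ((case p of (x, y) => q x y * (a y - a x) * a x) + (case p of (x, y) => q x y * (a x - a y) * a y)) = G p" for p
   by (cases p) (simp add: G_def power2_eq_square algebra_simps)
  ultimately show ?thesis by simp
 qed
 have DG: "abs (D p) <= G p" for p
 proof (cases p)
  case (Pair x y)
  have "((a x - a y) * (of_bool (\<eta> y) - of_bool (\<eta> x)))\<^sup>2 <= (a x - a y)\<^sup>2" by (auto simp: of_bool_def power2_commute[of "a y" "a x"])
  thus ?thesis by (simp add: D_def G_def Pair lin_exchange[OF a] abs_mult mult_left_mono)
 qed
 have Gs: "G summable_on UNIV" using Gh by (simp add: has_sum_iff)
 note D = infsum_le_bound[OF Gs DG]
 have ws: "w summable_on UNIV" using gen_summable[OF variation_lin[OF a]] by (simp add: w_def[abs_def])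
 define u where "u p = (case p of (x, y) => q x y * ((lin a (\<eta>(x := \<eta> y, y := \<eta> x)))\<^sup>2 - (lin a \<eta>)\<^sup>2))" for p
 have "u p = 2 * lin a \<eta> * w p + D p" for p
  by (cases p) (simp add: u_def w_def D_def power2_eq_square algebra_simps)
 hence "infsum u UNIV = (INFSUM p. 2 * lin a \<eta> * w p + D p)" by presburger
 also have "\<dots> = 2 * lin a \<eta> * infsum w UNIV + infsum D UNIV"
  by (subst infsum_add[OF summable_on_cmult_right[OF ws] D(1)]) (simp add: infsum_cmult_right')
 also have "infsum w UNIV = 2 * lin (walk a) \<eta>"
  using gen_lin[OF a, of \<eta>] by (simp add: gen_def w_def[abs_def])
 finally have ueq: "infsum u UNIV = 2 * lin a \<eta> * (2 * lin (walk a) \<eta>) + infsum D UNIV" .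
 have "gen (\<lambda>\<eta>. (lin a \<eta>)\<^sup>2) \<eta> = 1/2 * infsum u UNIV" unfolding gen_def u_def[abs_def] ..
 hence "gen (\<lambda>\<eta>. (lin a \<eta>)\<^sup>2) \<eta> - 2 * lin a \<eta> * lin (walk a) \<eta> = infsum D UNIV / 2"
  unfolding ueq by simp
 moreover have "abs (infsum D UNIV / 2) <= A * (INFSUM x. abs (walk a x))"
 proof -
  have "abs (infsum D UNIV) <= - 2 * (INFSUM x. a x * walk a x)" using D(3) Gh by (simp add: has_sum_iff)
  also have "\<dots> <= 2 * abs (INFSUM x. a x * walk a x)" by simp
  also have "abs (INFSUM x. a x * walk a x) <= (INFSUM x. A * abs (walk a x))"
   by (rule infsum_le_bound(3)[OF summable_on_cmult_right[OF walk_summable[OF a]]])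
    (use A in \<open>auto simp: abs_mult mult_right_mono\<close>)
  finally show ?thesis by (simp add: infsum_cmult_right')
 qed
 ultimately show ?thesis by simp
qed

end

section \<open>Feller semigroups\<close>

text \<open>A mean value inequality from right difference quotients only, as these are what a
  semigroup generator controls. The slack \<open>e\<close> lets the bound be propagated beyond any
  point reached; it is removed at the end.\<close>

lemma right_lipschitz_bound:
 fixes F :: "real => 'a::real_normed_vector"
 assumes cont: "continuous_on {0..t} F" and t: "t >= 0"
  and step: "\<And>s e. 0 <= s ==> s < t ==> e > 0 ==>
   \<forall>\<^sub>F h in at_right 0. norm (F (s + h) - F s) <= (K + e) * h"
 shows "norm (F t - F 0) <= K * t"
proof -
 have main: "norm (F t - F 0) <= (K + e) * t" if e: "e > 0" for e
 proof -
  define A where "A = {s \<in> {0..t}. norm (F s - F 0) - (K + e) * s <= 0}"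
  have "closed A"
  proof -
   have "continuous_on {0..t} (\<lambda>s. norm (F s - F 0) - (K + e) * s)"
    by (intro continuous_intros cont)
   from continuous_closed_preimage[OF this closed_atLeastAtMost closed_atMost[of 0]]
   have "closed ({0..t} \<inter> (\<lambda>s. norm (F s - F 0) - (K + e) * s) -` {..0})" .
   moreover have "{0..t} \<inter> (\<lambda>s. norm (F s - F 0) - (K + e) * s) -` {..0} = A"
    unfolding A_def by blast
   ultimately show ?thesis by (simp only:)
  qed
  \<comment> \<open>Only the points up to which the bound holds throughout are connected to 0 by continuous induction.\<close>
  define B where "B = {s \<in> {0..t}. \<forall>r\<in>{0..s}. r \<in> A}"
  have B0: "0 \<in> B" using t by (auto simp: B_def A_def)
  have bdd: "bdd_above B" by (auto simp: B_def intro: bdd_aboveI[where M = t])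
  define c where "c = Sup B"
  have c: "0 <= c" "c <= t"
  proof -
   show "0 <= c" unfolding c_def by (rule cSup_upper[OF B0 bdd])
   have "B ~= {}" using B0 by blast
   thus "c <= t" unfolding c_def by (rule cSup_least) (simp add: B_def)
  qed
  have below: "r \<in> A" if r: "0 <= r" "r < c" for r
  proof -
   have "B ~= {}" using B0 by blast
   from less_cSup_iff[OF this bdd, of r] obtain s where "s \<in> B" "r < s"
    using r(2) unfolding c_def by blast
   thus ?thesis using r(1) by (simp add: B_def)
  qed
  have cA: "c \<in> A"
  proof (cases "c = 0")
   case True thus ?thesis using B0 by (auto simp: B_def)
  next
   case False
   hence "c \<in> closure {0..<c}" using c by simp
   moreover have "closure {0..<c} \<subseteq> A" using below \<open>closed A\<close> by (intro closure_minimal) auto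
   ultimately show ?thesis by blast
  qed
  have "c = t"
  proof (rule ccontr)
   assume "c ~= t"
   hence ct: "c < t" using c by simp
   from step[OF c(1) ct e] have "\<forall>\<^sub>F h in at_right 0. norm (F (c + h) - F c) <= (K + e) * h" .
   then obtain d where d: "d > 0" "\<And>h. 0 < h ==> h < d ==> norm (F (c + h) - F c) <= (K + e) * h"
    by (auto simp: eventually_at_right_field)
   define s where "s = min t (c + d / 2)"
   have s: "c < s" "s <= t" "s - c < d" using d ct by (auto simp: s_def)
   have "r \<in> A" if "0 <= r" "r <= s" for r
   proof (cases "r <= c")
    case True thus ?thesis using below[OF that(1)] cA by (cases "r = c") auto
   next
    case False
    have "norm (F r - F 0) <= norm (F r - F c) + norm (F c - F 0)"
     using norm_triangle_ineq[of "F r - F c" "F c - F 0"] by simp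
    also have "\<dots> <= (K + e) * (r - c) + (K + e) * c"
     using d(2)[of "r - c"] False that s cA by (intro add_mono) (auto simp: A_def)
    finally show ?thesis using that s c False by (simp add: A_def algebra_simps)
   qed
   hence "s \<in> B" using s c by (auto simp: B_def)
   hence "s <= c" unfolding c_def by (rule cSup_upper[OF _ bdd])
   thus False using s by simp
  qed
  thus ?thesis using cA by (simp add: A_def)
 qed
 show ?thesis
 proof (cases "t = 0")
  case False
  with t have "t > 0" by simp
  show ?thesis
  proof (rule field_le_epsilon)
   fix e :: real assume "e > 0"
   thus "norm (F t - F 0) <= K * t + e"
    using main[of "e / t"] \<open>t > 0\<close> by (simp add: distrib_right)
  qed
 qed simp
qed

text \<open>Positivity and preservation of constants, applied to \<open>norm f - f\<close> and
  \<open>norm f + f\<close>.\<close>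

lemma markov_semigroup_contraction:
 fixes f :: "'a::topological_space \<Rightarrow>\<^sub>C real"
 assumes S: "markov_semigroup S" and t: "t >= 0"
 shows "norm (S t f) <= norm f"
proof (rule norm_bound)
 fix \<eta>
 have lin: "linear (S t)" and one: "S t (const_bcontfun 1) = const_bcontfun 1"
  and pos: "\<And>g. (\<forall>\<eta>. apply_bcontfun g \<eta> >= 0) ==> apply_bcontfun (S t g) \<eta> >= 0"
  using S t unfolding markov_semigroup_def by simp_all
 define c :: "'a \<Rightarrow>\<^sub>C real" where "c = norm f *\<^sub>R const_bcontfun 1"
 have St: "S t (c - f) = c - S t f" "S t (c + f) = c + S t f"
  using lin one by (simp_all add: c_def linear_diff linear_add linear_scale)
 have "\<forall>\<eta>. abs (apply_bcontfun f \<eta>) <= norm f" using norm_bounded[of f] by simp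
 hence "\<forall>\<eta>. apply_bcontfun (c - f) \<eta> >= 0" "\<forall>\<eta>. apply_bcontfun (c + f) \<eta> >= 0"
  unfolding c_def by (simp_all add: const_bcontfun.rep_eq abs_le_iff) (smt (verit))+
 from pos[OF this(1)] pos[OF this(2)] show "norm (apply_bcontfun (S t f) \<eta>) <= norm f"
  unfolding St by (simp add: c_def const_bcontfun.rep_eq)
qed

lemma markov_semigroup_diff:
 assumes "markov_semigroup S" "t >= 0" shows "S t (f - g) = S t f - S t g"
 using assms unfolding markov_semigroup_def by (simp add: linear_diff)

lemma markov_semigroup_lipschitz:
 assumes S: "markov_semigroup S" and "0 <= r" "r <= s"
 shows "norm (S s f - S r f) <= norm (S (s - r) f - f)"
proof -
 have "S s f = S r (S (s - r) f)"
  using S assms(2,3) unfolding markov_semigroup_def by (metis add.commute diff_add_cancel diff_ge_0_iff_ge)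
 hence "S s f - S r f = S r (S (s - r) f - f)" using markov_semigroup_diff[OF S assms(2)] by simp
 thus ?thesis using markov_semigroup_contraction[OF S assms(2)] by simp
qed

lemma markov_semigroup_at_0:
 assumes S: "markov_semigroup S"
 shows "((\<lambda>h. S h f) \<longlongrightarrow> f) (at_right 0)"
proof -
 have "continuous (at_right 0) (\<lambda>r. S r f)" "S 0 f = f" using S unfolding markov_semigroup_def by auto
 thus ?thesis unfolding continuous_within by simp
qed

text \<open>A Duhamel estimate: \<open>s \<mapsto> S s (w s)\<close> has right derivative
  \<open>S s (l s + w' s)\<close>, of norm at most \<open>K\<close> by contraction, and joins
  \<open>w 0\<close> to \<open>S t (w t)\<close>.\<close>

lemma markov_semigroup_evolution:
 assumes S: "markov_semigroup S" and t: "t >= 0"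
  and cont: "continuous_on {0..t} w"
  and gen: "\<And>s. 0 <= s ==> s < t ==> (w s, l s) \<in> semigroup_generator S"
  and der: "\<And>s. 0 <= s ==> s < t ==> ((\<lambda>h. (1 / h) *\<^sub>R (w (s + h) - w s)) \<longlongrightarrow> w' s) (at_right 0)"
  and bd: "\<And>s. 0 <= s ==> s < t ==> norm (l s + w' s) <= K"
 shows "norm (S t (w t) - w 0) <= K * t"
proof -
 define F where "F s = S s (w s)" for s
 \<comment> \<open>Two splittings of the increment: for continuity at a point, from the left as from
   the right, the semigroup increment has to act on the vector belonging to that point.\<close>
 have F_le: "norm (F s - F r) <= norm (w s - w r) + norm (S (s - r) (w s) - w s)"
  and F_le2: "norm (F s - F r) <= norm (w s - w r) + norm (S (s - r) (w r) - w r)" if "0 <= r" "r <= s" for r s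
 proof -
  have "F s - F r = (S s (w s) - S r (w s)) + S r (w s - w r)"
   using markov_semigroup_diff[OF S that(1)] by (simp add: F_def)
  thus "norm (F s - F r) <= norm (w s - w r) + norm (S (s - r) (w s) - w s)"
   using norm_triangle_ineq[of "S s (w s) - S r (w s)" "S r (w s - w r)"]
    markov_semigroup_lipschitz[OF S that, of "w s"] markov_semigroup_contraction[OF S that(1), of "w s - w r"] by simp
  have "F s - F r = S s (w s - w r) + (S s (w r) - S r (w r))"
   using markov_semigroup_diff[OF S order_trans[OF that]] by (simp add: F_def)
  thus "norm (F s - F r) <= norm (w s - w r) + norm (S (s - r) (w r) - w r)"
   using norm_triangle_ineq[of "S s (w s - w r)" "S s (w r) - S r (w r)"]
    markov_semigroup_lipschitz[OF S that, of "w r"] markov_semigroup_contraction[OF S order_trans[OF that], of "w s - w r"] by simp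
 qed
 have contF: "continuous_on {0..t} F"
  unfolding continuous_on_iff
 proof (intro ballI allI impI)
  fix s e :: real assume s: "s \<in> {0..t}" and e: "e > 0"
  obtain d1 where d1: "d1 > 0" "\<And>r. r \<in> {0..t} ==> dist r s < d1 ==> dist (w r) (w s) < e / 2"
   using cont[unfolded continuous_on_iff, rule_format, OF s, of "e / 2"] e by auto
  have "\<forall>\<^sub>F h in at_right 0. dist (S h (w s)) (w s) < e / 2"
   using tendstoD[OF markov_semigroup_at_0[OF S, of "w s"], of "e / 2"] e by simp
  then obtain d2 where d2: "d2 > 0" "\<And>h. 0 < h ==> h < d2 ==> dist (S h (w s)) (w s) < e / 2"
   by (auto simp: eventually_at_right_field)
  show "\<exists>d>0. \<forall>r\<in>{0..t}. dist r s < d \<longrightarrow> dist (F r) (F s) < e"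
  proof (intro exI[of _ "min d1 d2"] conjI ballI impI)
   fix r assume r: "r \<in> {0..t}" "dist r s < min d1 d2"
   have w: "norm (w r - w s) < e / 2" using d1(2)[OF r(1)] r(2) by (simp add: dist_norm)
   show "dist (F r) (F s) < e"
   proof (cases r s rule: linorder_cases)
    case less
    have "norm (S (s - r) (w s) - w s) < e / 2" using d2(2)[of "s - r"] less r(2) by (simp add: dist_norm)
    thus ?thesis using F_le[of r s] less r(1) w by (simp add: dist_norm norm_minus_commute)
   next
    case greater
    have "norm (S (r - s) (w s) - w s) < e / 2" using d2(2)[of "r - s"] greater r(2) by (simp add: dist_norm)
    thus ?thesis using F_le2[of s r] greater s w by (simp add: dist_norm)
   qed (use e in simp)
  qed (use d1 d2 in simp)
 qed
 have "norm (F t - F 0) <= K * t"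
 proof (rule right_lipschitz_bound[OF contF t])
  fix s e :: real assume s: "0 <= s" "s < t" and e: "e > 0"
  define D where "D h = (1 / h) *\<^sub>R (w (s + h) - w s)" for h
  have D: "(D \<longlongrightarrow> w' s) (at_right 0)" using der[OF s] by (simp add: D_def[abs_def])
  have "((\<lambda>h. D h - w' s) \<longlongrightarrow> w' s - w' s) (at_right 0)" by (intro tendsto_intros D)
  hence D0: "((\<lambda>h. norm (D h - w' s)) \<longlongrightarrow> 0) (at_right 0)" by (simp add: tendsto_norm_zero)
  have "((\<lambda>h. norm (S h (w' s) - w' s)) \<longlongrightarrow> 0) (at_right 0)"
   using tendsto_diff[OF markov_semigroup_at_0[OF S, of "w' s"] tendsto_const[of "w' s"]] by (simp add: tendsto_norm_zero)
  moreover have "((\<lambda>h. norm ((1 / h) *\<^sub>R (S h (w s) - w s) - l s)) \<longlongrightarrow> 0) (at_right 0)"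
   using gen[OF s] tendsto_diff[OF _ tendsto_const[of "l s"]]
   by (intro tendsto_norm_zero) (fastforce simp: semigroup_generator_def)
  ultimately have "((\<lambda>h. norm (D h - w' s) + norm (S h (w' s) - w' s) + norm ((1 / h) *\<^sub>R (S h (w s) - w s) - l s)) \<longlongrightarrow> 0 + 0 + 0) (at_right 0)"
   by (intro tendsto_add D0)
  hence "\<forall>\<^sub>F h in at_right 0. norm (D h - w' s) + norm (S h (w' s) - w' s) + norm ((1 / h) *\<^sub>R (S h (w s) - w s) - l s) < e"
   using e order_tendstoD(2) by fastforce
  moreover have "\<forall>\<^sub>F h :: real in at_right 0. h > 0" by (simp add: eventually_at_right_less)
  ultimately show "\<forall>\<^sub>F h in at_right 0. norm (F (s + h) - F s) <= (K + e) * h"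
  proof eventually_elim
   case (elim h)
   have h: "h > 0" by (rule elim(2))
   have lin: "linear (S h)" using S h unfolding markov_semigroup_def by simp
   have Fs: "F (s + h) = S s (S h (w (s + h)))" "F s = S s (w s)"
    using S s h unfolding markov_semigroup_def F_def by auto
   have "S h (w (s + h)) - w s = S h (w (s + h) - w s) + (S h (w s) - w s)"
    using markov_semigroup_diff[OF S less_imp_le[OF h]] by simp
   \<comment> \<open>Per unit of \<open>h\<close>: the quotient error of \<open>w\<close> carried
     along, strong continuity at \<open>w' s\<close>, the generator error at \<open>w s\<close>, and
     the term bounded by \<open>K\<close>.\<close>
   also have "\<dots> = h *\<^sub>R (S h (D h - w' s) + (S h (w' s) - w' s) + ((1 / h) *\<^sub>R (S h (w s) - w s) - l s) + (l s + w' s))"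
   proof -
    have "w (s + h) - w s = h *\<^sub>R D h" using h by (simp add: D_def)
    hence "S h (w (s + h) - w s) = h *\<^sub>R S h (D h)" using lin by (simp add: linear_scale)
    moreover have "S h (D h - w' s) = S h (D h) - S h (w' s)" using lin by (simp add: linear_diff)
    ultimately show ?thesis using h by (simp add: algebra_simps)
   qed
   finally have eq: "S h (w (s + h)) - w s = h *\<^sub>R (S h (D h - w' s) + (S h (w' s) - w' s) + ((1 / h) *\<^sub>R (S h (w s) - w s) - l s) + (l s + w' s))" .
   have "norm (F (s + h) - F s) <= norm (S h (w (s + h)) - w s)"
    unfolding Fs using markov_semigroup_diff[OF S s(1), symmetric] markov_semigroup_contraction[OF S s(1)] by simp
   also have "\<dots> = h * norm (S h (D h - w' s) + (S h (w' s) - w' s) + ((1 / h) *\<^sub>R (S h (w s) - w s) - l s) + (l s + w' s))"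
    unfolding eq using h by simp
   also have "\<dots> <= h * (K + e)"
   proof (rule mult_left_mono)
    have "norm (S h (D h - w' s)) <= norm (D h - w' s)" by (rule markov_semigroup_contraction[OF S]) (use h in simp)
    thus "norm (S h (D h - w' s) + (S h (w' s) - w' s) + ((1 / h) *\<^sub>R (S h (w s) - w s) - l s) + (l s + w' s)) <= K + e"
     using elim(1) bd[OF s]
      norm_triangle_ineq[of "S h (D h - w' s)" "S h (w' s) - w' s"]
      norm_triangle_ineq[of "S h (D h - w' s) + (S h (w' s) - w' s)" "(1 / h) *\<^sub>R (S h (w s) - w s) - l s"]
      norm_triangle_ineq[of "S h (D h - w' s) + (S h (w' s) - w' s) + ((1 / h) *\<^sub>R (S h (w s) - w s) - l s)" "l s + w' s"]
     by linarith
   qed (use h in simp)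
   finally show ?case by (simp add: mult.commute)
  qed
 qed
 moreover have "F 0 = w 0" using S by (simp add: F_def markov_semigroup_def)
 ultimately show ?thesis by (simp add: F_def)
qed

section \<open>Evolution of linear and quadratic functionals\<close>

definition rate :: "'d::finite => real => real => real => nat => int^'d => int^'d => real" where
 "rate k \<alpha> \<beta> \<gamma> n x y = jump_prob \<gamma> (y - x) * bond_rate k \<alpha> \<beta> n x y"

lemma maxnorm_axis: "maxnorm (axis j r :: int^'d::finite) = abs (real_of_int r)"
proof -
 have "Max (range (\<lambda>i. abs ((axis j r :: int^'d) $ i))) = abs r"
 proof (rule Max_eqI)
  show "abs r \<in> range (\<lambda>i. abs ((axis j r :: int^'d) $ i))" by (rule image_eqI[where x = j]) (auto simp: axis_def)
 qed (auto simp: axis_def)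
 thus ?thesis by (simp add: maxnorm_def)
qed

lemma jump_weight_axis: "jump_weight \<gamma> (axis j r :: int^'d::finite) = jump_w \<gamma> r / CARD('d)"
proof (cases "r = 0")
 case False
 have "on_axis (axis j r :: int^'d)"
  unfolding on_axis_def maxnorm_axis by (rule exI[of _ j]) (auto simp: axis_def)
 moreover have "axis j r ~= (0 :: int^'d)" using False by (simp add: axis_eq_0_iff)
 ultimately show ?thesis by (simp add: jump_weight_def maxnorm_axis jump_w_def)
next
 case True
 have "axis j r = (0 :: int^'d)" using True by (simp add: axis_eq_0_iff)
 thus ?thesis using True by (simp add: jump_weight_def)
qed

lemma jump_weight_off_axis: "(\<And>j r. x ~= axis j r) ==> jump_weight \<gamma> (x :: int^'d::finite) = 0"
 by (auto simp: jump_weight_def on_axis_def)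

lemma jump_weight_nonneg [simp]: "jump_weight \<gamma> (x :: int^'d::finite) >= 0"
 by (auto simp: jump_weight_def)

lemma jump_weight_minus [simp]: "jump_weight \<gamma> (- x :: int^'d::finite) = jump_weight \<gamma> x"
proof (cases "\<exists>j r. x = axis j r")
 case True
 then obtain j r where x: "x = axis j r" by auto
 have "- x = axis j (- r)" by (simp add: x axis_def vec_eq_iff)
 thus ?thesis by (simp add: x jump_weight_axis)
next
 case False
 hence "- x ~= axis j r" for j r
 proof -
  have "- x = axis j r ==> x = axis j (- r)" by (auto simp: axis_def vec_eq_iff minus_equation_iff split: if_splits)
  thus ?thesis using False by auto
 qed
 thus ?thesis using False by (simp add: jump_weight_off_axis)
qed

text \<open>The axes meet only at the origin; since \<open>g 0 = 0\<close>, they may be punctured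
  there and become disjoint.\<close>

lemma has_sum_axes:
 fixes g :: "int^'d::finite => real"
 assumes off: "\<And>x. (\<And>j r. x ~= axis j r) ==> g x = 0" and g0: "g 0 = 0"
  and s: "\<And>j. (\<lambda>r. g (axis j r)) summable_on UNIV"
 shows "(g has_sum (\<Sum>j\<in>UNIV. INFSUM r. g (axis j r))) UNIV"
proof -
 define X where "X j = axis j ` (- {0 :: int})" for j :: 'd
 have "(g has_sum (\<Sum>j\<in>UNIV. INFSUM r. g (axis j r))) (\<Union>j\<in>UNIV. X j)"
 proof (rule sum_has_sum)
  show "(g has_sum (INFSUM r. g (axis j r))) (X j)" for j
  proof -
   have "((\<lambda>r. g (axis j r)) has_sum (INFSUM r. g (axis j r))) UNIV" using s by simp
   hence "((\<lambda>r. g (axis j r)) has_sum (INFSUM r. g (axis j r))) (- {0})"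
    by (rule iffD1[OF has_sum_cong_neutral, rotated -1]) (auto simp: axis_eq_0_iff[THEN iffD2] g0)
   thus ?thesis
    unfolding X_def by (subst has_sum_reindex) (auto intro!: inj_onI simp: axis_eq_axis o_def)
  qed
  show "X i \<inter> X j = {}" if "i \<in> UNIV" "j \<in> UNIV" "i ~= j" for i j
   using that by (auto simp: X_def axis_eq_axis)
 qed simp
 thus ?thesis
 proof (rule iffD1[OF has_sum_cong_neutral, rotated -1])
  fix x assume "x \<in> UNIV - (\<Union>j\<in>UNIV. X j)"
  hence "x = 0 \<or> (\<forall>j r. x ~= axis j r)"
   by (auto simp: X_def) (metis ComplI axis_eq_0_iff image_eqI singletonD)
  thus "g x = 0" using off g0 by auto
 qed auto
qed

text \<open>The reciprocal of \<open>c_\<gamma>\<close>: summing over the \<open>d\<close> axes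
  cancels the \<open>1 / d\<close> in the weight, so it is the same in every dimension.\<close>

definition jump_total :: "real => real" where "jump_total \<gamma> = (INFSUM r. jump_w \<gamma> r)"

lemma jump_w_summable: "\<gamma> >= 2 ==> jump_w \<gamma> summable_on UNIV"
 using jump_w_pow_sums(1)[of 0 \<gamma>] by simp

lemma jump_total_pos: assumes "\<gamma> >= 2" shows "jump_total \<gamma> > 0"
proof -
 have "sum (jump_w \<gamma>) {1} <= jump_total \<gamma>"
  unfolding jump_total_def by (rule finite_sum_le_infsum[OF jump_w_summable[OF assms]]) auto
 thus ?thesis by (simp add: jump_w_def)
qed

lemma jump_weight_sum:
 assumes "\<gamma> >= 2"
 shows "((jump_weight \<gamma> :: int^'d::finite => real) has_sum jump_total \<gamma>) UNIV"
proof -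
 have "((jump_weight \<gamma> :: int^'d => real) has_sum (\<Sum>j\<in>(UNIV::'d set). INFSUM r. jump_weight \<gamma> (axis j r))) UNIV"
  by (rule has_sum_axes)
   (auto simp: jump_weight_off_axis jump_weight_axis jump_weight_def[of _ 0] divide_inverse
      intro!: summable_on_cmult_left jump_w_summable[OF assms])
 thus ?thesis
  by (simp add: jump_weight_axis divide_inverse infsum_cmult_left' jump_total_def mult.left_commute[of "real CARD('d)"])
qed

lemma jump_const_eq: "\<gamma> >= 2 ==> jump_const TYPE('d::finite) \<gamma> = 1 / jump_total \<gamma>"
 using jump_weight_sum[where 'd = 'd, of \<gamma>] by (simp add: jump_const_def has_sum_iff)

lemma jump_prob_nonneg: "\<gamma> >= 2 ==> jump_prob \<gamma> (x :: int^'d::finite) >= 0"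
 unfolding jump_prob_def jump_const_eq using jump_total_pos[of \<gamma>] by simp

lemma jump_prob_sum:
 assumes "\<gamma> >= 2"
 shows "((jump_prob \<gamma> :: int^'d::finite => real) has_sum 1) UNIV"
 using has_sum_cmult_right[OF jump_weight_sum[OF assms, where 'd = 'd], of "jump_const TYPE('d) \<gamma>"]
  jump_total_pos[OF assms] by (simp add: jump_prob_def[abs_def] jump_const_eq[OF assms])

lemma bond_rate_bounds:
 assumes "\<alpha> >= 0"
 shows "bond_rate k \<alpha> \<beta> n x y >= 0" "bond_rate k \<alpha> \<beta> n x y <= 1 + \<alpha> * real n powr - \<beta>"
 using assms by (auto simp: bond_rate_def)

lemma exclusion_rates_rate:
 fixes k :: "'d::finite"
 assumes \<alpha>: "\<alpha> >= 0" and \<gamma>: "\<gamma> >= 2"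
 shows "exclusion_rates (rate k \<alpha> \<beta> \<gamma> n) (1 + \<alpha> * real n powr - \<beta>)"
proof
 fix x y :: "int^'d"
 show "rate k \<alpha> \<beta> \<gamma> n x y >= 0"
  unfolding rate_def by (intro mult_nonneg_nonneg jump_prob_nonneg[OF \<gamma>] bond_rate_bounds[OF \<alpha>])
 have "jump_prob \<gamma> (y - x) = jump_prob \<gamma> (x - y)"
  using jump_weight_minus[of \<gamma> "x - y"] by (simp add: jump_prob_def)
 thus "rate k \<alpha> \<beta> \<gamma> n x y = rate k \<alpha> \<beta> \<gamma> n y x"
  by (auto simp: rate_def bond_rate_def slow_bond_def)
 define K where "K = 1 + \<alpha> * real n powr - \<beta>"
 have "((\<lambda>y. jump_prob \<gamma> (y - x)) has_sum 1) UNIV"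
  by (rule iffD2[OF has_sum_reindex_bij_witness[where j = "\<lambda>y. y - x" and i = "\<lambda>y. y + x"] jump_prob_sum[OF \<gamma>, where 'd = 'd]]) auto
 from has_sum_cmult_left[OF this, of K]
 have s: "((\<lambda>y. jump_prob \<gamma> (y - x) * K) has_sum K) UNIV" by simp
 have le: "abs (rate k \<alpha> \<beta> \<gamma> n x y) <= jump_prob \<gamma> (y - x) * K" for y
  unfolding rate_def abs_mult K_def
  using jump_prob_nonneg[OF \<gamma>, of "y - x"] bond_rate_bounds[OF \<alpha>, of k \<beta> n x y] by (intro mult_mono) auto
 show "rate k \<alpha> \<beta> \<gamma> n x summable_on UNIV"
  using infsum_le_bound(1)[OF _ le] s by (auto simp: has_sum_iff)
 show "(INFSUM y. rate k \<alpha> \<beta> \<gamma> n x y) <= 1 + \<alpha> * real n powr - \<beta>"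
  using infsum_le_bound(3)[OF has_sum_imp_summable[OF s] le] unfolding infsumI[OF s] by (simp add: K_def abs_le_iff)
qed

lemma excl_gen_eq:
 assumes \<alpha>: "\<alpha> >= 0" and \<gamma>: "\<gamma> >= 2"
 shows "excl_gen k \<alpha> \<beta> \<gamma> n f \<eta> = exclusion_rates.gen (rate k \<alpha> \<beta> \<gamma> n) f \<eta>"
 unfolding exclusion_rates.gen_def[OF exclusion_rates_rate[OF assms]] excl_gen_def rate_def exchange_def ..

abbreviation Bc :: "(('d::finite) config => real) => ('d config \<Rightarrow>\<^sub>C real)" where
 "Bc \<equiv> Bcontfun"

lemma Bc_apply: "continuous_on UNIV f ==> bounded (range f) ==> apply_bcontfun (Bc f) = f"
 by (rule Bcontfun_inverse) (simp add: bcontfun_def)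

lemma Bc_variation: "variation c f ==> apply_bcontfun (Bc f) = f"
 by (rule Bc_apply) (auto intro: variation_continuous)

text \<open>The functionals used below depend on infinitely many sites and so lie outside the
  pregenerator. Approximating the function and its image simultaneously by local ones puts the pair
  into the closure of the graph.\<close>

lemma generator_of_variation:
 fixes k :: "'d::finite" and \<beta> :: real
 assumes \<alpha>: "\<alpha> >= 0" and \<gamma>: "\<gamma> >= 2" and \<Theta>: "time_scale \<gamma> n >= 0" and v: "variation c f"
 defines "L \<equiv> (\<lambda>\<eta>. time_scale \<gamma> n * exclusion_rates.gen (rate k \<alpha> \<beta> \<gamma> n) f \<eta>)"
 shows "(Bc f, Bc L) \<in> closure (excl_pregenerator k \<alpha> \<beta> \<gamma> n)" (is ?A) "apply_bcontfun (Bc L) = L"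
proof -
 interpret exclusion_rates "rate k \<alpha> \<beta> \<gamma> n" "1 + \<alpha> * real n powr - \<beta>"
  by (rule exclusion_rates_rate[OF \<alpha> \<gamma>])
 let ?\<Theta> = "time_scale \<gamma> n"
 have BL: "apply_bcontfun (Bc (\<lambda>\<eta>. ?\<Theta> * gen g \<eta>)) = (\<lambda>\<eta>. ?\<Theta> * gen g \<eta>)" if vg: "variation b g" for b g
 proof (rule Bc_apply)
  show "continuous_on UNIV (\<lambda>\<eta>. ?\<Theta> * gen g \<eta>)" by (intro continuous_intros gen_continuous[OF vg])
  obtain K where K: "\<And>\<eta>. abs (gen g \<eta>) <= K" using gen_continuous(2)[OF vg] by (auto simp: bounded_iff)
  show "bounded (range (\<lambda>\<eta>. ?\<Theta> * gen g \<eta>))"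
  proof (rule boundedI[where B = "?\<Theta> * K"])
   fix y assume "y \<in> range (\<lambda>\<eta>. ?\<Theta> * gen g \<eta>)"
   then obtain \<eta> where "y = ?\<Theta> * gen g \<eta>" by auto
   thus "norm y <= ?\<Theta> * K" using K[of \<eta>] \<Theta> by (simp add: abs_mult mult_left_mono)
  qed
 qed
 show "apply_bcontfun (Bc L) = L" unfolding L_def by (rule BL[OF v])
 show ?A
  unfolding closure_approachable
 proof (intro allI impI)
  fix e :: real assume e: "e > 0"
  define e' where "e' = e / (2 * (1 + ?\<Theta>))"
  have e': "e' > 0" "e' + ?\<Theta> * e' < e"
  proof -
   show "e' > 0" using e \<Theta> by (simp add: e'_def)
   have "T * (e / (2 * T)) = e / 2" if "T > 0" for T using that by simp
   from this[of "1 + ?\<Theta>"] have "(1 + ?\<Theta>) * e' = e / 2" using \<Theta> unfolding e'_def by simp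
   hence "e' + ?\<Theta> * e' = e / 2" by (simp only: distrib_right mult_1)
   thus "e' + ?\<Theta> * e' < e" using e by simp
  qed
  obtain F where F: "finite F" "\<And>\<eta>. abs (restr F f \<eta> - f \<eta>) < e'" "\<And>\<eta>. abs (gen (restr F f) \<eta> - gen f \<eta>) < e'"
   using gen_approx[OF v e'(1)] by metis
  let ?g = "restr F f"
  have vg: "variation c ?g" by (rule variation_restr[OF v])
  let ?L = "\<lambda>\<eta>. ?\<Theta> * gen ?g \<eta>"
  have mem: "(Bc ?g, Bc ?L) \<in> excl_pregenerator k \<alpha> \<beta> \<gamma> n"
   unfolding excl_pregenerator_def local_fun_def
   using F(1) restr_local[of F _ _ f]
   by (auto simp: Bc_variation[OF vg] BL[OF vg] excl_gen_eq[OF \<alpha> \<gamma>] intro!: exI[of _ F])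
  have 1: "dist (Bc ?g) (Bc f) <= e'"
   by (rule dist_bound) (use F(2) in \<open>auto simp: Bc_variation[OF vg] Bc_variation[OF v] dist_real_def intro: less_imp_le\<close>)
  have 2: "dist (Bc ?L) (Bc L) <= ?\<Theta> * e'"
  proof (rule dist_bound)
   fix \<eta>
   have "abs (?\<Theta> * gen ?g \<eta> - ?\<Theta> * gen f \<eta>) = ?\<Theta> * abs (gen ?g \<eta> - gen f \<eta>)"
    using \<Theta> by (simp add: abs_mult right_diff_distrib[symmetric])
   also have "\<dots> <= ?\<Theta> * e'" using F(3)[of \<eta>] \<Theta> by (intro mult_left_mono) auto
   finally show "dist (apply_bcontfun (Bc ?L) \<eta>) (apply_bcontfun (Bc L) \<eta>) <= ?\<Theta> * e'"
    unfolding L_def BL[OF vg] BL[OF v] dist_real_def .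
  qed
  have "dist (Bc ?g, Bc ?L) (Bc f, Bc L) <= dist (Bc ?g) (Bc f) + dist (Bc ?L) (Bc L)"
   unfolding dist_Pair_Pair by (rule sqrt_sum_squares_le_sum) auto
  also have "\<dots> < e" using 1 2 e'(2) by linarith
  finally show "\<exists>y\<in>excl_pregenerator k \<alpha> \<beta> \<gamma> n. dist y (Bc f, Bc L) < e" using mem by blast
 qed
qed

lemma difference_quotient_bound:
 fixes a a' :: "real => real"
 assumes d: "\<And>\<tau>. \<tau> \<in> {0..t} ==> (a has_real_derivative a' \<tau>) (at \<tau> within {0..t})"
  and B: "\<And>\<tau>. \<tau> \<in> {0..t} ==> abs (a' \<tau>) <= B" and "x \<in> {0..t}" "y \<in> {0..t}"
 shows "abs (a x - a y) <= B * abs (x - y)"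
 using field_differentiable_bound[of "{0..t}" a a' B x y] assms by simp

section \<open>Linear and quadratic functionals along the backward evolution\<close>

context
 fixes k :: "'d::finite" and \<alpha> \<beta> \<gamma> t e A :: real and n :: nat and S :: "real => ('d config \<Rightarrow>\<^sub>C real) => ('d config \<Rightarrow>\<^sub>C real)"
  and a a' :: "real => int^'d => real" and B :: "int^'d => real"
 assumes \<alpha>: "\<alpha> >= 0" and \<gamma>: "\<gamma> >= 2" and \<Theta>: "time_scale \<gamma> n >= 0"
  and S: "markov_semigroup S" and Sgen: "semigroup_generator S = closure (excl_pregenerator k \<alpha> \<beta> \<gamma> n)"
  and t: "t >= 0" and B: "B summable_on UNIV"
  and aB: "\<And>\<tau> x. \<tau> \<in> {0..t} ==> abs (a \<tau> x) <= B x" and a'B: "\<And>\<tau> x. \<tau> \<in> {0..t} ==> abs (a' \<tau> x) <= B x"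
  and der: "\<And>\<tau> x. \<tau> \<in> {0..t} ==> ((\<lambda>\<tau>. a \<tau> x) has_real_derivative a' \<tau> x) (at \<tau> within {0..t})"
  and e: "\<And>\<tau>. \<tau> \<in> {0..t} ==>
   (INFSUM x. abs (time_scale \<gamma> n * exclusion_rates.walk (rate k \<alpha> \<beta> \<gamma> n) (a \<tau>) x - a' \<tau> x)) <= e"
  and A: "\<And>\<tau> x. \<tau> \<in> {0..t} ==> abs (a \<tau> x) <= A"
begin

interpretation exclusion_rates "rate k \<alpha> \<beta> \<gamma> n" "1 + \<alpha> * real n powr - \<beta>"
 by (rule exclusion_rates_rate[OF \<alpha> \<gamma>])

private abbreviation (input) "\<Theta>n \<equiv> time_scale \<gamma> n"

private lemma a_summable: "\<tau> \<in> {0..t} ==> (\<lambda>x. abs (a \<tau> x)) summable_on UNIV"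
 and a'_summable: "\<tau> \<in> {0..t} ==> (\<lambda>x. abs (a' \<tau> x)) summable_on UNIV"
 using infsum_le_bound(2)[OF B aB] infsum_le_bound(2)[OF B a'B] by auto

private lemma B_nonneg: "B x >= 0"
 using aB[of 0 x] t by auto

private lemma b_nonneg: "infsum B UNIV >= 0"
 by (rule infsum_nonneg) (use B_nonneg in auto)

private lemma lin_a_bound: "\<tau> \<in> {0..t} ==> abs (lin (a \<tau>) \<eta>) <= infsum B UNIV"
 and lin_a'_bound: "\<tau> \<in> {0..t} ==> abs (lin (a' \<tau>) \<eta>) <= infsum B UNIV"
 using lin_bound[OF a_summable, of \<tau> \<eta>] lin_bound[OF a'_summable, of \<tau> \<eta>]
  infsum_mono[OF a_summable B aB, of \<tau>] infsum_mono[OF a'_summable B a'B, of \<tau>] by (auto intro: order_trans)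

private lemma lin_a_lipschitz:
 assumes "\<sigma> \<in> {0..t}" "\<tau> \<in> {0..t}"
 shows "abs (lin (a \<sigma>) \<eta> - lin (a \<tau>) \<eta>) <= infsum B UNIV * abs (\<sigma> - \<tau>)"
proof -
 have "lin (a \<sigma>) \<eta> - lin (a \<tau>) \<eta> = (INFSUM x. (a \<sigma> x - a \<tau> x) * of_bool (\<eta> x))"
  using infsum_add[OF lin_summable[OF a_summable[OF assms(1)]] iffD2[OF summable_on_uminus lin_summable[OF a_summable[OF assms(2)]]], of \<eta> \<eta>]
  by (simp add: lin_def infsum_uminus left_diff_distrib)
 also have "abs \<dots> <= (INFSUM x. B x * abs (\<sigma> - \<tau>))"
 proof (rule infsum_le_bound(3)[OF summable_on_cmult_left[OF B]])
  fix x
  have "abs (a \<sigma> x - a \<tau> x) <= B x * abs (\<sigma> - \<tau>)"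
   by (rule difference_quotient_bound[OF der a'B assms])
  thus "abs ((a \<sigma> x - a \<tau> x) * of_bool (\<eta> x)) <= B x * abs (\<sigma> - \<tau>)"
   using B_nonneg[of x] by (auto simp: abs_mult)
 qed
 finally show ?thesis by (simp add: infsum_cmult_left')
qed

text \<open>The \<open>l^1\<close> error of the difference quotient taken backwards in \<tau>, hence
  the plus sign before \<open>a' \<tau> x\<close>; it bounds the error of the functional uniformly
  in the configuration.\<close>

private definition \<delta> where
 "\<delta> \<tau> h = (INFSUM x. abs ((a (\<tau> - h) x - a \<tau> x) / h + a' \<tau> x))"

text \<open>Dominated convergence with majorant \<open>2 * B x\<close>, from the mean value bound
  for the quotients and the bound on \<open>a'\<close>.\<close>

private lemma \<delta>_props:
 assumes \<tau>: "0 < \<tau>" "\<tau> <= t"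
 shows "(\<delta> \<tau> \<longlongrightarrow> 0) (at_right 0)" (is ?A)
  and "0 < h ==> h < \<tau> ==> abs ((lin (a (\<tau> - h)) \<eta> - lin (a \<tau>) \<eta>) / h + lin (a' \<tau>) \<eta>) <= \<delta> \<tau> h"
proof -
 have bd: "abs ((a (\<tau> - h) x - a \<tau> x) / h + a' \<tau> x) <= 2 * B x" if h: "0 < h" "h < \<tau>" for h x
 proof -
  have "abs (a (\<tau> - h) x - a \<tau> x) <= B x * abs ((\<tau> - h) - \<tau>)"
   by (rule difference_quotient_bound[OF der a'B]) (use \<tau> h in auto)
  hence "abs ((a (\<tau> - h) x - a \<tau> x) / h) <= B x" using h by (simp add: divide_simps)
  moreover have "abs (a' \<tau> x) <= B x" by (rule a'B) (use \<tau> in auto)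
  ultimately show ?thesis by linarith
 qed
 show ?A
 proof -
  have "((\<lambda>h. INFSUM x. abs ((a (\<tau> - h) x - a \<tau> x) / h + a' \<tau> x)) \<longlongrightarrow> (\<Sum>\<^sub>\<infinity>(x::int^'d). 0)) (at_right 0)"
  proof (rule infsum_tendsto_dominated[where S = "{0<..<\<tau>}"])
   show "(\<lambda>x. 2 * B x) summable_on UNIV" by (rule summable_on_cmult_right[OF B])
   show "\<forall>\<^sub>F h in at_right 0. h \<in> {0<..<\<tau>}"
    using \<tau> eventually_at_right_real by blast
   show "((\<lambda>h. abs ((a (\<tau> - h) x - a \<tau> x) / h + a' \<tau> x)) \<longlongrightarrow> 0) (at_right 0)" for x
   proof -
    have "((\<lambda>y. (a y x - a \<tau> x) / (y - \<tau>)) \<longlongrightarrow> a' \<tau> x) (at \<tau> within {0..t})"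
     using der[of \<tau> x] \<tau> by (simp add: has_field_derivative_iff)
    moreover have "filterlim (\<lambda>h. \<tau> - h) (at \<tau> within {0..t}) (at_right 0)"
     unfolding filterlim_at
    proof
     show "((\<lambda>h. \<tau> - h) \<longlongrightarrow> \<tau>) (at_right 0)" by (rule tendsto_eq_intros | simp)+
     have "\<forall>\<^sub>F h in at_right 0. h \<in> {0<..<\<tau>}" using \<tau> eventually_at_right_real by blast
     thus "\<forall>\<^sub>F h in at_right 0. \<tau> - h \<in> {0..t} \<and> \<tau> - h ~= \<tau>"
      by eventually_elim (use \<tau> in auto)
    qed
    ultimately have "((\<lambda>h. (a (\<tau> - h) x - a \<tau> x) / ((\<tau> - h) - \<tau>)) \<longlongrightarrow> a' \<tau> x) (at_right 0)"
     by (rule filterlim_compose)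
    hence "((\<lambda>h. (a (\<tau> - h) x - a \<tau> x) / (- h)) \<longlongrightarrow> a' \<tau> x) (at_right 0)" by simp
    hence "((\<lambda>h. abs (- ((a (\<tau> - h) x - a \<tau> x) / (- h)) + a' \<tau> x)) \<longlongrightarrow> abs (- a' \<tau> x + a' \<tau> x)) (at_right 0)"
     by (intro tendsto_intros)
    thus ?thesis by simp
   qed
  qed (use bd in auto)
  thus ?thesis by (simp add: \<delta>_def[abs_def])
 qed
 assume h: "0 < h" "h < \<tau>"
 have m: "\<tau> - h \<in> {0..t}" "\<tau> \<in> {0..t}" using h \<tau> by auto
 have s: "(\<lambda>x. abs ((a (\<tau> - h) x - a \<tau> x) / h + a' \<tau> x)) summable_on UNIV"
  by (rule infsum_le_bound(2)[OF summable_on_cmult_right[OF B] bd[OF h]])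
 have "(lin (a (\<tau> - h)) \<eta> - lin (a \<tau>) \<eta>) / h + lin (a' \<tau>) \<eta>
   = lin (\<lambda>x. (1 / h) * a (\<tau> - h) x + ((- 1 / h) * a \<tau> x + a' \<tau> x)) \<eta>"
 proof -
  have s1: "(\<lambda>x. abs (c * a \<sigma> x)) summable_on UNIV" if "\<sigma> \<in> {0..t}" for c \<sigma>
   unfolding abs_mult by (rule summable_on_cmult_right[OF a_summable[OF that]])
  have s2: "(\<lambda>x. abs ((- 1 / h) * a \<tau> x + a' \<tau> x)) summable_on UNIV"
   by (rule infsum_le_bound(2)[OF summable_on_add[OF s1[OF m(2), of "-1/h"] a'_summable[OF m(2)]]])
    (rule abs_triangle_ineq)
  show ?thesis
   unfolding lin_add[OF s1[OF m(1)] s2] lin_add[OF s1[OF m(2)] a'_summable[OF m(2)]] lin_cmult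
   by (simp add: diff_divide_distrib)
 qed
 also have "(\<lambda>x. (1 / h) * a (\<tau> - h) x + ((- 1 / h) * a \<tau> x + a' \<tau> x)) = (\<lambda>x. (a (\<tau> - h) x - a \<tau> x) / h + a' \<tau> x)"
  by (simp add: diff_divide_distrib fun_eq_iff)
 finally show "abs ((lin (a (\<tau> - h)) \<eta> - lin (a \<tau>) \<eta>) / h + lin (a' \<tau>) \<eta>) <= \<delta> \<tau> h"
  using lin_bound[OF s, of \<eta>] unfolding \<delta>_def by simp
qed

text \<open>The accelerated walk differs from \<open>a'\<close> by at most \<open>e\<close> in
  \<open>l^1\<close>. The second bound, which no longer sees the size of the time scale, feeds the
  carre du champ.\<close>

private lemma walk_lin_bound:
 assumes \<tau>: "\<tau> \<in> {0..t}"
 shows "abs (\<Theta>n * lin (walk (a \<tau>)) \<eta> - lin (a' \<tau>) \<eta>) <= e" (is ?A) "\<Theta>n * (INFSUM x. abs (walk (a \<tau>) x)) <= infsum B UNIV + e" (is ?B)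
proof -
 have s1: "(\<lambda>x. abs (\<Theta>n * walk (a \<tau>) x)) summable_on UNIV"
  unfolding abs_mult by (rule summable_on_cmult_right[OF walk_summable[OF a_summable[OF \<tau>]]])
 have s2: "(\<lambda>x. abs ((- 1) * a' \<tau> x)) summable_on UNIV" using a'_summable[OF \<tau>] by simp
 have s3: "(\<lambda>x. abs (\<Theta>n * walk (a \<tau>) x - a' \<tau> x)) summable_on UNIV"
  by (rule infsum_le_bound(2)[OF summable_on_add[OF s1 a'_summable[OF \<tau>]]]) auto
 have "\<Theta>n * lin (walk (a \<tau>)) \<eta> - lin (a' \<tau>) \<eta> = lin (\<lambda>x. \<Theta>n * walk (a \<tau>) x + (- 1) * a' \<tau> x) \<eta>"
  unfolding lin_add[OF s1 s2] lin_cmult by simp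
 thus ?A
  using lin_bound[OF s3, of \<eta>] e[OF \<tau>] by simp
 have "\<Theta>n * (INFSUM x. abs (walk (a \<tau>) x)) = (INFSUM x. abs (\<Theta>n * walk (a \<tau>) x))"
  unfolding abs_mult infsum_cmult_right' using \<Theta> by simp
 also have "\<dots> <= (INFSUM x. B x + abs (\<Theta>n * walk (a \<tau>) x - a' \<tau> x))"
 proof (rule infsum_mono[OF s1 summable_on_add[OF B s3]])
  show "abs (\<Theta>n * walk (a \<tau>) x) <= B x + abs (\<Theta>n * walk (a \<tau>) x - a' \<tau> x)" for x
   using a'B[OF \<tau>, of x] by linarith
 qed
 also have "\<dots> = infsum B UNIV + (INFSUM x. abs (\<Theta>n * walk (a \<tau>) x - a' \<tau> x))" by (rule infsum_add[OF B s3])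
 finally show ?B using e[OF \<tau>] by simp
qed

private lemma Bc_lin: "\<tau> \<in> {0..t} ==> apply_bcontfun (Bc (lin (a \<tau>))) = lin (a \<tau>)"
 and Bc_lin': "\<tau> \<in> {0..t} ==> apply_bcontfun (Bc (lin (a' \<tau>))) = lin (a' \<tau>)"
 and Bc_lin_sq: "\<tau> \<in> {0..t} ==> apply_bcontfun (Bc (\<lambda>\<eta>. (lin (a \<tau>) \<eta>)\<^sup>2)) = (\<lambda>\<eta>. (lin (a \<tau>) \<eta>)\<^sup>2)"
 by (rule Bc_variation[OF variation_lin[OF a_summable]] Bc_variation[OF variation_lin[OF a'_summable]]
   Bc_variation[OF variation_lin_sq[OF a_summable]]; assumption)+

private lemma Bc_lin_prod:
 assumes \<tau>: "\<tau> \<in> {0..t}"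
 shows "apply_bcontfun (Bc (\<lambda>\<eta>. 2 * lin (a \<tau>) \<eta> * lin (a' \<tau>) \<eta>)) = (\<lambda>\<eta>. 2 * lin (a \<tau>) \<eta> * lin (a' \<tau>) \<eta>)"
proof (rule Bc_apply)
 show "continuous_on UNIV (\<lambda>\<eta>. 2 * lin (a \<tau>) \<eta> * lin (a' \<tau>) \<eta>)"
  by (intro continuous_intros variation_continuous(1)[OF variation_lin[OF a_summable[OF \<tau>]]]
     variation_continuous(1)[OF variation_lin[OF a'_summable[OF \<tau>]]])
 show "bounded (range (\<lambda>\<eta>. 2 * lin (a \<tau>) \<eta> * lin (a' \<tau>) \<eta>))"
 proof (rule boundedI[where B = "2 * infsum B UNIV * infsum B UNIV"])
  fix y assume "y \<in> range (\<lambda>\<eta>. 2 * lin (a \<tau>) \<eta> * lin (a' \<tau>) \<eta>)"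
  then obtain \<eta> where y: "y = 2 * lin (a \<tau>) \<eta> * lin (a' \<tau>) \<eta>" by auto
  show "norm y <= 2 * infsum B UNIV * infsum B UNIV"
   unfolding y real_norm_def abs_mult using lin_a_bound[OF \<tau>, of \<eta>] lin_a'_bound[OF \<tau>, of \<eta>] b_nonneg
   by (intro mult_mono) auto
 qed
qed

text \<open>The functional at time \<open>s\<close> uses the coefficients at remaining time
  \<open>t - s\<close>; its time derivative cancels the generator up to \<open>e\<close>.\<close>

lemma exclusion_evolution_linear:
 "norm (S t (Bc (lin (a 0))) - Bc (lin (a t))) <= e * t"
proof -
 define w where "w s = Bc (lin (a (t - s)))" for s
 define l where "l s = Bc (\<lambda>\<eta>. \<Theta>n * gen (lin (a (t - s))) \<eta>)" for s
 define w' where "w' s = - Bc (lin (a' (t - s)))" for s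
 have "norm (S t (w t) - w 0) <= e * t"
 proof (rule markov_semigroup_evolution[OF S t, where l = l and w' = w'])
  have "dist (w r) (w s) <= infsum B UNIV * dist r s" if "r \<in> {0..t}" "s \<in> {0..t}" for r s
  proof (rule dist_bound)
   show "dist (apply_bcontfun (w r) \<eta>) (apply_bcontfun (w s) \<eta>) <= infsum B UNIV * dist r s" for \<eta>
    using lin_a_lipschitz[of "t - r" "t - s" \<eta>] that
    by (simp add: w_def Bc_lin dist_real_def abs_minus_commute)
  qed
  hence "(infsum B UNIV)-lipschitz_on {0..t} w" by (rule lipschitz_onI[OF _ b_nonneg])
  thus "continuous_on {0..t} w" by (rule lipschitz_on_continuous_on)
  fix s assume s: "0 <= s" "s < t"
  hence \<tau>: "t - s \<in> {0..t}" "0 < t - s" "t - s <= t" by auto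
  note gv = generator_of_variation[OF \<alpha> \<gamma> \<Theta> variation_lin[OF a_summable[OF \<tau>(1)]], of k \<beta>]
  show "(w s, l s) \<in> semigroup_generator S" unfolding Sgen w_def l_def by (rule gv(1))
  show "((\<lambda>h. (1 / h) *\<^sub>R (w (s + h) - w s)) \<longlongrightarrow> w' s) (at_right 0)"
  proof (rule LIM_zero_cancel, rule Lim_null_comparison)
   show "(\<delta> (t - s) \<longlongrightarrow> 0) (at_right 0)" by (rule \<delta>_props[OF \<tau>(2,3)])
   have "\<forall>\<^sub>F h in at_right 0. h \<in> {0<..<t - s}" using \<tau> eventually_at_right_real by blast
   thus "\<forall>\<^sub>F h in at_right 0. norm ((1 / h) *\<^sub>R (w (s + h) - w s) - w' s) <= \<delta> (t - s) h"
   proof eventually_elim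
    case (elim h)
    show ?case
    proof (rule norm_bound)
     fix \<eta>
     have m: "t - s - h \<in> {0..t}" using elim s by auto
     have eq: "t - (s + h) = t - s - h" by simp
     show "norm (apply_bcontfun ((1 / h) *\<^sub>R (w (s + h) - w s) - w' s) \<eta>) <= \<delta> (t - s) h"
      using \<delta>_props(2)[OF \<tau>(2,3), of h \<eta>] elim
      by (simp add: w_def w'_def eq Bc_lin[OF m] Bc_lin'[OF \<tau>(1)] Bc_lin[OF \<tau>(1)])
    qed
   qed
  qed
  show "norm (l s + w' s) <= e"
  proof (rule norm_bound)
   fix \<eta>
   show "norm (apply_bcontfun (l s + w' s) \<eta>) <= e"
    using walk_lin_bound(1)[OF \<tau>(1), of \<eta>] gen_lin[OF a_summable[OF \<tau>(1)], of \<eta>]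
    by (simp add: l_def w'_def gv(2) Bc_lin'[OF \<tau>(1)])
  qed
 qed
 thus ?thesis by (simp add: w_def)
qed

text \<open>Two errors per unit time: \<open>2 * infsum B UNIV * e\<close> from the linear defect
  under squaring, and the carre du champ, at most \<open>A * (infsum B UNIV + e)\<close>. In the
  application \<open>A\<close> is of order \<open>n^(-d)\<close>.\<close>

lemma exclusion_evolution_quadratic:
 "norm (S t (Bc (\<lambda>\<eta>. (lin (a 0) \<eta>)\<^sup>2)) - Bc (\<lambda>\<eta>. (lin (a t) \<eta>)\<^sup>2))
  <= (2 * infsum B UNIV * e + A * (infsum B UNIV + e)) * t"
proof -
 let ?b = "infsum B UNIV"
 have A0: "A >= 0" using A[of 0 undefined] t by auto
 define w where "w s = Bc (\<lambda>\<eta>. (lin (a (t - s)) \<eta>)\<^sup>2)" for s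
 define l where "l s = Bc (\<lambda>\<eta>. \<Theta>n * gen (\<lambda>\<eta>. (lin (a (t - s)) \<eta>)\<^sup>2) \<eta>)" for s
 define w' where "w' s = - Bc (\<lambda>\<eta>. 2 * lin (a (t - s)) \<eta> * lin (a' (t - s)) \<eta>)" for s
 have "norm (S t (w t) - w 0) <= (2 * ?b * e + A * (?b + e)) * t"
 proof (rule markov_semigroup_evolution[OF S t, where l = l and w' = w'])
  have "dist (w r) (w s) <= (2 * ?b * ?b) * dist r s" if rs: "r \<in> {0..t}" "s \<in> {0..t}" for r s
  proof (rule dist_bound)
   fix \<eta>
   have m: "t - r \<in> {0..t}" "t - s \<in> {0..t}" using rs by auto
   have "abs ((lin (a (t - r)) \<eta>)\<^sup>2 - (lin (a (t - s)) \<eta>)\<^sup>2) =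
     abs (lin (a (t - r)) \<eta> + lin (a (t - s)) \<eta>) * abs (lin (a (t - r)) \<eta> - lin (a (t - s)) \<eta>)"
    by (simp add: abs_mult[symmetric] power2_eq_square algebra_simps)
   also have "\<dots> <= (2 * ?b) * (?b * abs ((t - r) - (t - s)))"
    using lin_a_bound[OF m(1), of \<eta>] lin_a_bound[OF m(2), of \<eta>] lin_a_lipschitz[OF m, of \<eta>] b_nonneg
    by (intro mult_mono) auto
   finally show "dist (apply_bcontfun (w r) \<eta>) (apply_bcontfun (w s) \<eta>) <= (2 * ?b * ?b) * dist r s"
    using m by (simp add: w_def Bc_lin_sq dist_real_def abs_minus_commute mult.assoc)
  qed
  moreover have "0 <= 2 * ?b * ?b" by (intro mult_nonneg_nonneg b_nonneg) simp
  ultimately have "(2 * ?b * ?b)-lipschitz_on {0..t} w" by (rule lipschitz_onI)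
  thus "continuous_on {0..t} w" by (rule lipschitz_on_continuous_on)
  fix s assume s: "0 <= s" "s < t"
  hence \<tau>: "t - s \<in> {0..t}" "0 < t - s" "t - s <= t" by auto
  note gv = generator_of_variation[OF \<alpha> \<gamma> \<Theta> variation_lin_sq[OF a_summable[OF \<tau>(1)]], of k \<beta>]
  show "(w s, l s) \<in> semigroup_generator S" unfolding Sgen w_def l_def by (rule gv(1))
  show "((\<lambda>h. (1 / h) *\<^sub>R (w (s + h) - w s)) \<longlongrightarrow> w' s) (at_right 0)"
  proof (rule LIM_zero_cancel, rule Lim_null_comparison)
   have "((\<lambda>h. \<delta> (t - s) h * (2 * ?b) + ?b * (?b * h)) \<longlongrightarrow> 0 * (2 * ?b) + ?b * (?b * 0)) (at_right 0)"
    by (intro tendsto_intros \<delta>_props[OF \<tau>(2,3)])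
   thus "((\<lambda>h. \<delta> (t - s) h * (2 * ?b) + ?b * (?b * h)) \<longlongrightarrow> 0) (at_right 0)" by simp
   have "\<forall>\<^sub>F h in at_right 0. h \<in> {0<..<t - s}" using \<tau> eventually_at_right_real by blast
   thus "\<forall>\<^sub>F h in at_right 0. norm ((1 / h) *\<^sub>R (w (s + h) - w s) - w' s) <= \<delta> (t - s) h * (2 * ?b) + ?b * (?b * h)"
   proof eventually_elim
    case (elim h)
    show ?case
    proof (rule norm_bound)
     fix \<eta>
     have m: "t - s - h \<in> {0..t}" using elim s by auto
     have eq: "t - (s + h) = t - s - h" by simp
     define u where "u = lin (a (t - s - h)) \<eta>"
     define v where "v = lin (a (t - s)) \<eta>"
     define v' where "v' = lin (a' (t - s)) \<eta>"
     have d: "abs ((u - v) / h + v') <= \<delta> (t - s) h"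
      using \<delta>_props(2)[OF \<tau>(2,3), of h \<eta>] elim by (simp add: u_def v_def v'_def)
     have bds: "abs u <= ?b" "abs v <= ?b" "abs v' <= ?b" "abs (u - v) <= ?b * h"
      using lin_a_bound[OF m] lin_a_bound[OF \<tau>(1)] lin_a'_bound[OF \<tau>(1)] lin_a_lipschitz[OF m \<tau>(1), of \<eta>] elim
      by (auto simp: u_def v_def v'_def)
     \<comment> \<open>An exact product rule: replacing \<open>u + v\<close> by \<open>2 * v\<close>
       costs \<open>v' * (u - v)\<close>, which is of order \<open>h\<close>.\<close>
     have "(1 / h) * (u\<^sup>2 - v\<^sup>2) + 2 * v * v' = ((u - v) / h + v') * (u + v) - v' * (u - v)"
      using elim by (simp add: field_simps power2_eq_square)
     also have "abs \<dots> <= abs ((u - v) / h + v') * abs (u + v) + abs v' * abs (u - v)"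
      by (simp only: abs_mult[symmetric] abs_triangle_ineq4)
     also have "\<dots> <= \<delta> (t - s) h * (2 * ?b) + ?b * (?b * h)"
      using d bds b_nonneg by (intro add_mono mult_mono) auto
     finally show "norm (apply_bcontfun ((1 / h) *\<^sub>R (w (s + h) - w s) - w' s) \<eta>) <= \<delta> (t - s) h * (2 * ?b) + ?b * (?b * h)"
      by (simp add: w_def w'_def eq Bc_lin_sq[OF m] Bc_lin_sq[OF \<tau>(1)] Bc_lin_prod[OF \<tau>(1)] u_def v_def v'_def)
    qed
   qed
  qed
  show "norm (l s + w' s) <= 2 * ?b * e + A * (?b + e)"
  proof (rule norm_bound)
   fix \<eta>
   define v where "v = lin (a (t - s)) \<eta>"
   define v' where "v' = lin (a' (t - s)) \<eta>"
   define L where "L = lin (walk (a (t - s))) \<eta>"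
   define g where "g = gen (\<lambda>\<eta>. (lin (a (t - s)) \<eta>)\<^sup>2) \<eta>"
   have "abs (g - 2 * v * L) <= A * (INFSUM x. abs (walk (a (t - s)) x))"
    unfolding g_def v_def L_def by (rule gen_lin_sq[OF a_summable[OF \<tau>(1)] A[OF \<tau>(1)]])
   hence "\<Theta>n * abs (g - 2 * v * L) <= \<Theta>n * (A * (INFSUM x. abs (walk (a (t - s)) x)))"
    by (rule mult_left_mono[OF _ \<Theta>])
   also have "\<dots> = A * (\<Theta>n * (INFSUM x. abs (walk (a (t - s)) x)))" by simp
   also have "\<dots> <= A * (?b + e)" by (rule mult_left_mono[OF walk_lin_bound(2)[OF \<tau>(1)] A0])
   finally have 1: "abs (\<Theta>n * g - 2 * v * (\<Theta>n * L)) <= A * (?b + e)"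
   proof -
    assume *: "\<Theta>n * abs (g - 2 * v * L) <= A * (?b + e)"
    have "\<Theta>n * g - 2 * v * (\<Theta>n * L) = \<Theta>n * (g - 2 * v * L)" by (simp add: algebra_simps)
    thus ?thesis using * \<Theta> by (simp add: abs_mult)
   qed
   have "abs (2 * v * (\<Theta>n * L - v')) <= (2 * ?b) * e"
    unfolding abs_mult using lin_a_bound[OF \<tau>(1), of \<eta>] walk_lin_bound(1)[OF \<tau>(1), of \<eta>] b_nonneg
    by (intro mult_mono) (auto simp: v_def L_def v'_def)
   with 1 have "abs (\<Theta>n * g - 2 * v * v') <= 2 * ?b * e + A * (?b + e)"
    by (simp add: right_diff_distrib abs_le_iff)
   thus "norm (apply_bcontfun (l s + w' s) \<eta>) <= 2 * ?b * e + A * (?b + e)"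
    by (simp add: l_def w'_def gv(2) Bc_lin_prod[OF \<tau>(1)] v_def v'_def g_def)
  qed
 qed
 thus ?thesis by (simp add: w_def)
qed

end

section \<open>Product test functions\<close>

lemma bij_vec_nth: "bij_betw (\<lambda>x::'a^'d::finite. ($) x) UNIV (PiE UNIV (\<lambda>_. UNIV))"
 by (rule bij_betw_byWitness[where f' = vec_lambda]) auto

text \<open>The product formula also yields summability: a non-summable family would have
  \<open>infsum\<close> 0, so a nonzero product of the absolute sums excludes it, and if that
  product is 0 one factor vanishes identically.\<close>

lemma vec_prod_sum:
 fixes f :: "'d::finite => int => real"
 assumes s: "\<And>i. (\<lambda>m. abs (f i m)) summable_on UNIV"
 shows "(\<Sum>\<^sub>\<infinity>x::int^'d. \<Prod>i\<in>UNIV. f i (x $ i)) = (\<Prod>i\<in>UNIV. INFSUM m. f i m)" (is ?A)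
  and "(\<lambda>x::int^'d. abs (\<Prod>i\<in>UNIV. f i (x $ i))) summable_on UNIV" (is ?B)
proof -
 have eq: "(\<Sum>\<^sub>\<infinity>x::int^'d. \<Prod>i\<in>UNIV. g i (x $ i)) = (\<Prod>i\<in>UNIV. INFSUM m. g i m)"
  if g: "\<And>i. (\<lambda>m. abs (g i m)) summable_on UNIV" for g :: "'d => int => real"
 proof -
  have "(\<Sum>\<^sub>\<infinity>x::int^'d. \<Prod>i\<in>UNIV. g i (x $ i)) = (\<Sum>\<^sub>\<infinity>x\<in>PiE UNIV (\<lambda>_. UNIV). \<Prod>i\<in>UNIV. g i (x i))"
   using infsum_reindex_bij_betw[OF bij_vec_nth, of "\<lambda>x. \<Prod>i\<in>UNIV. g i (x i)"] .
  also have "\<dots> = (\<Prod>i\<in>UNIV. INFSUM m. g i m)"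
   by (rule infsum_prod_PiE_abs) (use g in auto)
  finally show ?thesis .
 qed
 show ?A by (rule eq[OF s])
 show ?B
 proof (cases "(\<Prod>i\<in>UNIV. INFSUM m. abs (f i m)) = 0")
  case True
  then obtain i where i: "(INFSUM m. abs (f i m)) = 0" by auto
  have "f i m = 0" for m
   using nonneg_infsum_le_0D[OF _ s[of i], of m] i by simp
  hence "(\<lambda>x::int^'d. abs (\<Prod>i\<in>UNIV. f i (x $ i))) = (\<lambda>x. 0)"
   by (auto simp: fun_eq_iff intro!: prod_zero)
  thus ?thesis by simp
 next
  case False
  have "(\<Sum>\<^sub>\<infinity>x::int^'d. \<Prod>i\<in>UNIV. abs (f i (x $ i))) ~= 0"
   using False by (subst eq) (use s in auto)
  hence "(\<lambda>x::int^'d. \<Prod>i\<in>UNIV. abs (f i (x $ i))) summable_on UNIV"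
   using infsum_not_exists by blast
  thus ?thesis by (simp add: abs_prod)
 qed
qed

lemma prod_split: "(\<Prod>i\<in>UNIV. g i) = g j * (\<Prod>i\<in>UNIV - {j}. g i)" for g :: "'d::finite => real"
 by (rule prod.remove) auto

text \<open>Jumps follow the axes, so each changes one factor only, and a jump along axis
  \<open>j\<close> meets slow bonds only if \<open>j = k\<close>.\<close>

lemma walk_product:
 fixes k :: "'d::finite" and g :: "'d => int => real"
 assumes \<alpha>: "\<alpha> >= 0" and \<gamma>: "\<gamma> >= 2" and K: "\<And>i m. abs (g i m) <= K i"
 shows "exclusion_rates.walk (rate k \<alpha> \<beta> \<gamma> n) (\<lambda>x. \<Prod>i\<in>UNIV. g i (x $ i)) x =
  (\<Sum>j\<in>UNIV. (\<Prod>i\<in>UNIV - {j}. g i (x $ i)) *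
   (INFSUM r. jump_const TYPE('d) \<gamma> / CARD('d) * jump_w \<gamma> r *
     (if crossing (x $ j) (x $ j + r) then (if j = k then \<alpha> * real n powr - \<beta> else 1) else 1) *
     (g j (x $ j + r) - g j (x $ j))))"
proof -
 interpret exclusion_rates "rate k \<alpha> \<beta> \<gamma> n" "1 + \<alpha> * real n powr - \<beta>"
  by (rule exclusion_rates_rate[OF \<alpha> \<gamma>])
 let ?a = "\<lambda>x. \<Prod>i\<in>UNIV. g i (x $ i)"
 let ?c = "jump_const TYPE('d) \<gamma>"
 define G where "G v = jump_prob \<gamma> v * bond_rate k \<alpha> \<beta> n x (x + v) * (?a (x + v) - ?a x)" for v
 have "walk ?a x = (INFSUM v. G v)"
  unfolding walk_def rate_def
  by (rule infsum_reindex_bij_witness[where i = "\<lambda>v. x + v" and j = "\<lambda>y. y - x"]) (auto simp: G_def)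
 define T where "T j r = ?c / CARD('d) * jump_w \<gamma> r *
     (if crossing (x $ j) (x $ j + r) then (if j = k then \<alpha> * real n powr - \<beta> else 1) else 1) *
     (g j (x $ j + r) - g j (x $ j))" for j r
 have Gax: "G (axis j r) = (\<Prod>i\<in>UNIV - {j}. g i (x $ i)) * T j r" for j r
 proof -
  have br: "bond_rate k \<alpha> \<beta> n x (x + axis j r) =
    (if crossing (x $ j) (x $ j + r) then (if j = k then \<alpha> * real n powr - \<beta> else 1) else 1)"
   by (cases "j = k") (auto simp: bond_rate_def slow_bond_def crossing_def axis_def)
  have "?a (x + axis j r) = g j (x $ j + r) * (\<Prod>i\<in>UNIV - {j}. g i (x $ i))"
  proof -
   have "(\<Prod>i\<in>UNIV - {j}. g i ((x + axis j r) $ i)) = (\<Prod>i\<in>UNIV - {j}. g i (x $ i))"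
    by (rule prod.cong) (auto simp: axis_def)
   thus ?thesis unfolding prod_split[of _ j] by (simp add: axis_def)
  qed
  moreover have "?a x = g j (x $ j) * (\<Prod>i\<in>UNIV - {j}. g i (x $ i))" by (rule prod_split)
  ultimately have d: "?a (x + axis j r) - ?a x = (\<Prod>i\<in>UNIV - {j}. g i (x $ i)) * (g j (x $ j + r) - g j (x $ j))"
   by (simp add: algebra_simps)
  show ?thesis
   unfolding G_def T_def d br jump_prob_def jump_weight_axis by (simp add: mult_ac)
 qed
 have Ts: "T j summable_on UNIV" for j
 proof (rule infsum_le_bound(1)[OF summable_on_cmult_left[OF jump_w_summable[OF \<gamma>]]])
  fix r
  define c where "c = ?c / CARD('d)"
  define b where "b = (if crossing (x $ j) (x $ j + r) then (if j = k then \<alpha> * real n powr - \<beta> else 1) else 1)"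
  have "abs (T j r) = jump_w \<gamma> r * (abs c * abs b * abs (g j (x $ j + r) - g j (x $ j)))"
   unfolding T_def c_def[symmetric] b_def[symmetric] by (simp add: abs_mult)
  also have "\<dots> <= jump_w \<gamma> r * (abs c * (1 + \<alpha> * real n powr - \<beta>) * (2 * K j))"
  proof (intro mult_left_mono mult_mono)
   show "abs b <= 1 + \<alpha> * real n powr - \<beta>" using \<alpha> by (auto simp: b_def)
   show "abs (g j (x $ j + r) - g j (x $ j)) <= 2 * K j" using K[of j "x $ j + r"] K[of j "x $ j"] by linarith
  qed (use \<alpha> in auto)
  finally show "abs (T j r) <= jump_w \<gamma> r * (abs (?c / CARD('d)) * (1 + \<alpha> * real n powr - \<beta>) * (2 * K j))"
   unfolding c_def .
 qed
 have "(G has_sum (\<Sum>j\<in>UNIV. INFSUM r. G (axis j r))) UNIV"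
 proof (rule has_sum_axes)
  show "G v = 0" if "\<And>j r. v ~= axis j r" for v
   using jump_weight_off_axis[OF that] by (simp add: G_def jump_prob_def)
  show "G 0 = 0" by (simp add: G_def)
  show "(\<lambda>r. G (axis j r)) summable_on UNIV" for j
   unfolding Gax by (rule summable_on_cmult_right[OF Ts])
 qed
 hence "infsum G UNIV = (\<Sum>j\<in>UNIV. (\<Prod>i\<in>UNIV - {j}. g i (x $ i)) * infsum (T j) UNIV)"
  unfolding Gax infsum_cmult_right' by (rule infsumI)
 thus ?thesis unfolding \<open>walk ?a x = (INFSUM v. G v)\<close> T_def[abs_def] .
qed

text \<open>\<open>F j\<close> is the \<open>j\<close>-th space derivative and \<open>ht\<close> the time derivative. Only nonnegative times satisfy the
 heat equation; the extension to negative times exists because test functions are defined on \<open>[0,\<infinity>)\<close> while the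
 backward evolution reaches its final datum at a finite time.\<close>

definition heat_family :: "real => (nat => real => real => real) => (real => real => real) => bool" where
 "heat_family \<kappa> F ht \<longleftrightarrow>
  (\<forall>j<3. \<forall>\<tau> u. DERIV (F j \<tau>) u :> F (Suc j) \<tau> u) \<and>
  (\<forall>\<tau> u. DERIV (\<lambda>\<sigma>. F 0 \<sigma> u) \<tau> :> ht \<tau> u) \<and>
  (\<forall>\<tau>\<ge>0. \<forall>u. ht \<tau> u = \<kappa> * F 2 \<tau> u) \<and>
  (\<forall>j\<le>2. continuous_on UNIV (\<lambda>(\<tau>, u). F j \<tau> u)) \<and>
  continuous_on UNIV (\<lambda>(\<tau>, u). ht \<tau> u) \<and>
  (\<forall>t. \<exists>C. \<forall>\<tau>\<in>{0..t}. \<forall>u. \<forall>j\<le>3. abs (F j \<tau> u) <= C * (wt u)\<^sup>2)"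

text \<open>With slow bonds the two half spaces decouple in the limit: the factors in direction
  \<open>k\<close> are unrelated on the two sides, each with zero slope at the barrier for all
  times.\<close>

definition admissible ::
  "'d::finite => bool => real => ('d => nat => real => real => real) => ('d => nat => real => real => real) => bool" where
 "admissible k slow \<kappa> Fm Fp \<longleftrightarrow>
  (\<forall>i. (\<exists>ht. heat_family \<kappa> (Fm i) ht) \<and> (\<exists>ht. heat_family \<kappa> (Fp i) ht)) \<and>
  (\<forall>i. i ~= k \<longrightarrow> Fm i = Fp i) \<and>
  (if slow then (\<forall>\<tau>. Fm k 1 \<tau> 0 = 0 \<and> Fp k 1 \<tau> 0 = 0) else Fm k = Fp k)"

context
 fixes k :: "'d::finite" and slow :: bool and \<kappa> :: real and Fm Fp :: "'d => nat => real => real => real"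
begin

definition fac :: "'d => nat => real => real => real" where
 "fac i j \<tau> = glue1 (Fm i j \<tau>) (Fp i j \<tau>)"

definition prodH :: "real => real^'d => real" where
 "prodH \<tau> u = (\<Prod>i\<in>UNIV. fac i 0 \<tau> (u $ i))"

definition prodL :: "real => real^'d => real" where
 "prodL \<tau> u = \<kappa> * (\<Sum>j\<in>UNIV. (\<Prod>i\<in>UNIV - {j}. fac i 0 \<tau> (u $ i)) * fac j 2 \<tau> (u $ j))"

end

definition Wd :: "real^'d::finite => real" where "Wd u = (\<Prod>i\<in>UNIV. wt (u $ i))"

lemma Wd_nonneg [simp]: "Wd u >= 0" unfolding Wd_def by (intro prod_nonneg) auto
lemma Wd_le_1 [simp]: "Wd u <= 1" unfolding Wd_def by (intro prod_le_1) auto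

definition scaled :: "nat => int^'d::finite => real^'d" where
 "scaled n x = (\<chi> i. real_of_int (x $ i) / real n)"

lemma scaled_nth [simp]: "scaled n x $ i = real_of_int (x $ i) / real n"
 by (simp add: scaled_def)

lemma Wd_lattice_sum:
 assumes "n >= 1"
 shows "(\<lambda>x::int^'d::finite. Wd (scaled n x)) summable_on UNIV" (is ?A)
  "(\<Sum>\<^sub>\<infinity>x::int^'d. Wd (scaled n x)) <= (5 * real n) ^ CARD('d)" (is ?B)
proof -
 have s: "(\<lambda>m::int. abs (wt (real_of_int m / real n))) summable_on UNIV" using wt_lattice_sum[OF assms] by simp
 note v = vec_prod_sum[where 'd = 'd and f = "\<lambda>i m. wt (real_of_int m / real n)", OF s]
 have "0 <= (\<Prod>i\<in>(UNIV :: 'd set). wt (real_of_int (x $ i) / real n))" for x :: "int^'d"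
  by (intro prod_nonneg) auto
 thus ?A using v(2) by (simp add: Wd_def)
 have "(\<Sum>\<^sub>\<infinity>x::int^'d. Wd (scaled n x)) = (\<Prod>i\<in>(UNIV :: 'd set). INFSUM m. wt (real_of_int m / real n))"
  using v(1) by (simp add: Wd_def)
 also have "\<dots> = (INFSUM m. wt (real_of_int m / real n)) ^ CARD('d)" by simp
 also have "\<dots> <= (5 * real n) ^ CARD('d)"
  using wt_lattice_sum(2)[OF assms] by (intro power_mono infsum_nonneg) auto
 finally show ?B .
qed

lemma heat_family_decay3:
 assumes h: "heat_family \<kappa> F ht" and C: "\<And>u j. j <= 3 ==> abs (F j \<tau> u) <= C * (wt u)\<^sup>2" and C0: "C >= 0"
 shows "decay3 C (F 0 \<tau>) (F 1 \<tau>) (F 2 \<tau>) (F 3 \<tau>)"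
proof -
 have "C * (wt u)\<^sup>2 <= C * wt u" for u
  using C0 mult_left_le[OF wt_le_1[of u] wt_nonneg[of u]] by (intro mult_left_mono) (auto simp: power2_eq_square)
 hence b: "abs (F j \<tau> u) <= C * wt u" if "j <= 3" for j u using C[OF that, of u] by (rule order_trans[rotated])
 have d: "DERIV (F j \<tau>) u :> F (Suc j) \<tau> u" if "j < 3" for j u
  using h that by (simp add: heat_family_def)
 show ?thesis
  unfolding decay3_def using C0 b[of 0] b[of 1] b[of 2] b[of 3] d[of 0] d[of 1] d[of 2]
  by (simp add: numeral_2_eq_2 numeral_3_eq_3)
qed

text \<open>One factor \<open>wt\<close> is enough for lattice sums; the second one absorbs the
  cutoff errors in \<open>cutoff_bounds\<close>.\<close>

definition adm_bound ::
  "real => real => ('d::finite => nat => real => real => real) => ('d => nat => real => real => real) => bool" where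
 "adm_bound t C Fm Fp \<longleftrightarrow> C >= 0 \<and> (\<forall>i. \<forall>\<tau>\<in>{0..t}. \<forall>u. \<forall>j\<le>3.
   abs (Fm i j \<tau> u) <= C * (wt u)\<^sup>2 \<and> abs (Fp i j \<tau> u) <= C * (wt u)\<^sup>2)"

lemma adm_bound_exists:
 assumes "admissible k slow \<kappa> Fm Fp" shows "\<exists>C. adm_bound t C Fm Fp"
proof -
 have "\<exists>C. \<forall>\<tau>\<in>{0..t}. \<forall>u. \<forall>j\<le>3. abs (Fm i j \<tau> u) <= C * (wt u)\<^sup>2"
  "\<exists>C. \<forall>\<tau>\<in>{0..t}. \<forall>u. \<forall>j\<le>3. abs (Fp i j \<tau> u) <= C * (wt u)\<^sup>2" for i
  using assms unfolding admissible_def heat_family_def by meson+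
 then obtain Cm Cp where Cm: "\<And>i \<tau> u j. \<tau> \<in> {0..t} ==> j <= 3 ==> abs (Fm i j \<tau> u) <= Cm i * (wt u)\<^sup>2"
  and Cp: "\<And>i \<tau> u j. \<tau> \<in> {0..t} ==> j <= 3 ==> abs (Fp i j \<tau> u) <= Cp i * (wt u)\<^sup>2"
  by metis
 define C where "C = (\<Sum>i\<in>UNIV. abs (Cm i) + abs (Cp i))"
 have "abs (Cm i) + abs (Cp i) <= C" for i unfolding C_def by (rule member_le_sum) auto
 hence le: "Cm i * (wt u)\<^sup>2 <= C * (wt u)\<^sup>2" "Cp i * (wt u)\<^sup>2 <= C * (wt u)\<^sup>2" for i u
  by (intro mult_right_mono; smt (verit) zero_le_power2)+
 have "C >= 0" unfolding C_def by (intro sum_nonneg) auto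
 hence "adm_bound t C Fm Fp"
  unfolding adm_bound_def using order_trans[OF Cm le(1)] order_trans[OF Cp le(2)] by blast
 thus ?thesis by blast
qed

lemma fac_bound:
 assumes "adm_bound t C Fm Fp" "\<tau> \<in> {0..t}" "j <= 3"
 shows "abs (fac Fm Fp i j \<tau> u) <= C * (wt u)\<^sup>2" (is ?A) "abs (fac Fm Fp i j \<tau> u) <= C * wt u" (is ?B) "abs (fac Fm Fp i j \<tau> u) <= C" (is ?C)
proof -
 show 1: ?A
  using assms by (simp add: fac_def glue1_def adm_bound_def)
 have C: "C >= 0" using assms by (simp add: adm_bound_def)
 have "C * (wt u)\<^sup>2 <= C * wt u"
  using C mult_left_le[OF wt_le_1[of u] wt_nonneg[of u]] by (intro mult_left_mono) (auto simp: power2_eq_square)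
 with 1 show 2: ?B by simp
 have "C * wt u <= C" using mult_left_le[OF wt_le_1[of u] C] .
 with 2 show ?C by simp
qed

lemma prodH_bound:
 fixes Fm Fp :: "'d::finite => nat => real => real => real"
 assumes b: "adm_bound t C Fm Fp" and \<tau>: "\<tau> \<in> {0..t}"
 shows "abs (prodH Fm Fp \<tau> u) <= C ^ CARD('d) * (Wd u)\<^sup>2" (is ?A) "abs (prodH Fm Fp \<tau> u) <= C ^ CARD('d) * Wd u" (is ?B)
  "abs (prodL \<kappa> Fm Fp \<tau> u) <= abs \<kappa> * CARD('d) * C ^ CARD('d) * Wd u" (is ?C)
proof -
 have C: "C >= 0" using b by (simp add: adm_bound_def)
 have "abs (prodH Fm Fp \<tau> u) = (\<Prod>i\<in>UNIV. abs (fac Fm Fp i 0 \<tau> (u $ i)))" by (simp add: prodH_def abs_prod)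
 also have "\<dots> <= (\<Prod>i\<in>UNIV. C * (wt (u $ i))\<^sup>2)"
  by (intro prod_mono conjI fac_bound[OF b \<tau>]) auto
 also have "\<dots> = C ^ CARD('d) * (Wd u)\<^sup>2" by (simp add: prod.distrib Wd_def prod_power_distrib)
 finally show 1: ?A .
 also have "\<dots> <= C ^ CARD('d) * Wd u"
  using C mult_left_le[OF Wd_le_1[of u] Wd_nonneg[of u]] by (intro mult_left_mono) (auto simp: power2_eq_square)
 finally show ?B .
 have "abs ((\<Prod>i\<in>UNIV - {j}. fac Fm Fp i 0 \<tau> (u $ i)) * fac Fm Fp j 2 \<tau> (u $ j)) <= C ^ CARD('d) * Wd u" for j
 proof -
  have "abs ((\<Prod>i\<in>UNIV - {j}. fac Fm Fp i 0 \<tau> (u $ i)) * fac Fm Fp j 2 \<tau> (u $ j))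
    = (\<Prod>i\<in>UNIV - {j}. abs (fac Fm Fp i 0 \<tau> (u $ i))) * abs (fac Fm Fp j 2 \<tau> (u $ j))"
   by (simp add: abs_mult abs_prod)
  also have "\<dots> <= (\<Prod>i\<in>UNIV - {j}. C * wt (u $ i)) * (C * wt (u $ j))"
   using C by (intro mult_mono prod_mono conjI fac_bound[OF b \<tau>] prod_nonneg) auto
  also have "\<dots> = (\<Prod>i\<in>UNIV. C * wt (u $ i))" using prod_split[of "\<lambda>i. C * wt (u $ i)" j] by simp
  also have "\<dots> = C ^ CARD('d) * Wd u" by (simp add: prod.distrib Wd_def)
  finally show ?thesis .
 qed
 hence "abs (\<Sum>j\<in>UNIV. (\<Prod>i\<in>UNIV - {j}. fac Fm Fp i 0 \<tau> (u $ i)) * fac Fm Fp j 2 \<tau> (u $ j)) <= (\<Sum>j\<in>(UNIV::'d set). C ^ CARD('d) * Wd u)"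
  by (intro order_trans[OF sum_abs] sum_mono)
 hence "abs \<kappa> * abs (\<Sum>j\<in>UNIV. (\<Prod>i\<in>UNIV - {j}. fac Fm Fp i 0 \<tau> (u $ i)) * fac Fm Fp j 2 \<tau> (u $ j)) <= abs \<kappa> * (CARD('d) * (C ^ CARD('d) * Wd u))"
  by (intro mult_left_mono) auto
 thus ?C
  unfolding prodL_def abs_mult by (simp add: mult_ac)
qed

lemma fac_time_deriv:
 assumes a: "admissible k slow \<kappa> Fm Fp" and \<tau>: "\<tau> >= 0"
 shows "DERIV (\<lambda>\<sigma>. fac Fm Fp i 0 \<sigma> x) \<tau> :> \<kappa> * fac Fm Fp i 2 \<tau> x"
proof -
 obtain hm hp where "heat_family \<kappa> (Fm i) hm" "heat_family \<kappa> (Fp i) hp" using a unfolding admissible_def by blast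
 hence "DERIV (\<lambda>\<sigma>. Fm i 0 \<sigma> x) \<tau> :> \<kappa> * Fm i 2 \<tau> x"
  "DERIV (\<lambda>\<sigma>. Fp i 0 \<sigma> x) \<tau> :> \<kappa> * Fp i 2 \<tau> x"
  using \<tau> unfolding heat_family_def by metis+
 thus ?thesis by (cases "x < 0") (simp_all add: fac_def glue1_def)
qed

lemma prodH_time_deriv:
 assumes a: "admissible k slow \<kappa> Fm Fp" and \<tau>: "\<tau> >= 0"
 shows "DERIV (\<lambda>\<sigma>. prodH Fm Fp \<sigma> u) \<tau> :> prodL \<kappa> Fm Fp \<tau> u"
proof -
 have "((\<lambda>\<sigma>. \<Prod>i\<in>UNIV. fac Fm Fp i 0 \<sigma> (u $ i)) has_derivative
   (\<lambda>y. \<Sum>i\<in>UNIV. (\<kappa> * fac Fm Fp i 2 \<tau> (u $ i) * y) * (\<Prod>j\<in>UNIV - {i}. fac Fm Fp j 0 \<tau> (u $ j)))) (at \<tau>)"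
  by (rule has_derivative_prod) (use fac_time_deriv[OF a \<tau>] in \<open>simp add: has_field_derivative_def\<close>)
 moreover have "(\<lambda>y. \<Sum>i\<in>UNIV. (\<kappa> * fac Fm Fp i 2 \<tau> (u $ i) * y) * (\<Prod>j\<in>UNIV - {i}. fac Fm Fp j 0 \<tau> (u $ j))) = (*) (prodL \<kappa> Fm Fp \<tau> u)"
  by (auto simp: prodL_def sum_distrib_left sum_distrib_right mult_ac fun_eq_iff)
 ultimately show ?thesis by (simp add: prodH_def[abs_def] has_field_derivative_def)
qed

text \<open>The difference of walk and \<open>prodL\<close> is a sum over \<open>j\<close> of
  products with a one-dimensional error in coordinate \<open>j\<close> and plain factors elsewhere.
  Sums of such products factorise: each plain factor costs \<open>5 * C * n\<close>, the error
  \<open>C * n\<close> times the consistency error, and the powers of \<open>n\<close> are exactly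
  the normalisation.\<close>

theorem consistency_nd:
 fixes k :: "'d::finite" and C t \<tau> \<alpha> \<beta> \<gamma> \<kappa> :: real and n :: nat
 assumes a: "admissible k slow \<kappa> Fm Fp" and b: "adm_bound t C Fm Fp" and \<tau>: "\<tau> \<in> {0..t}"
  and n: "n >= 1" and \<alpha>: "\<alpha> >= 0" and \<gamma>: "\<gamma> >= 2"
  and free: "\<not> slow ==> \<alpha> * real n powr - \<beta> = 1"
 defines "\<theta> \<equiv> time_scale \<gamma> n * (jump_const TYPE('d) \<gamma> / CARD('d))"
 shows "(INFSUM x. abs (time_scale \<gamma> n * exclusion_rates.walk (rate k \<alpha> \<beta> \<gamma> n) (\<lambda>x. prodH Fm Fp \<tau> (scaled n x) / real n ^ CARD('d)) x
   - prodL \<kappa> Fm Fp \<tau> (scaled n x) / real n ^ CARD('d)))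
  <= CARD('d) * (5 * C) ^ (CARD('d) - 1) * (C * consistency_error \<gamma> \<kappa> (of_bool slow * (\<alpha> * real n powr - \<beta>)) \<theta> n)"
proof -
 interpret exclusion_rates "rate k \<alpha> \<beta> \<gamma> n" "1 + \<alpha> * real n powr - \<beta>"
  by (rule exclusion_rates_rate[OF \<alpha> \<gamma>])
 define R where "R = consistency_error \<gamma> \<kappa> (of_bool slow * (\<alpha> * real n powr - \<beta>)) \<theta> n"
 have C: "C >= 0" using b by (simp add: adm_bound_def)
 let ?\<Theta> = "time_scale \<gamma> n"
 let ?c = "jump_const TYPE('d) \<gamma> / CARD('d)"
 have c0: "?c >= 0" using jump_total_pos[OF \<gamma>] by (simp add: jump_const_eq[OF \<gamma>])
 have \<theta>0: "\<theta> >= 0" unfolding \<theta>_def by (intro mult_nonneg_nonneg time_scale_nonneg[OF n] c0)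
 define N where "N = real n ^ CARD('d)"
 have N: "N > 0" using n by (simp add: N_def)
 define g where "g i m = fac Fm Fp i 0 \<tau> (real_of_int m / n)" for i m
 define g2 where "g2 i m = fac Fm Fp i 2 \<tau> (real_of_int m / n)" for i m
 define aa where "aa j = (if j = k then \<alpha> * real n powr - \<beta> else 1)" for j
 define bb where "bb j = (if j = k \<and> slow then 1 else 0 :: real)" for j
 define E where "E j m = (INFSUM r. \<theta> * jump_w \<gamma> r * (if crossing m (m + r) then aa j else 1) * (g j (m + r) - g j m)) - \<kappa> * g2 j m" for j m
 have aa0: "aa j >= 0" for j using \<alpha> by (simp add: aa_def)
 have E: "(\<lambda>m. abs (E j m)) summable_on UNIV" "(INFSUM m. abs (E j m)) <= C * n * R" for j
 proof -
  obtain hm hp where hh: "heat_family \<kappa> (Fm j) hm" "heat_family \<kappa> (Fp j) hp" using a unfolding admissible_def by blast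
  have dm: "decay3 C (Fm j 0 \<tau>) (Fm j 1 \<tau>) (Fm j 2 \<tau>) (Fm j 3 \<tau>)"
   by (rule heat_family_decay3[OF hh(1) _ C]) (use b \<tau> in \<open>auto simp: adm_bound_def\<close>)
  have dp: "decay3 C (Fp j 0 \<tau>) (Fp j 1 \<tau>) (Fp j 2 \<tau>) (Fp j 3 \<tau>)"
   by (rule heat_family_decay3[OF hh(2) _ C]) (use b \<tau> in \<open>auto simp: adm_bound_def\<close>)
  \<comment> \<open>Directions other than \<open>k\<close> see no barrier and enter the
    one-dimensional estimate with rate 1.\<close>
  have bbj: "bb j = 0 \<and> aa j = 1 \<and> Fm j 0 \<tau> = Fp j 0 \<tau> \<or> bb j = 1 \<and> Fm j 1 \<tau> 0 = 0 \<and> Fp j 1 \<tau> 0 = 0"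
  proof (cases "j = k")
   case True
   thus ?thesis using a free by (cases slow) (auto simp: bb_def aa_def admissible_def)
  next
   case False
   hence "Fm j = Fp j" using a by (simp add: admissible_def)
   thus ?thesis using False by (simp add: bb_def aa_def)
  qed
  note c1 = consistency_1d[OF n dm dp aa0[of j] \<theta>0 \<gamma> bbj, of \<kappa>]
  have Eeq: "E j = (\<lambda>m. (INFSUM r. \<theta> * jump_w \<gamma> r * (if crossing m (m + r) then aa j else 1) *
      (glue1 (Fm j 0 \<tau>) (Fp j 0 \<tau>) ((m + r) / n) - glue1 (Fm j 0 \<tau>) (Fp j 0 \<tau>) (m / n))) - \<kappa> * glue1 (Fm j 2 \<tau>) (Fp j 2 \<tau>) (m / n))"
   by (auto simp: E_def g_def g2_def fac_def fun_eq_iff)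
  show "(\<lambda>m. abs (E j m)) summable_on UNIV" unfolding Eeq by (rule c1(1))
  have "(INFSUM m. abs (E j m)) <= C * n * consistency_error \<gamma> \<kappa> (bb j * aa j) \<theta> n"
   unfolding Eeq by (rule c1(2))
  also have "\<dots> <= C * n * R"
  proof -
   have S0: "(INFSUM r. jump_w \<gamma> r * abs (real_of_int r)) >= 0" by (rule infsum_nonneg) auto
   have "bb j * aa j <= of_bool slow * (\<alpha> * real n powr - \<beta>)" using \<alpha> by (auto simp: bb_def aa_def)
   hence "consistency_error \<gamma> \<kappa> (bb j * aa j) \<theta> n <= R" unfolding consistency_error_def R_def
    by (intro add_mono mult_left_mono mult_right_mono divide_right_mono order_refl S0 \<theta>0) auto
   thus ?thesis using C n by (intro mult_left_mono) auto
  qed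
  finally show "(INFSUM m. abs (E j m)) <= C * n * R" .
 qed
 have gs: "(\<lambda>m. abs (g i m)) summable_on UNIV" "(INFSUM m. abs (g i m)) <= 5 * C * n" for i
 proof -
  have s: "(\<lambda>m::int. C * wt (m / n)) summable_on UNIV"
   by (rule summable_on_cmult_right[OF wt_lattice_sum(1)[OF n]])
  have le: "abs (g i m) <= C * wt (m / n)" for m unfolding g_def by (rule fac_bound[OF b \<tau>]) simp
  show 1: "(\<lambda>m. abs (g i m)) summable_on UNIV" by (rule infsum_le_bound(2)[OF s le])
  have "(INFSUM m. abs (g i m)) <= C * (\<Sum>\<^sub>\<infinity>m::int. wt (m / n))"
   unfolding infsum_cmult_right'[symmetric] by (rule infsum_mono[OF 1 s le])
  also have "\<dots> <= C * real (5 * n)" by (rule mult_left_mono[OF wt_lattice_sum(2)[OF n] C])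
  finally show "(INFSUM m. abs (g i m)) <= 5 * C * n" by (simp add: mult_ac)
 qed
 define Q where "Q j x = (\<Prod>i\<in>UNIV. (if i = j then E j else g i) (x $ i))" for j and x :: "int^'d"
 have Qeq: "Q j x = (\<Prod>i\<in>UNIV - {j}. g i (x $ i)) * E j (x $ j)" for j x
  unfolding Q_def prod_split[of _ j] by (simp add: cong: prod.cong_simp)
 have main: "?\<Theta> * walk (\<lambda>x. prodH Fm Fp \<tau> (scaled n x) / N) x - prodL \<kappa> Fm Fp \<tau> (scaled n x) / N = (\<Sum>j\<in>UNIV. Q j x) / N" for x
 proof -
  have "walk (\<lambda>x. prodH Fm Fp \<tau> (scaled n x) / N) x = walk (\<lambda>x. \<Prod>i\<in>UNIV. g i (x $ i)) x / N"
  proof -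
   have "walk (\<lambda>x. prodH Fm Fp \<tau> (scaled n x) / N) x = (INFSUM y. rate k \<alpha> \<beta> \<gamma> n x y * ((\<Prod>i\<in>UNIV. g i (y $ i)) - (\<Prod>i\<in>UNIV. g i (x $ i))) * (1 / N))"
    unfolding walk_def by (rule infsum_cong) (simp add: prodH_def g_def diff_divide_distrib right_diff_distrib)
   thus ?thesis unfolding infsum_cmult_left' walk_def by simp
  qed
  moreover have "?\<Theta> * walk (\<lambda>x. \<Prod>i\<in>UNIV. g i (x $ i)) x = (\<Sum>j\<in>UNIV. (\<Prod>i\<in>UNIV - {j}. g i (x $ i)) *
   (INFSUM r. \<theta> * jump_w \<gamma> r * (if crossing (x $ j) (x $ j + r) then aa j else 1) * (g j (x $ j + r) - g j (x $ j))))"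
  proof -
   have gC: "abs (g i m) <= C" for i m unfolding g_def by (rule fac_bound[OF b \<tau>]) simp
   have *: "?\<Theta> * (INFSUM r. ?c * jump_w \<gamma> r * (if crossing (x $ j) (x $ j + r) then aa j else 1) * (g j (x $ j + r) - g j (x $ j)))
    = (INFSUM r. \<theta> * jump_w \<gamma> r * (if crossing (x $ j) (x $ j + r) then aa j else 1) * (g j (x $ j + r) - g j (x $ j)))" for j
    unfolding infsum_cmult_right'[symmetric] \<theta>_def by (rule infsum_cong) (simp only: mult.assoc)
   show ?thesis
    unfolding walk_product[OF \<alpha> \<gamma>, of g, OF gC] sum_distrib_left aa_def[symmetric]
    by (rule sum.cong[OF refl]) (simp only: *[symmetric] mult.left_commute)
  qed
  moreover have "prodL \<kappa> Fm Fp \<tau> (scaled n x) = (\<Sum>j\<in>UNIV. (\<Prod>i\<in>UNIV - {j}. g i (x $ i)) * (\<kappa> * g2 j (x $ j)))"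
   by (simp add: prodL_def g_def g2_def sum_distrib_left mult_ac)
  ultimately show ?thesis
   by (simp add: Qeq E_def diff_divide_distrib[symmetric] sum_subtractf[symmetric] right_diff_distrib)
 qed
 have Qs: "(\<lambda>x. abs (Q j x)) summable_on UNIV" "(INFSUM x. abs (Q j x)) <= (5 * C * n) ^ (CARD('d) - 1) * (C * n * R)" for j
 proof -
  let ?f = "\<lambda>i. if i = j then E j else g i"
  have fs: "(\<lambda>m. abs (?f i m)) summable_on UNIV" for i using E(1)[of j] gs(1)[of i] by simp
  show "(\<lambda>x. abs (Q j x)) summable_on UNIV" unfolding Q_def by (rule vec_prod_sum(2)[OF fs])
  have fs': "(\<lambda>m. abs (abs (?f i m))) summable_on UNIV" for i using fs by simp
  have "(INFSUM x. abs (Q j x)) = (\<Prod>i\<in>UNIV. INFSUM m. abs (?f i m))"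
   unfolding Q_def abs_prod by (rule vec_prod_sum(1)[OF fs'])
  also have "\<dots> = (INFSUM m. abs (E j m)) * (\<Prod>i\<in>UNIV - {j}. INFSUM m. abs (g i m))"
   unfolding prod_split[of _ j] by (simp cong: prod.cong_simp)
  also have "\<dots> <= (C * n * R) * (\<Prod>i\<in>UNIV - {j}. 5 * C * n)"
  proof (intro mult_mono E prod_mono conjI gs infsum_nonneg prod_nonneg)
   have "0 <= (INFSUM m. abs (E j m))" by (rule infsum_nonneg) simp
   thus "0 <= C * n * R" using E(2)[of j] by linarith
  qed auto
  also have "\<dots> = (5 * C * n) ^ (CARD('d) - 1) * (C * n * R)" by (simp add: card_Diff_singleton)
  finally show "(INFSUM x. abs (Q j x)) <= (5 * C * n) ^ (CARD('d) - 1) * (C * n * R)" .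
 qed
 have sumQ: "(\<lambda>x. \<Sum>j\<in>UNIV. abs (Q j x)) summable_on UNIV"
  and sumQ': "(INFSUM x. \<Sum>j\<in>UNIV. abs (Q j x)) = (\<Sum>j\<in>UNIV. INFSUM x. abs (Q j x))"
 proof -
  have "((\<lambda>x. \<Sum>j\<in>A. abs (Q j x)) has_sum (\<Sum>j\<in>A. INFSUM x. abs (Q j x))) UNIV" if "finite A" for A
   using that by (induction A) (auto intro!: has_sum_add has_sum_infsum Qs(1))
  from this[of UNIV] show "(\<lambda>x. \<Sum>j\<in>UNIV. abs (Q j x)) summable_on UNIV"
   "(INFSUM x. \<Sum>j\<in>UNIV. abs (Q j x)) = (\<Sum>j\<in>UNIV. INFSUM x. abs (Q j x))" by (auto simp: has_sum_iff)
 qed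
 have ptw: "abs (?\<Theta> * walk (\<lambda>x. prodH Fm Fp \<tau> (scaled n x) / N) x - prodL \<kappa> Fm Fp \<tau> (scaled n x) / N) <= (\<Sum>j\<in>UNIV. abs (Q j x)) * (1 / N)" for x
  unfolding main using N by (simp add: divide_right_mono)
 have sQ: "(\<lambda>x. (\<Sum>j\<in>UNIV. abs (Q j x)) * (1 / N)) summable_on UNIV" by (rule summable_on_cmult_left[OF sumQ])
 have "(INFSUM x. abs (?\<Theta> * walk (\<lambda>x. prodH Fm Fp \<tau> (scaled n x) / N) x - prodL \<kappa> Fm Fp \<tau> (scaled n x) / N)) <= (INFSUM x. (\<Sum>j\<in>UNIV. abs (Q j x)) * (1 / N))"
  by (rule infsum_mono[OF infsum_le_bound(2)[OF sQ ptw] sQ ptw])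
 also have "\<dots> = (\<Sum>j\<in>UNIV. INFSUM x. abs (Q j x)) * (1 / N)" unfolding infsum_cmult_left' sumQ' ..
 also have "\<dots> <= (\<Sum>j\<in>(UNIV::'d set). (5 * C * n) ^ (CARD('d) - 1) * (C * n * R)) * (1 / N)"
  by (intro mult_right_mono sum_mono Qs) (use N in auto)
 also have "\<dots> = CARD('d) * (5 * C) ^ (CARD('d) - 1) * (C * R)"
 proof -
  have "N = real n ^ (CARD('d) - 1) * n"
   unfolding N_def using power_minus_mult[of "CARD('d)" "real n"] by simp
  thus ?thesis using n by (simp add: power_mult_distrib)
 qed
 finally show ?thesis unfolding N_def R_def .
qed

section \<open>Convergence in probability\<close>

definition conv_prob :: "(nat => 'a measure) => (nat => 'a => real) => real => bool" where
 "conv_prob P X c \<longleftrightarrow> (\<forall>\<delta>>0. (\<lambda>n. measure (P n) {\<omega> \<in> space (P n). abs (X n \<omega> - c) > \<delta>}) \<longlonglongrightarrow> 0)"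

text \<open>For large \<open>n\<close> the event for \<open>X\<close> is contained in a measurable
  event for \<open>Y\<close>, since
  \<open>\<delta> - 2 * (\<delta> / 3) > \<delta> / 4\<close>.\<close>

lemma conv_prob_approx:
 assumes P: "\<And>n. n >= 1 ==> prob_space (P n)"
  and ap: "\<And>\<epsilon>. \<epsilon> > 0 ==> \<exists>Y d. (\<forall>n\<ge>1. Y n \<in> borel_measurable (P n)) \<and> conv_prob P Y d \<and> abs (c - d) <= \<epsilon> \<and>
   (\<forall>\<^sub>F n in sequentially. \<forall>\<omega>\<in>space (P n). abs (X n \<omega> - Y n \<omega>) <= \<epsilon>)"
 shows "conv_prob P X c"
 unfolding conv_prob_def
proof (intro allI impI)
 fix \<delta> :: real assume \<delta>: "\<delta> > 0"
 from ap[of "\<delta> / 3"] \<delta> obtain Y d where Y: "\<And>n. n >= 1 ==> Y n \<in> borel_measurable (P n)"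
  and c: "conv_prob P Y d" and d: "abs (c - d) <= \<delta> / 3"
  and ev: "\<forall>\<^sub>F n in sequentially. \<forall>\<omega>\<in>space (P n). abs (X n \<omega> - Y n \<omega>) <= \<delta> / 3" by auto
 show "(\<lambda>n. measure (P n) {\<omega> \<in> space (P n). abs (X n \<omega> - c) > \<delta>}) \<longlonglongrightarrow> 0"
 proof (rule Lim_null_comparison)
  show "(\<lambda>n. measure (P n) {\<omega> \<in> space (P n). abs (Y n \<omega> - d) > \<delta> / 4}) \<longlonglongrightarrow> 0"
   using c[unfolded conv_prob_def, rule_format, of "\<delta> / 4"] \<delta> by simp
  show "\<forall>\<^sub>F n in sequentially. norm (measure (P n) {\<omega> \<in> space (P n). abs (X n \<omega> - c) > \<delta>})
    <= measure (P n) {\<omega> \<in> space (P n). abs (Y n \<omega> - d) > \<delta> / 4}"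
   using ev eventually_ge_at_top[of 1]
  proof eventually_elim
   case (elim n)
   interpret prob_space "P n" by (rule P[OF elim(2)])
   note [measurable] = Y[OF elim(2)]
   have "measure (P n) {\<omega> \<in> space (P n). abs (X n \<omega> - c) > \<delta>} <= measure (P n) {\<omega> \<in> space (P n). abs (Y n \<omega> - d) > \<delta> / 4}"
   proof (rule finite_measure_mono)
    have "abs (Y n \<omega> - d) > \<delta> / 4" if "\<omega> \<in> space (P n)" "abs (X n \<omega> - c) > \<delta>" for \<omega>
     using elim(1)[rule_format, OF that(1)] that(2) d \<delta> by linarith
    thus "{\<omega> \<in> space (P n). abs (X n \<omega> - c) > \<delta>} \<subseteq> {\<omega> \<in> space (P n). abs (Y n \<omega> - d) > \<delta> / 4}" by blast
   qed simp
   thus ?case by simp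
  qed
 qed
qed

lemma conv_prob_add:
 assumes P: "\<And>n. n >= 1 ==> prob_space (P n)"
  and X: "\<And>n. n >= 1 ==> X n \<in> borel_measurable (P n)" and Y: "\<And>n. n >= 1 ==> Y n \<in> borel_measurable (P n)"
  and c: "conv_prob P X c" "conv_prob P Y d"
 shows "conv_prob P (\<lambda>n \<omega>. X n \<omega> + Y n \<omega>) (c + d)"
 unfolding conv_prob_def
proof (intro allI impI)
 fix \<delta> :: real assume \<delta>: "\<delta> > 0"
 show "(\<lambda>n. measure (P n) {\<omega> \<in> space (P n). abs (X n \<omega> + Y n \<omega> - (c + d)) > \<delta>}) \<longlonglongrightarrow> 0"
 proof (rule Lim_null_comparison)
  have "(\<lambda>n. measure (P n) {\<omega> \<in> space (P n). abs (X n \<omega> - c) > \<delta> / 2} + measure (P n) {\<omega> \<in> space (P n). abs (Y n \<omega> - d) > \<delta> / 2}) \<longlonglongrightarrow> 0 + 0"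
   using c[unfolded conv_prob_def, rule_format, of "\<delta> / 2"] \<delta> by (intro tendsto_add) simp_all
  thus "(\<lambda>n. measure (P n) {\<omega> \<in> space (P n). abs (X n \<omega> - c) > \<delta> / 2} + measure (P n) {\<omega> \<in> space (P n). abs (Y n \<omega> - d) > \<delta> / 2}) \<longlonglongrightarrow> 0" by simp
  show "\<forall>\<^sub>F n in sequentially. norm (measure (P n) {\<omega> \<in> space (P n). abs (X n \<omega> + Y n \<omega> - (c + d)) > \<delta>})
    <= measure (P n) {\<omega> \<in> space (P n). abs (X n \<omega> - c) > \<delta> / 2} + measure (P n) {\<omega> \<in> space (P n). abs (Y n \<omega> - d) > \<delta> / 2}"
   using eventually_ge_at_top[of 1]
  proof eventually_elim
   case (elim n)
   interpret prob_space "P n" by (rule P[OF elim])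
   note [measurable] = X[OF elim] Y[OF elim]
   have "measure (P n) {\<omega> \<in> space (P n). abs (X n \<omega> + Y n \<omega> - (c + d)) > \<delta>}
     <= measure (P n) ({\<omega> \<in> space (P n). abs (X n \<omega> - c) > \<delta> / 2} \<union> {\<omega> \<in> space (P n). abs (Y n \<omega> - d) > \<delta> / 2})"
   proof (rule finite_measure_mono)
    have "abs (X n \<omega> - c) > \<delta> / 2 \<or> abs (Y n \<omega> - d) > \<delta> / 2" if "abs (X n \<omega> + Y n \<omega> - (c + d)) > \<delta>" for \<omega>
     using that by linarith
    thus "{\<omega> \<in> space (P n). abs (X n \<omega> + Y n \<omega> - (c + d)) > \<delta>} \<subseteq> {\<omega> \<in> space (P n). abs (X n \<omega> - c) > \<delta> / 2} \<union> {\<omega> \<in> space (P n). abs (Y n \<omega> - d) > \<delta> / 2}" by blast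
   qed simp
   also have "\<dots> <= measure (P n) {\<omega> \<in> space (P n). abs (X n \<omega> - c) > \<delta> / 2} + measure (P n) {\<omega> \<in> space (P n). abs (Y n \<omega> - d) > \<delta> / 2}"
    by (rule measure_Un_le) simp_all
   finally show ?case by simp
  qed
 qed
qed

section \<open>Second moments under the law of the process\<close>

context
 fixes T :: real and S :: "real => ('a::topological_space \<Rightarrow>\<^sub>C real) => ('a \<Rightarrow>\<^sub>C real)" and \<mu> :: "'a measure" and P
 assumes law: "markov_law T S \<mu> P" and T: "T >= 0"
begin

lemma law_prob_space: "prob_space P" and law_sets: "sets P = sets (skorohod_space T)"
 and law_distr: "distr P borel (\<lambda>\<omega>. \<omega> 0) = \<mu>"
 using law by (auto simp: markov_law_def)

lemma law_eval_measurable: "s \<in> {0..T} ==> (\<lambda>\<omega>. \<omega> s) \<in> borel_measurable P"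
 unfolding measurable_cong_sets[OF law_sets refl] skorohod_space_def
 by (rule measurable_restrict_space1) (rule measurable_component_singleton)

lemma law_bcontfun_measurable: "s \<in> {0..T} ==> (\<lambda>\<omega>. apply_bcontfun f (\<omega> s)) \<in> borel_measurable P"
 by (rule measurable_compose[OF law_eval_measurable]) (auto intro: borel_measurable_continuous_onI)

lemma law_past_0:
 fixes h :: "'a \<Rightarrow>\<^sub>C real"
 shows "subalgebra P (past_algebra P 0)"
  and "(\<lambda>\<omega>. apply_bcontfun h (\<omega> 0)) \<in> borel_measurable (past_algebra P 0)" (is ?A)
proof -
 have r: "(\<lambda>\<omega>. restrict \<omega> {0..0}) \<in> measurable P (PiM {0..0::real} (\<lambda>_. borel :: 'a measure))"
  by (rule measurable_restrict) (use law_eval_measurable[of 0] T in auto)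
 show "subalgebra P (past_algebra P 0)"
  unfolding subalgebra_def past_algebra_def
  using sets_image_in_sets[OF refl r] by simp
 have "(\<lambda>\<omega>. restrict \<omega> {0..0}) \<in> measurable (past_algebra P 0) (PiM {0..0::real} (\<lambda>_. borel :: 'a measure))"
  unfolding past_algebra_def by (rule measurable_vimage_algebra1) (use r in \<open>auto simp: measurable_def\<close>)
 from measurable_compose[OF this measurable_component_singleton[of 0]]
 have "(\<lambda>\<omega>. \<omega> 0) \<in> measurable (past_algebra P 0) borel" by simp
 thus ?A
  by (rule measurable_compose) (auto intro: borel_measurable_continuous_onI)
qed

lemma law_integrable_prod:
 fixes h f :: "'a \<Rightarrow>\<^sub>C real"
 assumes "s \<in> {0..T}" "r \<in> {0..T}"
 shows "integrable P (\<lambda>\<omega>. apply_bcontfun h (\<omega> s) * apply_bcontfun f (\<omega> r))"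
proof -
 interpret prob_space P by (rule law_prob_space)
 show ?thesis
 proof (rule integrable_const_bound[where B = "norm h * norm f"])
  show "AE \<omega> in P. norm (apply_bcontfun h (\<omega> s) * apply_bcontfun f (\<omega> r)) <= norm h * norm f"
   using norm_bounded[of h] norm_bounded[of f] by (auto simp: abs_mult intro!: mult_mono)
 qed (intro borel_measurable_times law_bcontfun_measurable assms)
qed

lemma law_markov_0:
 fixes h f :: "'a \<Rightarrow>\<^sub>C real"
 assumes t: "t \<in> {0..T}"
 shows "(\<integral>\<omega>. apply_bcontfun h (\<omega> 0) * apply_bcontfun f (\<omega> t) \<partial>P)
  = (\<integral>\<omega>. apply_bcontfun h (\<omega> 0) * apply_bcontfun (S t f) (\<omega> 0) \<partial>P)"
proof -
 interpret prob_space P by (rule law_prob_space)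
 interpret sigma_finite_subalgebra P "past_algebra P 0"
  by (rule finite_measure_subalgebra_is_sigma_finite)
   (intro finite_measure_subalgebra.intro finite_measure_subalgebra_axioms.intro finite_measure_axioms law_past_0)
 have 0: "0 \<in> {0..T}" using T by simp
 have "(\<integral>\<omega>. apply_bcontfun h (\<omega> 0) * apply_bcontfun f (\<omega> t) \<partial>P)
  = (\<integral>\<omega>. apply_bcontfun h (\<omega> 0) * real_cond_exp P (past_algebra P 0) (\<lambda>\<omega>. apply_bcontfun f (\<omega> t)) \<omega> \<partial>P)"
  by (rule real_cond_exp_intg(2)[symmetric, OF law_integrable_prod[OF 0 t] law_past_0(2) law_bcontfun_measurable[OF t]])
 also have "\<dots> = (\<integral>\<omega>. apply_bcontfun h (\<omega> 0) * apply_bcontfun (S t f) (\<omega> 0) \<partial>P)"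
 proof (rule integral_cong_AE)
  have *: "\<And>s t f. 0 <= s ==> s <= t ==> t <= T ==>
    AE \<omega> in P. real_cond_exp P (past_algebra P s) (\<lambda>\<omega>'. apply_bcontfun f (\<omega>' t)) \<omega> = apply_bcontfun (S (t - s) f) (\<omega> s)"
   using law unfolding markov_law_def by blast
  have "AE \<omega> in P. real_cond_exp P (past_algebra P 0) (\<lambda>\<omega>'. apply_bcontfun f (\<omega>' t)) \<omega> = apply_bcontfun (S t f) (\<omega> 0)"
   using *[of 0 t f] t by simp
  thus "AE \<omega> in P. apply_bcontfun h (\<omega> 0) * real_cond_exp P (past_algebra P 0) (\<lambda>\<omega>. apply_bcontfun f (\<omega> t)) \<omega>
    = apply_bcontfun h (\<omega> 0) * apply_bcontfun (S t f) (\<omega> 0)" by eventually_elim simp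
 qed (intro borel_measurable_times law_bcontfun_measurable 0 borel_measurable_cond_exp2)+
 finally show ?thesis .
qed

text \<open>Chebyshev's inequality. Conditioning on time 0 turns the expanded square into
  \<open>S t f2 - 2 * v * S t f + v^2\<close>, which is
  \<open>(S t f2 - v2) - 2 * v * (S t f - v)\<close> and hence at most
  \<open>e2 + 2 * b * e1\<close> pointwise.\<close>

lemma law_second_moment:
 fixes f f2 v v2 :: "'a \<Rightarrow>\<^sub>C real"
 assumes t: "t \<in> {0..T}" and \<delta>: "\<delta> > 0"
  and f2: "\<And>\<eta>. apply_bcontfun f2 \<eta> = (apply_bcontfun f \<eta>)\<^sup>2" and v2: "\<And>\<eta>. apply_bcontfun v2 \<eta> = (apply_bcontfun v \<eta>)\<^sup>2"
  and e1: "norm (S t f - v) <= e1" and e2: "norm (S t f2 - v2) <= e2" and b: "norm v <= b"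
 shows "measure P {\<omega> \<in> space P. abs (apply_bcontfun f (\<omega> t) - apply_bcontfun v (\<omega> 0)) > \<delta>} <= (e2 + 2 * b * e1) / \<delta>\<^sup>2"
proof -
 interpret prob_space P by (rule law_prob_space)
 have 0: "0 \<in> {0..T}" using T by simp
 define X where "X \<omega> = apply_bcontfun f (\<omega> t)" for \<omega> :: "real => 'a"
 define Y where "Y \<omega> = apply_bcontfun v (\<omega> 0)" for \<omega> :: "real => 'a"
 have m[measurable]: "X \<in> borel_measurable P" "Y \<in> borel_measurable P"
  unfolding X_def Y_def by (intro law_bcontfun_measurable t 0)+
 have i: "integrable P (\<lambda>\<omega>. X \<omega> * X \<omega>)" "integrable P (\<lambda>\<omega>. Y \<omega> * X \<omega>)" "integrable P (\<lambda>\<omega>. Y \<omega> * Y \<omega>)"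
  unfolding X_def Y_def by (intro law_integrable_prod t 0)+
 have one: "apply_bcontfun (const_bcontfun 1) \<eta> = (1::real)" for \<eta> :: 'a by (simp add: const_bcontfun.rep_eq)
 have E1: "(\<integral>\<omega>. X \<omega> * X \<omega> \<partial>P) = (\<integral>\<omega>. apply_bcontfun (S t f2) (\<omega> 0) \<partial>P)"
  using law_markov_0[OF t, of "const_bcontfun 1" f2] by (simp add: one f2 X_def power2_eq_square)
 have E2: "(\<integral>\<omega>. Y \<omega> * X \<omega> \<partial>P) = (\<integral>\<omega>. Y \<omega> * apply_bcontfun (S t f) (\<omega> 0) \<partial>P)"
  unfolding X_def Y_def by (rule law_markov_0[OF t])
 have i2: "integrable P (\<lambda>\<omega>. apply_bcontfun (S t f2) (\<omega> 0))"
  using law_integrable_prod[OF 0 0, of "const_bcontfun 1" "S t f2"] by (simp add: one)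
 have i3: "integrable P (\<lambda>\<omega>. Y \<omega> * apply_bcontfun (S t f) (\<omega> 0))"
  unfolding Y_def by (rule law_integrable_prod[OF 0 0])
 have bnd: "abs (apply_bcontfun (S t f) \<eta> - apply_bcontfun v \<eta>) <= e1" "abs (apply_bcontfun (S t f2) \<eta> - (apply_bcontfun v \<eta>)\<^sup>2) <= e2"
  "abs (apply_bcontfun v \<eta>) <= b" for \<eta>
  using norm_bounded[of "S t f - v" \<eta>] e1 norm_bounded[of "S t f2 - v2" \<eta>] e2 norm_bounded[of v \<eta>] b v2[of \<eta>] by auto
 have b0: "b >= 0" using b norm_ge_zero order_trans by blast
 have "(\<integral>\<omega>. (X \<omega> - Y \<omega>)\<^sup>2 \<partial>P) = (\<integral>\<omega>. (X \<omega> * X \<omega> - 2 * (Y \<omega> * X \<omega>)) + Y \<omega> * Y \<omega> \<partial>P)"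
  by (rule Bochner_Integration.integral_cong) (auto simp: power2_eq_square algebra_simps)
 also have "\<dots> = (\<integral>\<omega>. X \<omega> * X \<omega> \<partial>P) - 2 * (\<integral>\<omega>. Y \<omega> * X \<omega> \<partial>P) + (\<integral>\<omega>. Y \<omega> * Y \<omega> \<partial>P)"
  using i by simp
 also have "\<dots> = (\<integral>\<omega>. (apply_bcontfun (S t f2) (\<omega> 0) - 2 * (Y \<omega> * apply_bcontfun (S t f) (\<omega> 0))) + Y \<omega> * Y \<omega> \<partial>P)"
  unfolding E1 E2 using i2 i3 i(3) by simp
 also have "\<dots> <= (\<integral>\<omega>. e2 + 2 * b * e1 \<partial>P)"
 proof (rule integral_mono)
  fix \<omega> :: "real => 'a"
  define y where "y = apply_bcontfun v (\<omega> 0)"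
  have "abs (y * (apply_bcontfun (S t f) (\<omega> 0) - y)) <= b * e1"
   unfolding abs_mult y_def using bnd(1,3)[of "\<omega> 0"] b0 by (intro mult_mono) auto
  thus "(apply_bcontfun (S t f2) (\<omega> 0) - 2 * (Y \<omega> * apply_bcontfun (S t f) (\<omega> 0))) + Y \<omega> * Y \<omega> <= e2 + 2 * b * e1"
   using bnd(2)[of "\<omega> 0"] unfolding Y_def y_def[symmetric]
   by (simp add: right_diff_distrib power2_eq_square abs_le_iff)
 qed (use i2 i3 i(3) in simp_all)
 also have "\<dots> = e2 + 2 * b * e1" by (simp add: prob_space)
 finally have E: "(\<integral>\<omega>. (X \<omega> - Y \<omega>)\<^sup>2 \<partial>P) <= e2 + 2 * b * e1" .
 have iZ: "integrable P (\<lambda>\<omega>. (X \<omega> - Y \<omega>)\<^sup>2)"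
 proof -
  have "integrable P (\<lambda>\<omega>. (X \<omega> * X \<omega> - 2 * (Y \<omega> * X \<omega>)) + Y \<omega> * Y \<omega>)" using i by simp
  thus ?thesis by (rule Bochner_Integration.integrable_cong[OF refl, THEN iffD1, rotated]) (simp add: power2_eq_square algebra_simps)
 qed
 define A where "A = {\<omega> \<in> space P. abs (X \<omega> - Y \<omega>) > \<delta>}"
 have A[measurable]: "A \<in> sets P" unfolding A_def by measurable
 have "\<delta>\<^sup>2 * measure P A = (\<integral>\<omega>. \<delta>\<^sup>2 * indicator A \<omega> \<partial>P)" by simp
 also have "\<dots> <= (\<integral>\<omega>. (X \<omega> - Y \<omega>)\<^sup>2 \<partial>P)"
 proof (rule integral_mono[OF _ iZ])
  show "integrable P (\<lambda>\<omega>. \<delta>\<^sup>2 * indicator A \<omega>)"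
   by (intro integrable_mult_right integrable_real_indicator A) (simp add: less_top[symmetric])
  fix \<omega> :: "real => 'a"
  have "\<delta>\<^sup>2 <= (X \<omega> - Y \<omega>)\<^sup>2" if "\<omega> \<in> A"
  proof -
   have "abs \<delta> <= abs (X \<omega> - Y \<omega>)" using that \<delta> by (simp add: A_def)
   thus ?thesis by (rule iffD1[OF abs_le_square_iff])
  qed
  thus "\<delta>\<^sup>2 * indicator A \<omega> <= (X \<omega> - Y \<omega>)\<^sup>2" by (auto simp: indicator_def)
 qed
 finally have "\<delta>\<^sup>2 * measure P A <= e2 + 2 * b * e1" using E by simp
 hence "measure P A <= (e2 + 2 * b * e1) / \<delta>\<^sup>2" using \<delta> by (simp add: field_simps)
 thus ?thesis by (simp add: A_def X_def Y_def)
qed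

lemma law_time_0:
 assumes "Q \<in> sets borel"
 shows "measure P {\<omega> \<in> space P. \<omega> 0 \<in> Q} = measure \<mu> (Q \<inter> space \<mu>)"
proof -
 have 0: "0 \<in> {0..T}" using T by simp
 have "measure (distr P borel (\<lambda>\<omega>. \<omega> 0)) Q = measure P ((\<lambda>\<omega>. \<omega> 0) -` Q \<inter> space P)"
  by (rule measure_distr[OF law_eval_measurable[OF 0] assms])
 moreover have "space \<mu> = UNIV" using law_distr by (metis space_borel space_distr)
 ultimately show ?thesis unfolding law_distr by (simp add: vimage_def Int_def conj_commute)
qed

end

section \<open>Empirical averages\<close>

lemma empirical_eq: "empirical n \<eta> G = (INFSUM x. G (scaled n x) / real n ^ CARD('d) * of_bool (\<eta> x))"
 for \<eta> :: "'d::finite config"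
 unfolding empirical_def infsum_cmult_right'[symmetric] scaled_def
 by (rule infsum_cong) simp

lemma scaled_summable:
 fixes G :: "real^'d::finite => real"
 assumes n: "n >= 1" and G: "\<And>u. abs (G u) <= K * Wd u"
 shows "(\<lambda>x. abs (G (scaled n x) / real n ^ CARD('d))) summable_on UNIV" (is ?A)
  "(INFSUM x. abs (G (scaled n x) / real n ^ CARD('d))) <= K * 5 ^ CARD('d)" (is ?B)
proof -
 have K: "K >= 0" using G[of 0] by (simp add: Wd_def wt_def)
 have s: "(\<lambda>x::int^'d. K / real n ^ CARD('d) * Wd (scaled n x)) summable_on UNIV"
  by (rule summable_on_cmult_right[OF Wd_lattice_sum(1)[OF n]])
 have le: "abs (G (scaled n x) / real n ^ CARD('d)) <= K / real n ^ CARD('d) * Wd (scaled n x)" for x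
  using G[of "scaled n x"] n by (simp add: divide_right_mono)
 show 1: ?A by (rule infsum_le_bound(2)[OF s le])
 have "(INFSUM x. abs (G (scaled n x) / real n ^ CARD('d))) <= K / real n ^ CARD('d) * (\<Sum>\<^sub>\<infinity>x::int^'d. Wd (scaled n x))"
  unfolding infsum_cmult_right'[symmetric] by (rule infsum_mono[OF 1 s le])
 also have "\<dots> <= K / real n ^ CARD('d) * (5 * real n) ^ CARD('d)"
  by (intro mult_left_mono Wd_lattice_sum[OF n]) (use K in simp)
 also have "\<dots> = K * 5 ^ CARD('d)" using n by (simp add: power_mult_distrib)
 finally show ?B .
qed

lemma empirical_bound:
 fixes G :: "real^'d::finite => real"
 assumes n: "n >= 1" and G: "\<And>u. abs (G u) <= K * Wd u"
 shows "abs (empirical n \<eta> G) <= K * 5 ^ CARD('d)"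
proof -
 have "abs (empirical n \<eta> G) <= (INFSUM x. abs (G (scaled n x) / real n ^ CARD('d)))"
  unfolding empirical_eq by (rule infsum_le_bound(3)[OF scaled_summable(1)[OF n G]]) (simp add: abs_mult)
 thus ?thesis using scaled_summable(2)[OF n G] by simp
qed

lemma empirical_add:
 fixes G H :: "real^'d::finite => real"
 assumes n: "n >= 1" and G: "\<And>u. abs (G u) <= K * Wd u" and H: "\<And>u. abs (H u) <= L * Wd u"
 shows "empirical n \<eta> (\<lambda>u. G u + H u) = empirical n \<eta> G + empirical n \<eta> H"
proof -
 have s: "(\<lambda>x. F (scaled n x) / real n ^ CARD('d) * of_bool (\<eta> x)) summable_on UNIV"
  if "\<And>u. abs (F u) <= J * Wd u" for F :: "real^'d => real" and J
  by (rule infsum_le_bound(1)[OF scaled_summable(1)[OF n that]]) (simp_all add: abs_mult)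
 show ?thesis
  unfolding empirical_eq infsum_add[OF s[OF G] s[OF H], symmetric]
  by (rule infsum_cong) (simp add: add_divide_distrib distrib_right)
qed

lemma empirical_diff_bound:
 fixes G H :: "real^'d::finite => real"
 assumes n: "n >= 1" and G: "\<And>u. abs (G u) <= K * Wd u" and H: "\<And>u. abs (H u) <= L * Wd u"
  and d: "\<And>x. abs (G (scaled n x) - H (scaled n x)) <= D x" and D: "D summable_on UNIV"
 shows "abs (empirical n \<eta> G - empirical n \<eta> H) <= infsum D UNIV / real n ^ CARD('d)"
proof -
 have s: "(\<lambda>x. F (scaled n x) / real n ^ CARD('d) * of_bool (\<eta> x)) summable_on UNIV"
  if "\<And>u. abs (F u) <= J * Wd u" for F :: "real^'d => real" and J
  by (rule infsum_le_bound(1)[OF scaled_summable(1)[OF n that]]) (simp_all add: abs_mult)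
 have "empirical n \<eta> G - empirical n \<eta> H = (INFSUM x. (G (scaled n x) / real n ^ CARD('d) * of_bool (\<eta> x)) + - (H (scaled n x) / real n ^ CARD('d) * of_bool (\<eta> x)))"
  unfolding empirical_eq using infsum_add[OF s[OF G] iffD2[OF summable_on_uminus s[OF H]]] by (simp add: infsum_uminus)
 also have "abs \<dots> <= (INFSUM x. D x * inverse (real n ^ CARD('d)))"
 proof (rule infsum_le_bound(3)[OF summable_on_cmult_left[OF D]])
  fix x
  have "abs (G (scaled n x) / real n ^ CARD('d) * of_bool (\<eta> x) + - (H (scaled n x) / real n ^ CARD('d) * of_bool (\<eta> x)))
   <= abs (G (scaled n x) - H (scaled n x)) * inverse (real n ^ CARD('d))"
   using n by (cases "\<eta> x") (simp_all add: diff_divide_distrib[symmetric] abs_divide divide_inverse[symmetric])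
  also have "\<dots> <= D x * inverse (real n ^ CARD('d))" by (rule mult_right_mono[OF d]) (use n in simp)
  finally show "abs (G (scaled n x) / real n ^ CARD('d) * of_bool (\<eta> x) + - (H (scaled n x) / real n ^ CARD('d) * of_bool (\<eta> x)))
   <= D x * inverse (real n ^ CARD('d))" .
 qed
 finally show ?thesis by (simp add: infsum_cmult_left' divide_inverse)
qed

lemma empirical_continuous:
 fixes G :: "real^'d::finite => real"
 assumes n: "n >= 1" and G: "\<And>u. abs (G u) <= K * Wd u"
 shows "continuous_on UNIV (\<lambda>\<eta>. empirical n \<eta> G)" (is ?A) "(\<lambda>\<eta>. empirical n \<eta> G) \<in> borel_measurable borel" (is ?B)
proof -
 have ob: "continuous_on UNIV (\<lambda>\<eta> :: 'd config. of_bool (\<eta> x) :: real)" for x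
  by (rule local_fun_continuous(1)[of "{x}"]) auto
 show ?A
  unfolding empirical_eq
  by (rule continuous_on_infsum[OF scaled_summable(1)[OF n G]])
   (simp add: abs_mult, rule continuous_on_mult_left[OF ob])
 thus ?B by (rule borel_measurable_continuous_onI)
qed

section \<open>Lebesgue integrals of products\<close>

lemma nn_integral_vec_prod:
 fixes f :: "'d::finite => real => ennreal"
 assumes [measurable]: "\<And>i. f i \<in> borel_measurable borel"
 shows "(\<integral>\<^sup>+u. (\<Prod>i\<in>UNIV. f i (u $ i)) \<partial>(lborel :: (real^'d) measure)) = (\<Prod>i\<in>UNIV. \<integral>\<^sup>+x. f i x \<partial>lborel)"
proof -
 let ?ax = "\<lambda>i::'d. axis i (1::real)"
 have inj: "inj ?ax" by (auto simp: inj_on_def axis_eq_axis)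
 have B: "(Basis :: (real^'d) set) = range ?ax" by (auto simp: Basis_vec_def)
 define F where "F b = f (inv ?ax b)" for b
 have F: "F (?ax i) = f i" for i unfolding F_def by (simp add: inv_f_f[OF inj])
 have "(\<integral>\<^sup>+u. (\<Prod>i\<in>UNIV. f i (u $ i)) \<partial>(lborel :: (real^'d) measure)) = (\<integral>\<^sup>+u. (\<Prod>b\<in>Basis. F b (u \<bullet> b)) \<partial>(lborel :: (real^'d) measure))"
  unfolding B prod.reindex[OF inj] by (simp add: F inner_axis)
 also have "\<dots> = (\<Prod>b\<in>(Basis :: (real^'d) set). \<integral>\<^sup>+x. F b x \<partial>lborel)"
  by (rule nn_integral_lborel_prod) (auto simp: F_def)
 also have "\<dots> = (\<Prod>i\<in>UNIV. \<integral>\<^sup>+x. f i x \<partial>lborel)"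
  unfolding B prod.reindex[OF inj] by (simp add: F)
 finally show ?thesis .
qed

lemma wt_measurable [measurable]: "wt \<in> borel_measurable borel"
 unfolding wt_def[abs_def] by measurable

lemma nn_integral_wt: "(\<integral>\<^sup>+x. ennreal (wt x) \<partial>lborel) < \<infinity>"
proof -
 have half: "(\<integral>\<^sup>+x. ennreal (wt x) * indicator {0..} x \<partial>lborel) = ennreal (pi / 2 - arctan 0)"
 proof (rule nn_integral_FTC_atLeast)
  show "DERIV arctan x :> wt x" for x
   using DERIV_arctan[of x] by (simp add: wt_def inverse_eq_divide)
  show "(arctan \<longlongrightarrow> pi / 2) at_top" by (rule tendsto_arctan_at_top)
 qed auto
 have half': "(\<integral>\<^sup>+x. ennreal (wt x) * indicator {..0} x \<partial>lborel) = (\<integral>\<^sup>+x. ennreal (wt x) * indicator {0..} x \<partial>lborel)"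
 proof -
  have "(\<integral>\<^sup>+x. ennreal (wt x) * indicator {..0} x \<partial>lborel) = (\<integral>\<^sup>+x. ennreal (wt x) * indicator {..0} x \<partial>(distr lborel borel uminus))"
   by (simp add: lborel_distr_uminus)
  also have "\<dots> = (\<integral>\<^sup>+x. ennreal (wt (- x)) * indicator {..0} (- x) \<partial>lborel)"
   by (rule nn_integral_distr) auto
  also have "\<dots> = (\<integral>\<^sup>+x. ennreal (wt x) * indicator {0..} x \<partial>lborel)"
   by (rule nn_integral_cong) (auto simp: indicator_def)
  finally show ?thesis .
 qed
 have "(\<integral>\<^sup>+x. ennreal (wt x) \<partial>lborel) <= (\<integral>\<^sup>+x. ennreal (wt x) * indicator {..0} x + ennreal (wt x) * indicator {0..} x \<partial>lborel)"
  by (rule nn_integral_mono) (auto simp: indicator_def)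
 also have "\<dots> = ennreal (pi / 2 - arctan 0) + ennreal (pi / 2 - arctan 0)"
  by (subst nn_integral_add) (simp_all add: half half')
 also have "\<dots> < \<infinity>" by simp
 finally show ?thesis .
qed

lemma Wd_measurable [measurable]: "Wd \<in> borel_measurable borel"
 unfolding Wd_def[abs_def] by measurable

lemma Wd_integrable: "integrable lborel (Wd :: real^'d::finite => real)"
proof (rule integrableI_bounded)
 have "(\<integral>\<^sup>+u. ennreal (norm (Wd u)) \<partial>(lborel :: (real^'d) measure)) = (\<integral>\<^sup>+u. (\<Prod>i\<in>UNIV. ennreal (wt (u $ i))) \<partial>(lborel :: (real^'d) measure))"
  by (rule nn_integral_cong) (simp add: Wd_def prod_ennreal prod_nonneg)
 also have "\<dots> = (\<Prod>i\<in>(UNIV :: 'd set). \<integral>\<^sup>+x. ennreal (wt x) \<partial>lborel)"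
  by (rule nn_integral_vec_prod) simp
 also have "\<dots> < \<infinity>" using nn_integral_wt by (simp add: power_less_top_ennreal)
 finally show "(\<integral>\<^sup>+u. ennreal (norm (Wd u)) \<partial>(lborel :: (real^'d) measure)) < \<infinity>" .
qed simp

lemma integrable_Wd_bound:
 fixes f :: "real^'d::finite => real"
 assumes "f \<in> borel_measurable borel" "\<And>u. abs (f u) <= K * Wd u"
 shows "integrable lborel f"
 by (rule Bochner_Integration.integrable_bound[OF integrable_mult_right[OF Wd_integrable, of K]])
  (use assms in \<open>auto intro: order_trans[OF _ abs_ge_self]\<close>)

lemma AE_off_hyperplane: "AE u in (lborel :: (real^'d::finite) measure). u $ k ~= 0"
proof -
 have "negligible {u :: real^'d. axis k 1 \<bullet> u = 0}"
  by (rule negligible_hyperplane) (simp add: axis_eq_0_iff)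
 moreover have "{u :: real^'d. axis k 1 \<bullet> u = 0} = {u. u $ k = 0}" by (simp add: inner_axis')
 ultimately have "{u :: real^'d. u $ k = 0} \<in> null_sets (completion lborel)" by (simp add: negligible_iff_null_sets)
 moreover have "{u :: real^'d. u $ k = 0} \<in> sets lborel" by measurable
 ultimately have "{u :: real^'d. u $ k = 0} \<in> null_sets lborel" by (simp add: null_sets_completion_iff)
 thus ?thesis by (rule AE_I') auto
qed

section \<open>Discontinuous test functions at the initial time\<close>

text \<open>A union bound: the product is peeled off one factor at a time.\<close>

lemma one_minus_prod_le:
 fixes a :: "'i => real"
 assumes "finite I" "\<And>i. i \<in> I ==> 0 <= a i" "\<And>i. i \<in> I ==> a i <= 1"
 shows "1 - (\<Prod>i\<in>I. a i) <= (\<Sum>i\<in>I. 1 - a i)"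
 using assms
proof (induction I rule: finite_induct)
 case (insert j I)
 have P: "0 <= (\<Prod>i\<in>I. a i)" "(\<Prod>i\<in>I. a i) <= 1" using insert.prems by (auto intro: prod_nonneg prod_le_1)
 have "1 - a j * (\<Prod>i\<in>I. a i) = (1 - (\<Prod>i\<in>I. a i)) + (1 - a j) * (\<Prod>i\<in>I. a i)" by (simp add: algebra_simps)
 also have "\<dots> <= (1 - (\<Prod>i\<in>I. a i)) + (1 - a j) * 1"
  using P insert.prems by (intro add_left_mono mult_left_mono) auto
 also have "\<dots> <= (\<Sum>i\<in>I. 1 - a i) + (1 - a j)" using insert by (intro add_mono) auto
 finally show ?case using insert by simp
qed simp

text \<open>The first factor vanishes outside a cube of half-side \<open>R\<close>, the second on
  the hyperplane \<open>u $ k = 0\<close>; together they turn a bounded function with a jump there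
  into a test function.\<close>

definition cutoff :: "'d::finite => real => real^'d => real" where
 "cutoff k R u = (\<Prod>i\<in>UNIV. max 0 (1 - (u $ i / R)\<^sup>2)) * min 1 (R * abs (u $ k))"

text \<open>In the last claim one factor \<open>Wd\<close> is spent on the cube: the defect of the
  first factor is at most the sum of \<open>(u $ i / R)^2\<close>, and
  \<open>(u $ i)^2 * wt (u $ i) \<le> 1\<close>. Near the barrier only a thin slab is left.\<close>

lemma cutoff_bounds:
 fixes u :: "real^'d::finite"
 assumes R: "R > 0"
 shows "0 <= cutoff k R u" "cutoff k R u <= 1"
  "(1 - cutoff k R u) * (Wd u)\<^sup>2 <= CARD('d) / R\<^sup>2 * Wd u + Wd u * of_bool (abs (u $ k) < 1 / R)" (is ?A)
proof -
 define p where "p = (\<Prod>i\<in>UNIV. max 0 (1 - (u $ i / R)\<^sup>2))"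
 define m where "m = min 1 (R * abs (u $ k))"
 have p: "0 <= p" "p <= 1" unfolding p_def by (auto intro!: prod_nonneg prod_le_1)
 have m: "0 <= m" "m <= 1" using R by (auto simp: m_def)
 have c: "cutoff k R u = p * m" by (simp add: cutoff_def p_def m_def)
 show "0 <= cutoff k R u" "cutoff k R u <= 1" using p m unfolding c by (auto intro: mult_le_one)
 have W: "0 <= Wd u" "Wd u <= 1" by auto
 have p1: "(1 - p) * Wd u <= CARD('d) / R\<^sup>2"
 proof -
  have "1 - p <= (\<Sum>i\<in>UNIV. 1 - max 0 (1 - (u $ i / R)\<^sup>2))"
   unfolding p_def by (rule one_minus_prod_le) auto
  also have "\<dots> <= (\<Sum>i\<in>UNIV. (u $ i / R)\<^sup>2)" by (rule sum_mono) auto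
  finally have "(1 - p) * Wd u <= (\<Sum>i\<in>UNIV. (u $ i / R)\<^sup>2) * Wd u" by (rule mult_right_mono) simp
  also have "\<dots> = (\<Sum>i\<in>UNIV. (u $ i / R)\<^sup>2 * Wd u)" by (simp add: sum_distrib_right)
  also have "\<dots> <= (\<Sum>i\<in>(UNIV::'d set). 1 / R\<^sup>2)"
  proof (rule sum_mono)
   fix i
   have "Wd u = wt (u $ i) * (\<Prod>j\<in>UNIV - {i}. wt (u $ j))" unfolding Wd_def by (rule prod_split)
   also have "\<dots> <= wt (u $ i) * 1" by (intro mult_left_mono prod_le_1) auto
   finally have "(u $ i)\<^sup>2 * Wd u <= (u $ i)\<^sup>2 * wt (u $ i)" by (intro mult_left_mono) auto
   also have "\<dots> <= 1" by (simp add: wt_def divide_simps add_pos_nonneg)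
   finally have "(u $ i)\<^sup>2 * Wd u / R\<^sup>2 <= 1 / R\<^sup>2" by (intro divide_right_mono) auto
   thus "(u $ i / R)\<^sup>2 * Wd u <= 1 / R\<^sup>2" by (simp add: power_divide)
  qed
  finally show ?thesis by simp
 qed
 have m1: "(1 - m) <= of_bool (abs (u $ k) < 1 / R)" using R by (auto simp: m_def min_def field_simps)
 have "1 - p * m = (1 - p) + p * (1 - m)" by (simp add: algebra_simps)
 also have "\<dots> <= (1 - p) + 1 * (1 - m)" using p m by (intro add_left_mono mult_right_mono) auto
 finally have "1 - p * m <= (1 - p) + of_bool (abs (u $ k) < 1 / R)" using m1 by simp
 hence "(1 - p * m) * (Wd u)\<^sup>2 <= ((1 - p) + of_bool (abs (u $ k) < 1 / R)) * (Wd u)\<^sup>2" by (rule mult_right_mono) simp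
 also have "\<dots> = ((1 - p) * Wd u) * Wd u + of_bool (abs (u $ k) < 1 / R) * (Wd u * Wd u)"
  by (simp add: algebra_simps power2_eq_square)
 also have "\<dots> <= CARD('d) / R\<^sup>2 * Wd u + of_bool (abs (u $ k) < 1 / R) * (Wd u * 1)"
  using p1 W by (intro add_mono mult_mono mult_left_mono) auto
 finally show ?A
  unfolding c by (simp only: mult_1_right mult.commute[of "of_bool _"])
qed

lemma cutoff_tendsto: "u $ k ~= 0 ==> (\<lambda>m. cutoff k (real (Suc m)) u) \<longlonglongrightarrow> 1"
proof -
 assume u: "u $ k ~= 0"
 have a: "(\<lambda>m. max 0 (1 - (x / real (Suc m))\<^sup>2)) \<longlonglongrightarrow> max 0 (1 - 0\<^sup>2)" for x :: real
  by (intro tendsto_intros) real_asymp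
 have "\<forall>\<^sub>F m in sequentially. real (Suc m) * abs (u $ k) >= 1"
 proof -
  have "filterlim (\<lambda>m. real (Suc m) * abs (u $ k)) at_top sequentially" using u by real_asymp
  thus ?thesis by (simp add: filterlim_at_top)
 qed
 hence "\<forall>\<^sub>F m in sequentially. min 1 (real (Suc m) * abs (u $ k)) = 1" by eventually_elim simp
 hence b: "(\<lambda>m. min 1 (real (Suc m) * abs (u $ k))) \<longlonglongrightarrow> 1" by (rule tendsto_eventually)
 have "(\<lambda>m. cutoff k (real (Suc m)) u) \<longlonglongrightarrow> (\<Prod>i\<in>(UNIV::'a set). max 0 (1 - 0\<^sup>2)) * 1"
  unfolding cutoff_def by (intro tendsto_mult tendsto_prod a b)
 thus ?thesis by simp
qed

text \<open>On the hyperplane continuity comes from boundedness of \<open>L\<close>: the cutoff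
  vanishes there at a linear rate.\<close>

lemma cutoff_test_fun:
 fixes L :: "real^'d::finite => real"
 assumes R: "R > 0" and L: "\<And>u. u $ k ~= 0 ==> isCont L u" and K: "\<And>u. abs (L u) <= K"
 shows "test_fun (\<lambda>u. L u * cutoff k R u)"
 unfolding test_fun_def
proof
 have K0: "K >= 0" using K[of 0] by simp
 have cont: "isCont (cutoff k R) u" for u unfolding cutoff_def[abs_def] by (intro continuous_intros) (use R in auto)
 have "isCont (\<lambda>u. L u * cutoff k R u) u" for u
 proof (cases "u $ k = 0")
  case False
  thus ?thesis by (intro continuous_mult L cont)
 next
  case True
  have "((\<lambda>v. L v * cutoff k R v) \<longlongrightarrow> 0) (at u)"
  proof (rule Lim_null_comparison)
   have "((\<lambda>v. K * (R * abs (v $ k))) \<longlongrightarrow> K * (R * abs (u $ k))) (at u)" by (intro tendsto_intros)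
   thus "((\<lambda>v. K * (R * abs (v $ k))) \<longlongrightarrow> 0) (at u)" using True by simp
   have "abs (L v * cutoff k R v) <= K * (R * abs (v $ k))" for v
   proof -
    have "cutoff k R v <= 1 * (R * abs (v $ k))"
     unfolding cutoff_def using R by (intro mult_mono prod_le_1) auto
    thus ?thesis unfolding abs_mult using K[of v] cutoff_bounds(1)[OF R, of k v] K0 by (intro mult_mono) auto
   qed
   thus "\<forall>\<^sub>F v in at u. norm (L v * cutoff k R v) <= K * (R * abs (v $ k))" by simp
  qed
  moreover have "cutoff k R u = 0" using True by (simp add: cutoff_def)
  ultimately show ?thesis by (simp add: isCont_def)
 qed
 thus "continuous_on UNIV (\<lambda>u. L u * cutoff k R u)" by (simp add: continuous_at_imp_continuous_on)
 show "\<exists>C. compact C \<and> (\<forall>u. u \<notin> C \<longrightarrow> L u * cutoff k R u = 0)"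
 proof (intro exI conjI allI impI)
  show "compact (cbox (\<chi> i. - R) (\<chi> i. R) :: (real^'d) set)" by (rule compact_cbox)
  fix u :: "real^'d" assume "u \<notin> cbox (\<chi> i. - R) (\<chi> i. R)"
  then obtain i where "\<not> (- R <= u $ i \<and> u $ i <= R)" by (auto simp: mem_box_cart)
  hence "abs (u $ i / R) > 1" using R by (auto simp: abs_if divide_simps)
  hence "1 <= (u $ i / R)\<^sup>2" using abs_square_le_1[of "u $ i / R"] by linarith
  hence "(\<Prod>i\<in>UNIV. max 0 (1 - (u $ i / R)\<^sup>2)) = 0"
   by (intro prod_zero bexI[of _ i]) auto
  thus "L u * cutoff k R u = 0" by (simp add: cutoff_def)
 qed
qed

text \<open>In direction \<open>k\<close> at most \<open>2 * \<lfloor>n / R\<rfloor> + 1\<close>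
  layers remain; the other directions contribute \<open>5 * n\<close> each.\<close>

lemma slab_lattice_sum:
 assumes n: "n >= 1" and R: "R > 0"
 shows "(\<lambda>x::int^'d::finite. Wd (scaled n x) * of_bool (abs (scaled n x $ k) < 1 / R)) summable_on UNIV" (is ?A)
  "(\<Sum>\<^sub>\<infinity>x::int^'d. Wd (scaled n x) * of_bool (abs (scaled n x $ k) < 1 / R)) <= (5 * real n) ^ (CARD('d) - 1) * (2 * real n / R + 1)" (is ?B)
proof -
 define f where "f i m = wt (real_of_int m / n) * (if i = k then of_bool (abs (real_of_int m / n) < 1 / R) else 1)" for i m
 have f0: "f i m >= 0" for i m by (simp add: f_def)
 have fs: "(\<lambda>m. abs (f i m)) summable_on UNIV" for i
  by (rule infsum_le_bound(2)[OF wt_lattice_sum(1)[OF n]]) (auto simp: f_def)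
 have eq: "Wd (scaled n x) * of_bool (abs (scaled n x $ k) < 1 / R) = (\<Prod>i\<in>UNIV. f i (x $ i))" for x
  unfolding f_def prod.distrib Wd_def by (simp add: prod_split[of _ k] cong: prod.cong_simp)
 note v = vec_prod_sum[of f, OF fs]
 have "0 <= (\<Prod>i\<in>UNIV. f i (x $ i))" for x by (intro prod_nonneg) (use f0 in auto)
 thus ?A
  unfolding eq using v(2) by simp
 have fk: "(INFSUM m. f k m) <= 2 * real n / R + 1"
 proof -
  define q where "q = \<lfloor>real n / R\<rfloor>"
  have q0: "q >= 0" using R by (simp add: q_def)
  have "((\<lambda>m. of_bool (m \<in> {-q..q})) has_sum real_of_int (2 * q + 1)) UNIV"
  proof -
   have "((\<lambda>m. 1) has_sum (\<Sum>m\<in>{-q..q}. 1 :: real)) {-q..q}" by (rule has_sum_finite) simp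
   moreover have "(\<Sum>m\<in>{-q..q}. 1 :: real) = real_of_int (2 * q + 1)" using q0 by simp
   ultimately have "((\<lambda>m. 1) has_sum real_of_int (2 * q + 1)) {-q..q}" by simp
   thus ?thesis by (rule iffD1[OF has_sum_cong_neutral, rotated -1]) auto
  qed
  note h = this
  have le: "abs (f k m) <= of_bool (m \<in> {-q..q})" for m
  proof (cases "abs (real_of_int m / n) < 1 / R")
   case True
   hence "abs (real_of_int m) <= real n / R" using n R by (simp add: field_simps)
   hence "abs m <= q" unfolding q_def by (simp add: le_floor_iff)
   thus ?thesis by (auto simp: f_def)
  qed (simp add: f_def)
  have "(INFSUM m. f k m) <= real_of_int (2 * q + 1)"
   using infsum_le_bound(3)[OF has_sum_imp_summable[OF h] le] unfolding infsumI[OF h] by simp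
  also have "\<dots> <= 2 * (real n / R) + 1"
  proof -
   have "real_of_int q <= real n / R" unfolding q_def by (rule of_int_floor_le)
   thus ?thesis by linarith
  qed
  finally show ?thesis by simp
 qed
 have "(\<Sum>\<^sub>\<infinity>x::int^'d. Wd (scaled n x) * of_bool (abs (scaled n x $ k) < 1 / R)) = (INFSUM m. f k m) * (\<Prod>i\<in>UNIV - {k}. INFSUM m. f i m)"
  unfolding eq v(1) by (rule prod_split)
 also have "\<dots> <= (2 * real n / R + 1) * (\<Prod>i\<in>UNIV - {k}. 5 * real n)"
 proof (intro mult_mono fk prod_mono conjI infsum_nonneg prod_nonneg f0)
  show "(INFSUM m. f i m) <= 5 * real n" if "i \<in> UNIV - {k}" for i
   using that wt_lattice_sum(2)[OF n] by (simp add: f_def)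
 qed (use R in auto)
 also have "\<dots> = (5 * real n) ^ (CARD('d) - 1) * (2 * real n / R + 1)" by (simp add: card_Diff_singleton)
 finally show ?B .
qed

text \<open>Association speaks of continuous test functions, whereas \<open>L\<close> may jump at
  the barrier. Replacing \<open>L\<close> by its cutoff changes the empirical average, uniformly
  over configurations, by an amount that vanishes as first \<open>n\<close> and then the cutoff
  radius grows.\<close>

lemma associated_discontinuous:
 fixes L g :: "real^'d::finite => real"
 assumes \<mu>: "\<And>n. n >= 1 ==> prob_space (\<mu> n) \<and> sets (\<mu> n) = sets borel" and as: "associated \<mu> g"
  and g: "g \<in> borel_measurable borel" "\<And>u. g u \<in> {0..1}"
  and L: "\<And>u. u $ k ~= 0 ==> isCont L u" "L \<in> borel_measurable borel" and K: "\<And>u. abs (L u) <= K * (Wd u)\<^sup>2"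
 shows "conv_prob \<mu> (\<lambda>n \<eta>. empirical n \<eta> L) (LINT u|lborel. g u * L u)"
proof (rule conv_prob_approx)
 show "n >= 1 ==> prob_space (\<mu> n)" for n using \<mu> by blast
 have K0: "K >= 0" using K[of 0] by (simp add: Wd_def wt_def)
 have W2: "(Wd u)\<^sup>2 <= Wd u" for u :: "real^'d" using mult_left_le[OF Wd_le_1[of u] Wd_nonneg[of u]] by (simp add: power2_eq_square)
 have KW: "abs (L u) <= K * Wd u" for u using K[of u] mult_left_mono[OF W2[of u] K0] by simp
 have KK: "abs (L u) <= K" for u using KW[of u] mult_left_mono[OF Wd_le_1[of u] K0] by simp
 define LR where "LR R u = L u * cutoff k R u" for R u
 have cm[measurable]: "cutoff k R \<in> borel_measurable borel" for R unfolding cutoff_def[abs_def] by measurable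
 note [measurable] = g(1) L(2)
 have LRb: "abs (LR R u) <= K * Wd u" if "R > 0" for R u
 proof -
  have "abs (LR R u) <= abs (L u) * 1" unfolding LR_def abs_mult using cutoff_bounds(1,2)[OF that, of k u] by (intro mult_left_mono) auto
  thus ?thesis using KW[of u] by simp
 qed
 have I: "(\<lambda>m. LINT u|lborel. g u * LR (real (Suc m)) u) \<longlonglongrightarrow> (LINT u|lborel. g u * L u)"
 proof (rule integral_dominated_convergence)
  show "integrable lborel (\<lambda>u. K * Wd u :: real)" by (rule integrable_mult_right[OF Wd_integrable])
  show "AE u in lborel. (\<lambda>m. g u * LR (real (Suc m)) u) \<longlonglongrightarrow> g u * L u"
   using AE_off_hyperplane[of k]
  proof eventually_elim
   case (elim u)
   have "(\<lambda>m. g u * (L u * cutoff k (real (Suc m)) u)) \<longlonglongrightarrow> g u * (L u * 1)"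
    by (intro tendsto_intros cutoff_tendsto elim)
   thus ?case by (simp add: LR_def)
  qed
  show "AE u in lborel. norm (g u * LR (real (Suc m)) u) <= K * Wd u" for m
  proof (rule AE_I2)
   fix u
   have "abs (g u) * abs (LR (real (Suc m)) u) <= 1 * (K * Wd u)"
    using g(2)[of u] LRb[of "real (Suc m)" u] K0 by (intro mult_mono) auto
   thus "norm (g u * LR (real (Suc m)) u) <= K * Wd u" by (simp add: abs_mult)
  qed
 qed (simp_all add: LR_def)
 fix \<epsilon> :: real assume \<epsilon>: "\<epsilon> > 0"
 let ?d = "CARD('d)"
 \<comment> \<open>The limit in \<open>n\<close> of the cutoff error for radius
   \<open>Suc m\<close>; the remainder of order \<open>1 / n\<close> comes from the
   \<open>+ 1\<close> in the slab count.\<close>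
 define err where "err m = K * (?d / (real (Suc m))\<^sup>2 * 5 ^ ?d + 5 ^ (?d - 1) * (2 / real (Suc m)))" for m
 have "err \<longlonglongrightarrow> K * (0 * 5 ^ ?d + 5 ^ (?d - 1) * 0)"
  unfolding err_def[abs_def] by (intro tendsto_intros) real_asymp+
 hence "\<forall>\<^sub>F m in sequentially. err m < \<epsilon> / 2" using \<epsilon> by (intro order_tendstoD) auto
 moreover have "\<forall>\<^sub>F m in sequentially. dist (LINT u|lborel. g u * LR (real (Suc m)) u) (LINT u|lborel. g u * L u) < \<epsilon>"
  by (rule tendstoD[OF I \<epsilon>])
 ultimately have "\<forall>\<^sub>F m in sequentially. err m < \<epsilon> / 2 \<and> dist (LINT u|lborel. g u * LR (real (Suc m)) u) (LINT u|lborel. g u * L u) < \<epsilon>"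
  by (rule eventually_conj)
 then obtain m where m: "err m < \<epsilon> / 2" "dist (LINT u|lborel. g u * LR (real (Suc m)) u) (LINT u|lborel. g u * L u) < \<epsilon>"
  by (auto simp: eventually_sequentially)
 define R where "R = real (Suc m)"
 have R: "R > 0" by (simp add: R_def)
 show "\<exists>Y d. (\<forall>n\<ge>1. Y n \<in> borel_measurable (\<mu> n)) \<and> conv_prob \<mu> Y d \<and> abs ((LINT u|lborel. g u * L u) - d) <= \<epsilon> \<and>
   (\<forall>\<^sub>F n in sequentially. \<forall>\<omega>\<in>space (\<mu> n). abs (empirical n \<omega> L - Y n \<omega>) <= \<epsilon>)"
 proof (intro exI conjI allI impI)
  show "(\<lambda>\<eta>. empirical n \<eta> (LR R)) \<in> borel_measurable (\<mu> n)" if n: "n >= 1" for n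
  proof -
   have "sets (\<mu> n) = sets borel" using \<mu>[OF n] by simp
   thus ?thesis using empirical_continuous(2)[OF n LRb[OF R]] measurable_cong_sets by blast
  qed
  have "test_fun (LR R)" unfolding LR_def by (rule cutoff_test_fun[OF R L(1) KK])
  thus "conv_prob \<mu> (\<lambda>n \<eta>. empirical n \<eta> (LR R)) (LINT u|lborel. g u * LR R u)"
   using as unfolding associated_def conv_prob_def by blast
  show "abs ((LINT u|lborel. g u * L u) - (LINT u|lborel. g u * LR R u)) <= \<epsilon>"
   using m(2) unfolding R_def[symmetric] dist_real_def by simp
  have "(\<lambda>n. K * 5 ^ (?d - 1) * (1 / real n)) \<longlonglongrightarrow> K * 5 ^ (?d - 1) * 0"
   by (intro tendsto_intros)
  hence "\<forall>\<^sub>F n in sequentially. K * 5 ^ (?d - 1) * (1 / real n) < \<epsilon> / 2" using \<epsilon> by (intro order_tendstoD) auto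
  thus "\<forall>\<^sub>F n in sequentially. \<forall>\<omega>\<in>space (\<mu> n). abs (empirical n \<omega> L - empirical n \<omega> (LR R)) <= \<epsilon>"
   using eventually_ge_at_top[of 1]
  proof eventually_elim
   case (elim n)
   note n = elim(2)
   define D where "D x = K * (?d / R\<^sup>2) * Wd (scaled n x) + K * (Wd (scaled n x) * of_bool (abs (scaled n x $ k) < 1 / R))" for x :: "int^'d"
   have D: "D summable_on UNIV" unfolding D_def
    by (intro summable_on_add summable_on_cmult_right Wd_lattice_sum[OF n] slab_lattice_sum[OF n R])
   have LD: "abs (L (scaled n x) - LR R (scaled n x)) <= D x" for x
   proof -
    let ?u = "scaled n x"
    have "abs (L ?u - LR R ?u) = abs (L ?u) * (1 - cutoff k R ?u)"
    proof -
     have "L ?u - LR R ?u = L ?u * (1 - cutoff k R ?u)" by (simp add: LR_def right_diff_distrib)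
     thus ?thesis using cutoff_bounds(2)[OF R, of k ?u] by (simp add: abs_mult)
    qed
    also have "\<dots> <= K * (Wd ?u)\<^sup>2 * (1 - cutoff k R ?u)"
     using cutoff_bounds(2)[OF R, of k ?u] by (intro mult_right_mono K) auto
    also have "\<dots> <= K * (?d / R\<^sup>2 * Wd ?u + Wd ?u * of_bool (abs (?u $ k) < 1 / R))"
     using mult_left_mono[OF cutoff_bounds(3)[OF R, of k ?u] K0] by (simp add: mult_ac)
    finally show ?thesis by (simp add: D_def distrib_left mult.assoc)
   qed
   have "infsum D UNIV = K * (?d / R\<^sup>2) * (\<Sum>\<^sub>\<infinity>x::int^'d. Wd (scaled n x)) + K * (\<Sum>\<^sub>\<infinity>x::int^'d. Wd (scaled n x) * of_bool (abs (scaled n x $ k) < 1 / R))"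
    unfolding D_def infsum_cmult_right'[symmetric]
    by (intro infsum_add summable_on_cmult_right Wd_lattice_sum[OF n] slab_lattice_sum[OF n R])
   also have "\<dots> <= K * (?d / R\<^sup>2) * (5 * real n) ^ ?d + K * ((5 * real n) ^ (?d - 1) * (2 * real n / R + 1))"
    using K0 by (intro add_mono mult_left_mono Wd_lattice_sum[OF n] slab_lattice_sum[OF n R]) auto
   finally have "infsum D UNIV / real n ^ ?d <= (K * (?d / R\<^sup>2) * (5 * real n) ^ ?d + K * ((5 * real n) ^ (?d - 1) * (2 * real n / R + 1))) / real n ^ ?d"
    by (rule divide_right_mono) simp
   also have "\<dots> = err m + K * 5 ^ (?d - 1) * (1 / real n)"
   proof -
    have "real n ^ ?d = real n ^ (?d - 1) * n" using power_minus_mult[of ?d "real n"] by simp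
    thus ?thesis using n R unfolding err_def R_def[symmetric]
     by (simp add: power_mult_distrib add_divide_distrib distrib_left distrib_right)
   qed
   also have "\<dots> <= \<epsilon>" using m(1) elim(1) by linarith
   finally have "infsum D UNIV / real n ^ ?d <= \<epsilon>" .
   thus ?case
    using empirical_diff_bound[OF n KW LRb[OF R] LD D] by (auto intro: order_trans)
  qed
 qed
qed

section \<open>Convergence for product test functions\<close>

lemma isCont_component: "isCont F (u $ i) ==> isCont (\<lambda>v :: real^'d::finite. F (v $ i) :: real) u"
 by (rule isCont_o2[where g = F and f = "\<lambda>v. v $ i"]) (auto intro: continuous_intros)

lemma prodH_regular:
 fixes k :: "'d::finite"
 assumes a: "admissible k slow \<kappa> Fm Fp"
 shows "u $ k ~= 0 ==> isCont (prodH Fm Fp \<tau>) u" "prodH Fm Fp \<tau> \<in> borel_measurable borel" (is ?A)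
proof -
 have c: "isCont (Fm i 0 \<tau>) x" "isCont (Fp i 0 \<tau>) x" for i x
 proof -
  obtain hm hp where "heat_family \<kappa> (Fm i) hm" "heat_family \<kappa> (Fp i) hp" using a unfolding admissible_def by blast
  hence "DERIV (Fm i 0 \<tau>) x :> Fm i (Suc 0) \<tau> x" "DERIV (Fp i 0 \<tau>) x :> Fp i (Suc 0) \<tau> x"
   unfolding heat_family_def by auto
  thus "isCont (Fm i 0 \<tau>) x" "isCont (Fp i 0 \<tau>) x" by (auto intro: DERIV_isCont)
 qed
 have fc: "isCont (fac Fm Fp i 0 \<tau>) x" if "i ~= k \<or> x ~= 0" for i x
 proof (cases "i = k")
  case False
  hence "fac Fm Fp i 0 \<tau> = Fp i 0 \<tau>" using a by (auto simp: fac_def glue1_def admissible_def)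
  thus ?thesis using c by simp
 next
  case True
  hence "x ~= 0" using that by simp
  show ?thesis
  proof (cases "x < 0")
   case True
   have "\<forall>\<^sub>F y in nhds x. fac Fm Fp i 0 \<tau> y = Fm i 0 \<tau> y"
    using eventually_nhds_in_open[of "{..<0}" x] True by (auto elim!: eventually_mono simp: fac_def glue1_def)
   thus ?thesis using isCont_cong[of "fac Fm Fp i 0 \<tau>" "Fm i 0 \<tau>" x] c by blast
  next
   case False
   have "\<forall>\<^sub>F y in nhds x. fac Fm Fp i 0 \<tau> y = Fp i 0 \<tau> y"
    using eventually_nhds_in_open[of "{0<..}" x] False \<open>x ~= 0\<close> by (auto elim!: eventually_mono simp: fac_def glue1_def)
   thus ?thesis using isCont_cong[of "fac Fm Fp i 0 \<tau>" "Fp i 0 \<tau>" x] c by blast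
  qed
 qed
 show "isCont (prodH Fm Fp \<tau>) u" if "u $ k ~= 0"
  unfolding prodH_def[abs_def]
  by (intro continuous_prod isCont_component fc) (use that in auto)
 have [measurable]: "Fm i 0 \<tau> \<in> borel_measurable borel" "Fp i 0 \<tau> \<in> borel_measurable borel" for i
  by (intro borel_measurable_continuous_onI continuous_at_imp_continuous_on ballI c)+
 show ?A
  unfolding prodH_def[abs_def] fac_def glue1_def by measurable
qed

lemma jump_const_pos: "\<gamma> >= 2 ==> jump_const TYPE('d::finite) \<gamma> > 0"
 using jump_total_pos by (simp add: jump_const_eq)

text \<open>The Taylor factor 1/2 meets the limit of \<open>S3\<close>: the value 2 at
  \<open>\<gamma> = 2\<close> gives \<open>c_2 / d\<close>, and twice the series gives the variance
  over \<open>2 d\<close> beyond.\<close>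

lemma diff_coeff_limit:
 assumes \<gamma>: "\<gamma> >= 2"
 shows "(\<lambda>n. time_scale \<gamma> n * (jump_const TYPE('d::finite) \<gamma> / CARD('d)) * S3 \<gamma> n / 2) \<longlonglongrightarrow> diff_coeff TYPE('d) \<gamma>"
proof -
 let ?c = "jump_const TYPE('d) \<gamma>"
 have "(\<lambda>n. ?c / CARD('d) / 2 * (time_scale \<gamma> n * S3 \<gamma> n)) \<longlonglongrightarrow> ?c / CARD('d) / 2 * (if \<gamma> = 2 then 2 else 2 * (\<Sum>k. real (Suc k) powr (1 - \<gamma>)))"
  by (intro tendsto_intros time_scale_S3[OF \<gamma>])
 moreover have "?c / CARD('d) / 2 * (if \<gamma> = 2 then 2 else 2 * (\<Sum>k. real (Suc k) powr (1 - \<gamma>))) = diff_coeff TYPE('d) \<gamma>"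
 proof (cases "\<gamma> = 2")
  case False
  have "summable (\<lambda>k. real (Suc k) powr (1 - \<gamma>))"
   using summable_real_powr_iff[of "1 - \<gamma>"] summable_Suc_iff[of "\<lambda>k. real k powr (1 - \<gamma>)"] \<gamma> False by simp
  hence "(\<Sum>k. ?c * real (Suc k) powr (1 - \<gamma>)) = ?c * (\<Sum>k. real (Suc k) powr (1 - \<gamma>))" by (rule suminf_mult)
  thus ?thesis using False by (simp add: diff_coeff_def sigma_sq_def)
 qed (simp add: diff_coeff_def)
 ultimately show ?thesis by (simp add: mult_ac)
qed

lemma diff_coeff_pos:
 assumes \<gamma>: "\<gamma> >= 2" shows "diff_coeff TYPE('d::finite) \<gamma> > 0"
proof (cases "\<gamma> = 2")
 case True
 thus ?thesis using jump_const_pos[of 2, where 'd = 'd] by (simp add: diff_coeff_def)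
next
 case False
 have s: "summable (\<lambda>k. real (Suc k) powr (1 - \<gamma>))"
  using summable_real_powr_iff[of "1 - \<gamma>"] summable_Suc_iff[of "\<lambda>k. real k powr (1 - \<gamma>)"] \<gamma> False by simp
 hence "(\<Sum>k. jump_const TYPE('d) \<gamma> * real (Suc k) powr (1 - \<gamma>)) > 0"
  by (intro suminf_pos summable_mult s) (use jump_const_pos[OF \<gamma>, where 'd = 'd] in auto)
 thus ?thesis using False by (simp add: diff_coeff_def sigma_sq_def)
qed

definition regime :: "bool => real => real => real => bool" where
 "regime slow \<alpha> \<beta> \<gamma> \<longleftrightarrow> (if slow then \<alpha> > 0 \<and> (\<beta>, \<gamma>) \<in> R0 else \<alpha> = 1 \<and> \<beta> = 0 \<and> \<gamma> >= 2)"

lemma regimeD: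
 assumes "regime slow \<alpha> \<beta> \<gamma>"
 shows "\<gamma> >= 2" "\<alpha> >= 0" "\<not> slow ==> n >= 1 ==> \<alpha> * real n powr - \<beta> = 1" "slow ==> (\<beta>, \<gamma>) \<in> R0"
 using assms by (auto simp: regime_def R0_def split: if_splits)

lemma consistency_limit:
 assumes r: "regime slow \<alpha> \<beta> \<gamma>"
 shows "(\<lambda>n. consistency_error \<gamma> (diff_coeff TYPE('d::finite) \<gamma>) (of_bool slow * (\<alpha> * real n powr - \<beta>))
   (time_scale \<gamma> n * (jump_const TYPE('d) \<gamma> / CARD('d))) n) \<longlonglongrightarrow> 0"
proof -
 note \<gamma> = regimeD(1)[OF r]
 let ?c = "jump_const TYPE('d) \<gamma> / CARD('d)"
 let ?S0 = "INFSUM r. jump_w \<gamma> r * abs (real_of_int r)"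
 have 3: "(\<lambda>n. of_bool slow * (time_scale \<gamma> n * (real n powr - \<beta> / n))) \<longlonglongrightarrow> 0"
  using time_scale_slow[OF regimeD(4)[OF r]] by (cases slow) auto
 have "(\<lambda>n. 16 * (?c * (time_scale \<gamma> n * S1 \<gamma> n)) + 12 * (?c * (time_scale \<gamma> n * S2 \<gamma> n))
   + 2 * \<alpha> * ?c * ?S0 * (of_bool slow * (time_scale \<gamma> n * (real n powr - \<beta> / n)))
   + 5 * abs (time_scale \<gamma> n * ?c * S3 \<gamma> n / 2 - diff_coeff TYPE('d) \<gamma>))
  \<longlonglongrightarrow> 16 * (?c * 0) + 12 * (?c * 0) + 2 * \<alpha> * ?c * ?S0 * 0 + 5 * abs (diff_coeff TYPE('d) \<gamma> - diff_coeff TYPE('d) \<gamma>)"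
  by (intro tendsto_intros time_scale_S1[OF \<gamma>] time_scale_S2[OF \<gamma>] 3 diff_coeff_limit[OF \<gamma>])
 thus ?thesis by (simp add: consistency_error_def mult_ac)
qed

text \<open>The average at time \<open>t\<close> is compared in second moment with the average of
  the evolved function at time 0, where association applies. The coefficients are of size
  \<open>n^(-d)\<close>, which kills the carre du champ, while their \<open>l^1\<close> norm stays
  bounded.\<close>

theorem product_convergence:
 fixes k :: "'d::finite" and T t \<alpha> \<beta> \<gamma> :: real
  and g :: "real^'d => real" and \<mu> :: "nat => 'd config measure" and P :: "nat => (real => 'd config) measure"
 assumes g: "g \<in> borel_measurable borel" "\<And>u. g u \<in> {0..1}"
  and \<mu>: "\<And>n. n >= 1 ==> prob_space (\<mu> n) \<and> sets (\<mu> n) = sets borel" and as: "associated \<mu> g"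
  and law: "\<And>n. n >= 1 ==> exclusion_law k T \<alpha> \<beta> \<gamma> n (\<mu> n) (P n)"
  and t: "t \<in> {0..T}" and r: "regime slow \<alpha> \<beta> \<gamma>"
  and a: "admissible k slow (diff_coeff TYPE('d) \<gamma>) Fm Fp"
 shows "conv_prob P (\<lambda>n \<omega>. empirical n (\<omega> t) (prodH Fm Fp 0)) (LINT u|lborel. g u * prodH Fm Fp t u)"
proof -
 note \<gamma> = regimeD(1)[OF r] and \<alpha> = regimeD(2)[OF r]
 let ?\<kappa> = "diff_coeff TYPE('d) \<gamma>"
 let ?d = "CARD('d)"
 have T: "T >= 0" and t0: "t >= 0" and 0: "0 \<in> {0..T}" using t by auto
 obtain C where b: "adm_bound t C Fm Fp" using adm_bound_exists[OF a] by blast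
 have C: "C >= 0" using b by (simp add: adm_bound_def)
 define K where "K = C ^ ?d + abs (?\<kappa>) * ?d * C ^ ?d"
 have K0: "K >= 0" using C by (simp add: K_def)
 have HK: "abs (prodH Fm Fp \<tau> u) <= K * Wd u" and LK: "abs (prodL ?\<kappa> Fm Fp \<tau> u) <= K * Wd u"
  and HC: "abs (prodH Fm Fp \<tau> u) <= C ^ ?d" if "\<tau> \<in> {0..t}" for \<tau> u
 proof -
  have "C ^ ?d * Wd u <= K * Wd u" "abs (?\<kappa>) * ?d * C ^ ?d * Wd u <= K * Wd u"
   unfolding K_def using C by (intro mult_right_mono; simp)+
  thus "abs (prodH Fm Fp \<tau> u) <= K * Wd u" "abs (prodL ?\<kappa> Fm Fp \<tau> u) <= K * Wd u"
   using prodH_bound(2)[OF b that, of u] prodH_bound(3)[OF b that, of ?\<kappa> u] by linarith+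
  have "C ^ ?d * Wd u <= C ^ ?d" using mult_left_le[OF Wd_le_1[of u], of "C ^ ?d"] C by simp
  thus "abs (prodH Fm Fp \<tau> u) <= C ^ ?d" using prodH_bound(2)[OF b that, of u] by simp
 qed
 have t_in: "0 \<in> {0..t}" "t \<in> {0..t}" using t0 by auto
 define e where "e n = ?d * (5 * C) ^ (?d - 1) * (C * consistency_error \<gamma> ?\<kappa> (of_bool slow * (\<alpha> * real n powr - \<beta>))
   (time_scale \<gamma> n * (jump_const TYPE('d) \<gamma> / ?d)) n)" for n
 have e0: "e \<longlonglongrightarrow> 0"
  unfolding e_def[abs_def] by (intro tendsto_mult_right_zero consistency_limit[OF r])
 define b0 where "b0 = K * 5 ^ ?d"
 \<comment> \<open>The quadratic defect plus \<open>2 * b0\<close> times the linear one, as in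
   \<open>law_second_moment\<close>; \<open>b0\<close> bounds the \<open>l^1\<close> norm of the
   coefficients and \<open>C ^ d / n ^ d\<close> their size.\<close>
 define bnd where "bnd n = (2 * b0 * e n + C ^ ?d / real n ^ ?d * (b0 + e n)) * t + 2 * b0 * (e n * t)" for n
 have bnd0: "bnd \<longlonglongrightarrow> 0"
 proof -
  have "(\<lambda>n. C ^ ?d / real n ^ ?d) \<longlonglongrightarrow> 0"
  proof -
   have "filterlim (\<lambda>n. real n ^ ?d) at_top sequentially"
    by (rule filterlim_pow_at_top) (auto simp: filterlim_real_sequentially)
   thus ?thesis by (rule tendsto_divide_0[OF tendsto_const filterlim_at_top_imp_at_infinity])
  qed
  hence "bnd \<longlonglongrightarrow> (2 * b0 * 0 + 0 * (b0 + 0)) * t + 2 * b0 * (0 * t)"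
   unfolding bnd_def[abs_def] by (intro tendsto_intros e0)
  thus ?thesis by simp
 qed
 have pr: "prob_space (P n)" if "n >= 1" for n
  using law[OF that] by (auto simp: exclusion_law_def markov_law_def)
 define X where "X n \<omega> = empirical n (\<omega> t) (prodH Fm Fp 0)" for n and \<omega> :: "real => 'd config"
 define Y where "Y n \<omega> = empirical n (\<omega> 0) (prodH Fm Fp t)" for n and \<omega> :: "real => 'd config"
 have XY: "X n \<in> borel_measurable (P n)" "Y n \<in> borel_measurable (P n)"
  "measure (P n) {\<omega> \<in> space (P n). abs (Y n \<omega> - c) > \<delta>} = measure (\<mu> n) {\<eta> \<in> space (\<mu> n). abs (empirical n \<eta> (prodH Fm Fp t) - c) > \<delta>}"
  "\<delta> > 0 ==> measure (P n) {\<omega> \<in> space (P n). abs (X n \<omega> - Y n \<omega>) > \<delta>} <= bnd n / \<delta>\<^sup>2"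
  if n: "n >= 1" for n c \<delta>
 proof -
  obtain S where S: "markov_semigroup S" "semigroup_generator S = closure (excl_pregenerator k \<alpha> \<beta> \<gamma> n)"
   and L: "markov_law T S (\<mu> n) (P n)" using law[OF n] by (auto simp: exclusion_law_def)
  show "X n \<in> borel_measurable (P n)" unfolding X_def
   by (rule measurable_compose[OF law_eval_measurable[OF L T t] empirical_continuous(2)[OF n HK[OF t_in(1)]]])
  show "Y n \<in> borel_measurable (P n)" unfolding Y_def
   by (rule measurable_compose[OF law_eval_measurable[OF L T 0] empirical_continuous(2)[OF n HK[OF t_in(2)]]])
  note [measurable] = empirical_continuous(2)[OF n HK[OF t_in(2)]]
  have "{\<eta>. abs (empirical n \<eta> (prodH Fm Fp t) - c) > \<delta>} \<in> sets borel" by measurable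
  from law_time_0[OF L T this]
  show "measure (P n) {\<omega> \<in> space (P n). abs (Y n \<omega> - c) > \<delta>} = measure (\<mu> n) {\<eta> \<in> space (\<mu> n). abs (empirical n \<eta> (prodH Fm Fp t) - c) > \<delta>}"
   by (simp add: Y_def Int_def conj_commute)
  interpret exclusion_rates "rate k \<alpha> \<beta> \<gamma> n" "1 + \<alpha> * real n powr - \<beta>"
   by (rule exclusion_rates_rate[OF \<alpha> \<gamma>])
  define a where "a \<tau> x = prodH Fm Fp \<tau> (scaled n x) / real n ^ ?d" for \<tau> x
  define a' where "a' \<tau> x = prodL ?\<kappa> Fm Fp \<tau> (scaled n x) / real n ^ ?d" for \<tau> x
  define B where "B x = K / real n ^ ?d * Wd (scaled n x)" for x :: "int^'d"
  have Bs: "B summable_on UNIV" unfolding B_def by (rule summable_on_cmult_right[OF Wd_lattice_sum(1)[OF n]])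
  have Bb: "infsum B UNIV <= b0"
  proof -
   have "infsum B UNIV = K / real n ^ ?d * (\<Sum>\<^sub>\<infinity>x::int^'d. Wd (scaled n x))" unfolding B_def infsum_cmult_right' ..
   also have "\<dots> <= K / real n ^ ?d * (5 * real n) ^ ?d" by (intro mult_left_mono Wd_lattice_sum[OF n]) (use K0 in simp)
   also have "\<dots> = b0" using n by (simp add: power_mult_distrib b0_def)
   finally show ?thesis .
  qed
  have B0: "infsum B UNIV >= 0" unfolding B_def by (rule infsum_nonneg) (use K0 in simp)
  have aB: "abs (a \<tau> x) <= B x" and a'B: "abs (a' \<tau> x) <= B x" and aA: "abs (a \<tau> x) <= C ^ ?d / real n ^ ?d" if "\<tau> \<in> {0..t}" for \<tau> x
   using HK[OF that, of "scaled n x"] LK[OF that, of "scaled n x"] HC[OF that, of "scaled n x"] n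
   by (simp_all add: a_def a'_def B_def divide_right_mono)
  have der: "((\<lambda>\<tau>. a \<tau> x) has_real_derivative a' \<tau> x) (at \<tau> within {0..t})" if "\<tau> \<in> {0..t}" for \<tau> x
   unfolding a_def a'_def using that
   by (intro DERIV_cdivide has_field_derivative_at_within[OF prodH_time_deriv[OF \<open>admissible k slow ?\<kappa> Fm Fp\<close>]]) auto
  have en: "(INFSUM x. abs (time_scale \<gamma> n * walk (a \<tau>) x - a' \<tau> x)) <= e n" if "\<tau> \<in> {0..t}" for \<tau>
   unfolding a_def a'_def e_def
   by (rule consistency_nd[OF \<open>admissible k slow ?\<kappa> Fm Fp\<close> b that n \<alpha> \<gamma> regimeD(3)[OF r _ n]])
  note ev1 = exclusion_evolution_linear[OF \<alpha> \<gamma> time_scale_nonneg[OF n] S t0 Bs aB a'B der en aA]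
  note ev2 = exclusion_evolution_quadratic[OF \<alpha> \<gamma> time_scale_nonneg[OF n] S t0 Bs aB a'B der en aA]
  have as: "(\<lambda>x. abs (a \<tau> x)) summable_on UNIV" if "\<tau> \<in> {0..t}" for \<tau>
   by (rule infsum_le_bound(2)[OF Bs aB[OF that]])
  have lin: "lin (a \<tau>) \<eta> = empirical n \<eta> (prodH Fm Fp \<tau>)" for \<tau> \<eta> by (simp add: lin_def a_def empirical_eq)
  note Bl = Bc_variation[OF variation_lin[OF as]] and Bq = Bc_variation[OF variation_lin_sq[OF as]]
  have sq: "apply_bcontfun (Bc (\<lambda>\<eta>. (lin (a \<tau>) \<eta>)\<^sup>2)) \<eta> = (apply_bcontfun (Bc (lin (a \<tau>))) \<eta>)\<^sup>2"
   if "\<tau> \<in> {0..t}" for \<tau> \<eta> by (simp add: Bl[OF that] Bq[OF that])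
  have nv: "norm (Bc (lin (a t))) <= b0"
  proof (rule norm_bound)
   fix \<eta>
   have "abs (lin (a t) \<eta>) <= (INFSUM x. abs (a t x))" by (rule lin_bound[OF as[OF t_in(2)]])
   also have "\<dots> <= infsum B UNIV" by (rule infsum_mono[OF as[OF t_in(2)] Bs aB[OF t_in(2)]])
   finally show "norm (apply_bcontfun (Bc (lin (a t))) \<eta>) <= b0" using Bb by (simp add: Bl[OF t_in(2)])
  qed
  assume \<delta>: "\<delta> > 0"
  have e_nn: "e n >= 0" using en[OF t_in(1)] infsum_nonneg[of UNIV "\<lambda>x. abs (time_scale \<gamma> n * walk (a 0) x - a' 0 x)"] by simp
  have "measure (P n) {\<omega> \<in> space (P n). abs (X n \<omega> - Y n \<omega>) > \<delta>} \<le>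
   ((2 * infsum B UNIV * e n + C ^ ?d / real n ^ ?d * (infsum B UNIV + e n)) * t + 2 * b0 * (e n * t)) / \<delta>\<^sup>2"
   using law_second_moment[OF L T t \<delta> sq[OF t_in(1)] sq[OF t_in(2)] ev1 ev2 nv]
   by (simp add: Bl[OF t_in(1)] Bl[OF t_in(2)] lin X_def Y_def)
  also have "\<dots> <= bnd n / \<delta>\<^sup>2"
   unfolding bnd_def using Bb B0 e_nn C t0
   by (intro divide_right_mono add_mono mult_right_mono mult_left_mono) auto
  finally show "measure (P n) {\<omega> \<in> space (P n). abs (X n \<omega> - Y n \<omega>) > \<delta>} <= bnd n / \<delta>\<^sup>2" .
 qed
 have cY: "conv_prob P Y (LINT u|lborel. g u * prodH Fm Fp t u)"
 proof -
  have "conv_prob \<mu> (\<lambda>n \<eta>. empirical n \<eta> (prodH Fm Fp t)) (LINT u|lborel. g u * prodH Fm Fp t u)"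
   by (rule associated_discontinuous[OF \<mu> as g prodH_regular[OF a] prodH_bound(1)[OF b t_in(2)]])
  thus ?thesis
   unfolding conv_prob_def
  proof (intro allI impI)
   fix \<delta> :: real let ?c = "LINT u|lborel. g u * prodH Fm Fp t u"
   assume "\<forall>\<delta>>0. (\<lambda>n. measure (\<mu> n) {\<eta> \<in> space (\<mu> n). \<delta> < abs (empirical n \<eta> (prodH Fm Fp t) - ?c)}) \<longlonglongrightarrow> 0" "\<delta> > 0"
   hence "(\<lambda>n. measure (\<mu> n) {\<eta> \<in> space (\<mu> n). \<delta> < abs (empirical n \<eta> (prodH Fm Fp t) - ?c)}) \<longlonglongrightarrow> 0" by blast
   thus "(\<lambda>n. measure (P n) {\<omega> \<in> space (P n). \<delta> < abs (Y n \<omega> - ?c)}) \<longlonglongrightarrow> 0"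
    by (rule Lim_transform_eventually) (use XY(3) in \<open>auto intro!: eventually_sequentiallyI[of 1]\<close>)
  qed
 qed
 have cXY: "conv_prob P (\<lambda>n \<omega>. X n \<omega> - Y n \<omega>) 0"
  unfolding conv_prob_def
 proof (intro allI impI)
  fix \<delta> :: real assume \<delta>: "\<delta> > 0"
  show "(\<lambda>n. measure (P n) {\<omega> \<in> space (P n). abs (X n \<omega> - Y n \<omega> - 0) > \<delta>}) \<longlonglongrightarrow> 0"
  proof (rule Lim_null_comparison)
   have "(\<lambda>n. bnd n / \<delta>\<^sup>2) \<longlonglongrightarrow> 0 / \<delta>\<^sup>2" using \<delta> by (intro tendsto_intros bnd0) auto
   thus "(\<lambda>n. bnd n / \<delta>\<^sup>2) \<longlonglongrightarrow> 0" by simp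
  qed (use XY(4) \<delta> in \<open>auto intro!: eventually_sequentiallyI[of 1]\<close>)
 qed
 have "conv_prob P (\<lambda>n \<omega>. (X n \<omega> - Y n \<omega>) + Y n \<omega>) (0 + (LINT u|lborel. g u * prodH Fm Fp t u))"
  by (rule conv_prob_add[OF pr _ _ cXY cY]) (use XY in auto)
 thus ?thesis by (simp add: X_def)
qed

section \<open>Gaussian families\<close>

text \<open>From the second power on, the positive part is differentiable at 0. This gives cutoffs
  and extensions with explicit derivatives.\<close>

lemma pos_part_power_deriv:
 "DERIV (\<lambda>y::real. max 0 y ^ Suc (Suc n)) x :> real (Suc (Suc n)) * max 0 x ^ Suc n"
proof (cases x "0::real" rule: linorder_cases)
 case less
 have "DERIV (\<lambda>y::real. 0) x :> real (Suc (Suc n)) * max 0 x ^ Suc n" using less by simp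
 thus ?thesis
  by (rule has_field_derivative_transform_within_open[where S = "{..<0}"]) (use less in auto)
next
 case greater
 have "DERIV (\<lambda>y::real. y ^ Suc (Suc n)) x :> real (Suc (Suc n)) * max 0 x ^ Suc n"
  using greater DERIV_pow[of "Suc (Suc n)" x] by (simp add: max_def)
 thus ?thesis
  by (rule has_field_derivative_transform_within_open[where S = "{0<..}"]) (use greater in auto)
next
 case equal
 have "((\<lambda>y::real. max 0 y ^ Suc (Suc n) / y) \<longlongrightarrow> 0) (at 0)"
 proof (rule Lim_null_comparison)
  have "((\<lambda>y::real. abs y ^ Suc n) \<longlongrightarrow> abs 0 ^ Suc n) (at 0)" by (intro tendsto_intros)
  thus "((\<lambda>y::real. abs y ^ Suc n) \<longlongrightarrow> 0) (at 0)" by simp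
  show "\<forall>\<^sub>F y::real in at 0. norm (max 0 y ^ Suc (Suc n) / y) <= abs y ^ Suc n"
  proof (intro always_eventually allI)
   show "norm (max 0 y ^ Suc (Suc n) / y) <= abs y ^ Suc n" for y :: real
   proof (cases "y > 0")
    case False
    hence "max 0 y = 0" by simp
    thus ?thesis by (simp del: power_Suc add: power_0_Suc)
   qed (simp add: max_def)
  qed
 qed
 thus ?thesis using equal by (simp add: has_field_derivative_iff)
qed

text \<open>For negative \<tau> the added square makes the variance
  \<open>\<epsilon> * ((1 + x)^2 + x^2)\<close> with
  \<open>x = \<kappa> * \<tau> / \<epsilon>\<close>, so it stays positive, and it joins the line
  \<open>\<epsilon> + 2 * \<kappa> * \<tau>\<close> differentiably at 0.\<close>

definition var_ext :: "real => real => real => real" where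
 "var_ext \<kappa> \<epsilon> \<tau> = \<epsilon> + 2 * \<kappa> * \<tau> + 2 * \<kappa>\<^sup>2 / \<epsilon> * max 0 (- \<tau>) ^ 2"

lemma var_ext_pos: assumes "\<epsilon> > 0" "\<kappa> > 0" shows "var_ext \<kappa> \<epsilon> \<tau> > 0"
proof (cases "\<tau> >= 0")
 case True thus ?thesis using assms by (simp add: var_ext_def add_pos_nonneg)
next
 case False
 hence "var_ext \<kappa> \<epsilon> \<tau> = \<epsilon> * ((1 + \<kappa> * \<tau> / \<epsilon>)\<^sup>2 + (\<kappa> * \<tau> / \<epsilon>)\<^sup>2)"
  using assms by (simp add: var_ext_def max_def field_simps power2_eq_square)
 moreover have "(1 + x)\<^sup>2 + x\<^sup>2 > 0" for x :: real
  by (cases "x = 0") (auto intro: add_nonneg_pos)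
 ultimately show ?thesis using assms by simp
qed

lemma var_ext_deriv:
 "DERIV (var_ext \<kappa> \<epsilon>) \<tau> :> 2 * \<kappa> - 4 * \<kappa>\<^sup>2 / \<epsilon> * max 0 (- \<tau>)"
proof -
 have "DERIV (\<lambda>\<tau>. max 0 (- \<tau>) ^ 2) \<tau> :> (2 * max 0 (- \<tau>)) * (- 1)"
  using DERIV_chain2[where f = "\<lambda>y. max 0 y ^ Suc (Suc 0)" and g = uminus and x = \<tau>,
    OF pos_part_power_deriv[of 0 "- \<tau>"] DERIV_minus[OF DERIV_ident]]
  by (simp add: numeral_2_eq_2)
 hence "DERIV (var_ext \<kappa> \<epsilon>) \<tau> :> 0 + 2 * \<kappa> * 1 + 2 * \<kappa>\<^sup>2 / \<epsilon> * ((2 * max 0 (- \<tau>)) * (- 1))"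
  unfolding var_ext_def[abs_def] by (intro DERIV_add DERIV_const DERIV_cmult DERIV_ident)
 thus ?thesis by (simp add: mult.assoc)
qed

text \<open>\<open>exp (- w^2 / (2 v)) / sqrt v\<close> as a single exponential, without the
  constant \<open>1 / sqrt (2 * pi)\<close>.\<close>

definition gauss_kernel :: "real => real => real" where
 "gauss_kernel v w = exp (- w\<^sup>2 / (2 * v) - ln v / 2)"

definition gauss_deriv :: "nat => real => real => real" where
 "gauss_deriv j v w = gauss_kernel v w * (if j = 0 then 1 else if j = 1 then - w / v else if j = 2 then w\<^sup>2 / v\<^sup>2 - 1 / v
   else 3 * w / v\<^sup>2 - w ^ 3 / v ^ 3)"

lemma gauss_deriv_space:
 assumes v: "v > 0" and j: "j < 3"
 shows "DERIV (gauss_deriv j v) w :> gauss_deriv (Suc j) v w"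
proof -
 have k: "DERIV (gauss_kernel v) w :> gauss_kernel v w * (- w / v)"
  unfolding gauss_kernel_def[abs_def] using v
  by (auto intro!: derivative_eq_intros simp: less_imp_neq[symmetric] field_simps)
 consider "j = 0" | "j = 1" | "j = 2" using j by linarith
 thus ?thesis
 proof cases
  case 1
  thus ?thesis using k by (simp add: gauss_deriv_def[abs_def])
 next
  case 2
  have "DERIV (\<lambda>w. gauss_kernel v w * (- w / v)) w :> gauss_kernel v w * (- w / v) * (- w / v) + (- 1 / v) * gauss_kernel v w"
   by (rule DERIV_mult[OF k DERIV_cdivide[OF DERIV_minus[OF DERIV_ident]]])
  thus ?thesis using 2 by (simp add: gauss_deriv_def[abs_def] algebra_simps power2_eq_square)
 next
  case 3
  have "DERIV (\<lambda>w. gauss_kernel v w * (w\<^sup>2 / v\<^sup>2 - 1 / v)) w :> gauss_kernel v w * (- w / v) * (w\<^sup>2 / v\<^sup>2 - 1 / v) + (2 * w / v\<^sup>2) * gauss_kernel v w"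
  proof (rule DERIV_mult[OF k])
   have "DERIV (\<lambda>w. w\<^sup>2 / v\<^sup>2 - 1 / v) w :> (2 * w) / v\<^sup>2 - 0"
    by (intro DERIV_diff DERIV_cdivide DERIV_const) (auto intro!: derivative_eq_intros)
   thus "DERIV (\<lambda>w. w\<^sup>2 / v\<^sup>2 - 1 / v) w :> 2 * w / v\<^sup>2" by simp
  qed
  moreover have "gauss_kernel v w * (- w / v) * (w\<^sup>2 / v\<^sup>2 - 1 / v) + (2 * w / v\<^sup>2) * gauss_kernel v w = gauss_deriv 3 v w"
   using v by (simp add: gauss_deriv_def field_simps power2_eq_square power3_eq_cube)
  ultimately show ?thesis using 3 by (simp add: gauss_deriv_def[abs_def])
 qed
qed

text \<open>The heat equation in the variance variable, with diffusivity 1/2; hence a variance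
  growing at speed \<open>2 * \<kappa>\<close> gives diffusivity \<kappa>.\<close>

lemma gauss_deriv_var:
 assumes v: "v > 0"
 shows "DERIV (\<lambda>v. gauss_deriv 0 v w) v :> gauss_deriv 2 v w / 2"
 unfolding gauss_deriv_def[abs_def] gauss_kernel_def using v
 by (auto intro!: derivative_eq_intros simp: field_simps power2_eq_square)

text \<open>Fourth power of \<open>1 + x \<le> (1 + 4 / c) * (1 + c * x / 4)\<close>, combined with
  \<open>1 + y \<le> exp y\<close>.\<close>

lemma poly_exp_bound:
 fixes c :: real assumes c: "c > 0" and x: "x >= 0"
 shows "(1 + x) ^ 4 <= (1 + 4 / c) ^ 4 * exp (c * x)"
proof -
 have "1 + x <= (1 + 4 / c) * (1 + c / 4 * x)" using c x by (simp add: field_simps)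
 also have "\<dots> <= (1 + 4 / c) * exp (c / 4 * x)" using c by (intro mult_left_mono exp_ge_add_one_self) auto
 finally have "(1 + x) ^ 4 <= ((1 + 4 / c) * exp (c / 4 * x)) ^ 4" using x by (intro power_mono) auto
 also have "\<dots> = (1 + 4 / c) ^ 4 * exp (c * x)" by (simp add: power_mult_distrib exp_of_nat_mult[symmetric])
 finally show ?thesis .
qed

text \<open>With \<open>x = w^2\<close>: the kernel is bounded by taking the smallest variance in
  front and the largest in the exponent, the polynomial factor is at most
  \<open>(1 + 4 * q ^ 3) * (1 + x)^2\<close>, and the exponential beats \<open>(1 + x)^4\<close>,
  which leaves \<open>(1 + x)^(-2) = (wt w)^2\<close>.\<close>

lemma gauss_deriv_bound:
 assumes e: "0 < \<epsilon>" and v: "\<epsilon> <= v" "v <= V" and j: "j <= 3"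
 shows "abs (gauss_deriv j v w) <= (exp (- ln \<epsilon> / 2) * (1 + 4 * (1 + 1 / \<epsilon>) ^ 3) * (1 + 8 * V) ^ 4) * (wt w)\<^sup>2"
proof -
 have V: "V > 0" and v0: "v > 0" using e v by auto
 define x where "x = w\<^sup>2"
 have x: "x >= 0" by (simp add: x_def)
 have k: "gauss_kernel v w <= exp (- ln \<epsilon> / 2) * exp (- (1 / (2 * V)) * x)"
 proof -
  have "- w\<^sup>2 / (2 * v) <= - (1 / (2 * V)) * x" unfolding x_def using v v0 by (simp add: frac_le)
  moreover have "ln \<epsilon> <= ln v" using e v by simp
  ultimately have "- w\<^sup>2 / (2 * v) - ln v / 2 <= - ln \<epsilon> / 2 + - (1 / (2 * V)) * x" by simp
  thus ?thesis unfolding gauss_kernel_def exp_add[symmetric] by (simp only: exp_le_cancel_iff)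
 qed
 define q where "q = 1 + 1 / \<epsilon>"
 have "1 / v <= 1 / \<epsilon>" using e v by (intro divide_left_mono) auto
 hence q: "1 / v <= q" "1 <= q" using e by (auto simp: q_def)
 have q3: "q ^ 3 >= 0" using q by simp
 have w1: "abs w <= 1 + x" "abs w ^ 3 <= (1 + x)\<^sup>2" "x <= (1 + x)\<^sup>2" "1 + x <= (1 + x)\<^sup>2"
 proof -
  have "0 <= (abs w - 1)\<^sup>2" by simp
  hence "2 * abs w <= 1 + x" by (simp add: power2_eq_square x_def algebra_simps)
  thus 1: "abs w <= 1 + x" by linarith
  have "abs w ^ 3 = abs w * x" by (simp add: x_def power3_eq_cube power2_eq_square)
  also have "\<dots> <= (1 + x) * (1 + x)" using 1 x by (intro mult_mono) auto
  finally show "abs w ^ 3 <= (1 + x)\<^sup>2" by (simp add: power2_eq_square)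
  show "x <= (1 + x)\<^sup>2" "1 + x <= (1 + x)\<^sup>2" using x by (auto simp: power2_eq_square algebra_simps)
 qed
 define p where "p = (if j = 0 then 1 else if j = 1 then - w / v else if j = 2 then w\<^sup>2 / v\<^sup>2 - 1 / v
   else 3 * w / v\<^sup>2 - w ^ 3 / v ^ 3)"
 have pb: "abs p <= (1 + 4 * q ^ 3) * (1 + x)\<^sup>2"
 proof -
  have A: "1 <= (1 + x)\<^sup>2" using x by (simp add: power2_eq_square algebra_simps)
  have B: "(1 / v) ^ i * z <= q ^ 3 * (1 + x)\<^sup>2" if "i <= 3" "z <= (1 + x)\<^sup>2" "0 <= z" for z i
  proof -
   have "(1 / v) ^ i <= q ^ i" "q ^ i <= q ^ 3" using q v0 that by (auto intro: power_mono power_increasing)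
   thus ?thesis using that q3 by (intro mult_mono) auto
  qed
  have b: "(1 / v) * abs w <= q ^ 3 * (1 + x)\<^sup>2" "(1 / v)\<^sup>2 * x <= q ^ 3 * (1 + x)\<^sup>2" "1 / v <= q ^ 3 * (1 + x)\<^sup>2"
   "(1 / v)\<^sup>2 * abs w <= q ^ 3 * (1 + x)\<^sup>2" "(1 / v) ^ 3 * abs w ^ 3 <= q ^ 3 * (1 + x)\<^sup>2"
   using B[of 1 "abs w"] B[of 2 x] B[of 1 1] B[of 2 "abs w"] B[of 3 "abs w ^ 3"] w1 x A by auto
  have Q: "0 <= q ^ 3 * (1 + x)\<^sup>2" "(1 + 4 * q ^ 3) * (1 + x)\<^sup>2 = (1 + x)\<^sup>2 + 4 * (q ^ 3 * (1 + x)\<^sup>2)" using q3 by (auto simp: algebra_simps)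
  have "abs (- w / v) = (1 / v) * abs w" "abs (w\<^sup>2 / v\<^sup>2 - 1 / v) <= (1 / v)\<^sup>2 * x + 1 / v" "abs (3 * w / v\<^sup>2) = 3 * ((1 / v)\<^sup>2 * abs w)" "abs (w ^ 3 / v ^ 3) = (1 / v) ^ 3 * abs w ^ 3"
   using v0 by (auto simp: abs_divide abs_mult power_divide power_abs x_def abs_le_iff)
  thus ?thesis unfolding p_def Q(2) using A Q(1) b abs_triangle_ineq4[of "3 * w / v\<^sup>2" "w ^ 3 / v ^ 3"] by (auto split: if_splits)
 qed
 have pe: "(1 + x)\<^sup>2 * exp (- (1 / (2 * V)) * x) <= (1 + 8 * V) ^ 4 * (wt w)\<^sup>2"
 proof -
  have "(1 + x) ^ 4 <= (1 + 8 * V) ^ 4 * exp (1 / (2 * V) * x)"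
   using poly_exp_bound[of "1 / (2 * V)" x] V x by simp
  hence "(1 + x) ^ 4 * exp (- (1 / (2 * V)) * x) <= (1 + 8 * V) ^ 4 * exp (1 / (2 * V) * x) * exp (- (1 / (2 * V)) * x)"
   by (rule mult_right_mono) simp
  also have "\<dots> = (1 + 8 * V) ^ 4" by (simp add: mult.assoc exp_add[symmetric])
  finally have *: "(1 + x)\<^sup>2 * exp (- (1 / (2 * V)) * x) * (1 + x)\<^sup>2 <= (1 + 8 * V) ^ 4"
   by (simp add: power4_eq_xxxx power2_eq_square mult_ac)
  have pos: "(1 + x)\<^sup>2 > 0" using x by simp
  have "(1 + x)\<^sup>2 * exp (- (1 / (2 * V)) * x) <= (1 + 8 * V) ^ 4 / (1 + x)\<^sup>2"
   using * pos by (simp only: pos_le_divide_eq)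
  thus ?thesis by (simp add: wt_def x_def power_divide)
 qed
 have "abs (gauss_deriv j v w) = gauss_kernel v w * abs p" by (simp add: gauss_deriv_def p_def abs_mult gauss_kernel_def)
 also have "\<dots> <= (exp (- ln \<epsilon> / 2) * exp (- (1 / (2 * V)) * x)) * ((1 + 4 * q ^ 3) * (1 + x)\<^sup>2)"
  by (intro mult_mono k pb) (auto simp: gauss_kernel_def)
 also have "\<dots> = exp (- ln \<epsilon> / 2) * (1 + 4 * q ^ 3) * ((1 + x)\<^sup>2 * exp (- (1 / (2 * V)) * x))" by (simp add: mult_ac)
 also have "\<dots> <= exp (- ln \<epsilon> / 2) * (1 + 4 * q ^ 3) * ((1 + 8 * V) ^ 4 * (wt w)\<^sup>2)"
  using q3 by (intro mult_left_mono pe) auto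
 finally show ?thesis by (simp add: q_def mult_ac)
qed

lemma wt_translate: "wt (u - b) <= (2 + 2 * b\<^sup>2) * wt u"
proof -
 have "0 <= (u - 2 * b)\<^sup>2" by simp
 hence "u\<^sup>2 <= 2 * (u - b)\<^sup>2 + 2 * b\<^sup>2" by (simp add: power2_eq_square algebra_simps)
 moreover have "0 <= b\<^sup>2 * (u - b)\<^sup>2" by simp
 moreover have "(2 + 2 * b\<^sup>2) * (1 + (u - b)\<^sup>2) = 2 + 2 * (u - b)\<^sup>2 + 2 * b\<^sup>2 + 2 * (b\<^sup>2 * (u - b)\<^sup>2)"
  by (simp only: distrib_left distrib_right mult_1_right mult.assoc)
 ultimately have "1 + u\<^sup>2 <= (2 + 2 * b\<^sup>2) * (1 + (u - b)\<^sup>2)" by linarith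
 thus ?thesis unfolding wt_def by (simp add: divide_simps add_pos_nonneg)
qed

definition gauss_fam :: "real => real => real => real => nat => real => real => real" where
 "gauss_fam \<kappa> c \<epsilon> b j \<tau> u = c * gauss_deriv j (var_ext \<kappa> \<epsilon> \<tau>) (u - b)"

lemma heat_family_gauss:
 assumes k: "\<kappa> > 0" and e: "\<epsilon> > 0"
 shows "heat_family \<kappa> (gauss_fam \<kappa> c \<epsilon> b) (\<lambda>\<tau> u. (2 * \<kappa> - 4 * \<kappa>\<^sup>2 / \<epsilon> * max 0 (- \<tau>)) / 2 * gauss_fam \<kappa> c \<epsilon> b 2 \<tau> u)"
 unfolding heat_family_def
proof (intro conjI allI impI)
 let ?v = "var_ext \<kappa> \<epsilon>"
 have v: "?v \<tau> > 0" for \<tau> by (rule var_ext_pos[OF e k])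
 fix \<tau> u :: real
 show "DERIV (gauss_fam \<kappa> c \<epsilon> b j \<tau>) u :> gauss_fam \<kappa> c \<epsilon> b (Suc j) \<tau> u" if "j < 3" for j
  unfolding gauss_fam_def[abs_def]
  by (rule DERIV_cmult) (use DERIV_shift[of "gauss_deriv j (?v \<tau>)" _ u "- b"] gauss_deriv_space[OF v[of \<tau>] that, of "u - b"] in simp)
 have "DERIV (\<lambda>\<sigma>. gauss_deriv 0 (?v \<sigma>) (u - b)) \<tau> :> gauss_deriv 2 (?v \<tau>) (u - b) / 2 * (2 * \<kappa> - 4 * \<kappa>\<^sup>2 / \<epsilon> * max 0 (- \<tau>))"
  by (rule DERIV_chain2[OF gauss_deriv_var[OF v] var_ext_deriv])
 from DERIV_cmult[OF this, of c]
 show "DERIV (\<lambda>\<sigma>. gauss_fam \<kappa> c \<epsilon> b 0 \<sigma> u) \<tau> :> (2 * \<kappa> - 4 * \<kappa>\<^sup>2 / \<epsilon> * max 0 (- \<tau>)) / 2 * gauss_fam \<kappa> c \<epsilon> b 2 \<tau> u"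
  by (simp add: gauss_fam_def mult_ac)
 show "(2 * \<kappa> - 4 * \<kappa>\<^sup>2 / \<epsilon> * max 0 (- \<tau>)) / 2 * gauss_fam \<kappa> c \<epsilon> b 2 \<tau> u = \<kappa> * gauss_fam \<kappa> c \<epsilon> b 2 \<tau> u" if "\<tau> >= 0"
  using that by simp
 have vc: "continuous_on UNIV (\<lambda>p :: real \<times> real. ?v (fst p))"
  unfolding var_ext_def by (intro continuous_intros)
 have nv: "?v a ~= 0" for a using v[of a] by simp
 have ne: "?v (fst p) ~= 0" for p :: "real \<times> real" using v[of "fst p"] by simp
 have kc: "continuous_on UNIV (\<lambda>p :: real \<times> real. gauss_kernel (?v (fst p)) (snd p - b))"
  unfolding gauss_kernel_def by (intro continuous_intros vc) (use ne v in \<open>auto simp: less_imp_neq[symmetric]\<close>)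
 have gc: "continuous_on UNIV (\<lambda>p :: real \<times> real. gauss_fam \<kappa> c \<epsilon> b j (fst p) (snd p))" for j
 proof -
  consider "j = 0" | "j = 1" | "j = 2" | "j > 2" by linarith
  thus ?thesis
   unfolding gauss_fam_def gauss_deriv_def
   by cases (auto intro!: continuous_intros kc vc simp: nv)
 qed
 show "continuous_on UNIV (\<lambda>(\<tau>, u). gauss_fam \<kappa> c \<epsilon> b j \<tau> u)" for j
  using gc[of j] by (simp add: case_prod_unfold)
 show "continuous_on UNIV (\<lambda>(\<tau>, u). (2 * \<kappa> - 4 * \<kappa>\<^sup>2 / \<epsilon> * max 0 (- \<tau>)) / 2 * gauss_fam \<kappa> c \<epsilon> b 2 \<tau> u)"
  unfolding case_prod_unfold using e by (intro continuous_intros gc) auto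
next
 fix t :: real
 define V where "V = \<epsilon> + 2 * \<kappa> * abs t"
 define K where "K = exp (- ln \<epsilon> / 2) * (1 + 4 * (1 + 1 / \<epsilon>) ^ 3) * (1 + 8 * V) ^ 4"
 have K: "K >= 0" unfolding K_def using e by (intro mult_nonneg_nonneg) auto
 show "\<exists>C. \<forall>\<tau>\<in>{0..t}. \<forall>u. \<forall>j\<le>3. abs (gauss_fam \<kappa> c \<epsilon> b j \<tau> u) <= C * (wt u)\<^sup>2"
 proof (intro exI ballI allI impI)
  fix \<tau> u :: real and j :: nat assume \<tau>: "\<tau> \<in> {0..t}" and j: "j <= 3"
  have ve: "var_ext \<kappa> \<epsilon> \<tau> = \<epsilon> + 2 * \<kappa> * \<tau>" using \<tau> by (simp add: var_ext_def)
  have "2 * \<kappa> * \<tau> <= 2 * \<kappa> * abs t" using \<tau> k by (intro mult_left_mono) auto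
  hence "abs (gauss_deriv j (var_ext \<kappa> \<epsilon> \<tau>) (u - b)) <= K * (wt (u - b))\<^sup>2"
   unfolding K_def ve using \<tau> k by (intro gauss_deriv_bound[OF e _ _ j]) (auto simp: V_def)
  also have "\<dots> <= K * ((2 + 2 * b\<^sup>2) * wt u)\<^sup>2"
   using K wt_translate[of u b] by (intro mult_left_mono power_mono) auto
  finally have "abs c * abs (gauss_deriv j (var_ext \<kappa> \<epsilon> \<tau>) (u - b)) <= abs c * (K * ((2 + 2 * b\<^sup>2) * wt u)\<^sup>2)" by (intro mult_left_mono) auto
  thus "abs (gauss_fam \<kappa> c \<epsilon> b j \<tau> u) <= (abs c * K * (2 + 2 * b\<^sup>2)\<^sup>2) * (wt u)\<^sup>2"
   by (simp add: gauss_fam_def abs_mult power_mult_distrib mult_ac)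
 qed
qed

lemma heat_family_add:
 assumes F: "heat_family \<kappa> F f" and G: "heat_family \<kappa> G g"
 shows "heat_family \<kappa> (\<lambda>j \<tau> u. F j \<tau> u + G j \<tau> u) (\<lambda>\<tau> u. f \<tau> u + g \<tau> u)"
 unfolding heat_family_def
proof (intro conjI allI impI)
 fix t
 from F G obtain C D where "\<forall>\<tau>\<in>{0..t}. \<forall>u. \<forall>j\<le>3. abs (F j \<tau> u) <= C * (wt u)\<^sup>2" "\<forall>\<tau>\<in>{0..t}. \<forall>u. \<forall>j\<le>3. abs (G j \<tau> u) <= D * (wt u)\<^sup>2"
  unfolding heat_family_def by meson
 hence "\<forall>\<tau>\<in>{0..t}. \<forall>u. \<forall>j\<le>3. abs (F j \<tau> u + G j \<tau> u) <= (C + D) * (wt u)\<^sup>2"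
  unfolding distrib_right by (meson abs_triangle_ineq add_mono order_trans)
 thus "\<exists>C. \<forall>\<tau>\<in>{0..t}. \<forall>u. \<forall>j\<le>3. abs (F j \<tau> u + G j \<tau> u) <= C * (wt u)\<^sup>2" by blast
qed (use F G in \<open>auto simp: heat_family_def case_prod_unfold distrib_left intro!: DERIV_add continuous_intros\<close>)

text \<open>Method of images: equal masses at \<open>b\<close> and \<open>- b\<close> make the
  family even, hence flat at the barrier.\<close>

definition even_gauss :: "real => real => real => real => nat => real => real => real" where
 "even_gauss \<kappa> c \<epsilon> b j \<tau> u = gauss_fam \<kappa> (c / 2) \<epsilon> b j \<tau> u + gauss_fam \<kappa> (c / 2) \<epsilon> (- b) j \<tau> u"

lemma heat_family_even_gauss:
 assumes "\<kappa> > 0" "\<epsilon> > 0"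
 shows "\<exists>ht. heat_family \<kappa> (even_gauss \<kappa> c \<epsilon> b) ht"
 using heat_family_add[OF heat_family_gauss[OF assms, of "c/2" b] heat_family_gauss[OF assms, of "c/2" "- b"]]
 unfolding even_gauss_def[abs_def] by blast

lemma even_gauss_flat: "even_gauss \<kappa> c \<epsilon> b 1 \<tau> 0 = 0"
 by (simp add: even_gauss_def gauss_fam_def gauss_deriv_def gauss_kernel_def)

section \<open>Density of Gaussians\<close>

text \<open>Gaussians with arbitrary centre and the same variance in all directions. The product of
  two is again one, so the span is an algebra, without constants.\<close>

inductive_set gspan :: "(real^'d::finite => real) set" where
 gspan_base: "c > 0 ==> (\<lambda>u. r * exp (b \<bullet> u - c * (u \<bullet> u))) \<in> gspan"
| gspan_add: "f \<in> gspan ==> g \<in> gspan ==> (\<lambda>u. f u + g u) \<in> gspan"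

lemma gspan_scale: "f \<in> gspan ==> (\<lambda>u. s * f u) \<in> gspan"
proof (induction rule: gspan.induct)
 case (gspan_base c r b)
 thus ?case using gspan.gspan_base[of c "s * r" b] by (simp add: mult.assoc)
next
 case (gspan_add f g)
 thus ?case using gspan.gspan_add by (simp add: distrib_left)
qed

lemma gspan_mult: "f \<in> gspan ==> g \<in> gspan ==> (\<lambda>u. f u * g u) \<in> gspan"
proof (induction arbitrary: g rule: gspan.induct)
 case (gspan_base c r b)
 from gspan_base(2,1) show ?case
 proof (induction rule: gspan.induct)
  case (gspan_base c' r' b')
  hence "(\<lambda>u. (r * r') * exp ((b + b') \<bullet> u - (c + c') * (u \<bullet> u))) \<in> gspan"
   by (intro gspan.gspan_base) simp
  moreover have "exp (b \<bullet> u - c * (u \<bullet> u)) * exp (b' \<bullet> u - c' * (u \<bullet> u)) = exp ((b + b') \<bullet> u - (c + c') * (u \<bullet> u))" for u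
   by (simp add: exp_add[symmetric] inner_add_left algebra_simps)
  ultimately show ?case by (simp add: mult_ac)
 next
  case (gspan_add f g)
  thus ?case using gspan.gspan_add by (simp add: distrib_left)
 qed
next
 case (gspan_add f f')
 show ?case using gspan.gspan_add[OF gspan_add.IH(1) gspan_add.IH(2), OF gspan_add.prems gspan_add.prems]
  by (simp add: distrib_right)
qed

lemma gspan_0: "(\<lambda>u. 0) \<in> gspan"
 using gspan_base[of 1 0 0] by simp

text \<open>The weighted bound makes the function continuous at the point at infinity of the
  compactification. It follows from \<open>2 b \<bullet> u \<le> \<bar>b\<bar>^2 / c + c
  \<bar>u\<bar>^2\<close>, which leaves half of the Gaussian decay.\<close>

lemma gspan_regular:
 assumes "f \<in> gspan"
 shows "continuous_on UNIV f" "\<exists>K. \<forall>u. abs (f u) * (1 + u \<bullet> u) <= K" (is ?A)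
proof -
 show "continuous_on UNIV f" using assms
  by (induction rule: gspan.induct) (auto intro!: continuous_intros)
 show ?A using assms
 proof (induction rule: gspan.induct)
  case (gspan_base c r b)
  have "exp (b \<bullet> u - c * (u \<bullet> u)) * (1 + u \<bullet> u) <= exp (b \<bullet> b / (2 * c)) * (1 + 8 / c) ^ 4" for u
  proof -
   have "0 <= (b - c *\<^sub>R u) \<bullet> (b - c *\<^sub>R u)" by simp
   also have "\<dots> = b \<bullet> b - 2 * c * (b \<bullet> u) + c * c * (u \<bullet> u)"
    by (simp add: inner_diff_left inner_diff_right inner_commute algebra_simps)
   finally have "b \<bullet> u <= b \<bullet> b / (2 * c) + c / 2 * (u \<bullet> u)" using gspan_base by (simp add: field_simps)
   hence "b \<bullet> u - c * (u \<bullet> u) <= b \<bullet> b / (2 * c) + - (c / 2 * (u \<bullet> u))" by simp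
   hence 1: "exp (b \<bullet> u - c * (u \<bullet> u)) <= exp (b \<bullet> b / (2 * c)) * exp (- (c / 2 * (u \<bullet> u)))"
    unfolding exp_add[symmetric] by simp
   have "1 + u \<bullet> u <= (1 + u \<bullet> u) ^ 4" using self_le_power[of "1 + u \<bullet> u" 4] by simp
   also have "\<dots> <= (1 + 4 / (c / 2)) ^ 4 * exp (c / 2 * (u \<bullet> u))" by (rule poly_exp_bound) (use gspan_base in auto)
   finally have 2: "1 + u \<bullet> u <= (1 + 8 / c) ^ 4 * exp (c / 2 * (u \<bullet> u))" by simp
   have "exp (b \<bullet> u - c * (u \<bullet> u)) * (1 + u \<bullet> u) <= (exp (b \<bullet> b / (2 * c)) * exp (- (c / 2 * (u \<bullet> u)))) * ((1 + 8 / c) ^ 4 * exp (c / 2 * (u \<bullet> u)))"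
    by (intro mult_mono 1 2) (auto intro: add_nonneg_nonneg)
   also have "\<dots> = exp (b \<bullet> b / (2 * c)) * (1 + 8 / c) ^ 4 * (exp (- (c / 2 * (u \<bullet> u))) * exp (c / 2 * (u \<bullet> u)))"
    by (simp only: mult_ac)
   also have "exp (- (c / 2 * (u \<bullet> u))) * exp (c / 2 * (u \<bullet> u)) = 1" by (simp add: exp_add[symmetric])
   finally show ?thesis by simp
  qed
  hence "abs r * (exp (b \<bullet> u - c * (u \<bullet> u)) * (1 + u \<bullet> u)) <= abs r * (exp (b \<bullet> b / (2 * c)) * (1 + 8 / c) ^ 4)" for u
   by (intro mult_left_mono) auto
  thus ?case by (intro exI[of _ "abs r * (exp (b \<bullet> b / (2 * c)) * (1 + 8 / c) ^ 4)"]) (simp add: abs_mult mult.assoc)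
 next
  case (gspan_add f g)
  then obtain K L where "\<And>u. abs (f u) * (1 + u \<bullet> u) <= K" "\<And>u. abs (g u) * (1 + u \<bullet> u) <= L" by blast
  hence "abs (f u + g u) * (1 + u \<bullet> u) <= K + L" for u
   using mult_right_mono[OF abs_triangle_ineq[of "f u" "g u"], of "1 + u \<bullet> u"]
   by (smt (verit) distrib_right inner_ge_zero)
  thus ?case by blast
 qed
qed

text \<open>The sphere \<open>|v|\<^sup>2 + r\<^sup>2 = r\<close> is the one-point compactification of \<open>\<real>\<^sup>d\<close> under \<open>u \<mapsto> (r u, r)\<close> with
 \<open>r = 1 / (1 + |u|\<^sup>2)\<close>; the point at infinity is the origin.\<close>

definition cpt_sphere :: "((real^'d::finite) \<times> real) set" where
 "cpt_sphere = {(v, r). v \<bullet> v + r * r = r}"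

definition cpt_lift :: "(real^'d::finite => real) => ((real^'d) \<times> real) => real" where
 "cpt_lift f p = (if snd p = 0 then 0 else f (fst p /\<^sub>R snd p))"

lemma cpt_sphereD:
 assumes "p \<in> cpt_sphere"
 shows "0 <= snd p" "snd p <= 1" "fst p \<bullet> fst p <= 1" "snd p = 0 ==> fst p = 0"
  "snd p ~= 0 ==> 1 + (fst p /\<^sub>R snd p) \<bullet> (fst p /\<^sub>R snd p) = 1 / snd p"
proof -
 obtain v r where p: "p = (v, r)" by (cases p)
 hence e: "v \<bullet> v + r * r = r" using assms by (simp add: cpt_sphere_def)
 have r0: "0 <= r" using e inner_ge_zero[of v] zero_le_square[of r] by linarith
 have r1: "r <= 1"
 proof (rule ccontr)
  assume "\<not> r <= 1"
  hence "r * 1 < r * r" by (intro mult_strict_left_mono) auto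
  thus False using e inner_ge_zero[of v] by linarith
 qed
 show "0 <= snd p" "snd p <= 1" "snd p = 0 ==> fst p = 0" using r0 r1 e by (auto simp: p)
 have "v \<bullet> v <= 1" using e r1 zero_le_square[of r] by linarith
 thus "fst p \<bullet> fst p <= 1" by (simp add: p)
 show "1 + (fst p /\<^sub>R snd p) \<bullet> (fst p /\<^sub>R snd p) = 1 / snd p" if "snd p ~= 0"
 proof -
  have rn: "r ~= 0" using that p by simp
  have "v \<bullet> v = r - r * r" using e by linarith
  thus ?thesis using rn by (simp add: p field_simps)
 qed
qed

lemma compact_cpt_sphere: "compact (cpt_sphere :: ((real^'d::finite) \<times> real) set)"
proof -
 have "closed {p :: (real^'d) \<times> real. fst p \<bullet> fst p + snd p * snd p = snd p}"
  by (intro closed_Collect_eq continuous_intros)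
 hence "closed (cpt_sphere :: ((real^'d) \<times> real) set)" by (simp add: cpt_sphere_def case_prod_unfold)
 moreover have "bounded (cpt_sphere :: ((real^'d) \<times> real) set)"
 proof (rule boundedI)
  fix p :: "(real^'d) \<times> real" assume p: "p \<in> cpt_sphere"
  have "norm (fst p) <= 1" using cpt_sphereD(3)[OF p] by (simp add: norm_le_square power2_eq_square)
  thus "norm p <= 2" using norm_Pair_le[of "fst p" "snd p"] cpt_sphereD(1,2)[OF p] by simp
 qed
 ultimately show ?thesis by (simp add: compact_eq_bounded_closed)
qed

text \<open>Away from infinity \<open>snd q = 1 / (1 + \<bar>u\<bar>^2)\<close>, so the hypothesis
  reads \<open>\<bar>cpt_lift f q\<bar> \<le> K * snd q\<close>, which gives continuity at the
  origin.\<close>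

lemma cpt_lift_continuous:
 fixes f :: "real^'d::finite => real"
 assumes f: "continuous_on UNIV f" and K: "\<And>u. abs (f u) * (1 + u \<bullet> u) <= K"
 shows "continuous_on cpt_sphere (cpt_lift f)"
 unfolding continuous_on_def
proof
 fix p :: "(real^'d) \<times> real" assume p: "p \<in> cpt_sphere"
 show "(cpt_lift f \<longlongrightarrow> cpt_lift f p) (at p within cpt_sphere)"
 proof (cases "snd p = 0")
  case True
  have "(cpt_lift f \<longlongrightarrow> 0) (at p within cpt_sphere)"
  proof (rule Lim_null_comparison)
   have "((\<lambda>q. K * snd q) \<longlongrightarrow> K * snd p) (at p within cpt_sphere)" by (intro tendsto_intros)
   thus "((\<lambda>q. K * snd q) \<longlongrightarrow> 0) (at p within cpt_sphere)" using True by simp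
   have "abs (cpt_lift f q) <= K * snd q" if q: "q \<in> cpt_sphere" for q
   proof (cases "snd q = 0")
    case False
    hence "snd q > 0" using cpt_sphereD(1)[OF q] by simp
    thus ?thesis using K[of "fst q /\<^sub>R snd q"] unfolding cpt_sphereD(5)[OF q False] by (simp add: cpt_lift_def field_simps)
   qed (simp add: cpt_lift_def)
   thus "\<forall>\<^sub>F q in at p within cpt_sphere. norm (cpt_lift f q) <= K * snd q"
    by (simp add: eventually_at_filter)
  qed
  thus ?thesis using True by (simp add: cpt_lift_def)
 next
  case False
  have "isCont f (fst p /\<^sub>R snd p)" using f by (simp add: continuous_on_eq_continuous_at)
  hence "((\<lambda>q. f (fst q /\<^sub>R snd q)) \<longlongrightarrow> f (fst p /\<^sub>R snd p)) (at p within cpt_sphere)"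
   by (rule isCont_tendsto_compose) (intro tendsto_intros False)
  moreover have "\<forall>\<^sub>F q in at p within cpt_sphere. f (fst q /\<^sub>R snd q) = cpt_lift f q"
  proof -
   have "(snd \<longlongrightarrow> snd p) (at p within cpt_sphere)" by (intro tendsto_intros)
   from tendsto_imp_eventually_ne[OF this False] show ?thesis
    by eventually_elim (simp add: cpt_lift_def)
  qed
  ultimately have "(cpt_lift f \<longlongrightarrow> f (fst p /\<^sub>R snd p)) (at p within cpt_sphere)"
   by (rule Lim_transform_eventually)
  thus ?thesis using False by (simp add: cpt_lift_def)
 qed
qed

lemma cpt_sphere_embed: "((1 / (1 + u \<bullet> u)) *\<^sub>R u, 1 / (1 + u \<bullet> u)) \<in> cpt_sphere"
proof -
 define q where "q = 1 + u \<bullet> u"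
 have q: "q > 0" unfolding q_def by (simp add: add_pos_nonneg)
 have uu: "u \<bullet> u = q - 1" by (simp add: q_def)
 show ?thesis unfolding cpt_sphere_def q_def[symmetric] using q uu by (simp add: field_simps)
qed

lemma gspan_uniform_dense:
 fixes f :: "real^'d::finite => real"
 assumes f: "continuous_on UNIV f" and K: "\<And>u. abs (f u) * (1 + u \<bullet> u) <= K" and e: "e > 0"
 obtains L where "L \<in> gspan" "\<And>u. abs (f u - L u) < e"
proof -
 define R :: "(((real^'d) \<times> real) => real) set" where "R = {h. \<exists>c. \<exists>L\<in>gspan. h = (\<lambda>p. c + cpt_lift L p)}"
 have RI: "(\<lambda>p. c + cpt_lift L p) \<in> R" if "L \<in> gspan" for c L using that by (auto simp: R_def)
 interpret function_ring_on R "cpt_sphere :: ((real^'d) \<times> real) set"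
 proof
  show "compact (cpt_sphere :: ((real^'d) \<times> real) set)" by (rule compact_cpt_sphere)
  show "continuous_on cpt_sphere h" if hR: "h \<in> R" for h
  proof -
   obtain c L where h: "h = (\<lambda>p. c + cpt_lift L p)" "L \<in> gspan" using hR by (auto simp: R_def)
   obtain J where J: "\<And>u. abs (L u) * (1 + u \<bullet> u) <= J" using gspan_regular(2)[OF h(2)] by blast
   show ?thesis unfolding h(1) by (intro continuous_intros cpt_lift_continuous[OF gspan_regular(1)[OF h(2)] J])
  qed
  fix h h' assume "h \<in> R" "h' \<in> R"
  then obtain c L c' L' where h: "h = (\<lambda>p. c + cpt_lift L p)" "L \<in> gspan" "h' = (\<lambda>p. c' + cpt_lift L' p)" "L' \<in> gspan"
   by (auto simp: R_def)
  have "(\<lambda>x. h x + h' x) = (\<lambda>p. (c + c') + cpt_lift (\<lambda>u. L u + L' u) p)" by (auto simp: h cpt_lift_def fun_eq_iff)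
  thus "(\<lambda>x. h x + h' x) \<in> R" using RI[OF gspan_add[OF h(2,4)]] by simp
  have "(\<lambda>x. h x * h' x) = (\<lambda>p. (c * c') + cpt_lift (\<lambda>u. (c * L' u + c' * L u) + L u * L' u) p)"
   by (auto simp: h cpt_lift_def fun_eq_iff algebra_simps)
  moreover have "(\<lambda>u. (c * L' u + c' * L u) + L u * L' u) \<in> gspan"
   by (rule gspan_add[OF gspan_add[OF gspan_scale[OF h(4)] gspan_scale[OF h(2)]] gspan_mult[OF h(2,4)]])
  ultimately show "(\<lambda>x. h x * h' x) \<in> R" using RI by simp
 next
  show "(\<lambda>_. c) \<in> R" for c using RI[OF gspan_0, of c] by (simp add: cpt_lift_def)
 next
  fix p q :: "(real^'d) \<times> real" assume pq: "p \<in> cpt_sphere" "q \<in> cpt_sphere" "p ~= q"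
  have sep: "\<exists>h\<in>R. h p ~= h q" if p: "p \<in> cpt_sphere" "q \<in> cpt_sphere" "p ~= q" "snd p ~= 0" for p q :: "(real^'d) \<times> real"
  proof -
   define a where "a = fst p /\<^sub>R snd p"
   \<comment> \<open>A multiple of the Gaussian centred at the point below \<open>p\<close>; its
     maximum is attained only there.\<close>
   define L where "L u = 1 * exp ((2 *\<^sub>R a) \<bullet> u - 1 * (u \<bullet> u))" for u
   have L: "L \<in> gspan" unfolding L_def by (rule gspan_base) simp
   have Lv: "L u = exp (a \<bullet> a) * exp (- ((u - a) \<bullet> (u - a)))" for u
    unfolding L_def exp_add[symmetric] by (simp add: inner_diff_left inner_diff_right inner_commute)
   have "cpt_lift L p ~= cpt_lift L q"
   proof (cases "snd q = 0")
    case True thus ?thesis using p(4) by (simp add: cpt_lift_def L_def)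
   next
    case False
    define b where "b = fst q /\<^sub>R snd q"
    have "a ~= b"
    proof
     assume "a = b"
     hence "1 / snd p = 1 / snd q" using cpt_sphereD(5)[OF p(1,4)] cpt_sphereD(5)[OF p(2) False] by (simp add: a_def b_def)
     hence s: "snd p = snd q" by simp
     have "fst p = snd p *\<^sub>R a" "fst q = snd q *\<^sub>R b" using p(4) False by (simp_all add: a_def b_def)
     hence "p = q" using s \<open>a = b\<close> by (simp add: prod_eq_iff)
     thus False using p(3) by simp
    qed
    hence "exp (- ((b - a) \<bullet> (b - a))) ~= exp (- ((a - a) \<bullet> (a - a)))" by simp
    thus ?thesis using p(4) False unfolding cpt_lift_def a_def[symmetric] b_def[symmetric] Lv by simp
   qed
   thus ?thesis using RI[OF L, of 0] by (intro bexI[of _ "\<lambda>p. 0 + cpt_lift L p"]) auto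
  qed
  show "\<exists>h\<in>R. h p ~= h q"
  proof (cases "snd p = 0")
   case True
   hence "snd q ~= 0" using pq cpt_sphereD(4)[OF pq(1)] cpt_sphereD(4)[OF pq(2)] by (auto simp: prod_eq_iff)
   then obtain h where "h \<in> R" "h q ~= h p" using sep[of q p] pq by metis
   thus ?thesis by metis
  qed (use sep pq in blast)
 qed
 obtain h where h: "h \<in> R" "\<And>p. p \<in> cpt_sphere ==> abs (cpt_lift f p - h p) < e / 2"
  using Stone_Weierstrass_basic[OF cpt_lift_continuous[OF f K], of "e / 2"] e by auto
 obtain c L where hL: "h = (\<lambda>p. c + cpt_lift L p)" "L \<in> gspan" using h(1) by (auto simp: R_def)
 have "(0, 0) \<in> (cpt_sphere :: ((real^'d) \<times> real) set)" by (simp add: cpt_sphere_def)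
 from h(2)[OF this] have c: "abs c < e / 2" by (simp add: hL cpt_lift_def)
 have "abs (f u - L u) < e" for u
 proof -
  have q: "1 + u \<bullet> u > 0" by (simp add: add_pos_nonneg)
  have "abs (f u - (c + L u)) < e / 2"
   using h(2)[OF cpt_sphere_embed[of u]] q by (simp add: hL cpt_lift_def)
  thus ?thesis using c by linarith
 qed
 thus ?thesis using that hL(2) by blast
qed

lemma exp_le_Wd: "exp (- (u \<bullet> u)) <= Wd u"
proof -
 have "exp (- (u \<bullet> u)) = (\<Prod>i\<in>UNIV. exp (- (u $ i)\<^sup>2))"
  by (simp add: inner_vec_def exp_sum[symmetric] sum_negf power2_eq_square)
 also have "\<dots> <= Wd u" unfolding Wd_def
 proof (intro prod_mono conjI)
  fix i
  have "1 + (u $ i)\<^sup>2 <= exp ((u $ i)\<^sup>2)" by (rule exp_ge_add_one_self)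
  thus "exp (- (u $ i)\<^sup>2) <= wt (u $ i)" by (simp add: wt_def exp_minus inverse_eq_divide frac_le add_pos_nonneg)
 qed simp
 finally show ?thesis .
qed

lemma test_fun_bounded:
 assumes "test_fun G" and w: "continuous_on UNIV w" obtains K :: real where "\<And>u. abs (G u * w u) <= K"
proof -
 obtain C where C: "compact C" "\<And>u. u \<notin> C ==> G u = 0" and G: "continuous_on UNIV G"
  using assms by (auto simp: test_fun_def)
 have "compact ((\<lambda>u. G u * w u) ` C)"
  by (intro compact_continuous_image C continuous_intros continuous_on_subset[OF G] continuous_on_subset[OF w]) auto
 then obtain K where K: "\<And>y. y \<in> (\<lambda>u. G u * w u) ` C ==> norm y <= K" using compact_imp_bounded bounded_iff by metis
 have "abs (G u * w u) <= abs K" for u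
 proof (cases "u \<in> C")
  case True thus ?thesis using K[of "G u * w u"] by fastforce
 next
  case False thus ?thesis using C(2)[of u] by simp
 qed
 thus ?thesis using that by blast
qed

text \<open>Approximating \<open>G u * exp (u \<bullet> u)\<close> uniformly and multiplying back by
  the Gaussian turns the uniform error into one weighted by
  \<open>exp (- (u \<bullet> u)) \<le> Wd u\<close>.\<close>

lemma gspan_dense:
 fixes G :: "real^'d::finite => real"
 assumes G: "test_fun G" and e: "e > 0"
 obtains L where "L \<in> gspan" "\<And>u. abs (G u - L u) <= e * Wd u"
proof -
 have Gc: "continuous_on UNIV G" using G by (simp add: test_fun_def)
 obtain K where K: "\<And>u. abs (G u * (exp (u \<bullet> u) * (1 + u \<bullet> u))) <= K"
  by (rule test_fun_bounded[OF G, of "\<lambda>u. exp (u \<bullet> u) * (1 + u \<bullet> u)"]) (auto intro!: continuous_intros)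
 have K': "abs (G u * exp (u \<bullet> u)) * (1 + u \<bullet> u) <= K" for u
 proof -
  have "abs (1 + u \<bullet> u) = 1 + u \<bullet> u" by (simp add: add_nonneg_nonneg)
  thus ?thesis using K[of u] by (simp add: abs_mult mult.assoc)
 qed
 have c: "continuous_on UNIV (\<lambda>u. G u * exp (u \<bullet> u))" by (intro continuous_intros Gc)
 obtain L where L: "L \<in> gspan" "\<And>u. abs (G u * exp (u \<bullet> u) - L u) < e"
  using gspan_uniform_dense[OF c K' e] by blast
 define L' where "L' u = L u * (1 * exp (0 \<bullet> u - 1 * (u \<bullet> u)))" for u
 have "L' \<in> gspan" unfolding L'_def by (intro gspan_mult L gspan_base) simp
 moreover have "abs (G u - L' u) <= e * Wd u" for u
 proof -
  have "G u - L' u = (G u * exp (u \<bullet> u) - L u) * exp (- (u \<bullet> u))"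
   by (simp add: L'_def left_diff_distrib mult.assoc exp_add[symmetric])
  hence "abs (G u - L' u) = abs (G u * exp (u \<bullet> u) - L u) * exp (- (u \<bullet> u))" by (simp add: abs_mult)
  also have "\<dots> <= e * Wd u" using L(2)[of u] by (intro mult_mono exp_le_Wd) auto
  finally show ?thesis .
 qed
 ultimately show ?thesis using that by blast
qed

text \<open>The initial data reached by duality. Scalars enter through the amplitude of a
  factor.\<close>

inductive_set aspan :: "'d::finite => bool => real => (real^'d => real) set" for k slow \<kappa> where
 aspan_base: "admissible k slow \<kappa> Fm Fp ==> prodH Fm Fp 0 \<in> aspan k slow \<kappa>"
| aspan_add: "f \<in> aspan k slow \<kappa> ==> g \<in> aspan k slow \<kappa> ==> (\<lambda>u. f u + g u) \<in> aspan k slow \<kappa>"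

section \<open>Reflection in direction \<open>k\<close> and density of the admissible initial
  data\<close>

definition reflect :: "'d::finite => real^'d => real^'d" where
 "reflect k u = (\<chi> i. if i = k then - u $ i else u $ i)"

lemma reflect_nth [simp]: "reflect k u $ i = (if i = k then - u $ i else u $ i)"
 by (simp add: reflect_def)

lemma reflect_reflect [simp]: "reflect k (reflect k u) = u"
 by (simp add: vec_eq_iff)

lemma Wd_reflect [simp]: "Wd (reflect k u) = Wd u"
 unfolding Wd_def by (rule prod.cong) auto

lemma reflect_continuous: "continuous_on A (reflect k)"
 unfolding reflect_def[abs_def]
proof (rule continuous_on_vec_lambda)
 show "continuous_on A (\<lambda>u. if i = k then - u $ i else u $ i)" for i
  by (cases "i = k") (auto intro!: continuous_intros)
qed

text \<open>Completing the square: centre \<open>b / (2 c)\<close>, variance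
  \<open>1 / (2 c)\<close>, and an amplitude that undoes the completed constant and the
  \<open>1 / sqrt v\<close> of the kernel.\<close>

lemma gauss_fam_0:
 assumes c: "c > 0"
 shows "gauss_fam \<kappa> (s * exp (b\<^sup>2 / (4 * c) + ln (1 / (2 * c)) / 2)) (1 / (2 * c)) (b / (2 * c)) 0 0 x = s * exp (b * x - c * x\<^sup>2)"
proof -
 have "(x - b / (2 * c))\<^sup>2 * c = c * x\<^sup>2 - b * x + b\<^sup>2 / (4 * c)"
  using c by (simp add: field_simps power2_eq_square)
 hence eq: "- (x - b / (2 * c))\<^sup>2 / (2 * (1 / (2 * c))) - ln (1 / (2 * c)) / 2 = b * x - c * x\<^sup>2 - (b\<^sup>2 / (4 * c) + ln (1 / (2 * c)) / 2)"
  using c by (simp add: algebra_simps)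
 define q where "q = b\<^sup>2 / (4 * c) + ln (1 / (2 * c)) / 2"
 have "gauss_kernel (1 / (2 * c)) (x - b / (2 * c)) = exp (b * x - c * x\<^sup>2 - q)"
  unfolding gauss_kernel_def eq q_def ..
 thus ?thesis unfolding q_def[symmetric]
  by (simp add: gauss_fam_def gauss_deriv_def var_ext_def) (simp add: exp_diff)
qed

lemma even_gauss_0:
 assumes c: "c > 0"
 shows "even_gauss \<kappa> (s * exp (b\<^sup>2 / (4 * c) + ln (1 / (2 * c)) / 2)) (1 / (2 * c)) (b / (2 * c)) 0 0 x =
  (s * exp (b * x - c * x\<^sup>2) + s * exp (b * (- x) - c * (- x)\<^sup>2)) / 2"
 using gauss_fam_0[OF c, of \<kappa> "s / 2" b x] gauss_fam_0[OF c, of \<kappa> "s / 2" "- b" x]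
 by (simp add: even_gauss_def add_divide_distrib)

lemma gspan_base_prod:
 fixes b u :: "real^'d::finite"
 shows "s * exp (b \<bullet> u - c * (u \<bullet> u)) = (\<Prod>i\<in>UNIV. (if i = k then s else 1) * exp (b $ i * u $ i - c * (u $ i)\<^sup>2))"
proof -
 have "b \<bullet> u - c * (u \<bullet> u) = (\<Sum>i\<in>UNIV. b $ i * u $ i - c * (u $ i)\<^sup>2)"
  by (simp add: inner_vec_def sum_subtractf sum_distrib_left power2_eq_square)
 thus ?thesis by (simp add: prod.distrib exp_sum)
qed

lemma gspan_subset_aspan:
 assumes \<kappa>: "\<kappa> > 0" and f: "f \<in> gspan" shows "f \<in> aspan k False \<kappa>"
 using f
proof (induction rule: gspan.induct)
 case (gspan_base c s b)
 define F where "F i = gauss_fam \<kappa> ((if i = k then s else 1) * exp ((b $ i)\<^sup>2 / (4 * c) + ln (1 / (2 * c)) / 2)) (1 / (2 * c)) (b $ i / (2 * c))" for i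
 have "admissible k False \<kappa> F F"
  unfolding admissible_def F_def using heat_family_gauss[OF \<kappa>, of "1 / (2 * c)"] gspan_base by auto
 from aspan_base[OF this] have "prodH F F 0 \<in> aspan k False \<kappa>" .
 moreover have "prodH F F 0 = (\<lambda>u. s * exp (b \<bullet> u - c * (u \<bullet> u)))"
  unfolding prodH_def fac_def glue1_def F_def gspan_base_prod[of s b _ c k] by (simp add: gauss_fam_0[OF gspan_base] fun_eq_iff)
 ultimately show ?case by simp
qed (rule aspan_add)

text \<open>Each side is produced separately with zero data on the other, which is admissible
  because the sides decouple. The symmetrisation in direction \<open>k\<close> is what the even
  family imposes.\<close>

lemma gspan_half_aspan:
 assumes \<kappa>: "\<kappa> > 0" and f: "f \<in> gspan"
 shows "(\<lambda>u. if u $ k < 0 then 0 else (f u + f (reflect k u)) / 2) \<in> aspan k True \<kappa>"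
  "(\<lambda>u. if u $ k < 0 then (f u + f (reflect k u)) / 2 else 0) \<in> aspan k True \<kappa>"
 using f
proof (induction rule: gspan.induct)
 case (gspan_base c s b)
 define a where "a i = (if i = k then s else 1) * exp ((b $ i)\<^sup>2 / (4 * c) + ln (1 / (2 * c)) / 2)" for i
 define F where "F i = (if i = k then even_gauss \<kappa> (a i) (1 / (2 * c)) (b $ i / (2 * c)) else gauss_fam \<kappa> (a i) (1 / (2 * c)) (b $ i / (2 * c)))" for i
 \<comment> \<open>The vanishing side: only the factor in direction \<open>k\<close> is zero, as all
   other factors must agree on the two sides.\<close>
 define Z where "Z i = (if i = k then gauss_fam \<kappa> 0 1 0 else F i)" for i
 have c2: "1 / (2 * c) > 0" using gspan_base by simp
 have hF: "\<exists>ht. heat_family \<kappa> (F i) ht" for i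
 proof (cases "i = k")
  case True
  show ?thesis unfolding F_def if_P[OF True] by (rule heat_family_even_gauss[OF \<kappa> c2])
 next
  case False
  show ?thesis unfolding F_def if_not_P[OF False] by (rule exI, rule heat_family_gauss[OF \<kappa> c2])
 qed
 have hZ: "\<exists>ht. heat_family \<kappa> (Z i) ht" for i
 proof (cases "i = k")
  case True
  show ?thesis unfolding Z_def if_P[OF True] by (rule exI, rule heat_family_gauss[OF \<kappa> zero_less_one])
 next
  case False
  show ?thesis unfolding Z_def if_not_P[OF False] by (rule hF)
 qed
 have flat: "F k 1 \<tau> 0 = 0" "Z k 1 \<tau> 0 = 0" for \<tau>
  by (simp_all add: F_def Z_def even_gauss_flat[unfolded One_nat_def] gauss_fam_def)
 have "admissible k True \<kappa> Z F" "admissible k True \<kappa> F Z"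
  unfolding admissible_def using hF hZ flat by (auto simp: Z_def)
 from this[THEN aspan_base] have mem: "prodH Z F 0 \<in> aspan k True \<kappa>" "prodH F Z 0 \<in> aspan k True \<kappa>" .
 let ?f = "\<lambda>u. s * exp (b \<bullet> u - c * (u \<bullet> u))"
 have Fv: "F i 0 0 x = (if i = k then ((if i = k then s else 1) * exp (b $ i * x - c * x\<^sup>2) + (if i = k then s else 1) * exp (b $ i * (- x) - c * (- x)\<^sup>2)) / 2
   else (if i = k then s else 1) * exp (b $ i * x - c * x\<^sup>2))" for i x
  unfolding F_def a_def using even_gauss_0[OF gspan_base, of \<kappa> s "b $ i" x] gauss_fam_0[OF gspan_base, of \<kappa> 1 "b $ i" x]
  by (cases "i = k") simp_all
 have half: "(\<Prod>i\<in>UNIV. F i 0 0 (u $ i)) = (?f u + ?f (reflect k u)) / 2" for u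
 proof -
  define P where "P = (\<Prod>i\<in>UNIV - {k}. exp (b $ i * u $ i - c * (u $ i)\<^sup>2))"
  have p1: "(\<Prod>i\<in>UNIV. F i 0 0 (u $ i)) = F k 0 0 (u $ k) * P"
   unfolding prod_split[of _ k] P_def by (intro arg_cong2[where f = "(*)"] refl prod.cong) (auto simp: Fv)
  have p2: "?f u = s * exp (b $ k * u $ k - c * (u $ k)\<^sup>2) * P"
   unfolding gspan_base_prod[of s b u c k] prod_split[of _ k] P_def by (simp cong: prod.cong_simp)
  have p3: "?f (reflect k u) = s * exp (b $ k * (- u $ k) - c * (- u $ k)\<^sup>2) * P"
   unfolding gspan_base_prod[of s b "reflect k u" c k] prod_split[of _ k] P_def by (simp cong: prod.cong_simp)
  have p4: "F k 0 0 (u $ k) = (s * exp (b $ k * u $ k - c * (u $ k)\<^sup>2) + s * exp (b $ k * (- u $ k) - c * (- u $ k)\<^sup>2)) / 2"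
   by (simp only: Fv if_True simp_thms)
  show ?thesis unfolding p1 p2 p3 p4 by (simp only: distrib_right times_divide_eq_left)
 qed
 have zero: "(\<Prod>i\<in>UNIV. Z i 0 0 (u $ i)) = 0" for u
  by (rule prod_zero) (auto simp: Z_def gauss_fam_def intro!: bexI[of _ k])
 have e1: "prodH Z F 0 u = (if u $ k < 0 then 0 else (?f u + ?f (reflect k u)) / 2)"
  and e2: "prodH F Z 0 u = (if u $ k < 0 then (?f u + ?f (reflect k u)) / 2 else 0)" for u
 proof -
  have "fac Z F i 0 0 x = (if u $ k < 0 then Z i 0 0 x else F i 0 0 x)" "fac F Z i 0 0 x = (if u $ k < 0 then F i 0 0 x else Z i 0 0 x)"
   if "i = k ==> x = u $ k" for i x
   using that by (auto simp: fac_def glue1_def Z_def)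
  hence "prodH Z F 0 u = (\<Prod>i\<in>UNIV. if u $ k < 0 then Z i 0 0 (u $ i) else F i 0 0 (u $ i))"
   "prodH F Z 0 u = (\<Prod>i\<in>UNIV. if u $ k < 0 then F i 0 0 (u $ i) else Z i 0 0 (u $ i))"
   unfolding prodH_def by (auto intro!: prod.cong)
  thus "prodH Z F 0 u = (if u $ k < 0 then 0 else (?f u + ?f (reflect k u)) / 2)"
   "prodH F Z 0 u = (if u $ k < 0 then (?f u + ?f (reflect k u)) / 2 else 0)"
   using half[of u] zero[of u] by (cases "u $ k < 0"; simp)+
 qed
 show "(\<lambda>u. if u $ k < 0 then 0 else (?f u + ?f (reflect k u)) / 2) \<in> aspan k True \<kappa>"
  using mem(1) unfolding e1[abs_def, symmetric] by (simp add: e1[symmetric])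
 show "(\<lambda>u. if u $ k < 0 then (?f u + ?f (reflect k u)) / 2 else 0) \<in> aspan k True \<kappa>"
  using mem(2) by (simp add: e2[symmetric])
next
 case (gspan_add f g)
 have "(\<lambda>u. if u $ k < 0 then 0 else ((f u + g u) + (f (reflect k u) + g (reflect k u))) / 2) =
   (\<lambda>u. (if u $ k < 0 then 0 else (f u + f (reflect k u)) / 2) + (if u $ k < 0 then 0 else (g u + g (reflect k u)) / 2))"
  "(\<lambda>u. if u $ k < 0 then ((f u + g u) + (f (reflect k u) + g (reflect k u))) / 2 else 0) =
   (\<lambda>u. (if u $ k < 0 then (f u + f (reflect k u)) / 2 else 0) + (if u $ k < 0 then (g u + g (reflect k u)) / 2 else 0))"
  by (auto simp: fun_eq_iff add_divide_distrib)
 thus "(\<lambda>u. if u $ k < 0 then 0 else ((f u + g u) + (f (reflect k u) + g (reflect k u))) / 2) \<in> aspan k True \<kappa>"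
  "(\<lambda>u. if u $ k < 0 then ((f u + g u) + (f (reflect k u) + g (reflect k u))) / 2 else 0) \<in> aspan k True \<kappa>"
  using aspan_add[OF gspan_add.IH(1) gspan_add.IH(3)] aspan_add[OF gspan_add.IH(2) gspan_add.IH(4)] by simp_all
qed

text \<open>Folds space onto the half space of sign \<open>s\<close>; composition with it is the
  even extension of the restriction to that side.\<close>

definition fold_coord :: "'d::finite => real => real^'d => real^'d" where
 "fold_coord k s u = (\<chi> i. if i = k then s * abs (u $ i) else u $ i)"

lemma fold_coord_continuous: "continuous_on A (fold_coord k s)"
 unfolding fold_coord_def[abs_def]
proof (rule continuous_on_vec_lambda)
 show "continuous_on A (\<lambda>u. if i = k then s * abs (u $ i) else u $ i)" for i
  by (cases "i = k") (auto intro!: continuous_intros)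
qed

lemma test_fun_fold:
 fixes G :: "real^'d::finite => real"
 assumes G: "test_fun G" and s: "abs s = 1" shows "test_fun (\<lambda>u. G (fold_coord k s u))"
proof -
 obtain C where C: "compact C" "\<And>u. u \<notin> C ==> G u = 0" and Gc: "continuous_on UNIV G"
  using G by (auto simp: test_fun_def)
 obtain B where B: "\<And>u. u \<in> C ==> norm u <= B" using compact_imp_bounded[OF C(1)] by (auto simp: bounded_iff)
 have nf: "norm (fold_coord k s u) = norm u" for u
 proof -
  have "norm (fold_coord k s u $ i) = norm (u $ i)" for i using s by (simp add: fold_coord_def abs_mult)
  thus ?thesis by (simp add: norm_vec_def L2_set_def)
 qed
 show ?thesis unfolding test_fun_def
 proof (intro conjI exI allI impI)
  show "continuous_on UNIV (\<lambda>u. G (fold_coord k s u))" by (rule continuous_on_compose2[OF Gc fold_coord_continuous]) simp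
  show "compact (cball 0 B :: (real^'d) set)" by simp
  show "G (fold_coord k s u) = 0" if "u \<notin> cball 0 B" for u
   using that B[of "fold_coord k s u"] C(2) nf[of u] by force
 qed
qed

text \<open>With slow bonds each side of \<open>G\<close> is extended evenly, which keeps it
  continuous; as the extension is symmetric, symmetrising its approximation does not increase the
  error, and the two sides are glued.\<close>

theorem aspan_dense:
 fixes G :: "real^'d::finite => real"
 assumes \<kappa>: "\<kappa> > 0" and G: "test_fun G" and e: "e > 0"
 obtains L where "L \<in> aspan k slow \<kappa>" "\<And>u. abs (G u - L u) <= e * Wd u"
proof (cases slow)
 case False
 obtain L where "L \<in> gspan" "\<And>u. abs (G u - L u) <= e * Wd u" using gspan_dense[OF G e] by blast
 thus ?thesis using that gspan_subset_aspan[OF \<kappa>] False by metis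
next
 case True
 have side: "\<exists>L\<in>gspan. \<forall>u. abs (G (fold_coord k s u) - (L u + L (reflect k u)) / 2) <= e * Wd u" if s: "abs s = 1" for s
 proof -
  obtain L where L: "L \<in> gspan" "\<And>u. abs (G (fold_coord k s u) - L u) <= e * Wd u"
   using gspan_dense[OF test_fun_fold[OF G s] e] by blast
  have "abs (G (fold_coord k s u) - (L u + L (reflect k u)) / 2) <= e * Wd u" for u
  proof -
   have "fold_coord k s (reflect k u) = fold_coord k s u" by (simp add: fold_coord_def vec_eq_iff)
   hence "abs (G (fold_coord k s u) - L (reflect k u)) <= e * Wd u" using L(2)[of "reflect k u"] by simp
   thus ?thesis using L(2)[of u] unfolding abs_le_iff by (simp add: field_simps)
  qed
  thus ?thesis using L(1) by blast
 qed
 obtain Lp Lm where Lp: "Lp \<in> gspan" "\<And>u. abs (G (fold_coord k 1 u) - (Lp u + Lp (reflect k u)) / 2) <= e * Wd u"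
  and Lm: "Lm \<in> gspan" "\<And>u. abs (G (fold_coord k (- 1) u) - (Lm u + Lm (reflect k u)) / 2) <= e * Wd u"
  using side[of 1] side[of "- 1"] by auto
 define L where "L u = (if u $ k < 0 then 0 else (Lp u + Lp (reflect k u)) / 2) + (if u $ k < 0 then (Lm u + Lm (reflect k u)) / 2 else 0)" for u
 have "L \<in> aspan k slow \<kappa>"
  unfolding L_def using aspan_add[OF gspan_half_aspan(1)[OF \<kappa> Lp(1)] gspan_half_aspan(2)[OF \<kappa> Lm(1)]] True by simp
 moreover have "abs (G u - L u) <= e * Wd u" for u
 proof (cases "u $ k < 0")
  case True
  hence "fold_coord k (- 1) u = u" by (simp add: fold_coord_def vec_eq_iff)
  thus ?thesis using Lm(2)[of u] True by (simp add: L_def)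
 next
  case False
  hence "fold_coord k 1 u = u" by (simp add: fold_coord_def vec_eq_iff)
  thus ?thesis using Lp(2)[of u] False by (simp add: L_def)
 qed
 ultimately show ?thesis using that by blast
qed

section \<open>Compactly supported test functions from heat families\<close>

text \<open>A twice continuously differentiable bump. It is flat at 0, so multiplying by it
  preserves the Neumann condition.\<close>

definition chi :: "real => real" where "chi x = max 0 (1 - x\<^sup>2) ^ 3"
definition chi1 :: "real => real" where "chi1 x = - 6 * x * max 0 (1 - x\<^sup>2) ^ 2"
definition chi2 :: "real => real" where "chi2 x = 24 * x\<^sup>2 * max 0 (1 - x\<^sup>2) - 6 * max 0 (1 - x\<^sup>2) ^ 2"

lemma chi_deriv: "DERIV chi x :> chi1 x" "DERIV chi1 x :> chi2 x"
proof -
 have q: "DERIV (\<lambda>x. 1 - x\<^sup>2) x :> - (2 * x)" by (auto intro!: derivative_eq_intros)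
 have 3: "DERIV (\<lambda>x. max 0 (1 - x\<^sup>2) ^ 3) x :> (3 * max 0 (1 - x\<^sup>2) ^ 2) * - (2 * x)"
  using DERIV_chain2[where f = "\<lambda>y. max 0 y ^ Suc (Suc 1)" and g = "\<lambda>x. 1 - x\<^sup>2" and x = x, OF pos_part_power_deriv[of 1 "1 - x\<^sup>2"] q]
  by (simp add: numeral_2_eq_2 numeral_3_eq_3)
 thus "DERIV chi x :> chi1 x" by (simp add: chi_def[abs_def] chi1_def mult_ac)
 have 2: "DERIV (\<lambda>x. max 0 (1 - x\<^sup>2) ^ 2) x :> (2 * max 0 (1 - x\<^sup>2)) * - (2 * x)"
  using DERIV_chain2[where f = "\<lambda>y. max 0 y ^ Suc (Suc 0)" and g = "\<lambda>x. 1 - x\<^sup>2" and x = x, OF pos_part_power_deriv[of 0 "1 - x\<^sup>2"] q]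
  by (simp add: numeral_2_eq_2)
 have "DERIV (\<lambda>x. (- 6 * x) * max 0 (1 - x\<^sup>2) ^ 2) x :> (- 6 * 1) * max 0 (1 - x\<^sup>2) ^ 2 + ((2 * max 0 (1 - x\<^sup>2)) * - (2 * x)) * (- 6 * x)"
  by (rule DERIV_mult[OF DERIV_cmult[OF DERIV_ident] 2])
 thus "DERIV chi1 x :> chi2 x"
  by (simp add: chi1_def[abs_def] chi2_def power2_eq_square algebra_simps)
qed

lemma chi_continuous: "continuous_on A chi" "continuous_on A chi1" "continuous_on A chi2"
 unfolding chi_def[abs_def] chi1_def[abs_def] chi2_def[abs_def] by (intro continuous_intros)+

lemma chi_bounds: "0 <= chi x" "chi x <= 1" "abs (chi1 x) <= 6" "abs (chi2 x) <= 30" "abs x >= 1 ==> chi x = 0"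
proof -
 define m where "m = max 0 (1 - x\<^sup>2)"
 have m: "0 <= m" "m <= 1" by (auto simp: m_def)
 have m2: "0 <= m ^ 2" "m ^ 2 <= 1" "m ^ 3 <= 1" "0 <= m ^ 3" using m by (auto intro: power_le_one)
 show "0 <= chi x" "chi x <= 1" unfolding chi_def m_def[symmetric] using m2 by auto
 have z: "m = 0" if "abs x >= 1" using that abs_le_square_iff[of 1 x] by (simp add: m_def)
 show "chi x = 0" if "abs x >= 1" unfolding chi_def m_def[symmetric] using z[OF that] by simp
 show "abs (chi1 x) <= 6"
 proof (cases "abs x >= 1")
  case True thus ?thesis unfolding chi1_def m_def[symmetric] using z by simp
 next
  case False
  hence "abs x * m ^ 2 <= 1 * 1" using m2 by (intro mult_mono) auto
  thus ?thesis unfolding chi1_def m_def[symmetric] by (simp add: abs_mult)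
 qed
 show "abs (chi2 x) <= 30"
 proof (cases "abs x >= 1")
  case True thus ?thesis unfolding chi2_def m_def[symmetric] using z by simp
 next
  case False
  hence "x\<^sup>2 <= 1" by (simp add: abs_square_le_1)
  hence "x\<^sup>2 * m <= 1 * 1" using m by (intro mult_mono) auto
  hence "x\<^sup>2 * m <= 1" "0 <= x\<^sup>2 * m" using m by auto
  thus ?thesis unfolding chi2_def m_def[symmetric] using m2 by (simp only: abs_le_iff mult.assoc) linarith
 qed
qed

text \<open>Test functions must have compact support in time; this factor is 1 up to time
  \<open>t\<close>, so the weak formulation at time \<open>t\<close> does not see it, and 0 from
  \<open>t + 1\<close> on.\<close>

definition time_cut :: "real => real => real" where "time_cut t s = max 0 (1 - max 0 (s - t) ^ 2) ^ 2"
definition time_cut' :: "real => real => real" where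
 "time_cut' t s = 2 * max 0 (1 - max 0 (s - t) ^ 2) * - (2 * max 0 (s - t))"

lemma time_cut_deriv: "DERIV (time_cut t) s :> time_cut' t s"
proof -
 have "DERIV (\<lambda>s. max 0 (s - t) ^ 2) s :> (2 * max 0 (s - t)) * (1 - 0)"
  using DERIV_chain2[where f = "\<lambda>y. max 0 y ^ Suc (Suc 0)" and g = "\<lambda>s. s - t" and x = s,
    OF pos_part_power_deriv[of 0 "s - t"] DERIV_diff[OF DERIV_ident DERIV_const]]
  by (simp add: numeral_2_eq_2)
 hence "DERIV (\<lambda>s. 1 - max 0 (s - t) ^ 2) s :> 0 - (2 * max 0 (s - t)) * (1 - 0)"
  by (intro DERIV_diff DERIV_const)
 from DERIV_chain2[where f = "\<lambda>y. max 0 y ^ Suc (Suc 0)" and x = s, OF pos_part_power_deriv[of 0 "1 - max 0 (s - t) ^ 2"] this]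
 show ?thesis unfolding time_cut_def[abs_def] time_cut'_def by (simp add: numeral_2_eq_2)
qed

lemma time_cut_simps: "s <= t ==> time_cut t s = 1" "s <= t ==> time_cut' t s = 0" "s >= t + 1 ==> time_cut t s = 0"
proof -
 show "s >= t + 1 ==> time_cut t s = 0"
  using one_le_power[of "s - t" 2] by (auto simp: time_cut_def max_def intro: antisym)
qed (simp_all add: time_cut_def time_cut'_def)

lemma time_cut_continuous: "continuous_on A (time_cut t)" "continuous_on A (time_cut' t)"
 unfolding time_cut_def[abs_def] time_cut'_def[abs_def] by (intro continuous_intros)+

lemma at_within_nonneg_nontrivial: "s >= 0 ==> at s within {0::real..} ~= bot"
proof
 assume "s >= 0" "at s within {0..} = bot"
 have "{s<..} \<subseteq> {0..}" using \<open>s >= 0\<close> by auto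
 from at_le[OF this, of s] have "at_right s <= bot" using \<open>at s within {0..} = bot\<close> by simp
 thus False using trivial_limit_at_right_real[of s] by (simp add: bot_unique)
qed

lemma time_deriv_eq:
 assumes "s >= 0" "((\<lambda>r. G r u) has_real_derivative d) (at s within {0..})"
 shows "time_deriv G s u = d" "(\<lambda>r. G r u) differentiable (at s within {0..})"
 unfolding time_deriv_def
 using vector_derivative_within[OF at_within_nonneg_nontrivial[OF assms(1)]] assms(2)
 by (auto simp: has_real_derivative_iff_has_vector_derivative intro: differentiableI_vector)

lemma partial_deriv_eq:
 assumes "\<And>u. DERIV (\<lambda>h. f (u + h *\<^sub>R axis i 1)) 0 :> f' u"
 shows "partial_deriv i f = f'" "partially_differentiable i f"
proof -
 show "partial_deriv i f = f'" unfolding partial_deriv_def using DERIV_imp_deriv[OF assms] by (simp add: fun_eq_iff)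
 show "partially_differentiable i f"
  unfolding partially_differentiable_def using assms real_differentiable_def by blast
qed

lemma prod_axis_deriv:
 fixes a :: "'d::finite => real => real"
 assumes a: "\<And>x. DERIV (a i) x :> a' x"
 shows "DERIV (\<lambda>h. c * (\<Prod>j\<in>UNIV. a j ((u + h *\<^sub>R axis i 1) $ j))) 0 :> c * (\<Prod>j\<in>UNIV. (a(i := a')) j (u $ j))"
proof -
 define P where "P = (\<Prod>j\<in>UNIV - {i}. a j (u $ j))"
 have e1: "(\<Prod>j\<in>UNIV. a j ((u + h *\<^sub>R axis i 1) $ j)) = a i (u $ i + h) * P" for h
 proof -
  have "(\<Prod>j\<in>UNIV - {i}. a j ((u + h *\<^sub>R axis i 1) $ j)) = P" unfolding P_def by (rule prod.cong) (auto simp: axis_def)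
  thus ?thesis unfolding prod_split[of _ i] by (simp add: axis_def)
 qed
 have e2: "(\<Prod>j\<in>UNIV. (a(i := a')) j (u $ j)) = a' (u $ i) * P"
 proof -
  have "(\<Prod>j\<in>UNIV - {i}. (a(i := a')) j (u $ j)) = P" unfolding P_def by (rule prod.cong) auto
  thus ?thesis unfolding prod_split[of _ i] by simp
 qed
 have "DERIV (\<lambda>h. a i (u $ i + h)) 0 :> a' (u $ i)"
  using a[of "u $ i"] DERIV_shift[of "a i" "a' (u $ i)" 0 "u $ i"] by (simp add: add.commute)
 from DERIV_cmult[OF DERIV_cmult_right[OF this, of P], of c] show ?thesis unfolding e1 e2 .
qed

lemma partial_deriv_prod:
 fixes a :: "'d::finite => real => real"
 assumes a: "\<And>x. DERIV (a i) x :> a' x"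
 shows "partial_deriv i (\<lambda>u. c * (\<Prod>j\<in>UNIV. a j (u $ j))) = (\<lambda>u. c * (\<Prod>j\<in>UNIV. (a(i := a')) j (u $ j)))" (is ?A)
  "partially_differentiable i (\<lambda>u. c * (\<Prod>j\<in>UNIV. a j (u $ j)))"
proof -
 note d = prod_axis_deriv[where a = a and i = i, OF a, of c]
 from partial_deriv_eq[OF d]
 show ?A
  "partially_differentiable i (\<lambda>u. c * (\<Prod>j\<in>UNIV. a j (u $ j)))" by auto
qed

text \<open>Leibniz expansion of the \<open>j\<close>-th space derivative of
  \<open>F 0 (t - s) x * chi (x / R)\<close>; indices above 1 all mean the second
  derivative.\<close>

definition tfac :: "(nat => real => real => real) => real => real => nat => real => real => real" where
 "tfac F t R j s x = (if j = 0 then F 0 (t - s) x * chi (x / R)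
  else if j = 1 then F 1 (t - s) x * chi (x / R) + F 0 (t - s) x * (chi1 (x / R) / R)
  else F 2 (t - s) x * chi (x / R) + 2 * F 1 (t - s) x * (chi1 (x / R) / R) + F 0 (t - s) x * (chi2 (x / R) / R\<^sup>2))"

lemma tfac_deriv:
 assumes F: "heat_family \<kappa> F ht" and R: "R > 0" and j: "j < 2"
 shows "DERIV (tfac F t R j s) x :> tfac F t R (Suc j) s x"
proof -
 have d: "DERIV (F j \<tau>) x :> F (Suc j) \<tau> x" if "j < 3" for j \<tau>
  using F that by (simp add: heat_family_def)
 have "DERIV (\<lambda>x. x / R) x :> 1 / R" by (intro DERIV_cdivide DERIV_ident)
 note c = DERIV_chain2[OF chi_deriv(1) this] DERIV_chain2[OF chi_deriv(2) this]
 consider "j = 0" | "j = 1" using j by linarith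
 thus ?thesis
 proof cases
  case 1
  have "DERIV (\<lambda>x. F 0 (t - s) x * chi (x / R)) x :> F (Suc 0) (t - s) x * chi (x / R) + (chi1 (x / R) * (1 / R)) * F 0 (t - s) x"
   by (rule DERIV_mult[OF d c(1)]) simp
  thus ?thesis using 1 by (simp add: tfac_def[abs_def] mult_ac)
 next
  case 2
  have "((\<lambda>x. F 1 (t - s) x * chi (x / R) + F 0 (t - s) x * (chi1 (x / R) / R)) has_real_derivative
   (F (Suc 1) (t - s) x * chi (x / R) + (chi1 (x / R) * (1 / R)) * F 1 (t - s) x) +
   (F (Suc 0) (t - s) x * (chi1 (x / R) / R) + ((chi2 (x / R) * (1 / R)) / R) * F 0 (t - s) x)) (at x)"
   by (intro DERIV_add DERIV_mult DERIV_cdivide c d) simp_all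
  thus ?thesis using 2 by (simp add: tfac_def[abs_def] numeral_2_eq_2 power2_eq_square algebra_simps)
 qed
qed

lemma tfac_time_deriv:
 assumes F: "heat_family \<kappa> F ht"
 shows "DERIV (\<lambda>s. tfac F t R 0 s x) s :> - ht (t - s) x * chi (x / R)"
proof -
 have "DERIV (\<lambda>\<sigma>. F 0 \<sigma> x) (t - s) :> ht (t - s) x" using F by (simp add: heat_family_def)
 from DERIV_chain2[OF this DERIV_diff[OF DERIV_const DERIV_ident]]
 have "DERIV (\<lambda>s. F 0 (t - s) x) s :> ht (t - s) x * (0 - 1)" .
 from DERIV_cmult_right[OF this, of "chi (x / R)"] show ?thesis by (simp add: tfac_def)
qed

lemma heat_family_continuous:
 assumes F: "heat_family \<kappa> F ht" and "j <= 2" "continuous_on A a" "continuous_on A b"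
 shows "continuous_on A (\<lambda>p. F j (a p) (b p))" (is ?A) "continuous_on A (\<lambda>p. ht (a p) (b p))"
proof -
 have "continuous_on UNIV (\<lambda>(\<tau>, u). F j \<tau> u)" "continuous_on UNIV (\<lambda>(\<tau>, u). ht \<tau> u)"
  using assms by (simp_all add: heat_family_def)
 note c = this[THEN continuous_on_compose2, OF continuous_on_Pair[OF assms(3,4)]]
 show ?A "continuous_on A (\<lambda>p. ht (a p) (b p))"
  using c by simp_all
qed

lemma tfac_continuous:
 assumes F: "heat_family \<kappa> F ht" and R: "R > 0" and j: "j <= 2" and ab: "continuous_on A a" "continuous_on A b"
 shows "continuous_on A (\<lambda>p. tfac F t R j (a p) (b p))"
proof -
 have t: "continuous_on A (\<lambda>p. t - a p)" by (intro continuous_intros ab)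
 note c = heat_family_continuous(1)[OF F _ t ab(2)]
 have bR: "continuous_on A (\<lambda>p. b p / R)" using R by (intro continuous_intros ab) auto
 have k: "continuous_on A (\<lambda>p. chi (b p / R))" "continuous_on A (\<lambda>p. chi1 (b p / R))" "continuous_on A (\<lambda>p. chi2 (b p / R))"
  by (rule continuous_on_compose2[OF chi_continuous(1)[of UNIV] bR] continuous_on_compose2[OF chi_continuous(2)[of UNIV] bR]
    continuous_on_compose2[OF chi_continuous(3)[of UNIV] bR]; simp)+
 consider "j = 0" | "j = 1" | "j = 2" using j by linarith
 thus ?thesis
  unfolding tfac_def by cases (use R in \<open>auto intro!: continuous_intros c k\<close>)
qed

text \<open>Time is reversed, so for \<open>s > t\<close> the family is evaluated at negative times,
  down to \<open>- 1\<close> where the time cutoff ends.\<close>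

definition ptest :: "('d::finite => nat => real => real => real) => real => real => real => real^'d => real" where
 "ptest F t R s u = time_cut t s * (\<Prod>i\<in>UNIV. tfac (F i) t R 0 s (u $ i))"

text \<open>Differentiating in a coordinate raises the index of one factor, so the indices count
  derivatives; mixed derivatives are included because \<open>S_Dif\<close> asks for them.\<close>

lemma ptest_partial:
 fixes F :: "'d::finite => nat => real => real => real"
 assumes F: "\<And>i. heat_family \<kappa> (F i) (ht i)" and R: "R > 0"
 shows "partial_deriv i (ptest F t R s) = (\<lambda>u. time_cut t s * (\<Prod>l\<in>UNIV. tfac (F l) t R (if l = i then 1 else 0) s (u $ l)))" (is ?A)
  "partially_differentiable i (ptest F t R s)" (is ?B)
  "partial_deriv j (partial_deriv i (ptest F t R s)) =
   (\<lambda>u. time_cut t s * (\<Prod>l\<in>UNIV. tfac (F l) t R ((if l = i then 1 else 0) + (if l = j then 1 else 0)) s (u $ l)))" (is ?C)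
  "partially_differentiable j (partial_deriv i (ptest F t R s))" (is ?D)
proof -
 define a where "a l = tfac (F l) t R 0 s" for l
 define b where "b l = tfac (F l) t R (if l = i then 1 else 0) s" for l
 have d1: "DERIV (a i) x :> tfac (F i) t R 1 s x" for x
  using tfac_deriv[OF F R, of 0 i t s x] by (simp add: a_def)
 have e1: "(a(i := tfac (F i) t R 1 s)) = b" by (auto simp: a_def b_def fun_eq_iff)
 have p: "ptest F t R s = (\<lambda>u. time_cut t s * (\<Prod>l\<in>UNIV. a l (u $ l)))" by (simp add: ptest_def[abs_def] a_def)
 note pd = partial_deriv_prod[where a = a and i = i, OF d1, of "time_cut t s", folded p, unfolded e1]
 show ?A
  unfolding pd(1) b_def ..
 show ?B by (rule pd(2))
 define m where "m = (if j = i then 1 else 0::nat)"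
 have d2: "DERIV (b j) x :> tfac (F j) t R (Suc m) s x" for x
  using tfac_deriv[OF F R, of m j t s x] by (simp add: b_def m_def)
 note pd2 = partial_deriv_prod[where a = b and i = j, OF d2, of "time_cut t s", folded pd(1)]
 show ?D by (rule pd2(2))
 have e2: "(b(j := tfac (F j) t R (Suc m) s)) l = tfac (F l) t R ((if l = i then 1 else 0) + (if l = j then 1 else 0)) s" for l
  by (auto simp: b_def m_def)
 show ?C
  unfolding pd2(1) e2 ..
qed

lemma ptest_time:
 fixes F :: "'d::finite => nat => real => real => real"
 assumes F: "\<And>i. heat_family \<kappa> (F i) (ht i)" and s: "s >= 0"
 shows "time_deriv (ptest F t R) s u = time_cut' t s * (\<Prod>i\<in>UNIV. tfac (F i) t R 0 s (u $ i)) +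
  time_cut t s * (\<Sum>i\<in>UNIV. (- ht i (t - s) (u $ i) * chi (u $ i / R)) * (\<Prod>j\<in>UNIV - {i}. tfac (F j) t R 0 s (u $ j)))" (is ?A)
  "(\<lambda>r. ptest F t R r u) differentiable (at s within {0..})" (is ?B)
proof -
 have "((\<lambda>s. \<Prod>i\<in>UNIV. tfac (F i) t R 0 s (u $ i)) has_derivative
   (\<lambda>y. \<Sum>i\<in>UNIV. ((- ht i (t - s) (u $ i) * chi (u $ i / R)) * y) * (\<Prod>j\<in>UNIV - {i}. tfac (F j) t R 0 s (u $ j)))) (at s)"
 proof (rule has_derivative_prod)
  show "((\<lambda>s. tfac (F i) t R 0 s (u $ i)) has_derivative (\<lambda>y. (- ht i (t - s) (u $ i) * chi (u $ i / R)) * y)) (at s)" for i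
   using tfac_time_deriv[OF F[of i], of t R "u $ i" s] unfolding has_field_derivative_def .
 qed
 hence "((\<lambda>s. \<Prod>i\<in>UNIV. tfac (F i) t R 0 s (u $ i)) has_real_derivative
   (\<Sum>i\<in>UNIV. (- ht i (t - s) (u $ i) * chi (u $ i / R)) * (\<Prod>j\<in>UNIV - {i}. tfac (F j) t R 0 s (u $ j)))) (at s)"
  unfolding has_field_derivative_def by (rule has_derivative_eq_rhs) (rule ext, unfold sum_distrib_right, rule sum.cong, simp_all add: mult_ac)
 note m = DERIV_mult'[OF time_cut_deriv this]
 have "((\<lambda>r. ptest F t R r u) has_real_derivative time_cut' t s * (\<Prod>i\<in>UNIV. tfac (F i) t R 0 s (u $ i)) +
  time_cut t s * (\<Sum>i\<in>UNIV. (- ht i (t - s) (u $ i) * chi (u $ i / R)) * (\<Prod>j\<in>UNIV - {i}. tfac (F j) t R 0 s (u $ j)))) (at s within {0..})"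
  unfolding ptest_def by (rule has_field_derivative_at_within) (rule DERIV_cong[OF m add.commute])
 note td = time_deriv_eq[where G = "ptest F t R" and u = u, OF s this]
 show ?A
  by (rule td(1))
 show ?B by (rule td(2))
qed

lemma ptest_S_Dif:
 fixes F :: "'d::finite => nat => real => real => real"
 assumes F: "\<And>i. heat_family \<kappa> (F i) (ht i)" and R: "R > 0" and t: "t >= 0"
 shows "ptest F t R \<in> S_Dif"
proof -
 let ?A = "{0..} \<times> UNIV :: (real \<times> (real^'d)) set"
 have cn: "continuous_on ?A (\<lambda>p. snd p $ i)" for i by (intro continuous_intros)
 have cs: "continuous_on ?A (\<lambda>p. fst p)" by (intro continuous_intros)
 have cT: "continuous_on ?A (\<lambda>p. time_cut t (fst p))" "continuous_on ?A (\<lambda>p. time_cut' t (fst p))"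
  by (rule continuous_on_compose2[OF time_cut_continuous(1)[of UNIV] cs] continuous_on_compose2[OF time_cut_continuous(2)[of UNIV] cs]; simp)+
 have cf: "continuous_on ?A (\<lambda>p. tfac (F i) t R j (fst p) (snd p $ i))" if "j <= 2" for i j
  by (rule tfac_continuous[OF F R that cs cn])
 have cp: "continuous_on ?A (\<lambda>p. time_cut t (fst p) * (\<Prod>i\<in>UNIV. tfac (F i) t R (J i) (fst p) (snd p $ i)))" if "\<And>i. J i <= 2" for J
  by (intro continuous_intros cT cf that)
 have ch: "continuous_on ?A (\<lambda>p. ht i (t - fst p) (snd p $ i))" for i
  by (rule heat_family_continuous(2)[OF F le_refl]) (intro continuous_intros)+
 have cc: "continuous_on ?A (\<lambda>p. chi (snd p $ i / R))" for i
  by (rule continuous_on_compose2[OF chi_continuous(1)[of UNIV]]) (use R in \<open>auto intro!: continuous_intros\<close>)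
 show ?thesis
  unfolding S_Dif_def mem_Collect_eq
 proof (intro conjI allI impI)
  show "\<exists>K. compact K \<and> K \<subseteq> {0..} \<times> UNIV \<and> (\<forall>s\<ge>0. \<forall>u. (s, u) \<notin> K \<longrightarrow> ptest F t R s u = 0)"
  proof (intro exI conjI allI impI)
   show "compact ({0..t + 1} \<times> cbox (\<chi> i. - R) (\<chi> i. R) :: (real \<times> (real^'d)) set)" by (intro compact_Times compact_Icc compact_cbox)
   show "{0..t + 1} \<times> cbox (\<chi> i. - R) (\<chi> i. R) \<subseteq> {0..} \<times> UNIV" by auto
   fix s :: real and u :: "real^'d" assume s: "s >= 0" and n: "(s, u) \<notin> {0..t + 1} \<times> cbox (\<chi> i. - R) (\<chi> i. R)"
   show "ptest F t R s u = 0"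
   proof (cases "s >= t + 1")
    case True thus ?thesis by (simp add: ptest_def time_cut_simps)
   next
    case False
    hence "u \<notin> cbox (\<chi> i. - R) (\<chi> i. R)" using n s by auto
    then obtain i where "\<not> (- R <= u $ i \<and> u $ i <= R)" by (auto simp: mem_box_cart)
    hence "abs (u $ i / R) >= 1" using R by (auto simp: abs_if divide_simps)
    hence "tfac (F i) t R 0 s (u $ i) = 0" using chi_bounds(5) by (simp add: tfac_def)
    hence "(\<Prod>i\<in>UNIV. tfac (F i) t R 0 s (u $ i)) = 0" by (intro prod_zero bexI[of _ i]) auto
    thus ?thesis by (simp add: ptest_def)
   qed
  qed
  show "continuous_on ?A (\<lambda>(s, u). ptest F t R s u)"
   unfolding case_prod_unfold ptest_def by (rule cp) simp
  show "(\<lambda>r. ptest F t R r u) differentiable (at s within {0..})" if "0 <= s" for s u by (rule ptest_time(2)[where F = F and ht = ht, OF F that])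
  show "continuous_on ?A (\<lambda>(s, u). time_deriv (ptest F t R) s u)"
  proof -
   have "continuous_on ?A (\<lambda>p. time_cut' t (fst p) * (\<Prod>i\<in>UNIV. tfac (F i) t R 0 (fst p) (snd p $ i)) +
    time_cut t (fst p) * (\<Sum>i\<in>UNIV. (- ht i (t - fst p) (snd p $ i) * chi (snd p $ i / R)) * (\<Prod>j\<in>UNIV - {i}. tfac (F j) t R 0 (fst p) (snd p $ j))))"
    by (intro continuous_intros cT ch cc cf) simp_all
   thus ?thesis
    by (rule continuous_on_eq) (auto simp: ptest_time(1)[where F = F and ht = ht, OF F])
  qed
  show "partially_differentiable i (ptest F t R s)" for i s by (rule ptest_partial(2)[where F = F and ht = ht, OF F R])
  show "continuous_on ?A (\<lambda>(s, u). partial_deriv i (ptest F t R s) u)" for i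
   unfolding ptest_partial(1)[where F = F and ht = ht, OF F R] case_prod_unfold by (rule cp) simp
  show "partially_differentiable j (partial_deriv i (ptest F t R s))" for i j s by (rule ptest_partial(4)[where F = F and ht = ht, OF F R])
  show "continuous_on ?A (\<lambda>(s, u). partial_deriv j (partial_deriv i (ptest F t R s)) u)" for i j
   unfolding ptest_partial(3)[where F = F and ht = ht, OF F R] case_prod_unfold by (rule cp) simp
 qed
qed

section \<open>Duality for weak solutions\<close>

definition weak_solution :: "bool => 'd::finite => real => real => (real^'d => real) => (real => real^'d => real) => bool" where
 "weak_solution slow = (if slow then neumann_weak_solution else heat_weak_solution)"

text \<open>A non-integrable \<open>f\<close> has integral 0 by convention, so domination alone
  decides; this suits integrands that are themselves integrals.\<close>

lemma abs_lebesgue_integral_le: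
 fixes f g :: "'a => real"
 assumes "integrable M g" "\<And>x. x \<in> space M ==> abs (f x) <= g x"
 shows "abs (integral\<^sup>L M f) <= integral\<^sup>L M g"
proof (cases "integrable M f")
 case True
 have "abs (integral\<^sup>L M f) <= (\<integral>x. abs (f x) \<partial>M)" by (rule integral_abs_bound)
 also have "\<dots> <= integral\<^sup>L M g" by (rule integral_mono) (use True assms in auto)
 finally show ?thesis .
next
 case False
 have "0 <= integral\<^sup>L M g" by (rule Bochner_Integration.integral_nonneg_AE) (use assms(2) in \<open>force intro!: AE_I2\<close>)
 thus ?thesis using False by (simp add: not_integrable_integral_eq)
qed

lemma profile_slice:
 assumes "profile T \<rho>" "t \<in> {0..T}"
 shows "\<rho> t \<in> borel_measurable borel" (is ?A) "\<rho> t u \<in> {0..1}"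
proof -
 show "\<rho> t u \<in> {0..1}" using assms by (simp add: profile_def)
 have m: "(\<lambda>u. (t, u)) \<in> borel \<rightarrow>\<^sub>M restrict_space borel ({0..T} \<times> UNIV)"
  by (rule measurable_restrict_space2) (use assms(2) in \<open>auto intro!: borel_measurable_continuous_onI continuous_intros\<close>)
 have "(\<lambda>(t, u). \<rho> t u) \<in> borel_measurable (restrict_space borel ({0..T} \<times> UNIV))"
  using assms(1) by (simp add: profile_def)
 from measurable_compose[OF m this] show ?A by simp
qed

text \<open>In the test function every factor is a backward solution times a spatial cutoff, so
  \<open>\<kappa> * L_Delta\<close> and the time derivative cancel except where a derivative falls
  on the cutoff. That defect is \<open>O(1 / R)\<close> relative to an integrable weight.\<close>

theorem weak_solution_duality:
 fixes k :: "'d::finite" and g :: "real^'d => real"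
 assumes sol: "weak_solution slow k T \<kappa> g \<rho>" and a: "admissible k slow \<kappa> Fm Fp" and t: "t \<in> {0..T}"
  and g: "g \<in> borel_measurable borel" "\<And>u. g u \<in> {0..1}"
 shows "(LINT u|lborel. \<rho> t u * prodH Fm Fp 0 u) = (LINT u|lborel. g u * prodH Fm Fp t u)"
proof -
 have t0: "t >= 0" using t by simp
 have tt: "0 \<in> {0..t}" "t \<in> {0..t}" using t0 by auto
 obtain C where b: "adm_bound t C Fm Fp" using adm_bound_exists[OF a] by blast
 have C: "C >= 0" using b by (simp add: adm_bound_def)
 have prof: "profile T \<rho>" using sol by (auto simp: weak_solution_def neumann_weak_solution_def heat_weak_solution_def split: if_splits)
 have \<rho>m: "\<rho> t \<in> borel_measurable borel" and \<rho>01: "\<And>s u. s \<in> {0..T} ==> \<rho> s u \<in> {0..1}"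
  using profile_slice[OF prof] t by auto
 obtain hm hp where hm: "\<And>i. heat_family \<kappa> (Fm i) (hm i)" and hp: "\<And>i. heat_family \<kappa> (Fp i) (hp i)"
  using a unfolding admissible_def by metis
 have off: "i ~= k ==> Fm i = Fp i" for i using a by (simp add: admissible_def)
 define X where "X R u = (\<Prod>i\<in>UNIV. chi (u $ i / R))" for R and u :: "real^'d"
 have X01: "0 <= X R u" "X R u <= 1" for R u unfolding X_def by (auto intro!: prod_nonneg prod_le_1 chi_bounds)
 have chim [measurable]: "chi \<in> borel_measurable borel" by (rule borel_measurable_continuous_onI[OF chi_continuous(1)])
 have Xm [measurable]: "X R \<in> borel_measurable borel" for R unfolding X_def[abs_def] by measurable
 have Xlim: "(\<lambda>m. X (real (Suc m)) u) \<longlonglongrightarrow> 1" for u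
 proof -
  have "(\<lambda>m. chi (x / real (Suc m))) \<longlonglongrightarrow> chi 0" for x
  proof (rule isCont_tendsto_compose[of 0 chi])
   show "isCont chi 0" using chi_deriv(1) by (rule DERIV_isCont)
   show "(\<lambda>m. x / real (Suc m)) \<longlonglongrightarrow> 0" by real_asymp
  qed
  hence "(\<lambda>m. X (real (Suc m)) u) \<longlonglongrightarrow> (\<Prod>i\<in>(UNIV::'d set). chi 0)"
   unfolding X_def by (intro tendsto_prod)
  thus ?thesis by (simp add: chi_def)
 qed
 define G where "G R = (ptest Fm t R, ptest Fp t R)" for R
 define PX where "PX R s u i = (\<Prod>j\<in>UNIV - {i}. fac Fm Fp j 0 (t - s) (u $ j) * chi (u $ j / R))" for R s i and u :: "real^'d"
 define Y where "Y R s u i = 2 * fac Fm Fp i 1 (t - s) (u $ i) * (chi1 (u $ i / R) / R) + fac Fm Fp i 0 (t - s) (u $ i) * (chi2 (u $ i / R) / R\<^sup>2)" for R s i and u :: "real^'d"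
 \<comment> \<open>The defect: \<open>PX\<close> collects the undisturbed factors, \<open>Y\<close>
   the terms with one or two derivatives on the cutoff.\<close>
 define E where "E R s u = \<kappa> * (\<Sum>i\<in>UNIV. PX R s u i * Y R s u i)" for R s u
 have pick: "fac Fm Fp i j \<tau> (u $ i) = (if u $ k < 0 then Fm i j \<tau> (u $ i) else Fp i j \<tau> (u $ i))" for i j \<tau> and u :: "real^'d"
  using off[of i] by (cases "i = k") (auto simp: fac_def glue1_def)
 have gl: "glue k (G R) s u = prodH Fm Fp (t - s) u * X R u" if "s <= t" for R s u
  using that by (simp add: G_def glue_def ptest_def time_cut_simps prodH_def X_def prod.distrib[symmetric] pick tfac_def)
 have Ed: "\<kappa> * L_Delta k (G R) s u + time_deriv (glue k (G R)) s u = E R s u" if s: "s \<in> {0..t}" and R: "R > 0" for R s u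
 proof -
  define F where "F = (if u $ k < 0 then Fm else Fp)"
  define h where "h = (if u $ k < 0 then hm else hp)"
  have hF: "\<And>i. heat_family \<kappa> (F i) (h i)" using hm hp by (auto simp: F_def h_def)
  have pF: "fac Fm Fp i j \<tau> (u $ i) = F i j \<tau> (u $ i)" for i j \<tau> using pick[of i j \<tau> u] by (simp add: F_def)
  have L: "L_Delta k (G R) s u = (\<Sum>i\<in>UNIV. partial_deriv i (partial_deriv i (ptest F t R s)) u)"
   by (auto simp: L_Delta_def G_def laplacian_def F_def)
  have "L_Delta k (G R) s u = (\<Sum>i\<in>UNIV. (\<Prod>j\<in>UNIV - {i}. tfac (F j) t R 0 s (u $ j)) * tfac (F i) t R 2 s (u $ i))"
   unfolding L ptest_partial(3)[where F = F and ht = h, OF hF R]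
  proof (rule sum.cong[OF refl])
   fix i
   have "(\<Prod>l\<in>UNIV - {i}. tfac (F l) t R ((if l = i then 1 else 0) + (if l = i then 1 else 0)) s (u $ l)) = (\<Prod>j\<in>UNIV - {i}. tfac (F j) t R 0 s (u $ j))"
    by (rule prod.cong) auto
   thus "time_cut t s * (\<Prod>l\<in>UNIV. tfac (F l) t R ((if l = i then 1 else 0) + (if l = i then 1 else 0)) s (u $ l)) =
     (\<Prod>j\<in>UNIV - {i}. tfac (F j) t R 0 s (u $ j)) * tfac (F i) t R 2 s (u $ i)"
    unfolding prod_split[of _ i] using s by (simp add: time_cut_simps numeral_2_eq_2)
  qed
  moreover have "time_deriv (glue k (G R)) s u = time_deriv (ptest F t R) s u"
  proof -
   have "(\<lambda>r. glue k (G R) r u) = (\<lambda>r. ptest F t R r u)" by (auto simp: glue_def G_def F_def)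
   thus ?thesis by (simp add: time_deriv_def)
  qed
  moreover have "time_deriv (ptest F t R) s u = (\<Sum>i\<in>UNIV. (- (\<kappa> * F i 2 (t - s) (u $ i)) * chi (u $ i / R)) * (\<Prod>j\<in>UNIV - {i}. tfac (F j) t R 0 s (u $ j)))"
  proof -
   have "h i (t - s) x = \<kappa> * F i 2 (t - s) x" for i x using hF[of i] s by (simp add: heat_family_def)
   thus ?thesis using ptest_time(1)[where F = F and ht = h and s = s and t = t and R = R and u = u, OF hF] s by (simp add: time_cut_simps)
  qed
  ultimately show ?thesis
   by (simp add: E_def PX_def Y_def pF sum_distrib_left sum.distrib[symmetric] tfac_def algebra_simps)
 qed
 \<comment> \<open>\<open>12 = 2 * 6\<close> and \<open>30\<close> come from the Leibniz rule and
   the bounds 6 and 30 on the first two derivatives of \<open>chi\<close>.\<close>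
 define K where "K R = abs \<kappa> * (CARD('d) * (C ^ CARD('d) * (12 / R + 30 / R\<^sup>2)))" for R
 have Eb: "abs (E R s u) <= K R * Wd u" if s: "s \<in> {0..t}" and R: "R > 0" for R s u
 proof -
  have m: "t - s \<in> {0..t}" using s by auto
  have "abs (PX R s u i * Y R s u i)
   <= C ^ CARD('d) * (12 / R + 30 / R\<^sup>2) * Wd u" for i
  proof -
   have 1: "abs (PX R s u i) <= (\<Prod>j\<in>UNIV - {i}. C * wt (u $ j))"
    unfolding PX_def abs_prod
   proof (intro prod_mono conjI)
    fix j
    have "abs (fac Fm Fp j 0 (t - s) (u $ j)) * abs (chi (u $ j / R)) <= (C * wt (u $ j)) * 1"
     using chi_bounds(1,2)[of "u $ j / R"] C by (intro mult_mono fac_bound[OF b m]) auto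
    thus "abs (fac Fm Fp j 0 (t - s) (u $ j) * chi (u $ j / R)) <= C * wt (u $ j)" by (simp add: abs_mult)
   qed simp
   have f: "abs (fac Fm Fp i 1 (t - s) (u $ i)) <= C * wt (u $ i)" "abs (fac Fm Fp i 0 (t - s) (u $ i)) <= C * wt (u $ i)"
    by (rule fac_bound[OF b m]; simp)+
   have c: "abs (chi1 (u $ i / R) / R) <= 6 / R" "abs (chi2 (u $ i / R) / R\<^sup>2) <= 30 / R\<^sup>2"
    using chi_bounds(3,4)[of "u $ i / R"] R by (auto simp: abs_divide divide_right_mono)
   have "abs (Y R s u i)
     <= 2 * (abs (fac Fm Fp i 1 (t - s) (u $ i)) * abs (chi1 (u $ i / R) / R)) + abs (fac Fm Fp i 0 (t - s) (u $ i)) * abs (chi2 (u $ i / R) / R\<^sup>2)"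
    unfolding Y_def by (rule order_trans[OF abs_triangle_ineq]) (simp add: abs_mult)
   also have "\<dots> <= 2 * ((C * wt (u $ i)) * (6 / R)) + (C * wt (u $ i)) * (30 / R\<^sup>2)"
    using C by (intro add_mono mult_left_mono mult_mono f c) auto
   also have "\<dots> = (C * wt (u $ i)) * (12 / R + 30 / R\<^sup>2)" by (simp add: algebra_simps)
   finally have 2: "abs (Y R s u i) <= (C * wt (u $ i)) * (12 / R + 30 / R\<^sup>2)" .
   have "abs (PX R s u i * Y R s u i)
    <= (\<Prod>j\<in>UNIV - {i}. C * wt (u $ j)) * ((C * wt (u $ i)) * (12 / R + 30 / R\<^sup>2))"
    by (subst abs_mult) (use C in \<open>intro mult_mono 1 2 prod_nonneg; simp\<close>)
   also have "\<dots> = (\<Prod>j\<in>UNIV. C * wt (u $ j)) * (12 / R + 30 / R\<^sup>2)"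
    unfolding prod_split[of "\<lambda>j. C * wt (u $ j)" i] by (simp only: mult_ac)
   also have "\<dots> = C ^ CARD('d) * (12 / R + 30 / R\<^sup>2) * Wd u" by (simp add: prod.distrib Wd_def)
   finally show ?thesis .
  qed
  hence "abs (\<Sum>i\<in>UNIV. PX R s u i * Y R s u i)
   <= (\<Sum>i\<in>(UNIV::'d set). C ^ CARD('d) * (12 / R + 30 / R\<^sup>2) * Wd u)"
   by (intro order_trans[OF sum_abs] sum_mono)
  thus ?thesis unfolding E_def abs_mult[of \<kappa>] K_def
   using mult_left_mono[of _ _ "abs \<kappa>"] by (fastforce simp: mult_ac)
 qed
 define I where "I = (LINT u|lborel. Wd (u :: real^'d))"
 have F0: "F_Dif k t \<rho> (G R) g \<kappa> = 0" if R: "R > 0" for R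
 proof (cases slow)
  case True
  have flat: "Fm k 1 \<tau> 0 = 0" "Fp k 1 \<tau> 0 = 0" for \<tau> using a True by (auto simp: admissible_def)
  \<comment> \<open>The normal derivative vanishes at the barrier because both the family and
    \<open>chi\<close> are flat there; this places the test function in
    \<open>S_Neu\<close>.\<close>
  have z: "partial_deriv k (ptest F t R s) u = 0" if F: "\<And>i. heat_family \<kappa> (F i) (h i)" and f: "\<And>\<tau>. F k 1 \<tau> 0 = 0" and u: "u $ k = 0"
   for F h s and u :: "real^'d"
  proof -
   have "tfac (F k) t R 1 s (u $ k) = 0" using f u by (simp add: tfac_def chi1_def)
   hence "(\<Prod>l\<in>UNIV. tfac (F l) t R (if l = k then 1 else 0) s (u $ l)) = 0" by (intro prod_zero bexI[of _ k]) auto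
   thus ?thesis unfolding ptest_partial(1)[where F = F and ht = h, OF F R] by simp
  qed
  have "G R \<in> S_Neu k T"
   unfolding S_Neu_def G_def using ptest_S_Dif[where F = Fm and ht = hm, OF hm R t0] ptest_S_Dif[where F = Fp and ht = hp, OF hp R t0]
    z[where F = Fm and h = hm, OF hm flat(1)] z[where F = Fp and h = hp, OF hp flat(2)] by auto
  thus ?thesis using sol True t by (auto simp: weak_solution_def neumann_weak_solution_def)
 next
  case False
  hence "Fm i = Fp i" for i using a off by (cases "i = k") (auto simp: admissible_def)
  hence "Fm = Fp" by blast
  hence "G R = (ptest Fp t R, ptest Fp t R)" by (simp add: G_def)
  thus ?thesis using sol False t ptest_S_Dif[where F = Fp and ht = hp, OF hp R t0] by (auto simp: weak_solution_def heat_weak_solution_def)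
 qed
 have err: "abs ((LINT u|lborel. \<rho> t u * (prodH Fm Fp 0 u * X R u)) - (LINT u|lborel. g u * (prodH Fm Fp t u * X R u))) <= t * (K R * I)" if R: "R > 0" for R
 proof -
  have "(LINT u|lborel. \<rho> t u * glue k (G R) t u) - (LINT u|lborel. g u * glue k (G R) 0 u) =
   (LINT s:{0..t}|lborel. LINT u|lborel. \<rho> s u * (\<kappa> * L_Delta k (G R) s u + time_deriv (glue k (G R)) s u))"
   using F0[OF R] by (simp add: F_Dif_def)
  moreover have "abs (LINT s:{0..t}|lborel. LINT u|lborel. \<rho> s u * (\<kappa> * L_Delta k (G R) s u + time_deriv (glue k (G R)) s u))
   <= (LINT s|lborel. indicator {0..t} s * (K R * I))"
   unfolding set_lebesgue_integral_def
  proof (rule abs_lebesgue_integral_le)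
   show "integrable lborel (\<lambda>s. indicator {0..t} s * (K R * I))" by (intro integrable_mult_left integrable_real_indicator) (auto simp: emeasure_lborel_Icc_eq)
   fix s
   have "abs (LINT u|lborel. \<rho> s u * (\<kappa> * L_Delta k (G R) s u + time_deriv (glue k (G R)) s u)) <= K R * I" if s: "s \<in> {0..t}"
   proof -
    have "abs (LINT u|lborel. \<rho> s u * (\<kappa> * L_Delta k (G R) s u + time_deriv (glue k (G R)) s u)) <= (LINT u|lborel. K R * Wd (u :: real^'d))"
    proof (rule abs_lebesgue_integral_le)
     show "integrable lborel (\<lambda>u :: real^'d. K R * Wd u)" by (rule integrable_mult_right[OF Wd_integrable])
     fix u
     have "\<rho> s u \<in> {0..1}" using \<rho>01[of s u] s t by auto
     hence "abs (\<rho> s u) * abs (E R s u) <= 1 * (K R * Wd u)" by (intro mult_mono Eb[OF s R]) auto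
     thus "abs (\<rho> s u * (\<kappa> * L_Delta k (G R) s u + time_deriv (glue k (G R)) s u)) <= K R * Wd u"
      unfolding Ed[OF s R] by (simp add: abs_mult)
    qed
    thus ?thesis by (simp add: I_def)
   qed
   thus "abs (indicator {0..t} s *\<^sub>R (LINT u|lborel. \<rho> s u * (\<kappa> * L_Delta k (G R) s u + time_deriv (glue k (G R)) s u))) <= indicator {0..t} s * (K R * I)"
    by (auto simp: indicator_def)
  qed
  moreover have "(LINT s|lborel. indicator {0..t} s * (K R * I)) = t * (K R * I)" using t0 by simp
  ultimately show ?thesis using gl t0 by simp
 qed
 have conv: "(\<lambda>m. LINT u|lborel. f u * (prodH Fm Fp \<tau> u * X (real (Suc m)) u)) \<longlonglongrightarrow> (LINT u|lborel. f u * prodH Fm Fp \<tau> u)"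
  if [measurable]: "f \<in> borel_measurable borel" and f: "\<And>u. f u \<in> {0..1}" and \<tau>: "\<tau> \<in> {0..t}" for f \<tau>
 proof (rule integral_dominated_convergence)
  note [measurable] = prodH_regular(2)[OF a]
  show "integrable lborel (\<lambda>u :: real^'d. C ^ CARD('d) * Wd u)" by (rule integrable_mult_right[OF Wd_integrable])
  show "AE u in lborel. (\<lambda>m. f u * (prodH Fm Fp \<tau> u * X (real (Suc m)) u)) \<longlonglongrightarrow> f u * prodH Fm Fp \<tau> u"
  proof (rule AE_I2)
   fix u
   have "(\<lambda>m. f u * (prodH Fm Fp \<tau> u * X (real (Suc m)) u)) \<longlonglongrightarrow> f u * (prodH Fm Fp \<tau> u * 1)" by (intro tendsto_intros Xlim)
   thus "(\<lambda>m. f u * (prodH Fm Fp \<tau> u * X (real (Suc m)) u)) \<longlonglongrightarrow> f u * prodH Fm Fp \<tau> u" by simp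
  qed
  show "AE u in lborel. norm (f u * (prodH Fm Fp \<tau> u * X (real (Suc m)) u)) <= C ^ CARD('d) * Wd u" for m
  proof (rule AE_I2)
   fix u
   have "abs (f u) * (abs (prodH Fm Fp \<tau> u) * abs (X (real (Suc m)) u)) <= 1 * ((C ^ CARD('d) * Wd u) * 1)"
    using f[of u] X01[of "real (Suc m)" u] C by (intro mult_mono prodH_bound(2)[OF b \<tau>]) auto
   thus "norm (f u * (prodH Fm Fp \<tau> u * X (real (Suc m)) u)) <= C ^ CARD('d) * Wd u" by (simp add: abs_mult)
  qed
  show "(\<lambda>u. f u * prodH Fm Fp \<tau> u) \<in> borel_measurable lborel"
   "(\<lambda>u. f u * (prodH Fm Fp \<tau> u * X (real (Suc m)) u)) \<in> borel_measurable lborel" for m by measurable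
 qed
 have l1: "(\<lambda>m. abs ((LINT u|lborel. \<rho> t u * (prodH Fm Fp 0 u * X (real (Suc m)) u)) - (LINT u|lborel. g u * (prodH Fm Fp t u * X (real (Suc m)) u))))
  \<longlonglongrightarrow> abs ((LINT u|lborel. \<rho> t u * prodH Fm Fp 0 u) - (LINT u|lborel. g u * prodH Fm Fp t u))"
  by (intro tendsto_intros conv \<rho>m \<rho>01 t g tt)
 have "(\<lambda>m. K (real (Suc m))) \<longlonglongrightarrow> abs \<kappa> * (CARD('d) * (C ^ CARD('d) * (0 + 0)))"
  unfolding K_def by (intro tendsto_intros) real_asymp+
 hence l2: "(\<lambda>m. t * (K (real (Suc m)) * I)) \<longlonglongrightarrow> t * (abs \<kappa> * (CARD('d) * (C ^ CARD('d) * (0 + 0))) * I)"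
  by (intro tendsto_intros)
 have "abs ((LINT u|lborel. \<rho> t u * prodH Fm Fp 0 u) - (LINT u|lborel. g u * prodH Fm Fp t u)) <= t * (abs \<kappa> * (CARD('d) * (C ^ CARD('d) * (0 + 0))) * I)"
  by (rule LIMSEQ_le[OF l1 l2]) (use err in auto)
 thus ?thesis by simp
qed

section \<open>Uniqueness and convergence of the empirical measure\<close>

lemma weak_solution_profile: "weak_solution slow k T \<kappa> g \<rho> ==> profile T \<rho>"
 by (auto simp: weak_solution_def neumann_weak_solution_def heat_weak_solution_def split: if_splits)

lemma aspan_bounded:
 assumes "L \<in> aspan k slow \<kappa>"
 shows "L \<in> borel_measurable borel" "\<exists>K. \<forall>u. abs (L u) <= K * Wd u"
proof -
 have "L \<in> borel_measurable borel \<and> (\<exists>K. \<forall>u. abs (L u) <= K * Wd u)" using assms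
 proof (induction rule: aspan.induct)
  case (aspan_base Fm Fp)
  obtain C where b: "adm_bound 0 C Fm Fp" using adm_bound_exists[OF aspan_base] by blast
  show ?case using prodH_regular(2)[OF aspan_base] prodH_bound(2)[OF b, of 0] by auto
 next
  case (aspan_add f h)
  then obtain K J where "\<And>u. abs (f u) <= K * Wd u" "\<And>u. abs (h u) <= J * Wd u" by blast
  hence "abs (f u + h u) <= (K + J) * Wd u" for u
   using abs_triangle_ineq[of "f u" "h u"] by (smt (verit) distrib_right)
  thus ?case using aspan_add by (auto intro!: borel_measurable_add)
 qed
 thus "L \<in> borel_measurable borel" "\<exists>K. \<forall>u. abs (L u) <= K * Wd u" by auto
qed

lemma integrable_profile_mult:
 fixes f r :: "real^'d::finite => real"
 assumes r: "r \<in> borel_measurable borel" "\<And>u. r u \<in> {0..1}" and f: "f \<in> borel_measurable borel" "\<And>u. abs (f u) <= K * Wd u"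
 shows "integrable lborel (\<lambda>u. r u * f u)"
proof (rule integrable_Wd_bound)
 show "(\<lambda>u. r u * f u) \<in> borel_measurable borel" using r f by measurable
 fix u
 have "abs (r u) * abs (f u) <= 1 * (K * Wd u)" using r(2)[of u] f(2)[of u] by (intro mult_mono) auto
 thus "abs (r u * f u) <= K * Wd u" by (simp add: abs_mult)
qed

lemma test_fun_Wd:
 fixes G :: "real^'d::finite => real"
 assumes G: "test_fun G" shows "G \<in> borel_measurable borel" "\<exists>K. \<forall>u. abs (G u) <= K * Wd u" (is ?A)
proof -
 show "G \<in> borel_measurable borel" using G by (auto simp: test_fun_def intro: borel_measurable_continuous_onI)
 have Wp: "Wd u > 0" for u :: "real^'d" unfolding Wd_def by (intro prod_pos) (auto simp: wt_def add_pos_nonneg)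
 have "continuous_on UNIV (Wd :: real^'d => real)"
  unfolding Wd_def[abs_def] wt_def by (intro continuous_intros) (auto simp: add_nonneg_eq_0_iff)
 hence "continuous_on UNIV (\<lambda>u :: real^'d. 1 / Wd u)" using Wp by (intro continuous_intros) (auto simp: less_imp_neq[symmetric])
 from test_fun_bounded[OF G this] obtain K where K: "\<And>u. abs (G u * (1 / Wd u)) <= K" by blast
 have "abs (G u) <= K * Wd u" for u using K[of u] Wp[of u] by (simp add: abs_mult pos_divide_le_eq abs_of_pos)
 thus ?A by blast
qed

lemma integral_profile_approx:
 fixes r G L :: "real^'d::finite => real"
 assumes r: "r \<in> borel_measurable borel" "\<And>u. r u \<in> {0..1}" and G: "test_fun G" and L: "L \<in> aspan k slow \<kappa>"
  and e: "\<And>u. abs (G u - L u) <= e * Wd u"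
 shows "abs ((LINT u|lborel. r u * G u) - (LINT u|lborel. r u * L u)) <= e * (LINT u|lborel. Wd (u :: real^'d))"
proof -
 obtain J K where J: "\<And>u. abs (G u) <= J * Wd u" and K: "\<And>u. abs (L u) <= K * Wd u"
  using test_fun_Wd(2)[OF G] aspan_bounded(2)[OF L] by blast
 have "(LINT u|lborel. r u * G u) - (LINT u|lborel. r u * L u) = (LINT u|lborel. r u * G u - r u * L u)"
  by (rule Bochner_Integration.integral_diff[symmetric])
   (rule integrable_profile_mult[OF r] test_fun_Wd(1) aspan_bounded(1) G L J K)+
 moreover have "abs (LINT u|lborel. r u * G u - r u * L u) <= (LINT u|lborel. e * Wd (u :: real^'d))"
 proof (rule abs_lebesgue_integral_le[OF integrable_mult_right[OF Wd_integrable]])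
  fix u
  have "abs (r u) * abs (G u - L u) <= 1 * (e * Wd u)" using r(2)[of u] e[of u] by (intro mult_mono) auto
  thus "abs (r u * G u - r u * L u) <= e * Wd u" by (simp add: abs_mult[symmetric] right_diff_distrib)
 qed
 ultimately show ?thesis by simp
qed

lemma box_cutoff:
 fixes a b :: "real^'d::finite"
 obtains \<phi> where "\<And>m. test_fun (\<phi> m)" "\<And>m u. \<phi> m u \<in> {0..indicator (box a b) u}" "\<And>u. (\<lambda>m. \<phi> m u) \<longlonglongrightarrow> indicator (box a b) u"
proof -
 define \<phi> where "\<phi> m u = min 1 (real m * infdist u (- box a b))" for m u
 have ne: "- box a b ~= {}" using bounded_box[of a b] not_bounded_UNIV by (metis Compl_empty_eq double_compl)
 have out: "\<phi> m u = 0" if "u \<notin> box a b" for m u using that by (simp add: \<phi>_def infdist_zero)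
 show ?thesis
 proof (rule that[of \<phi>])
  show "test_fun (\<phi> m)" for m
   unfolding test_fun_def
  proof (intro conjI exI allI impI)
   show "continuous_on UNIV (\<phi> m)" unfolding \<phi>_def[abs_def] by (intro continuous_intros continuous_on_infdist)
   show "compact (cbox a b)" by simp
   show "\<phi> m u = 0" if "u \<notin> cbox a b" for u using that box_subset_cbox[of a b] by (intro out) auto
  qed
  show "\<phi> m u \<in> {0..indicator (box a b) u}" for m u
   using out[of u m] infdist_nonneg[of u "- box a b"] by (cases "u \<in> box a b") (auto simp: \<phi>_def)
  show "(\<lambda>m. \<phi> m u) \<longlonglongrightarrow> indicator (box a b) u" for u
  proof (cases "u \<in> box a b")
   case True
   have "closed (- box a b)" by (rule closed_Compl[OF open_box])
   from in_closed_iff_infdist_zero[OF this ne, of u] have p: "infdist u (- box a b) > 0"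
    using True infdist_nonneg[of u "- box a b"] by auto
   have "eventually (\<lambda>m. 1 <= real m * infdist u (- box a b)) sequentially"
   proof -
    obtain N where N: "real N * infdist u (- box a b) > 1" using reals_Archimedean3[OF p] by blast
    have "1 <= real m * infdist u (- box a b)" if "m >= N" for m
     using N mult_right_mono[of "real N" "real m" "infdist u (- box a b)"] that p by linarith
    thus ?thesis by (auto simp: eventually_sequentially)
   qed
   hence "eventually (\<lambda>m. \<phi> m u = 1) sequentially" by eventually_elim (simp add: \<phi>_def)
   thus ?thesis using True by (simp add: tendsto_eventually)
  next
   case False thus ?thesis using out by simp
  qed
 qed
qed

text \<open>Indicators of open boxes are limits of test functions; boxes form an intersection-stable
  generator, so the measures with densities \<open>r\<close> and \<open>r'\<close> coincide, and
  densities are unique up to null sets.\<close>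

lemma AE_eq_of_test_fun:
 fixes r r' :: "real^'d::finite => real"
 assumes r: "r \<in> borel_measurable borel" "\<And>u. r u \<in> {0..1}" and r': "r' \<in> borel_measurable borel" "\<And>u. r' u \<in> {0..1}"
  and eq: "\<And>G. test_fun G ==> (LINT u|lborel. r u * G u) = (LINT u|lborel. r' u * G u)"
 shows "AE u in lborel. r' u = r u"
proof -
 have box_int: "integrable lborel (\<lambda>u. indicator (box a b) u :: real)" for a b :: "real^'d"
  by (rule integrable_real_indicator) (use emeasure_bounded_finite[OF bounded_box] in auto)
 have q: "integrable lborel (\<lambda>u. q u * indicator (box a b) u)" if q: "q \<in> borel_measurable borel" "\<And>u. q u \<in> {0..1}" for q :: "real^'d => real" and a b
  by (rule Bochner_Integration.integrable_bound[OF box_int[of a b]]) (use q in \<open>auto simp: abs_mult indicator_def\<close>)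
 have em: "emeasure (density lborel (\<lambda>u. ennreal (q u))) (box a b) = ennreal (LINT u|lborel. q u * indicator (box a b) u)"
  if q': "q \<in> borel_measurable borel" "\<And>u. q u \<in> {0..1}" for q :: "real^'d => real" and a b
 proof -
  have "emeasure (density lborel (\<lambda>u. ennreal (q u))) (box a b) = (\<integral>\<^sup>+u. ennreal (q u) * indicator (box a b) u \<partial>lborel)"
   by (rule emeasure_density) (use q' in auto)
  also have "\<dots> = (\<integral>\<^sup>+u. ennreal (q u * indicator (box a b) u) \<partial>lborel)" by (intro nn_integral_cong) (auto simp: indicator_def)
  also have "\<dots> = ennreal (LINT u|lborel. q u * indicator (box a b) u)"
   by (rule nn_integral_eq_integral[OF q[OF q']]) (use q'(2) in auto)
  finally show ?thesis .
 qed
 have lim: "(\<lambda>m. LINT u|lborel. q u * \<phi> m u) \<longlonglongrightarrow> (LINT u|lborel. q u * indicator (box a b) u)"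
  if q': "q \<in> borel_measurable borel" "\<And>u. q u \<in> {0..1}"
   and \<phi>: "\<And>m. test_fun (\<phi> m)" "\<And>m u. \<phi> m u \<in> {0..indicator (box a b) u}" "\<And>u. (\<lambda>m. \<phi> m u) \<longlonglongrightarrow> indicator (box a b) u"
  for q :: "real^'d => real" and \<phi> :: "nat => real^'d => real" and a b
 proof (rule integral_dominated_convergence)
  show "integrable lborel (\<lambda>u. indicator (box a b) u :: real)" by (rule box_int)
  note [measurable] = q'(1) test_fun_Wd(1)[OF \<phi>(1)]
  show "(\<lambda>u. q u * indicator (box a b) u) \<in> borel_measurable lborel" "(\<lambda>u. q u * \<phi> m u) \<in> borel_measurable lborel" for m by measurable
  show "AE u in lborel. (\<lambda>m. q u * \<phi> m u) \<longlonglongrightarrow> q u * indicator (box a b) u" by (intro AE_I2 tendsto_intros \<phi>)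
  show "AE u in lborel. norm (q u * \<phi> m u) <= indicator (box a b) u" for m
  proof (rule AE_I2)
   fix u
   have "abs (q u) * abs (\<phi> m u) <= 1 * indicator (box a b) u" using q'(2)[of u] \<phi>(2)[of m u] by (intro mult_mono) auto
   thus "norm (q u * \<phi> m u) <= indicator (box a b) u" by (simp add: abs_mult)
  qed
 qed
 have box_eq: "(LINT u|lborel. r u * indicator (box a b) u) = (LINT u|lborel. r' u * indicator (box a b) u)" for a b
 proof -
  obtain \<phi> where \<phi>: "\<And>m. test_fun (\<phi> m)" "\<And>m u. \<phi> m u \<in> {0..indicator (box a b) u}" "\<And>u. (\<lambda>m. \<phi> m u) \<longlonglongrightarrow> indicator (box a b) u"
   using box_cutoff[of a b] by blast
  show ?thesis using LIMSEQ_unique[OF lim[OF r \<phi>]] lim[OF r' \<phi>] eq[OF \<phi>(1)] by simp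
 qed
 let ?E = "range (\<lambda>(a, b). box a b :: (real^'d) set)"
 have "density lborel (\<lambda>u. ennreal (r' u)) = density lborel (\<lambda>u. ennreal (r u))"
 proof (rule measure_eqI_generator_eq[where E = ?E and \<Omega> = UNIV and A = "\<lambda>n. box (\<chi> i. - real n) (\<chi> i. real n)"])
  show "Int_stable ?E" by (auto simp: Int_stable_def box_Int_box)
  show "emeasure (density lborel (\<lambda>u. ennreal (r' u))) X = emeasure (density lborel (\<lambda>u. ennreal (r u))) X" if "X \<in> ?E" for X
   using that em[OF r] em[OF r'] box_eq by auto
  show "sets (density lborel (\<lambda>u. ennreal (r' u))) = sigma_sets UNIV ?E" "sets (density lborel (\<lambda>u. ennreal (r u))) = sigma_sets UNIV ?E"
   using sets_measure_of[of ?E UNIV] by (simp_all add: borel_eq_box)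
  show "(\<Union>n. box (\<chi> i. - real n) (\<chi> i. real n) :: (real^'d) set) = UNIV"
  proof (intro equalityI subsetI UNIV_I)
   fix u :: "real^'d"
   obtain n where n: "norm u < real n" using reals_Archimedean2 by blast
   have "abs (u $ i) < real n" for i using component_le_norm_cart[of u i] n by linarith
   thus "u \<in> (\<Union>n. box (\<chi> i. - real n) (\<chi> i. real n))" by (auto simp: mem_box_cart abs_less_iff minus_less_iff intro!: exI[of _ n])
  qed
  show "emeasure (density lborel (\<lambda>u. ennreal (r' u))) (box (\<chi> i. - real n) (\<chi> i. real n)) ~= \<infinity>" for n
   unfolding em[OF r'] by simp
 qed auto
 hence "AE u in lborel. ennreal (r' u) = ennreal (r u)"
  by (subst (asm) sigma_finite_measure.density_unique_iff[OF sigma_finite_lborel]) (use r r' in auto)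
 thus ?thesis by eventually_elim (use r(2) r'(2) in auto)
qed

theorem weak_solution_unique:
 fixes k :: "'d::finite" and g :: "real^'d => real"
 assumes \<kappa>: "\<kappa> > 0" and g: "g \<in> borel_measurable borel" "\<And>u. g u \<in> {0..1}"
  and sol: "weak_solution slow k T \<kappa> g \<rho>"
 shows "unique_solution T (weak_solution slow k T \<kappa> g) \<rho>"
 unfolding unique_solution_def
proof (intro conjI allI impI ballI sol)
 fix \<rho>' t assume sol': "weak_solution slow k T \<kappa> g \<rho>'" and t: "t \<in> {0..T}"
 note p = profile_slice[OF weak_solution_profile[OF sol] t] and p' = profile_slice[OF weak_solution_profile[OF sol'] t]
 have sp: "(LINT u|lborel. \<rho> t u * L u) = (LINT u|lborel. \<rho>' t u * L u)" if "L \<in> aspan k slow \<kappa>" for L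
  using that
 proof (induction rule: aspan.induct)
  case (aspan_base Fm Fp)
  show ?case using weak_solution_duality[OF sol aspan_base t g] weak_solution_duality[OF sol' aspan_base t g] by simp
 next
  case (aspan_add f h)
  obtain K J where K: "\<And>u. abs (f u) <= K * Wd u" and J: "\<And>u. abs (h u) <= J * Wd u" using aspan_bounded(2) aspan_add by metis
  have *: "(LINT u|lborel. q u * (f u + h u)) = (LINT u|lborel. q u * f u) + (LINT u|lborel. q u * h u)"
   if q: "q \<in> borel_measurable borel" "\<And>u. q u \<in> {0..1}" for q
   unfolding distrib_left
   by (rule Bochner_Integration.integral_add) (rule integrable_profile_mult[OF q] aspan_bounded(1) aspan_add K J)+
  show ?case unfolding *[OF p] *[OF p'] using aspan_add by simp
 qed
 show "AE u in lborel. \<rho>' t u = \<rho> t u"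
 proof (rule AE_eq_of_test_fun[OF p p'])
  fix G :: "real^'d => real" assume G: "test_fun G"
  define I where "I = (LINT u|lborel. Wd (u :: real^'d))"
  have I: "I >= 0" unfolding I_def by (intro Bochner_Integration.integral_nonneg) simp
  have "abs ((LINT u|lborel. \<rho> t u * G u) - (LINT u|lborel. \<rho>' t u * G u)) <= 0 + e" if e: "e > 0" for e
  proof -
   \<comment> \<open>The approximation is used for both solutions, each time at the price of this
     constant times the integral \<open>I\<close> of the weight; the \<open>+ 1\<close> covers
     \<open>I = 0\<close>.\<close>
   obtain L where L: "L \<in> aspan k slow \<kappa>" "\<And>u. abs (G u - L u) <= (e / (2 * (I + 1))) * Wd u"
    using aspan_dense[OF \<kappa> G, of "e / (2 * (I + 1))"] e I by (metis add_nonneg_pos divide_pos_pos mult_pos_pos zero_less_numeral zero_less_one)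
   have "2 * ((e / (2 * (I + 1))) * I) <= e" using e I by (simp add: field_simps)
   thus ?thesis
    using integral_profile_approx[OF p G L] integral_profile_approx[OF p' G L] sp[OF L(1)] unfolding I_def by linarith
  qed
  hence "abs ((LINT u|lborel. \<rho> t u * G u) - (LINT u|lborel. \<rho>' t u * G u)) <= 0" by (rule field_le_epsilon)
  thus "(LINT u|lborel. \<rho> t u * G u) = (LINT u|lborel. \<rho>' t u * G u)" by simp
 qed
qed

theorem weak_solution_hydrodynamic_limit:
 fixes k :: "'d::finite" and T \<alpha> \<beta> \<gamma> :: real
  and g :: "real^'d => real" and \<mu> :: "nat => 'd config measure" and P :: "nat => (real => 'd config) measure"
 assumes g: "g \<in> borel_measurable borel" "\<And>u. g u \<in> {0..1}"
  and \<mu>: "\<And>n. n >= 1 ==> prob_space (\<mu> n) \<and> sets (\<mu> n) = sets borel" and as: "associated \<mu> g"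
  and law: "\<And>n. n >= 1 ==> exclusion_law k T \<alpha> \<beta> \<gamma> n (\<mu> n) (P n)"
  and r: "regime slow \<alpha> \<beta> \<gamma>" and sol: "weak_solution slow k T (diff_coeff TYPE('d) \<gamma>) g \<rho>"
 shows "hydrodynamic_limit T P \<rho>"
proof -
 let ?\<kappa> = "diff_coeff TYPE('d) \<gamma>"
 have \<kappa>: "?\<kappa> > 0" by (rule diff_coeff_pos[OF regimeD(1)[OF r]])
 have main: "conv_prob P (\<lambda>n \<omega>. empirical n (\<omega> t) G) (LINT u|lborel. \<rho> t u * G u)" if t: "t \<in> {0..T}" and G: "test_fun G" for t G
 proof -
  note p = profile_slice[OF weak_solution_profile[OF sol] t]
  have lawD: "prob_space (P n)" "(\<lambda>\<omega>. \<omega> t) \<in> borel_measurable (P n)" if n: "n >= 1" for n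
  proof -
   obtain S where "markov_law T S (\<mu> n) (P n)" using law[OF n] by (auto simp: exclusion_law_def)
   hence ps: "prob_space (P n)" and s: "sets (P n) = sets (skorohod_space T)" by (auto simp: markov_law_def)
   show "prob_space (P n)" by (rule ps)
   show "(\<lambda>\<omega>. \<omega> t) \<in> borel_measurable (P n)"
    unfolding measurable_cong_sets[OF s refl] skorohod_space_def
    by (rule measurable_restrict_space1) (rule measurable_component_singleton[OF t])
  qed
  have em: "(\<lambda>\<omega>. empirical n (\<omega> t) f) \<in> borel_measurable (P n)" if n: "n >= 1" and f: "f \<in> aspan k slow ?\<kappa>" for n f
  proof -
   obtain K where "\<And>u. abs (f u) <= K * Wd u" using aspan_bounded(2)[OF f] by blast
   from measurable_compose[OF lawD(2)[OF n] empirical_continuous(2)[OF n this]] show ?thesis .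
  qed
  have sp: "conv_prob P (\<lambda>n \<omega>. empirical n (\<omega> t) L) (LINT u|lborel. \<rho> t u * L u)" if "L \<in> aspan k slow ?\<kappa>" for L
   using that
  proof (induction rule: aspan.induct)
   case (aspan_base Fm Fp)
   show ?case
    unfolding weak_solution_duality[OF sol aspan_base t g] by (rule product_convergence[OF g \<mu> as law t r aspan_base])
  next
   case (aspan_add f h)
   obtain K J where K: "\<And>u. abs (f u) <= K * Wd u" and J: "\<And>u. abs (h u) <= J * Wd u" using aspan_bounded(2) aspan_add(1,2) by metis
   have i: "(LINT u|lborel. \<rho> t u * (f u + h u)) = (LINT u|lborel. \<rho> t u * f u) + (LINT u|lborel. \<rho> t u * h u)"
    unfolding distrib_left
    by (rule Bochner_Integration.integral_add) (rule integrable_profile_mult[OF p] aspan_bounded(1) aspan_add(1,2) K J)+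
   have ad: "conv_prob P (\<lambda>n \<omega>. empirical n (\<omega> t) f + empirical n (\<omega> t) h) ((LINT u|lborel. \<rho> t u * f u) + (LINT u|lborel. \<rho> t u * h u))"
    by (rule conv_prob_add[OF lawD(1) em em aspan_add(3,4)]) (use aspan_add(1,2) in auto)
   show ?case unfolding i
   proof (rule conv_prob_approx[OF lawD(1)])
    fix \<epsilon> :: real assume e: "\<epsilon> > 0"
    have "\<forall>\<^sub>F n in sequentially. \<forall>\<omega>\<in>space (P n). abs (empirical n (\<omega> t) (\<lambda>u. f u + h u) - (empirical n (\<omega> t) f + empirical n (\<omega> t) h)) <= \<epsilon>"
     using eventually_ge_at_top[of 1] by eventually_elim (use e in \<open>simp add: empirical_add[OF _ K J]\<close>)
    thus "\<exists>Y d. (\<forall>n\<ge>1. Y n \<in> borel_measurable (P n)) \<and> conv_prob P Y d \<and> abs ((LINT u|lborel. \<rho> t u * f u) + (LINT u|lborel. \<rho> t u * h u) - d) <= \<epsilon> \<and>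
      (\<forall>\<^sub>F n in sequentially. \<forall>\<omega>\<in>space (P n). abs (empirical n (\<omega> t) (\<lambda>u. f u + h u) - Y n \<omega>) <= \<epsilon>)"
     using em aspan_add(1,2) ad e
     by (intro exI[of _ "\<lambda>n \<omega>. empirical n (\<omega> t) f + empirical n (\<omega> t) h"] exI[of _ "(LINT u|lborel. \<rho> t u * f u) + (LINT u|lborel. \<rho> t u * h u)"])
      (auto intro!: borel_measurable_add)
   qed
  qed
  define I where "I = (LINT u|lborel. Wd (u :: real^'d))"
  have I: "I >= 0" unfolding I_def by (intro Bochner_Integration.integral_nonneg) simp
  obtain K where K: "\<And>u. abs (G u) <= K * Wd u" using test_fun_Wd(2)[OF G] by blast
  show ?thesis
  proof (rule conv_prob_approx[OF lawD(1)])
   fix \<epsilon> :: real assume \<epsilon>: "\<epsilon> > 0"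
   \<comment> \<open>The approximation error is paid against the integral \<open>I\<close> of the
     weight and against its rescaled lattice sums, which are bounded by
     \<open>5 ^ d\<close>.\<close>
   define e where "e = \<epsilon> / (I + 5 ^ CARD('d))"
   have pos: "I + 5 ^ CARD('d) > 0" using I by (simp add: add_nonneg_pos)
   have e: "e > 0" unfolding e_def using \<epsilon> pos by simp
   have e2: "e * I + e * 5 ^ CARD('d) = \<epsilon>" using pos unfolding distrib_left[symmetric] e_def by simp
   have e3: "e * I <= \<epsilon>" "e * 5 ^ CARD('d) <= \<epsilon>" using e2 e I by (smt (verit) mult_nonneg_nonneg zero_le_power zero_le_numeral)+
   obtain L where L: "L \<in> aspan k slow ?\<kappa>" "\<And>u. abs (G u - L u) <= e * Wd u" using aspan_dense[OF \<kappa> G e] by blast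
   obtain J where J: "\<And>u. abs (L u) <= J * Wd u" using aspan_bounded(2)[OF L(1)] by blast
   have d: "abs (empirical n \<eta> G - empirical n \<eta> L) <= \<epsilon>" if n: "n >= 1" for n and \<eta> :: "'d config"
   proof -
    have J': "abs (- L u) <= J * Wd u" for u using J[of u] by simp
    have "empirical n \<eta> (\<lambda>u. G u + - L u) = empirical n \<eta> G + empirical n \<eta> (\<lambda>u. - L u)"
     by (rule empirical_add[OF n K J'])
    moreover have "empirical n \<eta> (\<lambda>u. - L u) = - empirical n \<eta> L"
     by (simp add: empirical_def infsum_uminus)
    moreover have "abs (empirical n \<eta> (\<lambda>u. G u + - L u)) <= e * 5 ^ CARD('d)" by (rule empirical_bound[OF n]) (use L(2) in simp)
    ultimately show ?thesis using e3(2) by simp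
   qed
   have "\<forall>\<^sub>F n in sequentially. \<forall>\<omega>\<in>space (P n). abs (empirical n (\<omega> t) G - empirical n (\<omega> t) L) <= \<epsilon>"
    using eventually_ge_at_top[of 1] by eventually_elim (use d in blast)
   thus "\<exists>Y d. (\<forall>n\<ge>1. Y n \<in> borel_measurable (P n)) \<and> conv_prob P Y d \<and> abs ((LINT u|lborel. \<rho> t u * G u) - d) <= \<epsilon> \<and>
      (\<forall>\<^sub>F n in sequentially. \<forall>\<omega>\<in>space (P n). abs (empirical n (\<omega> t) G - Y n \<omega>) <= \<epsilon>)"
    using em[OF _ L(1)] sp[OF L(1)] order_trans[OF integral_profile_approx[OF p G L] e3(1)[unfolded I_def]]
    by (intro exI[of _ "\<lambda>n \<omega>. empirical n (\<omega> t) L"] exI[of _ "LINT u|lborel. \<rho> t u * L u"]) auto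
  qed
 qed
 show ?thesis
  using main unfolding hydrodynamic_limit_def conv_prob_def by (simp add: mult.commute)
qed

section \<open>Existence: the heat evolution of a profile\<close>

definition cube :: "real => (real^'d::finite) set" where "cube R = cbox (\<chi> i. - R) (\<chi> i. R)"

lemma cube_iff: "u \<in> cube R \<longleftrightarrow> (\<forall>i. abs (u $ i) <= R)"
 unfolding cube_def by (simp only: mem_box_cart vec_lambda_beta) (intro iff_allI; linarith)

lemma cube_fun:
 fixes f :: "real^'d::finite => real"
 assumes c: "continuous_on UNIV f" and z: "\<And>u. u \<notin> cube R ==> f u = 0"
 shows "test_fun f" "\<exists>K. \<forall>u. abs (f u) <= K * Wd u" (is ?A) "integrable lborel f" "integral (cube R) f = (LINT u|lborel. f u)" (is ?B)
proof -
 show t: "test_fun f" unfolding test_fun_def using c z by (intro conjI exI[of _ "cube R"]) (auto simp: cube_def)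
 show ?A by (rule test_fun_Wd(2)[OF t])
 thus i: "integrable lborel f" using integrable_Wd_bound[OF test_fun_Wd(1)[OF t]] by blast
 have "integral (cube R) f = integral UNIV (\<lambda>u. if u \<in> cube R then f u else 0)" by (rule Henstock_Kurzweil_Integration.integral_restrict_UNIV[symmetric])
 also have "(\<lambda>u. if u \<in> cube R then f u else 0) = f" using z by auto
 finally show ?B using integral_lborel[OF i] by simp
qed

lemma lborel_translate:
 fixes f :: "real^'d::finite => real"
 assumes "f \<in> borel_measurable borel"
 shows "(LINT u|lborel. f (u + c)) = (LINT u|lborel. f u)" "integrable lborel f ==> integrable lborel (\<lambda>u. f (u + c))"
 using integral_distr[of "(+) c" lborel borel f] integrable_distr_eq[of "(+) c" lborel borel f] assms
 unfolding lborel_distr_plus by (simp_all add: add.commute)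

text \<open>The integral of a partial derivative is the derivative at \<open>0\<close> of the constant \<open>h \<mapsto> \<integral> F (u + h e\<^sub>i) du\<close>.\<close>

lemma integral_partial_zero:
 fixes F :: "real^'d::finite => real"
 assumes d: "\<And>u. DERIV (\<lambda>h. F (u + h *\<^sub>R axis i 1)) 0 :> F' u"
  and c: "continuous_on UNIV F" "continuous_on UNIV F'"
  and z: "\<And>u. u \<notin> cube R ==> F u = 0" "\<And>u. u \<notin> cube R ==> F' u = 0"
 shows "(LINT u|lborel. F' u) = 0"
proof -
 let ?e = "axis i 1 :: real^'d"
 \<comment> \<open>Shifts of length at most 1 keep the support inside the cube enlarged by 1, so all
   integrals run over one fixed compact set.\<close>
 have far: "u + h *\<^sub>R ?e \<notin> cube R" if u: "u \<notin> cube (R + 1)" and h: "h \<in> {-1..1}" for u h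
 proof -
  obtain j where j: "abs (u $ j) > R + 1" using u by (auto simp: cube_iff not_le)
  have "abs ((h *\<^sub>R ?e) $ j) <= 1" using h by (auto simp: axis_def)
  hence "abs ((u + h *\<^sub>R ?e) $ j) > R" using j unfolding vector_add_component by linarith
  thus ?thesis by (auto simp: cube_iff not_le)
 qed
 have sh: "continuous_on UNIV (\<lambda>u. F (u + h *\<^sub>R ?e))" for h
  by (rule continuous_on_compose2[OF c(1)]) (auto intro!: continuous_intros)
 have D: "((\<lambda>h. integral (cbox (\<chi> i. - (R + 1)) (\<chi> i. R + 1)) (\<lambda>u. F (u + h *\<^sub>R ?e))) has_field_derivative
   integral (cbox (\<chi> i. - (R + 1)) (\<chi> i. R + 1)) (\<lambda>u. F' (u + 0 *\<^sub>R ?e))) (at 0 within {-1..1})"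
 proof (rule leibniz_rule_field_derivative[where fx = "\<lambda>h u. F' (u + h *\<^sub>R ?e)"])
  show "((\<lambda>h. F (u + h *\<^sub>R ?e)) has_field_derivative F' (u + h *\<^sub>R ?e)) (at h within {-1..1})" for h u
  proof (rule has_field_derivative_at_within)
   have "(\<lambda>k. F (u + h *\<^sub>R ?e + k *\<^sub>R ?e)) = (\<lambda>k. F (u + (k + h) *\<^sub>R ?e))" by (simp add: scaleR_add_left add_ac)
   with d[of "u + h *\<^sub>R ?e"] have "((\<lambda>k. F (u + (k + h) *\<^sub>R ?e)) has_field_derivative F' (u + h *\<^sub>R ?e)) (at 0)" by simp
   thus "((\<lambda>h. F (u + h *\<^sub>R ?e)) has_field_derivative F' (u + h *\<^sub>R ?e)) (at h)"
    using DERIV_shift[of "\<lambda>h. F (u + h *\<^sub>R ?e)" "F' (u + h *\<^sub>R ?e)" 0 h] by simp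
  qed
  show "(\<lambda>u. F (u + h *\<^sub>R ?e)) integrable_on cbox (\<chi> i. - (R + 1)) (\<chi> i. R + 1)" for h
   by (rule integrable_continuous[OF continuous_on_subset[OF sh]]) auto
  show "continuous_on ({-1..1} \<times> cbox (\<chi> i. - (R + 1)) (\<chi> i. R + 1)) (\<lambda>(h, u). F' (u + h *\<^sub>R ?e))"
   unfolding case_prod_unfold by (rule continuous_on_compose2[OF c(2)]) (auto intro!: continuous_intros)
 qed auto
 have const: "integral (cube (R + 1)) (\<lambda>u. F (u + h *\<^sub>R ?e)) = (LINT u|lborel. F u)" if h: "h \<in> {-1..1}" for h
 proof -
  have "integral (cube (R + 1)) (\<lambda>u. F (u + h *\<^sub>R ?e)) = (LINT u|lborel. F (u + h *\<^sub>R ?e))"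
   by (rule cube_fun(4)[OF sh]) (use far h z in auto)
  thus ?thesis using lborel_translate(1)[OF borel_measurable_continuous_onI[OF c(1)]] by simp
 qed
 have "((\<lambda>h. integral (cube (R + 1)) (\<lambda>u. F (u + h *\<^sub>R ?e))) has_field_derivative integral (cube (R + 1)) F') (at 0)"
  using D unfolding cube_def[symmetric] by (simp add: at_within_Icc_at)
 from has_field_derivative_transform_within_open[OF this, of "{-1<..<1}" "\<lambda>h. LINT u|lborel. F u"]
 have "((\<lambda>h. LINT u|lborel. F u) has_field_derivative integral (cube (R + 1)) F') (at 0)" using const by auto
 hence "integral (cube (R + 1)) F' = 0" using DERIV_const DERIV_unique by blast
 moreover have "u \<notin> cube (R + 1) ==> F' u = 0" for u using z(2)[of u] far[of u 0] by auto
 ultimately show ?thesis using cube_fun(4)[OF c(2), of "R + 1"] by simp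
qed

text \<open>Derivatives of the heat kernel with multi-index \<open>J\<close>; the prefactor restores
  the constants omitted in \<open>gauss_kernel\<close>.\<close>

definition kern :: "('d::finite => nat) => real => real^'d => real" where
 "kern J v x = (1 / sqrt (2 * pi)) ^ CARD('d) * (\<Prod>i\<in>UNIV. gauss_deriv (J i) v (x $ i))"

lemma kern_partial:
 fixes J :: "'d::finite => nat"
 assumes v: "v > 0" and J: "J i < 3"
 shows "DERIV (\<lambda>h. kern J v (x + h *\<^sub>R axis i 1)) 0 :> kern (J(i := Suc (J i))) v x"
proof -
 have e: "((\<lambda>j. gauss_deriv (J j) v)(i := gauss_deriv (Suc (J i)) v)) = (\<lambda>j. gauss_deriv ((J(i := Suc (J i))) j) v)" by auto
 show ?thesis
  using prod_axis_deriv[where a = "\<lambda>j. gauss_deriv (J j) v" and i = i, OF gauss_deriv_space[OF v J], of "(1 / sqrt (2 * pi)) ^ CARD('d)" x]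
  unfolding e kern_def .
qed

lemma kern_time:
 fixes x :: "real^'d::finite"
 assumes s: "s > 0" and \<kappa>: "\<kappa> > 0"
 shows "DERIV (\<lambda>s. kern (\<lambda>_. 0) (2 * \<kappa> * s) x) s :> \<kappa> * (\<Sum>i\<in>UNIV. kern ((\<lambda>_. 0)(i := 2)) (2 * \<kappa> * s) x)"
proof -
 let ?c = "(1 / sqrt (2 * pi)) ^ CARD('d)"
 have "((\<lambda>s. \<Prod>i\<in>UNIV. gauss_deriv 0 (2 * \<kappa> * s) (x $ i)) has_derivative
   (\<lambda>y. \<Sum>i\<in>UNIV. ((\<kappa> * gauss_deriv 2 (2 * \<kappa> * s) (x $ i)) * y) * (\<Prod>j\<in>UNIV - {i}. gauss_deriv 0 (2 * \<kappa> * s) (x $ j)))) (at s)"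
 proof (rule has_derivative_prod)
  fix i
  have "DERIV (\<lambda>s. gauss_deriv 0 (2 * \<kappa> * s) (x $ i)) s :> gauss_deriv 2 (2 * \<kappa> * s) (x $ i) / 2 * (2 * \<kappa>)"
   by (rule DERIV_chain2[where f = "\<lambda>v. gauss_deriv 0 v (x $ i)", OF gauss_deriv_var]) (use s \<kappa> in \<open>auto intro!: derivative_eq_intros\<close>)
  hence "DERIV (\<lambda>s. gauss_deriv 0 (2 * \<kappa> * s) (x $ i)) s :> \<kappa> * gauss_deriv 2 (2 * \<kappa> * s) (x $ i)"
   by (rule DERIV_cong) simp
  thus "((\<lambda>s. gauss_deriv 0 (2 * \<kappa> * s) (x $ i)) has_derivative (\<lambda>y. (\<kappa> * gauss_deriv 2 (2 * \<kappa> * s) (x $ i)) * y)) (at s)"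
   unfolding has_field_derivative_def .
 qed
 hence "((\<lambda>s. \<Prod>i\<in>UNIV. gauss_deriv 0 (2 * \<kappa> * s) (x $ i)) has_real_derivative
   (\<Sum>i\<in>UNIV. (\<kappa> * gauss_deriv 2 (2 * \<kappa> * s) (x $ i)) * (\<Prod>j\<in>UNIV - {i}. gauss_deriv 0 (2 * \<kappa> * s) (x $ j)))) (at s)"
  unfolding has_field_derivative_def by (rule has_derivative_eq_rhs) (rule ext, unfold sum_distrib_right, rule sum.cong, simp_all add: mult_ac)
 from DERIV_cmult[OF this, of ?c]
 have "((\<lambda>s. kern (\<lambda>_. 0) (2 * \<kappa> * s) x) has_real_derivative ?c *
   (\<Sum>i\<in>UNIV. (\<kappa> * gauss_deriv 2 (2 * \<kappa> * s) (x $ i)) * (\<Prod>j\<in>UNIV - {i}. gauss_deriv 0 (2 * \<kappa> * s) (x $ j)))) (at s)"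
  unfolding kern_def .
 moreover have "kern ((\<lambda>_. 0)(i := 2)) (2 * \<kappa> * s) x = ?c * (gauss_deriv 2 (2 * \<kappa> * s) (x $ i) * (\<Prod>j\<in>UNIV - {i}. gauss_deriv 0 (2 * \<kappa> * s) (x $ j)))" for i
 proof -
  have "(\<Prod>j\<in>UNIV - {i}. gauss_deriv (((\<lambda>_. 0)(i := 2)) j) (2 * \<kappa> * s) (x $ j)) = (\<Prod>j\<in>UNIV - {i}. gauss_deriv 0 (2 * \<kappa> * s) (x $ j))"
   by (rule prod.cong) auto
  thus ?thesis unfolding kern_def prod_split[of _ i] by simp
 qed
 ultimately show ?thesis by (simp add: sum_distrib_left mult_ac)
qed

lemma kern_continuous:
 fixes x :: "'a::topological_space => real^'d::finite"
 assumes v: "continuous_on A v" "\<And>p. p \<in> A ==> v p > 0" and x: "continuous_on A x"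
 shows "continuous_on A (\<lambda>p. kern J (v p) (x p))"
proof -
 have xi: "continuous_on A (\<lambda>p. x p $ i)" for i by (intro continuous_intros x)
 have k: "continuous_on A (\<lambda>p. gauss_kernel (v p) (x p $ i))" for i
  unfolding gauss_kernel_def using v(2) by (intro continuous_intros v(1) xi) (auto simp: less_imp_neq[symmetric])
 have "continuous_on A (\<lambda>p. gauss_deriv j (v p) (x p $ i))" for i j
 proof -
  have nz: "\<And>p. p \<in> A ==> v p ~= 0" using v(2) by force
  consider "j = 0" | "j = 1" | "j = 2" | "j > 2" by linarith
  thus ?thesis unfolding gauss_deriv_def
   by cases (auto intro!: continuous_intros k v(1) xi simp: nz)
 qed
 thus ?thesis unfolding kern_def by (intro continuous_intros)
qed

section \<open>Gaussian averages and their time derivative\<close>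

definition std_gauss :: "(real^'d::finite) measure" where
 "std_gauss = density lborel (\<lambda>z. ennreal (\<Prod>i\<in>UNIV. std_normal_density (z $ i)))"

lemma sets_std_gauss [measurable_cong, simp]: "sets std_gauss = sets borel"
 and space_std_gauss [simp]: "space std_gauss = UNIV"
 by (simp_all add: std_gauss_def)

lemma prob_space_std_gauss: "prob_space (std_gauss :: (real^'d::finite) measure)"
proof
 have 1: "(\<integral>\<^sup>+x. ennreal (std_normal_density x) \<partial>lborel) = 1"
  by (subst nn_integral_eq_integral) (auto simp: integral_normal_density integrable_normal_density)
 have "emeasure (std_gauss :: (real^'d) measure) UNIV = (\<integral>\<^sup>+z. (\<Prod>i\<in>UNIV. ennreal (std_normal_density (z $ i))) \<partial>(lborel :: (real^'d) measure))"
  by (simp add: std_gauss_def emeasure_density prod_ennreal)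
 also have "\<dots> = (\<Prod>i\<in>(UNIV :: 'd set). \<integral>\<^sup>+x. ennreal (std_normal_density x) \<partial>lborel)" by (rule nn_integral_vec_prod) simp
 finally show "emeasure (std_gauss :: (real^'d) measure) (space std_gauss) = 1" by (simp add: 1)
qed

text \<open>Substitution \<open>u = a + c z\<close>. It passes between the average over
  \<open>z\<close>, which makes sense down to variance 0, and the kernel form, which can be
  differentiated for positive variance.\<close>

lemma kern_integral:
 fixes F :: "real^'d::finite => real"
 assumes c: "c > 0" and [measurable]: "F \<in> borel_measurable borel"
 shows "(LINT z|std_gauss. F (a + c *\<^sub>R z)) = (LINT u|lborel. kern (\<lambda>_. 0) (c\<^sup>2) (u - a) * F u)"
proof -
 define T where "T z = a + c *\<^sub>R z" for z :: "real^'d"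
 have [measurable]: "T \<in> borel \<rightarrow>\<^sub>M borel" unfolding T_def by measurable
 have dc: "abs c ^ DIM(real^'d) = c ^ CARD('d)" using c by simp
 have lb: "lborel = density (distr lborel borel T) (\<lambda>_. ennreal (c ^ CARD('d)))"
  using lborel_affine[of c a] c unfolding dc T_def by blast
 have [measurable]: "kern (\<lambda>_. 0) (c\<^sup>2) \<in> borel_measurable (borel :: (real^'d) measure)"
  using c by (intro borel_measurable_continuous_onI kern_continuous) (auto intro!: continuous_intros)
 have pw: "c ^ CARD('d) * kern (\<lambda>_. 0) (c\<^sup>2) (c *\<^sub>R z) = (\<Prod>i\<in>UNIV. std_normal_density (z $ i))" for z :: "real^'d"
 proof -
  have "c * (1 / sqrt (2 * pi) * gauss_deriv 0 (c\<^sup>2) (c * y)) = std_normal_density y" for y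
  proof -
   have "- (c * y)\<^sup>2 / (2 * c\<^sup>2) - ln (c\<^sup>2) / 2 = - y\<^sup>2 / 2 - ln c" using c by (simp add: power_mult_distrib ln_realpow)
   hence "gauss_deriv 0 (c\<^sup>2) (c * y) = exp (- y\<^sup>2 / 2 - ln c)" by (simp add: gauss_deriv_def gauss_kernel_def)
   also have "\<dots> = exp (- y\<^sup>2 / 2) / c" using c by (simp add: exp_diff)
   finally show ?thesis using c by (simp add: std_normal_density_def)
  qed
  hence "(\<Prod>i\<in>(UNIV :: 'd set). c * (1 / sqrt (2 * pi) * gauss_deriv 0 (c\<^sup>2) (c * z $ i))) = (\<Prod>i\<in>UNIV. std_normal_density (z $ i))"
   by (intro prod.cong) auto
  thus ?thesis unfolding kern_def prod.distrib by simp
 qed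
 have "(LINT u|lborel. kern (\<lambda>_. 0) (c\<^sup>2) (u - a) * F u) =
   (LINT u|density (distr lborel borel T) (\<lambda>_. ennreal (c ^ CARD('d))). kern (\<lambda>_. 0) (c\<^sup>2) (u - a) * F u)"
  using lb by (rule arg_cong)
 also have "\<dots> = (LINT u|distr lborel borel T. c ^ CARD('d) *\<^sub>R (kern (\<lambda>_. 0) (c\<^sup>2) (u - a) * F u))"
  by (rule integral_density) (use c in auto)
 also have "\<dots> = (LINT z|lborel. c ^ CARD('d) *\<^sub>R (kern (\<lambda>_. 0) (c\<^sup>2) (T z - a) * F (T z)))"
  by (rule integral_distr) auto
 also have "\<dots> = (LINT z|lborel. (\<Prod>i\<in>UNIV. std_normal_density (z $ i)) *\<^sub>R F (a + c *\<^sub>R z))"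
  using pw by (intro Bochner_Integration.integral_cong refl) (simp add: T_def mult.assoc[symmetric])
 also have "\<dots> = (LINT z|std_gauss. F (a + c *\<^sub>R z))"
  unfolding std_gauss_def by (rule integral_density[symmetric]) (auto intro!: prod_nonneg)
 finally show ?thesis ..
qed

text \<open>The quotient by the positive continuous weight is bounded on the compact set carrying
  \<open>E\<close>.\<close>

lemma support_bound:
 fixes E :: "real => real^'d::finite => real"
 assumes c: "continuous_on ({0..t} \<times> UNIV) (\<lambda>(s, u). E s u)" and z: "\<And>s u. s \<in> {0..t} ==> u \<notin> cube R ==> E s u = 0"
 obtains M where "M >= 0" "\<And>s u. s \<in> {0..t} ==> abs (E s u) <= M * Wd u"
proof -
 have Wp: "Wd u > 0" for u :: "real^'d" unfolding Wd_def by (intro prod_pos) (auto simp: wt_def add_pos_nonneg)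
 have "continuous_on A (\<lambda>p. Wd (snd p :: real^'d))" for A :: "(real \<times> (real^'d)) set"
  unfolding Wd_def[abs_def] wt_def by (intro continuous_intros) (auto simp: add_nonneg_eq_0_iff)
 hence "continuous_on ({0..t} \<times> cube R) (\<lambda>p. (case p of (s, u) => E s u) / Wd (snd p))"
  by (intro continuous_intros continuous_on_subset[OF c]) (auto simp: less_imp_neq[OF Wp, symmetric])
 moreover have "compact ({0..t} \<times> (cube R :: (real^'d) set))" unfolding cube_def by (intro compact_Times compact_Icc compact_cbox)
 ultimately have "bounded ((\<lambda>p. (case p of (s, u) => E s u) / Wd (snd p)) ` ({0..t} \<times> cube R))"
  by (intro compact_imp_bounded compact_continuous_image)
 then obtain M where M: "\<And>s u. s \<in> {0..t} ==> u \<in> cube R ==> abs (E s u / Wd u) <= M" unfolding bounded_iff by fastforce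
 have "abs (E s u) <= abs M * Wd u" if s: "s \<in> {0..t}" for s u
 proof (cases "u \<in> cube R")
  case True
  have "abs (E s u) <= M * Wd u" using M[OF s True] Wp[of u] by (simp add: abs_divide pos_divide_le_eq)
  also have "\<dots> <= abs M * Wd u" by (intro mult_right_mono) auto
  finally show ?thesis .
 qed (use z s in auto)
 thus ?thesis using that[of "abs M"] by auto
qed

text \<open>Dominated convergence along sequences on a probability space; the end point
  \<open>s = 0\<close> is included.\<close>

lemma gauss_avg_continuous:
 fixes E :: "real => real^'d::finite => real"
 assumes c: "continuous_on ({0..t} \<times> UNIV) (\<lambda>(s, u). E s u)" and b: "\<And>s u. s \<in> {0..t} ==> abs (E s u) <= M"
 shows "continuous_on {0..t} (\<lambda>s. LINT z|std_gauss. E s (a + sqrt (2 * \<kappa> * s) *\<^sub>R z))"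
 unfolding continuous_on_sequentially o_def
proof (intro allI ballI impI, elim conjE)
 interpret prob_space "std_gauss :: (real^'d) measure" by (rule prob_space_std_gauss)
 fix x :: "nat => real" and s assume s: "s \<in> {0..t}" and x: "\<forall>n. x n \<in> {0..t}" "x \<longlonglongrightarrow> s"
 have m: "(\<lambda>z. E r (a + sqrt (2 * \<kappa> * r) *\<^sub>R z)) \<in> borel_measurable std_gauss" if "r \<in> {0..t}" for r
 proof -
  have "continuous_on UNIV (\<lambda>z. case (r, a + sqrt (2 * \<kappa> * r) *\<^sub>R z) of (s, u) => E s u)"
   by (rule continuous_on_compose2[OF c]) (use that in \<open>auto intro!: continuous_intros\<close>)
  thus ?thesis unfolding measurable_cong_sets[OF sets_std_gauss refl] by (intro borel_measurable_continuous_onI) simp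
 qed
 show "(\<lambda>n. LINT z|std_gauss. E (x n) (a + sqrt (2 * \<kappa> * x n) *\<^sub>R z)) \<longlonglongrightarrow> (LINT z|std_gauss. E s (a + sqrt (2 * \<kappa> * s) *\<^sub>R z))"
 proof (rule integral_dominated_convergence[where w = "\<lambda>_. M"])
  show "AE z in std_gauss. (\<lambda>n. E (x n) (a + sqrt (2 * \<kappa> * x n) *\<^sub>R z)) \<longlonglongrightarrow> E s (a + sqrt (2 * \<kappa> * s) *\<^sub>R z)"
  proof (rule AE_I2)
   fix z
   have "(\<lambda>n. case (x n, a + sqrt (2 * \<kappa> * x n) *\<^sub>R z) of (s, u) => E s u) \<longlonglongrightarrow> (case (s, a + sqrt (2 * \<kappa> * s) *\<^sub>R z) of (s, u) => E s u)"
    by (rule continuous_on_tendsto_compose[OF c]) (use x s in \<open>auto intro!: tendsto_intros\<close>)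
   thus "(\<lambda>n. E (x n) (a + sqrt (2 * \<kappa> * x n) *\<^sub>R z)) \<longlonglongrightarrow> E s (a + sqrt (2 * \<kappa> * s) *\<^sub>R z)" by simp
  qed
 qed (use m s x b in auto)
qed

text \<open>What integration by parts asks of a test function on \<open>[0, t]\<close>, with the
  derivatives passed as functions of their own. Even extensions of one-sided test functions are
  meant to fit as well, and their derivatives are given by explicit formulas.\<close>

definition heat_test ::
  "real => real => (real => real^'d::finite => real) => (real => real^'d => real) =>
  ('d => real => real^'d => real) => ('d => real => real^'d => real) => bool" where
 "heat_test t R G Gt D1 D2 \<longleftrightarrow>
  (\<forall>s\<in>{0..t}. \<forall>u. u \<notin> cube R \<longrightarrow> G s u = 0 \<and> Gt s u = 0 \<and> (\<forall>i. D1 i s u = 0 \<and> D2 i s u = 0)) \<and>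
  (\<forall>s\<in>{0..t}. \<forall>u. ((\<lambda>r. G r u) has_real_derivative Gt s u) (at s within {0..t}) \<and>
    (\<forall>i. DERIV (\<lambda>h. G s (u + h *\<^sub>R axis i 1)) 0 :> D1 i s u \<and>
      DERIV (\<lambda>h. D1 i s (u + h *\<^sub>R axis i 1)) 0 :> D2 i s u)) \<and>
  continuous_on ({0..t} \<times> UNIV) (\<lambda>(s, u). G s u) \<and>
  continuous_on ({0..t} \<times> UNIV) (\<lambda>(s, u). Gt s u) \<and>
  (\<forall>i. continuous_on ({0..t} \<times> UNIV) (\<lambda>(s, u). D1 i s u) \<and> continuous_on ({0..t} \<times> UNIV) (\<lambda>(s, u). D2 i s u))"

lemma continuous_slice:
 assumes "continuous_on ({0..t} \<times> UNIV) (\<lambda>(s, u). E s u)" "s \<in> {0..t}" shows "continuous_on UNIV (E s)"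
proof -
 have "continuous_on UNIV (\<lambda>u. case (s, u) of (s, u) => E s u)"
  by (rule continuous_on_compose2[OF assms(1)]) (use assms(2) in \<open>auto intro!: continuous_intros\<close>)
 thus ?thesis by simp
qed

lemma heat_test_generator:
 assumes "heat_test t R G Gt D1 D2"
 shows "continuous_on ({0..t} \<times> UNIV) (\<lambda>(s, u). \<kappa> * (\<Sum>i\<in>UNIV. D2 i s u) + Gt s u)" (is ?A)
  "s \<in> {0..t} ==> u \<notin> cube R ==> \<kappa> * (\<Sum>i\<in>UNIV. D2 i s u) + Gt s u = 0"
proof -
 show ?A
  using assms unfolding heat_test_def case_prod_unfold by (intro continuous_intros) auto
 show "\<kappa> * (\<Sum>i\<in>UNIV. D2 i s u) + Gt s u = 0" if "s \<in> {0..t}" "u \<notin> cube R"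
  using assms that by (simp add: heat_test_def)
qed

text \<open>For \<open>0 < s < t\<close> the average is differentiated in kernel form and both space
  derivatives are moved from the kernel to \<open>G\<close>. The kernel is singular at
  \<open>s = 0\<close>, so the fundamental theorem is used with derivatives in the interior and mere
  continuity at the end points.\<close>

lemma gauss_avg_ftc:
 fixes G :: "real => real^'d::finite => real"
 assumes \<kappa>: "\<kappa> > 0" and t: "t >= 0" and h: "heat_test t R G Gt D1 D2"
 shows "(LINT z|std_gauss. G t (a + sqrt (2 * \<kappa> * t) *\<^sub>R z)) - G 0 a =
  (LINT s:{0..t}|lborel. LINT z|std_gauss. \<kappa> * (\<Sum>i\<in>UNIV. D2 i s (a + sqrt (2 * \<kappa> * s) *\<^sub>R z)) + Gt s (a + sqrt (2 * \<kappa> * s) *\<^sub>R z))"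
proof -
 interpret prob_space "std_gauss :: (real^'d) measure" by (rule prob_space_std_gauss)
 define F where "F s u = \<kappa> * (\<Sum>i\<in>UNIV. D2 i s u) + Gt s u" for s u
 define \<Phi> where "\<Phi> s = (LINT z|std_gauss. G s (a + sqrt (2 * \<kappa> * s) *\<^sub>R z))" for s
 define \<Psi> where "\<Psi> s = (LINT z|std_gauss. F s (a + sqrt (2 * \<kappa> * s) *\<^sub>R z))" for s
 have z: "G s u = 0" "Gt s u = 0" "D1 i s u = 0" "D2 i s u = 0" "F s u = 0" if "s \<in> {0..t}" "u \<notin> cube R" for s u i
  using h that by (auto simp: heat_test_def F_def)
 have cG: "continuous_on ({0..t} \<times> UNIV) (\<lambda>(s, u). G s u)" and cGt: "continuous_on ({0..t} \<times> UNIV) (\<lambda>(s, u). Gt s u)"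
  and cD1: "continuous_on ({0..t} \<times> UNIV) (\<lambda>(s, u). D1 i s u)" and cD2: "continuous_on ({0..t} \<times> UNIV) (\<lambda>(s, u). D2 i s u)" for i
  using h by (auto simp: heat_test_def)
 have cF: "continuous_on ({0..t} \<times> UNIV) (\<lambda>(s, u). F s u)" unfolding F_def by (rule heat_test_generator(1)[OF h])
 have cont: "continuous_on {0..t} (\<lambda>s. LINT z|std_gauss. E s (a + sqrt (2 * \<kappa> * s) *\<^sub>R z))"
  if c: "continuous_on ({0..t} \<times> UNIV) (\<lambda>(s, u). E s u)" and zE: "\<And>s u. s \<in> {0..t} ==> u \<notin> cube R ==> E s u = 0" for E :: "real => real^'d => real"
 proof -
  obtain M where M: "M >= 0" "\<And>s u. s \<in> {0..t} ==> abs (E s u) <= M * Wd u" using support_bound[OF c zE] by blast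
  have "abs (E s u) <= M" if "s \<in> {0..t}" for s u
   using M(2)[OF that, of u] mult_left_le[OF Wd_le_1[of u] M(1)] by linarith
  from gauss_avg_continuous[OF c this] show ?thesis .
 qed
 have deriv: "(\<Phi> has_vector_derivative \<Psi> s) (at s)" if s: "s \<in> {0<..<t}" for s
 proof -
  have sI: "s \<in> {0..t}" and v: "2 * \<kappa> * s > 0" using s \<kappa> by auto
  define K where "K r u = kern (\<lambda>_. 0) (2 * \<kappa> * r) (u - a)" for r u
  define K1 where "K1 i u = kern ((\<lambda>_. 0)(i := 1)) (2 * \<kappa> * s) (u - a)" for i u
  define K2 where "K2 i r u = kern ((\<lambda>_. 0)(i := 2)) (2 * \<kappa> * r) (u - a)" for i r u
  have kc: "continuous_on A (\<lambda>p. kern J (2 * \<kappa> * r p) (u p - a))" if "continuous_on A r" "continuous_on A u" "\<And>p. p \<in> A ==> r p > 0"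
   for A :: "'z::topological_space set" and r u J using that \<kappa> by (intro kern_continuous continuous_intros) auto
  have slice: "continuous_on UNIV (\<lambda>u. kern J (2 * \<kappa> * r) (u - a) * E r u)"
   if "r \<in> {0<..<t}" "continuous_on ({0..t} \<times> UNIV) (\<lambda>(s, u). E s u)" for r E J
   by (intro continuous_on_mult kc continuous_slice[OF that(2)]) (use that(1) in \<open>auto intro!: continuous_intros\<close>)
  have avg: "(LINT z|std_gauss. E r (a + sqrt (2 * \<kappa> * r) *\<^sub>R z)) = (LINT u|lborel. K r u * E r u)"
   if r: "r \<in> {0<..<t}" and cE: "continuous_on ({0..t} \<times> UNIV) (\<lambda>(s, u). E s u)" for r E
  proof -
   have "E r \<in> borel_measurable borel" by (rule borel_measurable_continuous_onI[OF continuous_slice[OF cE]]) (use r in auto)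
   from kern_integral[OF _ this, of "sqrt (2 * \<kappa> * r)" a] show ?thesis using r \<kappa> by (simp add: K_def)
  qed
  define fx where "fx r u = \<kappa> * (\<Sum>i\<in>UNIV. K2 i r u) * G r u + Gt r u * K r u" for r u
  have "((\<lambda>r. integral (cbox (\<chi> i. - R) (\<chi> i. R)) (\<lambda>u. K r u * G r u)) has_field_derivative integral (cbox (\<chi> i. - R) (\<chi> i. R)) (fx s)) (at s within {0<..<t})"
  proof (rule leibniz_rule_field_derivative[where fx = fx and f = "\<lambda>r u. K r u * G r u"])
   fix r u assume r: "r \<in> {0<..<t}"
   have "((\<lambda>r. G r u) has_real_derivative Gt r u) (at r within {0..t})" using h r by (simp add: heat_test_def)
   hence g: "((\<lambda>r. G r u) has_real_derivative Gt r u) (at r within {0<..<t})" by (rule has_field_derivative_subset) auto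
   have "((\<lambda>r. K r u) has_real_derivative \<kappa> * (\<Sum>i\<in>UNIV. K2 i r u)) (at r within {0<..<t})"
    unfolding K_def K2_def by (rule has_field_derivative_at_within[OF kern_time]) (use r \<kappa> in auto)
   from DERIV_mult[OF this g] show "((\<lambda>r. K r u * G r u) has_field_derivative fx r u) (at r within {0<..<t})" by (simp add: fx_def)
  next
   show "(\<lambda>u. K r u * G r u) integrable_on cbox (\<chi> i. - R) (\<chi> i. R)" if "r \<in> {0<..<t}" for r
    unfolding K_def by (rule integrable_continuous[OF continuous_on_subset[OF slice[OF that cG]]]) auto
  next
   have sub: "continuous_on ({0<..<t} \<times> cbox (\<chi> i. - R) (\<chi> i. R)) (\<lambda>p. E (fst p) (snd p))"
    if "continuous_on ({0..t} \<times> UNIV) (\<lambda>(s, u). E s u)" for E :: "real => real^'d => real"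
    by (rule continuous_on_subset[OF that[unfolded case_prod_unfold]]) auto
   have kb: "continuous_on ({0<..<t} \<times> cbox (\<chi> i. - R) (\<chi> i. R)) (\<lambda>p. kern J (2 * \<kappa> * fst p) (snd p - a))" for J
    by (rule kc[OF continuous_on_fst[OF continuous_on_id] continuous_on_snd[OF continuous_on_id]]) auto
   show "continuous_on ({0<..<t} \<times> cbox (\<chi> i. - R) (\<chi> i. R)) (\<lambda>(r, u). fx r u)"
    unfolding fx_def K_def K2_def case_prod_unfold
    by (rule continuous_on_add[OF continuous_on_mult[OF continuous_on_mult[OF continuous_on_const continuous_on_sum[OF kb]] sub[OF cG]]
       continuous_on_mult[OF sub[OF cGt] kb]])
  qed (use s in auto)
  hence 1: "((\<lambda>r. integral (cube R) (\<lambda>u. K r u * G r u)) has_field_derivative integral (cube R) (fx s)) (at s)"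
   using s by (simp add: cube_def at_within_open[of s "{0<..<t}"])
  have \<Phi>c: "integral (cube R) (\<lambda>u. K r u * G r u) = \<Phi> r" if r: "r \<in> {0<..<t}" for r
   unfolding \<Phi>_def avg[OF r cG] K_def by (rule cube_fun(4)[OF slice[OF r cG]]) (use r z in auto)
  have 2: "(\<Phi> has_field_derivative integral (cube R) (fx s)) (at s)"
   by (rule has_field_derivative_transform_within_open[OF 1, of "{0<..<t}"]) (use s \<Phi>c in auto)
  \<comment> \<open>Green's identity: \<open>Z i\<close> is the \<open>i\<close>-th partial
    derivative of \<open>K1 i u * G s u - K s u * D1 i s u\<close>, hence has integral 0.\<close>
  define Z where "Z i u = K2 i s u * G s u - K s u * D2 i s u" for i u
  have cK2G: "continuous_on UNIV (\<lambda>u. K2 i s u * G s u)" and cKD2: "continuous_on UNIV (\<lambda>u. K s u * D2 i s u)" for i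
   unfolding K_def K2_def by (rule slice[OF s cG] slice[OF s cD2])+
  have cZ: "continuous_on UNIV (Z i)" for i unfolding Z_def[abs_def] by (intro continuous_on_diff cK2G cKD2)
  have zZ: "u \<notin> cube R ==> Z i u = 0" for i u by (simp add: Z_def z[OF sI])
  have cKF: "continuous_on UNIV (\<lambda>u. K s u * F s u)" unfolding K_def by (rule slice[OF s cF])
  have zKF: "u \<notin> cube R ==> K s u * F s u = 0" for u by (simp add: z[OF sI])
  have Z0: "(LINT u|lborel. Z i u) = 0" for i
  proof (rule integral_partial_zero[where R = R and i = i and F = "\<lambda>u. K1 i u * G s u - K s u * D1 i s u"])
   fix u
   have sa: "u + x *\<^sub>R axis i 1 - a = (u - a) + x *\<^sub>R axis i 1" for x :: real by simp
   have k1: "DERIV (\<lambda>x. K1 i (u + x *\<^sub>R axis i 1)) 0 :> K2 i s u"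
    using kern_partial[OF v, of "(\<lambda>_. 0)(i := 1)" i "u - a"] unfolding K1_def K2_def sa by (simp add: numeral_2_eq_2)
   have k0: "DERIV (\<lambda>x. K s (u + x *\<^sub>R axis i 1)) 0 :> K1 i u"
    using kern_partial[OF v, of "\<lambda>_. 0" i "u - a"] unfolding K_def K1_def sa by simp
   have d: "DERIV (\<lambda>x. G s (u + x *\<^sub>R axis i 1)) 0 :> D1 i s u" "DERIV (\<lambda>x. D1 i s (u + x *\<^sub>R axis i 1)) 0 :> D2 i s u"
    using h sI by (auto simp: heat_test_def)
   from DERIV_diff[OF DERIV_mult[OF k1 d(1)] DERIV_mult[OF k0 d(2)]]
   show "DERIV (\<lambda>x. K1 i (u + x *\<^sub>R axis i 1) * G s (u + x *\<^sub>R axis i 1) - K s (u + x *\<^sub>R axis i 1) * D1 i s (u + x *\<^sub>R axis i 1)) 0 :> Z i u"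
    by (simp add: Z_def algebra_simps)
   show "continuous_on UNIV (\<lambda>u. K1 i u * G s u - K s u * D1 i s u)"
    unfolding K_def K1_def by (intro continuous_on_diff slice[OF s cG] slice[OF s cD1])
  qed (use cZ zZ z[OF sI] in auto)
  have iZ: "integrable lborel (Z i)" for i by (rule cube_fun(3)[OF cZ zZ])
  have iKF: "integrable lborel (\<lambda>u. K s u * F s u)" by (rule cube_fun(3)[OF cKF zKF])
  have fxe: "fx s u = K s u * F s u + \<kappa> * (\<Sum>i\<in>UNIV. Z i u)" for u
   by (simp add: fx_def F_def Z_def sum_subtractf sum_distrib_left sum_distrib_right algebra_simps)
  have cfx: "continuous_on UNIV (fx s)" unfolding fxe by (intro continuous_intros cKF cZ)
  have "integral (cube R) (fx s) = (LINT u|lborel. fx s u)"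
   by (rule cube_fun(4)[OF cfx]) (use zZ zKF fxe in simp)
  also have "\<dots> = (LINT u|lborel. K s u * F s u) + (LINT u|lborel. \<kappa> * (\<Sum>i\<in>UNIV. Z i u))"
   unfolding fxe by (intro Bochner_Integration.integral_add iKF integrable_mult_right Bochner_Integration.integrable_sum iZ)
  also have "(LINT u|lborel. \<kappa> * (\<Sum>i\<in>UNIV. Z i u)) = \<kappa> * (\<Sum>i\<in>UNIV. LINT u|lborel. Z i u)"
   using Bochner_Integration.integral_sum[of UNIV lborel Z] iZ by simp
  also have "(LINT u|lborel. K s u * F s u) + \<kappa> * (\<Sum>i\<in>UNIV. LINT u|lborel. Z i u) = \<Psi> s"
   unfolding \<Psi>_def avg[OF s cF] Z0 by simp
  finally show ?thesis using 2 by (simp add: has_real_derivative_iff_has_vector_derivative)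
 qed
 have c\<Psi>: "continuous_on {0..t} \<Psi>" unfolding \<Psi>_def[abs_def] by (rule cont[OF cF]) (rule z)
 have "(\<Psi> has_integral (\<Phi> t - \<Phi> 0)) {0..t}"
 proof (rule fundamental_theorem_of_calculus_interior[OF t _ deriv])
  show "continuous_on {0..t} \<Phi>" unfolding \<Phi>_def[abs_def] by (rule cont[OF cG]) (rule z)
 qed
 hence "\<Phi> t - \<Phi> 0 = integral {0..t} \<Psi>" by (simp add: integral_unique)
 also have "\<dots> = (LINT s:{0..t}|lborel. \<Psi> s)"
  by (rule set_borel_integral_eq_integral(2)[symmetric]) (rule borel_integrable_atLeastAtMost'[OF c\<Psi>])
 moreover have "\<Phi> 0 = G 0 a" using prob_space by (simp add: \<Phi>_def)
 ultimately show ?thesis by (simp only: \<Phi>_def \<Psi>_def F_def)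
qed

text \<open>Serves both sides of a change of variables: the profile enters through \<open>q\<close>,
  either translated by \<open>- b z\<close> with no shift in \<open>F\<close>, or fixed while
  \<open>F\<close> is translated by \<open>b z\<close>.\<close>

lemma shear_integrable:
 fixes F q :: "'z => real^'d::finite => real"
 assumes N: "finite_measure N" and [measurable]: "b \<in> N \<rightarrow>\<^sub>M borel"
  and Fm [measurable]: "(\<lambda>(z, u). F z u) \<in> borel_measurable (N \<Otimes>\<^sub>M borel)" and F: "\<And>z u. z \<in> space N ==> abs (F z u) <= M * Wd u"
  and qm [measurable]: "(\<lambda>(z, u). q z u) \<in> borel_measurable (N \<Otimes>\<^sub>M borel)" and q: "\<And>z u. z \<in> space N ==> abs (q z u) <= 1"
 shows "integrable (N \<Otimes>\<^sub>M lborel) (\<lambda>(z, u). q z u * F z (u + b z))"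
proof -
 interpret finite_measure N by (rule N)
 interpret pair_sigma_finite N "lborel :: (real^'d) measure" ..
 have Fs: "(\<lambda>p. F (fst p) (snd p + b (fst p))) \<in> borel_measurable (N \<Otimes>\<^sub>M borel)"
  using measurable_compose[OF _ Fm, of "\<lambda>p. (fst p, snd p + b (fst p))" "N \<Otimes>\<^sub>M borel"] by simp
 have qs: "(\<lambda>p. q (fst p) (snd p)) \<in> borel_measurable (N \<Otimes>\<^sub>M borel)" using qm by (simp add: case_prod_unfold)
 have sets: "sets (N \<Otimes>\<^sub>M lborel) = sets (N \<Otimes>\<^sub>M (borel :: (real^'d) measure))" by (rule sets_pair_measure_cong) auto
 have m: "(\<lambda>(z, u). q z u * F z (u + b z)) \<in> borel_measurable (N \<Otimes>\<^sub>M lborel)"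
  unfolding case_prod_unfold measurable_cong_sets[OF sets refl] by (rule borel_measurable_times[OF qs Fs])
 have sec: "(\<lambda>u. q z u * F z (u + b z)) \<in> borel_measurable lborel" if "z \<in> space N" for z
  using measurable_Pair2[OF m that] by simp
 have W: "integrable lborel (\<lambda>u. M * Wd (u + b z))" for z
  using lborel_translate(2)[OF _ Wd_integrable, of "b z"] Wd_integrable by (intro integrable_mult_right) (auto dest: borel_measurable_integrable)
 have le: "abs (q z u * F z (u + b z)) <= M * Wd (u + b z)" if "z \<in> space N" for z u
 proof -
  have "abs (q z u) * abs (F z (u + b z)) <= 1 * (M * Wd (u + b z))" using q[OF that, of u] F[OF that, of "u + b z"] by (intro mult_mono) auto
  thus ?thesis by (simp add: abs_mult)
 qed
 show ?thesis
 proof (rule Fubini_integrable[OF m])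
  show "AE z in N. integrable lborel (\<lambda>u. case (z, u) of (z, u) => q z u * F z (u + b z))"
  proof (rule AE_I2)
   fix z assume z: "z \<in> space N"
   show "integrable lborel (\<lambda>u. case (z, u) of (z, u) => q z u * F z (u + b z))"
    by (rule Bochner_Integration.integrable_bound[OF W[of z]]) (use sec[OF z] order_trans[OF le[OF z] abs_ge_self] in auto)
  qed
  show "integrable N (\<lambda>z. LINT u|lborel. norm (case (z, u) of (z, u) => q z u * F z (u + b z)))"
  proof (rule integrable_const_bound[where B = "M * (LINT u|lborel. Wd (u :: real^'d))"])
   show "(\<lambda>z. LINT u|lborel. norm (case (z, u) of (z, u) => q z u * F z (u + b z))) \<in> borel_measurable N"
    by (rule lborel.borel_measurable_lebesgue_integral) (use measurable_compose[OF m borel_measurable_norm] in \<open>simp add: case_prod_unfold\<close>)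
   show "AE z in N. norm (LINT u|lborel. norm (case (z, u) of (z, u) => q z u * F z (u + b z))) <= M * (LINT u|lborel. Wd (u :: real^'d))"
   proof (rule AE_I2)
    fix z assume z: "z \<in> space N"
    have "abs (LINT u|lborel. norm (q z u * F z (u + b z))) <= (LINT u|lborel. M * Wd (u + b z))"
     by (rule abs_lebesgue_integral_le[OF W]) (use le[OF z] in auto)
    also have "\<dots> = M * (LINT u|lborel. Wd (u :: real^'d))"
     using lborel_translate(1)[of "Wd :: real^'d => real" "b z"] borel_measurable_integrable[OF Wd_integrable] by simp
    finally show "norm (LINT u|lborel. norm (case (z, u) of (z, u) => q z u * F z (u + b z))) <= M * (LINT u|lborel. Wd (u :: real^'d))" by simp
   qed
  qed
 qed
qed

text \<open>Fubini and translation invariance move the random shift from \<open>g\<close> to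
  \<open>F\<close>. The measure \<open>N\<close> is left general: the Gaussian law alone serves a
  fixed time, its product with Lebesgue measure on \<open>[0, t]\<close> the time integral.\<close>

lemma shear_duality:
 fixes F :: "'z => real^'d::finite => real"
 assumes N: "finite_measure N" and bm [measurable]: "b \<in> N \<rightarrow>\<^sub>M borel"
  and Fm: "(\<lambda>(z, u). F z u) \<in> borel_measurable (N \<Otimes>\<^sub>M borel)" and F: "\<And>z u. z \<in> space N ==> abs (F z u) <= M * Wd u"
  and g [measurable]: "g \<in> borel_measurable borel" and g01: "\<And>u. g u \<in> {0..1}"
 shows "(LINT u|lborel. LINT z|N. g (u - b z) * F z u) = (LINT z|N. LINT u|lborel. g (u - b z) * F z u)" (is ?A)
  "(LINT a|lborel. g a * (LINT z|N. F z (a + b z))) = (LINT z|N. LINT u|lborel. g (u - b z) * F z u)" (is ?B)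
  "integrable lborel (\<lambda>a. g a * (LINT z|N. F z (a + b z)))" (is ?C)
  "integrable N (\<lambda>z. LINT u|lborel. g (u - b z) * F z u)" (is ?D)
proof -
 interpret finite_measure N by (rule N)
 interpret pair_sigma_finite N "lborel :: (real^'d) measure" ..
 have g1: "abs (g u) <= 1" for u using g01[of u] by auto
 have i1: "integrable (N \<Otimes>\<^sub>M lborel) (\<lambda>(z, u). g (u - b z) * F z u)"
  using shear_integrable[OF N _ Fm F, of "\<lambda>_. 0" "\<lambda>z u. g (u - b z)"] g1 by simp
 have i2: "integrable (N \<Otimes>\<^sub>M lborel) (\<lambda>(z, u). g u * F z (u + b z))"
  by (rule shear_integrable[OF N bm Fm F]) (use g1 in auto)
 show ?A
  by (rule Fubini_integral[OF i1])
 have tr: "(LINT a|lborel. g a * F z (a + b z)) = (LINT u|lborel. g (u - b z) * F z u)" if z: "z \<in> space N" for z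
 proof -
  have "F z \<in> borel_measurable borel" using measurable_Pair2[OF Fm z] by simp
  hence "(\<lambda>u. g (u - b z) * F z u) \<in> borel_measurable borel" by measurable
  from lborel_translate(1)[OF this, of "b z"] show ?thesis by simp
 qed
 have "(LINT a|lborel. g a * (LINT z|N. F z (a + b z))) = (LINT a|lborel. LINT z|N. g a * F z (a + b z))" by simp
 also have "\<dots> = (LINT z|N. LINT a|lborel. g a * F z (a + b z))" by (rule Fubini_integral[OF i2])
 also have "\<dots> = (LINT z|N. LINT u|lborel. g (u - b z) * F z u)" by (rule Bochner_Integration.integral_cong[OF refl tr])
 finally show ?B .
 show ?C using integrable_snd[OF i2] by simp
 show ?D by (rule integrable_fst[OF i1])
qed

text \<open>The heat semigroup as a Gaussian average, so that \<open>s = 0\<close> returns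
  \<open>g\<close> itself without a limit.\<close>

definition heat_evol :: "real => (real^'d::finite => real) => real => real^'d => real" where
 "heat_evol \<kappa> g s u = (LINT z|std_gauss. g (u - sqrt (2 * \<kappa> * s) *\<^sub>R z))"

lemma heat_evol_profile:
 fixes g :: "real^'d::finite => real"
 assumes [measurable]: "g \<in> borel_measurable borel" and g01: "\<And>u. g u \<in> {0..1}"
 shows "(\<lambda>(s, u). heat_evol \<kappa> g s u) \<in> borel_measurable borel" (is ?A) "heat_evol \<kappa> g s u \<in> {0..1}" (is ?B) "heat_evol \<kappa> g 0 u = g u"
  "heat_evol \<kappa> g s \<in> borel_measurable borel" (is ?C)
proof -
 interpret prob_space "std_gauss :: (real^'d) measure" by (rule prob_space_std_gauss)
 have "(\<lambda>p. LINT z|std_gauss. g (snd p - sqrt (2 * \<kappa> * fst p) *\<^sub>R z)) \<in> borel_measurable (borel \<Otimes>\<^sub>M (borel :: (real^'d) measure))"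
  by measurable
 thus m: ?A
  by (simp add: heat_evol_def case_prod_unfold borel_prod)
 show ?C unfolding heat_evol_def[abs_def] by measurable
 have i: "integrable std_gauss (\<lambda>z. g (u - sqrt (2 * \<kappa> * s) *\<^sub>R z))"
  by (rule integrable_const_bound[where B = 1]) (use g01 in auto)
 have "heat_evol \<kappa> g s u <= (LINT z|(std_gauss :: (real^'d) measure). 1)" unfolding heat_evol_def
  by (rule integral_mono[OF i]) (use g01 in auto)
 moreover have "heat_evol \<kappa> g s u >= 0" unfolding heat_evol_def by (rule Bochner_Integration.integral_nonneg) (use g01 in auto)
 ultimately show ?B using prob_space by simp
 show "heat_evol \<kappa> g 0 u = g u" using prob_space by (simp add: heat_evol_def)
qed

lemma heat_evol_pairing:
 fixes g E :: "real^'d::finite => real"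
 assumes g: "g \<in> borel_measurable borel" "\<And>u. g u \<in> {0..1}" and E: "E \<in> borel_measurable borel" "\<And>u. abs (E u) <= M * Wd u"
 shows "(LINT u|lborel. heat_evol \<kappa> g s u * E u) = (LINT z|std_gauss. LINT u|lborel. g (u - sqrt (2 * \<kappa> * s) *\<^sub>R z) * E u)" (is ?A)
  "(LINT u|lborel. heat_evol \<kappa> g s u * E u) = (LINT a|lborel. g a * (LINT z|std_gauss. E (a + sqrt (2 * \<kappa> * s) *\<^sub>R z)))" (is ?B)
  "integrable lborel (\<lambda>a. g a * (LINT z|std_gauss. E (a + sqrt (2 * \<kappa> * s) *\<^sub>R z)))" (is ?C)
proof -
 interpret prob_space "std_gauss :: (real^'d) measure" by (rule prob_space_std_gauss)
 note [measurable] = E(1)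
 have b: "(\<lambda>z. sqrt (2 * \<kappa> * s) *\<^sub>R z) \<in> (std_gauss :: (real^'d) measure) \<rightarrow>\<^sub>M borel" by measurable
 have Em: "(\<lambda>(z, u). E u) \<in> borel_measurable ((std_gauss :: (real^'d) measure) \<Otimes>\<^sub>M borel)" by measurable
 note d = shear_duality[OF finite_measure_axioms b Em E(2) g]
 have "(LINT u|lborel. heat_evol \<kappa> g s u * E u) = (LINT u|lborel. LINT z|std_gauss. g (u - sqrt (2 * \<kappa> * s) *\<^sub>R z) * E u)"
  by (simp add: heat_evol_def)
 also note d(1)
 finally show 1: ?A .
 show ?B
  unfolding 1 d(2) ..
 show ?C by (rule d(3))
qed

text \<open>By duality the evolution of \<open>g\<close> is exchanged for the Gaussian average of
  \<open>G\<close> around a point \<open>a\<close>. There \<open>gauss_avg_ftc\<close> holds for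
  each \<open>a\<close>, and integrating against \<open>g a\<close> gives the claim. Since
  \<open>g\<close> is merely measurable, all derivatives stay on the test function.\<close>

theorem heat_evol_weak:
 fixes g :: "real^'d::finite => real"
 assumes \<kappa>: "\<kappa> > 0" and t: "t >= 0" and h: "heat_test t R G Gt D1 D2"
  and g: "g \<in> borel_measurable borel" "\<And>u. g u \<in> {0..1}"
 shows "set_integrable lborel {0..t} (\<lambda>s. LINT u|lborel. heat_evol \<kappa> g s u * (\<kappa> * (\<Sum>i\<in>UNIV. D2 i s u) + Gt s u))" (is ?A)
  "(LINT u|lborel. heat_evol \<kappa> g t u * G t u) - (LINT u|lborel. g u * G 0 u) =
   (LINT s:{0..t}|lborel. LINT u|lborel. heat_evol \<kappa> g s u * (\<kappa> * (\<Sum>i\<in>UNIV. D2 i s u) + Gt s u))" (is ?B)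
proof -
 let ?\<gamma> = "std_gauss :: (real^'d) measure"
 interpret \<gamma>: prob_space ?\<gamma> by (rule prob_space_std_gauss)
 define F where "F s u = \<kappa> * (\<Sum>i\<in>UNIV. D2 i s u) + Gt s u" for s u
 have cF: "continuous_on ({0..t} \<times> UNIV) (\<lambda>(s, u). F s u)" unfolding F_def by (rule heat_test_generator(1)[OF h])
 have zF: "F s u = 0" if "s \<in> {0..t}" "u \<notin> cube R" for s u unfolding F_def by (rule heat_test_generator(2)[OF h that])
 have cG: "continuous_on ({0..t} \<times> UNIV) (\<lambda>(s, u). G s u)" and zG: "\<And>s u. s \<in> {0..t} ==> u \<notin> cube R ==> G s u = 0"
  using h by (auto simp: heat_test_def)
 obtain M where M: "M >= 0" "\<And>s u. s \<in> {0..t} ==> abs (F s u) <= M * Wd u" using support_bound[OF cF zF] by blast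
 obtain MG where MG: "MG >= 0" "\<And>s u. s \<in> {0..t} ==> abs (G s u) <= MG * Wd u" using support_bound[OF cG zG] by blast
 have slm: "E s \<in> borel_measurable borel" if "continuous_on ({0..t} \<times> UNIV) (\<lambda>(s, u). E s u)" "s \<in> {0..t}" for E :: "real => real^'d => real" and s
  by (rule borel_measurable_continuous_onI[OF continuous_slice[OF that]])
 \<comment> \<open>Clamping time to \<open>[0, t]\<close> extends the integrand continuously to all
   times, which gives joint measurability on the product space.\<close>
 define cl where "cl s = max 0 (min t s)" for s
 have cl: "cl s \<in> {0..t}" for s using t by (auto simp: cl_def)
 have cl_id: "s \<in> {0..t} ==> cl s = s" for s by (auto simp: cl_def)
 define F' where "F' s = F (cl s)" for s
 have "continuous_on UNIV (\<lambda>p. case (cl (fst p), snd p) of (s, u) => F s u)"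
  by (rule continuous_on_compose2[OF cF]) (use cl in \<open>auto intro!: continuous_intros simp: cl_def\<close>)
 hence F'm [measurable]: "(\<lambda>(s, u). F' s u) \<in> borel_measurable (borel \<Otimes>\<^sub>M borel)"
  unfolding borel_prod by (intro borel_measurable_continuous_onI) (simp add: F'_def case_prod_unfold)
 have F'b: "abs (F' s u) <= M * Wd u" for s u unfolding F'_def by (rule M(2)[OF cl])
 have F'1: "abs (F' s u) <= M" for s u using F'b[of s u] mult_left_le[OF Wd_le_1[of u] M(1)] by linarith
 \<comment> \<open>Lebesgue measure on \<open>[0, t]\<close> as a finite measure, so that time and
   Gaussian variable together form the index space for \<open>shear_duality\<close>.\<close>
 define Lt where "Lt = density lborel (\<lambda>s. ennreal (indicator {0..t} s))"
 have sLt [measurable_cong]: "sets Lt = sets borel" by (simp add: Lt_def)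
 have fLt: "finite_measure Lt"
 proof
  have "emeasure Lt (space Lt) = (\<integral>\<^sup>+s. indicator {0..t} s \<partial>lborel)" by (simp add: Lt_def emeasure_density ennreal_indicator)
  thus "emeasure Lt (space Lt) ~= \<infinity>" using t by (simp add: emeasure_lborel_Icc_eq)
 qed
 interpret Lt: finite_measure Lt by (rule fLt)
 interpret LG: pair_sigma_finite Lt ?\<gamma> ..
 have Lt_int: "(LINT s|Lt. f s) = (LINT s:{0..t}|lborel. f s)" if "f \<in> borel_measurable borel" for f :: "real => real"
  unfolding Lt_def set_lebesgue_integral_def by (rule integral_density) (use that in auto)
 have fN: "finite_measure (Lt \<Otimes>\<^sub>M ?\<gamma>)" by (rule finite_measure_pair_measure[OF \<gamma>.finite_measure_axioms fLt])
 interpret N: finite_measure "Lt \<Otimes>\<^sub>M ?\<gamma>" by (rule fN)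
 define b where "b p = sqrt (2 * \<kappa> * fst p) *\<^sub>R snd p" for p :: "real \<times> (real^'d)"
 have bm [measurable]: "b \<in> (Lt \<Otimes>\<^sub>M ?\<gamma>) \<rightarrow>\<^sub>M borel" unfolding b_def[abs_def] by measurable
 have Nm: "(\<lambda>(p, u). F' (fst p) u) \<in> borel_measurable ((Lt \<Otimes>\<^sub>M ?\<gamma>) \<Otimes>\<^sub>M (borel :: (real^'d) measure))"
  using measurable_compose[OF _ F'm, of "\<lambda>q. (fst (fst q), snd q)" "(Lt \<Otimes>\<^sub>M ?\<gamma>) \<Otimes>\<^sub>M borel"] by (simp add: case_prod_unfold)
 note d = shear_duality[OF fN bm Nm F'b g]
 define V where "V s = (LINT u|lborel. heat_evol \<kappa> g s u * F' s u)" for s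
 have F's: "F' s \<in> borel_measurable borel" for s unfolding F'_def by (rule slm[OF cF cl])
 have Vs: "V s = (LINT z|?\<gamma>. LINT u|lborel. g (u - b (s, z)) * F' s u)" for s
  unfolding V_def b_def fst_conv snd_conv by (rule heat_evol_pairing(1)[OF g F's F'b])
 have dN: "integrable (Lt \<Otimes>\<^sub>M ?\<gamma>) (\<lambda>(s, z). LINT u|lborel. g (u - b (s, z)) * F' s u)"
  using d(4) by (simp add: case_prod_unfold)
 have iV: "integrable Lt V" using LG.integrable_fst[OF dN] unfolding Vs[symmetric] .
 have Vm: "V \<in> borel_measurable borel" using borel_measurable_integrable[OF iV] by (simp add: measurable_cong_sets[OF sLt refl])
 have "set_integrable lborel {0..t} V"
  using iV integrable_density[of V lborel "indicator {0..t}"] Vm unfolding Lt_def set_integrable_def by simp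
 thus ?A
  by (rule set_integrable_cong[THEN iffD1, rotated 3]) (auto simp: V_def F'_def F_def cl_id)
 have ti: "t \<in> {0..t}" "0 \<in> {0..t}" using t by auto
 have A: "g a * (LINT z|?\<gamma>. G t (a + sqrt (2 * \<kappa> * t) *\<^sub>R z)) - g a * G 0 a = g a * (LINT p|(Lt \<Otimes>\<^sub>M ?\<gamma>). F' (fst p) (a + b p))" for a
 proof -
  have mp: "(\<lambda>p. F' (fst p) (a + b p)) \<in> borel_measurable (Lt \<Otimes>\<^sub>M ?\<gamma>)"
   using measurable_compose[OF _ F'm, of "\<lambda>p. (fst p, a + b p)" "Lt \<Otimes>\<^sub>M ?\<gamma>"] by simp
  have i: "integrable (Lt \<Otimes>\<^sub>M ?\<gamma>) (\<lambda>(s, z). F' s (a + b (s, z)))"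
   using N.integrable_const_bound[of "\<lambda>p. F' (fst p) (a + b p)" M] mp F'1 by (simp add: case_prod_unfold)
  have im: "(\<lambda>s. LINT z|?\<gamma>. F' s (a + b (s, z))) \<in> borel_measurable borel"
   using borel_measurable_integrable[OF LG.integrable_fst[OF i]] by (simp add: measurable_cong_sets[OF sLt refl])
  have "(LINT p|(Lt \<Otimes>\<^sub>M ?\<gamma>). F' (fst p) (a + b p)) = (LINT s|Lt. LINT z|?\<gamma>. F' s (a + b (s, z)))"
   using LG.integral_fst[OF i] by (simp add: case_prod_unfold)
  also have "\<dots> = (LINT s:{0..t}|lborel. LINT z|?\<gamma>. F' s (a + b (s, z)))" by (rule Lt_int[OF im])
  also have "\<dots> = (LINT s:{0..t}|lborel. LINT z|?\<gamma>. F s (a + sqrt (2 * \<kappa> * s) *\<^sub>R z))"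
   by (rule set_lebesgue_integral_cong) (auto simp: F'_def cl_id b_def)
  also have "\<dots> = (LINT z|?\<gamma>. G t (a + sqrt (2 * \<kappa> * t) *\<^sub>R z)) - G 0 a"
   unfolding F_def by (rule gauss_avg_ftc[OF \<kappa> t h, symmetric])
  finally show ?thesis by (simp add: right_diff_distrib)
 qed
 note pt = heat_evol_pairing[OF g slm[OF cG ti(1)] MG(2)[OF ti(1)], of \<kappa> t]
 have "(LINT u|lborel. heat_evol \<kappa> g t u * G t u) - (LINT u|lborel. g u * G 0 u) =
  (LINT a|lborel. g a * (LINT z|?\<gamma>. G t (a + sqrt (2 * \<kappa> * t) *\<^sub>R z)) - g a * G 0 a)"
  unfolding pt(2) by (rule Bochner_Integration.integral_diff[symmetric, OF pt(3) integrable_profile_mult[OF g slm[OF cG ti(2)] MG(2)[OF ti(2)]]])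
 also have "\<dots> = (LINT p|(Lt \<Otimes>\<^sub>M ?\<gamma>). LINT u|lborel. g (u - b p) * F' (fst p) u)" unfolding A by (rule d(2))
 also have "\<dots> = (LINT s|Lt. V s)" unfolding Vs using LG.integral_fst[OF dN] by (simp add: case_prod_unfold)
 also have "\<dots> = (LINT s:{0..t}|lborel. V s)" by (rule Lt_int[OF Vm])
 also have "\<dots> = (LINT s:{0..t}|lborel. LINT u|lborel. heat_evol \<kappa> g s u * (\<kappa> * (\<Sum>i\<in>UNIV. D2 i s u) + Gt s u))"
  by (rule set_lebesgue_integral_cong) (auto simp: V_def F'_def F_def cl_id)
 finally show ?B .
qed

section \<open>Existence of weak solutions\<close>

lemma partial_deriv_zero:
 fixes f :: "real^'d::finite => real"
 assumes z: "\<And>u. u \<notin> cube R ==> f u = 0" and u: "u \<notin> cube R"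
 shows "partial_deriv i f u = 0"
proof -
 have "open ((\<lambda>h. u + h *\<^sub>R axis i 1) -` (- cube R))"
  by (rule open_vimage) (auto simp: cube_def intro!: continuous_intros)
 moreover have "0 \<in> (\<lambda>h. u + h *\<^sub>R axis i 1) -` (- cube R)" using u by simp
 ultimately have "eventually (\<lambda>h. h \<in> (\<lambda>h. u + h *\<^sub>R axis i 1) -` (- cube R)) (nhds (0 :: real))" by (rule eventually_nhds_in_open)
 hence "eventually (\<lambda>h. f (u + h *\<^sub>R axis i 1) = 0) (nhds (0 :: real))" by eventually_elim (use z in auto)
 from deriv_cong_ev[OF this refl] show ?thesis by (simp add: partial_deriv_def)
qed

text \<open>Outside a cube containing the space projection of the support all derivatives vanish,
  because the complement of the cube is open.\<close>

lemma S_Dif_heat_test: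
 fixes G :: "real => real^'d::finite => real"
 assumes G: "G \<in> S_Dif"
 obtains R where "heat_test t R G (time_deriv G) (\<lambda>i s. partial_deriv i (G s)) (\<lambda>i s. partial_deriv i (partial_deriv i (G s)))"
proof -
 obtain K where K: "compact K" "\<And>s u. s >= 0 ==> (s, u) \<notin> K ==> G s u = 0" using G by (auto simp: S_Dif_def)
 have "bounded (snd ` K)" by (intro compact_imp_bounded compact_continuous_image K continuous_intros)
 then obtain R where R: "\<And>u. u \<in> snd ` K ==> norm u <= R" by (auto simp: bounded_iff)
 have z: "G s u = 0" if "s >= 0" "u \<notin> cube R" for s u
 proof (rule K(2)[OF that(1)])
  show "(s, u) \<notin> K"
  proof
   assume "(s, u) \<in> K"
   hence "norm u <= R" using R by force
   hence "abs (u $ i) <= R" for i using component_le_norm_cart[of u i] by linarith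
   thus False using that(2) by (simp add: cube_iff)
  qed
 qed
 have zt: "time_deriv G s u = 0" if s: "s >= 0" and u: "u \<notin> cube R" for s u
 proof (rule time_deriv_eq(1)[OF s])
  show "((\<lambda>r. G r u) has_real_derivative 0) (at s within {0..})"
   by (rule has_field_derivative_transform_within[where f = "\<lambda>_. 0" and d = 1]) (use s z u in auto)
 qed
 have z1: "partial_deriv i (G s) u = 0" if "s >= 0" "u \<notin> cube R" for i s u
  by (rule partial_deriv_zero[OF z]) (use that in auto)
 have z2: "partial_deriv i (partial_deriv i (G s)) u = 0" if "s >= 0" "u \<notin> cube R" for i s u
  by (rule partial_deriv_zero[OF z1]) (use that in auto)
 have pd: "DERIV (\<lambda>h. f (u + h *\<^sub>R axis i 1)) 0 :> partial_deriv i f u"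
  if "partially_differentiable i f" for i f and u :: "real^'d"
  using that DERIV_deriv_iff_real_differentiable unfolding partially_differentiable_def partial_deriv_def by blast
 have td: "((\<lambda>r. G r u) has_real_derivative time_deriv G s u) (at s within {0..t})" if "s >= 0" for s u
 proof -
  have "(\<lambda>r. G r u) differentiable (at s within {0..})" using G that by (simp add: S_Dif_def)
  hence "((\<lambda>r. G r u) has_real_derivative time_deriv G s u) (at s within {0..})"
   by (simp add: vector_derivative_works time_deriv_def has_real_derivative_iff_has_vector_derivative)
  thus ?thesis by (rule has_field_derivative_subset) auto
 qed
 have sub: "continuous_on ({0..t} \<times> UNIV) E" if "continuous_on ({0..} \<times> UNIV) E" for E :: "real \<times> (real^'d) => real"
  by (rule continuous_on_subset[OF that]) auto
 have "heat_test t R G (time_deriv G) (\<lambda>i s. partial_deriv i (G s)) (\<lambda>i s. partial_deriv i (partial_deriv i (G s)))"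
  unfolding heat_test_def using G by (auto simp: S_Dif_def z zt z1 z2 intro!: td pd sub)
 thus ?thesis by (rule that)
qed

section \<open>Even extension across the barrier\<close>

lemma glue_deriv:
 fixes A B :: "real => real"
 assumes A: "DERIV A 0 :> D" and B: "DERIV B 0 :> D" and 0: "A 0 = B 0"
 shows "DERIV (\<lambda>x. if x < 0 then B x else A x) 0 :> D"
 unfolding has_field_derivative_iff filterlim_at_split
proof
 have A': "((\<lambda>y. (A y - A 0) / (y - 0)) \<longlongrightarrow> D) (at_right 0)" and B': "((\<lambda>y. (B y - B 0) / (y - 0)) \<longlongrightarrow> D) (at_left 0)"
  using A B unfolding has_field_derivative_iff filterlim_at_split by auto
 show "((\<lambda>y. ((if y < 0 then B y else A y) - (if 0 < (0::real) then B 0 else A 0)) / (y - 0)) \<longlongrightarrow> D) (at_left 0)"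
  by (rule Lim_transform_eventually[OF B']) (use 0 in \<open>auto simp: eventually_at_filter\<close>)
 show "((\<lambda>y. ((if y < 0 then B y else A y) - (if 0 < (0::real) then B 0 else A 0)) / (y - 0)) \<longlongrightarrow> D) (at_right 0)"
  by (rule Lim_transform_eventually[OF A']) (auto simp: eventually_at_filter)
qed

lemma glue_deriv_everywhere:
 fixes A B :: "real => real"
 assumes A: "\<And>x. DERIV A x :> A' x" and B: "\<And>x. DERIV B x :> B' x" and 0: "A 0 = B 0" "A' 0 = B' 0"
 shows "DERIV (\<lambda>x. if x < 0 then B x else A x) x :> (if x < 0 then B' x else A' x)"
proof -
 consider "x < 0" | "x = 0" | "x > 0" by linarith
 thus ?thesis
 proof cases
  case 1
  have "DERIV (\<lambda>x. if x < 0 then B x else A x) x :> B' x"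
   by (rule has_field_derivative_transform_within_open[OF B, of "{..<0}"]) (use 1 in auto)
  thus ?thesis using 1 by simp
 next
  case 2 thus ?thesis using glue_deriv[where A = A and B = B and D = "A' 0", OF A[of 0] _ 0(1)] B[of 0] 0(2) by simp
 next
  case 3
  have "DERIV (\<lambda>x. if x < 0 then B x else A x) x :> A' x"
   by (rule has_field_derivative_transform_within_open[OF A, of "{0<..}"]) (use 3 in auto)
  thus ?thesis using 3 by simp
 qed
qed

text \<open>The condition \<open>f' 0 = 0\<close> makes the one-sided first derivatives agree at 0;
  the second derivatives agree since the sign enters squared. The sign \<sigma> selects the
  half-line whose values are kept.\<close>

lemma even_extension_deriv:
 fixes f :: "real => real"
 assumes f: "\<And>y. DERIV f y :> f' y" "\<And>y. DERIV (f') y :> f'' y" and 0: "f' 0 = 0" and \<sigma>: "\<sigma> = 1 \<or> \<sigma> = -1"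
 shows "DERIV (\<lambda>x. f (\<sigma> * abs x)) x :> \<sigma> * sgn x * f' (\<sigma> * abs x)" (is ?A)
  "DERIV (\<lambda>x. \<sigma> * sgn x * f' (\<sigma> * abs x)) x :> f'' (\<sigma> * abs x)" (is ?B)
proof -
 have l: "DERIV (\<lambda>x. f (c * x)) x :> f' (c * x) * c" "DERIV (\<lambda>x. c * f' (c * x)) x :> c * (f'' (c * x) * c)" for c x
  by (intro DERIV_chain2[OF f(1)] DERIV_cmult DERIV_chain2[OF f(2)], (auto intro!: derivative_eq_intros)[1])+
 have "DERIV (\<lambda>x. if x < 0 then f (- \<sigma> * x) else f (\<sigma> * x)) x :> (if x < 0 then f' (- \<sigma> * x) * - \<sigma> else f' (\<sigma> * x) * \<sigma>)"
  by (rule glue_deriv_everywhere[OF l(1) l(1)]) (use 0 in auto)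
 moreover have "(\<lambda>x. if x < 0 then f (- \<sigma> * x) else f (\<sigma> * x)) = (\<lambda>x. f (\<sigma> * abs x))" by (auto simp: fun_eq_iff)
 moreover have "(if x < 0 then f' (- \<sigma> * x) * - \<sigma> else f' (\<sigma> * x) * \<sigma>) = \<sigma> * sgn x * f' (\<sigma> * abs x)" using 0 by (cases "x = 0") (auto simp: sgn_if)
 ultimately show ?A by simp
 have "((\<lambda>x. if x < 0 then - \<sigma> * f' (- \<sigma> * x) else \<sigma> * f' (\<sigma> * x)) has_real_derivative
   (if x < 0 then - \<sigma> * (f'' (- \<sigma> * x) * - \<sigma>) else \<sigma> * (f'' (\<sigma> * x) * \<sigma>))) (at x)"
  by (rule glue_deriv_everywhere[OF l(2) l(2)]) (use 0 in auto)
 moreover have "(\<lambda>x. if x < 0 then - \<sigma> * f' (- \<sigma> * x) else \<sigma> * f' (\<sigma> * x)) = (\<lambda>x. \<sigma> * sgn x * f' (\<sigma> * abs x))"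
  using 0 by (auto simp: fun_eq_iff sgn_if)
 moreover have "(if x < 0 then - \<sigma> * (f'' (- \<sigma> * x) * - \<sigma>) else \<sigma> * (f'' (\<sigma> * x) * \<sigma>)) = f'' (\<sigma> * abs x)" using \<sigma> by auto
 ultimately show ?B by simp
qed

lemma fold_coord_nth [simp]: "fold_coord k s u $ i = (if i = k then s * abs (u $ i) else u $ i)"
 by (simp add: fold_coord_def)

lemma fold_coord_reflect [simp]: "fold_coord k s (reflect k u) = fold_coord k s u"
 by (simp add: vec_eq_iff)

text \<open>This is where the Neumann condition on test functions enters: it makes the even
  extension of one side twice differentiable in each coordinate. Only the normal first derivative
  acquires a sign, and that sign jumps at zeros of \<open>D1 k\<close>.\<close>

lemma heat_test_fold:
 fixes k :: "'d::finite"
 assumes h: "heat_test t R G Gt D1 D2" and \<sigma>: "\<sigma> = 1 \<or> \<sigma> = -1"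
  and flat: "\<And>s u. s \<in> {0..t} ==> u $ k = 0 ==> D1 k s u = 0"
 shows "heat_test t R (\<lambda>s u. G s (fold_coord k \<sigma> u)) (\<lambda>s u. Gt s (fold_coord k \<sigma> u))
  (\<lambda>i s u. (if i = k then \<sigma> * sgn (u $ k) else 1) * D1 i s (fold_coord k \<sigma> u)) (\<lambda>i s u. D2 i s (fold_coord k \<sigma> u))"
proof -
 let ?f = "fold_coord k \<sigma> :: real^'d => real^'d"
 have "abs (?f u $ i) = abs (u $ i)" for u i using \<sigma> by (auto simp: abs_mult)
 hence cube: "?f u \<in> cube R \<longleftrightarrow> u \<in> cube R" for u by (simp only: cube_iff)
 have hd: "((\<lambda>r. G r u) has_real_derivative Gt s u) (at s within {0..t})"
  "DERIV (\<lambda>x. G s (u + x *\<^sub>R axis i 1)) 0 :> D1 i s u"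
  "DERIV (\<lambda>x. D1 i s (u + x *\<^sub>R axis i 1)) 0 :> D2 i s u" if "s \<in> {0..t}" for s u i
  using h that by (auto simp: heat_test_def)
 have cf: "continuous_on ({0..t} \<times> UNIV) (\<lambda>(s, u). E s (?f u))" if "continuous_on ({0..t} \<times> UNIV) (\<lambda>(s, u). E s u)" for E :: "real => real^'d => real"
 proof -
  have "continuous_on ({0..t} \<times> UNIV) (\<lambda>p. case (fst p, ?f (snd p)) of (s, u) => E s u)"
   by (rule continuous_on_compose2[OF that])
    (auto intro!: continuous_intros continuous_on_compose2[OF fold_coord_continuous[of UNIV] continuous_on_snd[OF continuous_on_id]])
  thus ?thesis by (simp add: case_prod_unfold)
 qed
 have c: "continuous_on ({0..t} \<times> UNIV) (\<lambda>(s, u). G s u)" "continuous_on ({0..t} \<times> UNIV) (\<lambda>(s, u). Gt s u)"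
  "\<And>i. continuous_on ({0..t} \<times> UNIV) (\<lambda>(s, u). D1 i s u)" "\<And>i. continuous_on ({0..t} \<times> UNIV) (\<lambda>(s, u). D2 i s u)"
  using h by (auto simp: heat_test_def)
 have flat0: "D1 k s (?f u) = 0" if "s \<in> {0..t}" "u $ k = 0" for s u by (rule flat[OF that(1)]) (use that in simp)
 have cD1: "continuous_on ({0..t} \<times> UNIV) (\<lambda>(s, u). (if i = k then \<sigma> * sgn (u $ k) else 1) * D1 i s (?f u))" for i
 proof (cases "i = k")
  case True
  have b: "continuous_on B (\<lambda>p. a * D1 k (fst p) (?f (snd p)))" if "B \<subseteq> {0..t} \<times> UNIV" for B a
   using continuous_on_subset[OF cf[OF c(3)[of k]] that] by (intro continuous_intros) (simp add: case_prod_unfold)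
  have "continuous_on ({0..t} \<times> UNIV) (\<lambda>p. if snd p $ k <= 0 then - \<sigma> * D1 k (fst p) (?f (snd p)) else \<sigma> * D1 k (fst p) (?f (snd p)))"
   by (rule continuous_on_cases_le[where h = "\<lambda>p. snd p $ k"]) (use flat0 in \<open>auto intro!: b continuous_intros\<close>)
  thus ?thesis
   by (rule continuous_on_eq) (use True flat0 in \<open>auto simp: sgn_if\<close>)
 qed (use cf[OF c(3)] in simp)
 have dk: "DERIV (\<lambda>x. G s (?f (u + x *\<^sub>R axis k 1))) 0 :> \<sigma> * sgn (u $ k) * D1 k s (?f u)"
  "DERIV (\<lambda>x. \<sigma> * sgn ((u + x *\<^sub>R axis k 1) $ k) * D1 k s (?f (u + x *\<^sub>R axis k 1))) 0 :> D2 k s (?f u)"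
  if s: "s \<in> {0..t}" for s u
 proof -
  define u0 where "u0 = u - (u $ k) *\<^sub>R axis k 1"
  have fu: "?f (u + x *\<^sub>R axis k 1) = u0 + (\<sigma> * abs (u $ k + x)) *\<^sub>R axis k 1" for x
   by (auto simp: vec_eq_iff u0_def axis_def)
  have line: "DERIV (\<lambda>y. f (u0 + y *\<^sub>R axis k 1)) y :> f' (u0 + y *\<^sub>R axis k 1)"
   if "\<And>u. DERIV (\<lambda>x. f (u + x *\<^sub>R axis k 1)) 0 :> f' u" for f f' y
   using that[of "u0 + y *\<^sub>R axis k 1"] DERIV_shift[of "\<lambda>y. f (u0 + y *\<^sub>R axis k 1)" "f' (u0 + y *\<^sub>R axis k 1)" 0 y]
   by (simp add: scaleR_add_left add_ac)
  have z: "D1 k s (u0 + 0 *\<^sub>R axis k 1) = 0" by (rule flat[OF s]) (simp add: u0_def)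
  note e = even_extension_deriv[where f = "\<lambda>y. G s (u0 + y *\<^sub>R axis k 1)", OF line[OF hd(2)[OF s]] line[OF hd(3)[OF s]] z \<sigma>, of "u $ k"]
  have f0: "?f u = u0 + (\<sigma> * abs (u $ k)) *\<^sub>R axis k 1" using fu[of 0] by simp
  have shift: "DERIV (\<lambda>x. f (u $ k + x)) 0 :> d" if "DERIV f (u $ k) :> d" for f d
   using that DERIV_shift[of f d 0 "u $ k"] by (simp add: add.commute)
  show "DERIV (\<lambda>x. G s (?f (u + x *\<^sub>R axis k 1))) 0 :> \<sigma> * sgn (u $ k) * D1 k s (?f u)"
   using shift[OF e(1)] unfolding fu f0 .
  show "DERIV (\<lambda>x. \<sigma> * sgn ((u + x *\<^sub>R axis k 1) $ k) * D1 k s (?f (u + x *\<^sub>R axis k 1))) 0 :> D2 k s (?f u)"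
   using shift[OF e(2)] unfolding fu f0 by simp
 qed
 have di: "DERIV (\<lambda>x. G s (?f (u + x *\<^sub>R axis i 1))) 0 :> D1 i s (?f u)"
  "DERIV (\<lambda>x. D1 i s (?f (u + x *\<^sub>R axis i 1))) 0 :> D2 i s (?f u)" if "s \<in> {0..t}" "i ~= k" for s u i
 proof -
  have "?f (u + x *\<^sub>R axis i 1) = ?f u + x *\<^sub>R axis i 1" for x using that(2) by (auto simp: vec_eq_iff axis_def)
  thus "DERIV (\<lambda>x. G s (?f (u + x *\<^sub>R axis i 1))) 0 :> D1 i s (?f u)"
   "DERIV (\<lambda>x. D1 i s (?f (u + x *\<^sub>R axis i 1))) 0 :> D2 i s (?f u)"
   using hd(2,3)[OF that(1)] by auto
 qed
 show ?thesis
  unfolding heat_test_def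
 proof (intro conjI ballI allI impI cf c cD1)
  fix s u assume s: "s \<in> {0..t}"
  show "((\<lambda>r. G r (?f u)) has_real_derivative Gt s (?f u)) (at s within {0..t})" by (rule hd(1)[OF s])
  show "((\<lambda>x. G s (?f (u + x *\<^sub>R axis i 1))) has_real_derivative (if i = k then \<sigma> * sgn (u $ k) else 1) * D1 i s (?f u)) (at 0)" for i
   using dk(1)[OF s] di(1)[OF s] by (cases "i = k") auto
  show "DERIV (\<lambda>x. (if i = k then \<sigma> * sgn ((u + x *\<^sub>R axis i 1) $ k) else 1) * D1 i s (?f (u + x *\<^sub>R axis i 1))) 0 :> D2 i s (?f u)" for i
   using dk(2)[OF s] di(2)[OF s] by (cases "i = k") auto
  assume u: "u \<notin> cube R"
  hence "?f u \<notin> cube R" by (simp add: cube)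
  thus "G s (?f u) = 0" "Gt s (?f u) = 0" "(if i = k then \<sigma> * sgn (u $ k) else 1) * D1 i s (?f u) = 0" "D2 i s (?f u) = 0" for i
   using h s by (auto simp: heat_test_def)
 qed
qed

lemma lborel_reflect:
 fixes f :: "real^'d::finite => real"
 assumes "f \<in> borel_measurable borel"
 shows "(LINT u|lborel. f (reflect k u)) = (LINT u|lborel. f u)" (is ?A) "integrable lborel f ==> integrable lborel (\<lambda>u. f (reflect k u))"
proof -
 define c where "c j = (if j = (axis k 1 :: real^'d) then - 1 else 1 :: real)" for j
 have "lborel = density (distr lborel borel (\<lambda>x :: real^'d. 0 + (\<Sum>j\<in>Basis. (c j * (x \<bullet> j)) *\<^sub>R j))) (\<lambda>_. ennreal (\<Prod>j\<in>(Basis :: (real^'d) set). abs (c j)))"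
  by (rule lborel_affine_euclidean) (simp add: c_def)
 moreover have "(\<lambda>x :: real^'d. 0 + (\<Sum>j\<in>Basis. (c j * (x \<bullet> j)) *\<^sub>R j)) = reflect k"
 proof
  fix x :: "real^'d"
  have inj: "inj (\<lambda>i::'d. axis i (1::real))" by (auto simp: inj_on_def axis_eq_axis)
  have B: "(Basis :: (real^'d) set) = range (\<lambda>i. axis i 1)" by (auto simp: Basis_vec_def)
  have "(\<Sum>j\<in>Basis. (c j * (x \<bullet> j)) *\<^sub>R j) = (\<Sum>i\<in>UNIV. (c (axis i 1) * x $ i) *\<^sub>R (axis i 1 :: real^'d))"
   unfolding B sum.reindex[OF inj] o_def by (simp add: inner_axis)
  also have "\<dots> = reflect k x"
   by (auto simp: vec_eq_iff axis_def c_def axis_eq_axis if_distrib[of "\<lambda>y. _ * y"] sum.delta cong: if_cong)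
  finally show "0 + (\<Sum>j\<in>Basis. (c j * (x \<bullet> j)) *\<^sub>R j) = reflect k x" by simp
 qed
 moreover have "(\<Prod>j\<in>(Basis :: (real^'d) set). abs (c j)) = 1" by (rule prod.neutral) (simp add: c_def)
 ultimately have d: "distr lborel borel (reflect k) = (lborel :: (real^'d) measure)" by (simp add: density_1)
 have m: "reflect k \<in> (lborel :: (real^'d) measure) \<rightarrow>\<^sub>M borel" using borel_measurable_continuous_onI[OF reflect_continuous] by simp
 show ?A "integrable lborel f ==> integrable lborel (\<lambda>u. f (reflect k u))"
  using integral_distr[OF m assms] integrable_distr_eq[OF m assms] unfolding d by auto
qed

text \<open>The Gaussian law is invariant under the reflection.\<close>

lemma heat_evol_reflect:
 fixes g :: "real^'d::finite => real"
 assumes g: "g \<in> borel_measurable borel" and even: "\<And>u. g (reflect k u) = g u"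
 shows "heat_evol \<kappa> g s (reflect k u) = heat_evol \<kappa> g s u"
proof -
 let ?c = "sqrt (2 * \<kappa> * s)"
 let ?d = "\<lambda>z :: real^'d. \<Prod>i\<in>UNIV. std_normal_density (z $ i)"
 note [measurable] = g
 have "reflect k u - ?c *\<^sub>R z = reflect k (u - ?c *\<^sub>R reflect k z)" for z by (simp add: vec_eq_iff)
 hence e: "g (reflect k u - ?c *\<^sub>R z) = g (u - ?c *\<^sub>R reflect k z)" for z by (simp add: even)
 have dr: "?d (reflect k z) = ?d z" for z by (rule prod.cong) (auto simp: std_normal_density_def)
 have "heat_evol \<kappa> g s v = (LINT z|lborel. ?d z * g (v - ?c *\<^sub>R z))" for v
  unfolding heat_evol_def std_gauss_def by (subst integral_density) (auto intro!: prod_nonneg)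
 note this[of "reflect k u"] also have "(LINT z|lborel. ?d z * g (reflect k u - ?c *\<^sub>R z)) = (LINT z|lborel. ?d (reflect k z) * g (u - ?c *\<^sub>R reflect k z))"
  unfolding e dr ..
 also have "\<dots> = (LINT z|lborel. ?d z * g (u - ?c *\<^sub>R z))" by (rule lborel_reflect(1)) measurable
 also have "\<dots> = heat_evol \<kappa> g s u"
  unfolding heat_evol_def std_gauss_def by (subst integral_density) (auto intro!: prod_nonneg)
 finally show ?thesis .
qed

text \<open>Adding the integrand to its reflection gives \<open>p + q\<close> off the hyperplane,
  which is a null set.\<close>

lemma even_halves_integral:
 fixes p q :: "real^'d::finite => real"
 assumes p: "integrable lborel p" "\<And>u. p (reflect k u) = p u" and q: "integrable lborel q" "\<And>u. q (reflect k u) = q u"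
 shows "(LINT u|lborel. (if u $ k < 0 then p u else q u)) = (LINT u|lborel. p u) / 2 + (LINT u|lborel. q u) / 2"
proof -
 define f where "f u = (if u $ k < 0 then p u else q u)" for u
 have [measurable]: "p \<in> borel_measurable borel" "q \<in> borel_measurable borel" using p q by (auto dest: borel_measurable_integrable)
 have fm: "f \<in> borel_measurable borel" unfolding f_def[abs_def] by measurable
 have i: "integrable lborel f"
  by (rule Bochner_Integration.integrable_bound[OF Bochner_Integration.integrable_add[OF integrable_abs[OF p(1)] integrable_abs[OF q(1)]]])
   (use fm in \<open>auto simp: f_def\<close>)
 have "(LINT u|lborel. f u) + (LINT u|lborel. f (reflect k u)) = (LINT u|lborel. f u + f (reflect k u))"
  by (rule Bochner_Integration.integral_add[symmetric, OF i lborel_reflect(2)[OF fm i]])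
 also have "\<dots> = (LINT u|lborel. p u + q u)"
 proof (rule integral_cong_AE)
  have "(\<lambda>u. f (reflect k u)) \<in> borel_measurable borel"
   using borel_measurable_integrable[OF lborel_reflect(2)[OF fm i]] by simp
  thus "(\<lambda>u. f u + f (reflect k u)) \<in> borel_measurable lborel" using fm by simp
  show "AE u in lborel. f u + f (reflect k u) = p u + q u"
   using AE_off_hyperplane[of k] by eventually_elim (use p q in \<open>auto simp: f_def\<close>)
 qed simp
 also have "\<dots> = (LINT u|lborel. p u) + (LINT u|lborel. q u)" by (rule Bochner_Integration.integral_add[OF p(1) q(1)])
 finally have "(LINT u|lborel. f u) = (LINT u|lborel. p u) / 2 + (LINT u|lborel. q u) / 2"
  unfolding lborel_reflect(1)[OF fm] by simp
 thus ?thesis unfolding f_def .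
qed

theorem heat_weak_solution_exists:
 fixes g :: "real^'d::finite => real"
 assumes \<kappa>: "\<kappa> > 0" and g: "g \<in> borel_measurable borel" "\<And>u. g u \<in> {0..1}"
 shows "heat_weak_solution k T \<kappa> g (heat_evol \<kappa> g)"
 unfolding heat_weak_solution_def
proof (intro conjI ballI)
 show "profile T (heat_evol \<kappa> g)"
  unfolding profile_def using heat_evol_profile[OF g] by (auto intro: measurable_restrict_space1)
 fix t G assume t: "t \<in> {0..T}" and "G \<in> (S_Dif :: (real => real^'d => real) set)"
 then obtain R where h: "heat_test t R G (time_deriv G) (\<lambda>i s. partial_deriv i (G s)) (\<lambda>i s. partial_deriv i (partial_deriv i (G s)))"
  using S_Dif_heat_test by blast
 have "glue k (G, G) = G" by (auto simp: glue_def fun_eq_iff)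
 moreover have "L_Delta k (G, G) s u = (\<Sum>i\<in>UNIV. partial_deriv i (partial_deriv i (G s)) u)" for s u by (simp add: L_Delta_def laplacian_def)
 ultimately show "F_Dif k t (heat_evol \<kappa> g) (G, G) g \<kappa> = 0"
  using heat_evol_weak(2)[OF \<kappa> _ h g] t by (simp add: F_Dif_def)
qed

text \<open>The half-space identities are halves of whole-space ones: on each side the datum and the
  test function are extended evenly, the evolution stays even, and
  \<open>even_halves_integral\<close> adds the two halves up.\<close>

theorem neumann_weak_solution_exists:
 fixes k :: "'d::finite" and g :: "real^'d => real"
 assumes \<kappa>: "\<kappa> > 0" and g: "g \<in> borel_measurable borel" "\<And>u. g u \<in> {0..1}"
 shows "\<exists>\<rho>. neumann_weak_solution k T \<kappa> g \<rho>"
proof -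
 let ?f = "\<lambda>\<sigma>. fold_coord k \<sigma> :: real^'d => real^'d"
 define e where "e \<sigma> u = g (?f \<sigma> u)" for \<sigma> u
 have fm: "?f \<sigma> \<in> borel \<rightarrow>\<^sub>M borel" for \<sigma> by (rule borel_measurable_continuous_onI[OF fold_coord_continuous])
 have em: "e \<sigma> \<in> borel_measurable borel" for \<sigma> unfolding e_def[abs_def] by (rule measurable_compose[OF fm g(1)])
 have e01: "e \<sigma> u \<in> {0..1}" for \<sigma> u unfolding e_def by (rule g(2))
 have er: "e \<sigma> (reflect k u) = e \<sigma> u" for \<sigma> u by (simp add: e_def)
 define Q where "Q \<sigma> = heat_evol \<kappa> (e \<sigma>)" for \<sigma>
 have Qp: "(\<lambda>(s, u). Q \<sigma> s u) \<in> borel_measurable borel" "Q \<sigma> s u \<in> {0..1}" "Q \<sigma> 0 u = e \<sigma> u" "Q \<sigma> s \<in> borel_measurable borel" for \<sigma> s u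
  unfolding Q_def by (rule heat_evol_profile[OF em e01])+
 have Qr: "Q \<sigma> s (reflect k u) = Q \<sigma> s u" for \<sigma> s u unfolding Q_def by (rule heat_evol_reflect[OF em er])
 have fold_id: "u $ k < 0 ==> ?f (-1) u = u" "\<not> u $ k < 0 ==> ?f 1 u = u" for u by (auto simp: vec_eq_iff)
 define \<rho> where "\<rho> s u = (if u $ k < 0 then Q (-1) s u else Q 1 s u)" for s u
 have prof: "profile T \<rho>"
  unfolding profile_def
 proof (intro conjI ballI allI measurable_restrict_space1)
  have "(\<lambda>p :: real \<times> (real^'d). if snd p $ k < 0 then (case p of (s, u) => Q (-1) s u) else (case p of (s, u) => Q 1 s u)) \<in> borel_measurable borel"
  proof (rule measurable_If)
   have "{p :: real \<times> (real^'d). snd p $ k < 0} \<in> sets borel"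
    by (rule borel_open) (intro open_Collect_less continuous_intros)
   thus "{p \<in> space borel. (snd p :: real^'d) $ k < 0} \<in> sets (borel :: (real \<times> (real^'d)) measure)" by simp
  qed (rule Qp)+
  thus "(\<lambda>(s, u). \<rho> s u) \<in> borel_measurable borel" unfolding \<rho>_def case_prod_unfold .
  show "\<rho> s u \<in> {0..1}" for s u using Qp(2) by (simp add: \<rho>_def)
 qed
 have "F_Dif k t \<rho> (Gm, Gp) g \<kappa> = 0" if t: "t \<in> {0..T}" and N: "(Gm, Gp) \<in> S_Neu k T" for t Gm Gp
 proof -
  have t0: "t >= 0" using t by simp
  \<comment> \<open>The index \<open>1\<close> stands for the upper side, \<open>-1\<close> for the
    lower one, matching the sign in \<open>fold_coord\<close>.\<close>
  define G where "G \<sigma> = (if \<sigma> = (1::real) then Gp else Gm)" for \<sigma>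
  define E where "E \<sigma> s u = \<kappa> * (\<Sum>i\<in>UNIV. partial_deriv i (partial_deriv i (G \<sigma> s)) (?f \<sigma> u)) + time_deriv (G \<sigma>) s (?f \<sigma> u)" for \<sigma> s u
  define ht where "ht \<sigma> R \<longleftrightarrow> heat_test t R (\<lambda>s u. G \<sigma> s (?f \<sigma> u)) (\<lambda>s u. time_deriv (G \<sigma>) s (?f \<sigma> u))
   (\<lambda>i s u. (if i = k then \<sigma> * sgn (u $ k) else 1) * partial_deriv i (G \<sigma> s) (?f \<sigma> u))
   (\<lambda>i s u. partial_deriv i (partial_deriv i (G \<sigma> s)) (?f \<sigma> u))" for \<sigma> R
  have "\<exists>R. ht \<sigma> R" if \<sigma>: "\<sigma> = 1 \<or> \<sigma> = -1" for \<sigma>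
  proof -
   have "G \<sigma> \<in> S_Dif" using N by (auto simp: S_Neu_def G_def)
   then obtain R where "heat_test t R (G \<sigma>) (time_deriv (G \<sigma>)) (\<lambda>i s. partial_deriv i (G \<sigma> s)) (\<lambda>i s. partial_deriv i (partial_deriv i (G \<sigma> s)))"
    using S_Dif_heat_test by blast
   from heat_test_fold[OF this \<sigma>] show ?thesis using N t unfolding ht_def by (fastforce simp: S_Neu_def G_def)
  qed
  then obtain Rs where "ht \<sigma> (Rs \<sigma>)" if "\<sigma> = 1 \<or> \<sigma> = -1" for \<sigma> by metis
  note h = this[unfolded ht_def]
  have int: "integrable lborel (\<lambda>u. Q \<sigma> r u * A s u)"
   if A: "continuous_on ({0..t} \<times> UNIV) (\<lambda>(s, u). A s u)" "\<And>s u. s \<in> {0..t} ==> u \<notin> cube R ==> A s u = 0" and s: "s \<in> {0..t}" for \<sigma> A r R s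
  proof -
   obtain M where "\<And>s u. s \<in> {0..t} ==> abs (A s u) <= M * Wd u" using support_bound[OF A] by blast
   hence "abs (A s u) <= M * Wd u" for u using s by blast
   from integrable_profile_mult[OF Qp(4) Qp(2) borel_measurable_continuous_onI[OF continuous_slice[OF A(1) s]] this] show ?thesis .
  qed
  have iG: "integrable lborel (\<lambda>u. Q \<sigma> r u * G \<sigma> s (?f \<sigma> u))" if "\<sigma> = 1 \<or> \<sigma> = -1" "s \<in> {0..t}" for \<sigma> r s
   by (rule int[where R = "Rs \<sigma>"]) (use h[OF that(1)] that(2) in \<open>auto simp: heat_test_def\<close>)
  have iE: "integrable lborel (\<lambda>u. Q \<sigma> s u * E \<sigma> s u)" if "\<sigma> = 1 \<or> \<sigma> = -1" "s \<in> {0..t}" for \<sigma> s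
   unfolding E_def by (rule int[OF heat_test_generator[OF h[OF that(1)]] that(2)])
  define V where "V \<sigma> s = (LINT u|lborel. Q \<sigma> s u * E \<sigma> s u)" for \<sigma> s
  define W where "W \<sigma> s = (LINT u|lborel. Q \<sigma> s u * G \<sigma> s (?f \<sigma> u))" for \<sigma> s
  have weak: "set_integrable lborel {0..t} (V \<sigma>)" "W \<sigma> t - W \<sigma> 0 = (LINT s:{0..t}|lborel. V \<sigma> s)" if "\<sigma> = 1 \<or> \<sigma> = -1" for \<sigma>
   using heat_evol_weak[OF \<kappa> t0 h[OF that] em[of \<sigma>] e01[of \<sigma>]] Qp(3)[of \<sigma>] unfolding V_def W_def E_def Q_def by simp_all
  have Wg: "(LINT u|lborel. \<rho> s u * glue k (Gm, Gp) s u) = W (-1) s / 2 + W 1 s / 2" if s: "s \<in> {0..t}" for s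
  proof -
   have "\<rho> s u * glue k (Gm, Gp) s u = (if u $ k < 0 then Q (-1) s u * G (-1) s (?f (-1) u) else Q 1 s u * G 1 s (?f 1 u))" for u
    using fold_id[of u] by (simp add: \<rho>_def glue_def G_def)
   thus ?thesis
    unfolding W_def using even_halves_integral[OF iG[of "-1" s s] _ iG[of 1 s s], of k] s by (simp add: Qr)
  qed
  have Vg: "(LINT u|lborel. \<rho> s u * (\<kappa> * L_Delta k (Gm, Gp) s u + time_deriv (glue k (Gm, Gp)) s u)) = V (-1) s / 2 + V 1 s / 2" if s: "s \<in> {0..t}" for s
  proof -
   have td: "time_deriv (glue k (Gm, Gp)) s u = (if u $ k < 0 then time_deriv Gm s u else time_deriv Gp s u)" for u
    by (simp add: time_deriv_def glue_def)
   have "\<rho> s u * (\<kappa> * L_Delta k (Gm, Gp) s u + time_deriv (glue k (Gm, Gp)) s u) = (if u $ k < 0 then Q (-1) s u * E (-1) s u else Q 1 s u * E 1 s u)" for u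
    unfolding td using fold_id[of u] by (simp add: \<rho>_def L_Delta_def laplacian_def E_def G_def)
   thus ?thesis
    unfolding V_def using even_halves_integral[OF iE[of "-1" s] _ iE[of 1 s], of k] s by (simp add: Qr E_def)
  qed
  have \<rho>0: "\<rho> 0 u = g u" for u using fold_id[of u] Qp(3) by (simp add: \<rho>_def e_def)
  have "(LINT s:{0..t}|lborel. LINT u|lborel. \<rho> s u * (\<kappa> * L_Delta k (Gm, Gp) s u + time_deriv (glue k (Gm, Gp)) s u)) =
   (LINT s:{0..t}|lborel. V (-1) s / 2 + V 1 s / 2)"
   by (rule set_lebesgue_integral_cong) (use Vg in auto)
  also have "\<dots> = (LINT s:{0..t}|lborel. V (-1) s) / 2 + (LINT s:{0..t}|lborel. V 1 s) / 2"
   using set_integral_add(2)[of lborel "{0..t}" "\<lambda>s. V (-1) s / 2" "\<lambda>s. V 1 s / 2"] weak(1) by simp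
  finally show ?thesis
   using Wg[of t] Wg[of 0] weak(2) t0 unfolding F_Dif_def by (simp add: \<rho>0 field_simps)
 qed
 hence "neumann_weak_solution k T \<kappa> g \<rho>" using prof by (auto simp: neumann_weak_solution_def)
 thus ?thesis by blast
qed

theorem theorem2p14:
  fixes k :: "'d::finite" and T \<alpha> \<beta> \<gamma> :: real
    and g :: "real^'d \<Rightarrow> real"
    and \<mu> :: "nat \<Rightarrow> 'd config measure"
    and P :: "nat \<Rightarrow> (real \<Rightarrow> 'd config) measure"
  assumes "T > 0"
    and "g \<in> borel_measurable borel" and "\<forall>u. g u \<in> {0..1}"
    and "\<forall>n\<ge>1. prob_space (\<mu> n) \<and> sets (\<mu> n) = sets borel"
    and "associated \<mu> g"
    and "\<forall>n\<ge>1. exclusion_law k T \<alpha> \<beta> \<gamma> n (\<mu> n) (P n)"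
  shows "((\<alpha>, \<beta>) = (1, 0) \<and> \<gamma> \<ge> 2 \<longrightarrow>
           (\<exists>\<rho>. unique_solution T (heat_weak_solution k T (diff_coeff TYPE('d) \<gamma>) g) \<rho> \<and>
                hydrodynamic_limit T P \<rho>)) \<and>
         (\<alpha> > 0 \<and> (\<beta>, \<gamma>) \<in> R0 \<longrightarrow>
           (\<exists>\<rho>. unique_solution T (neumann_weak_solution k T (diff_coeff TYPE('d) \<gamma>) g) \<rho> \<and>
                hydrodynamic_limit T P \<rho>))"
proof -
 let ?\<kappa> = "diff_coeff TYPE('d) \<gamma>"
 have g01: "g u \<in> {0..1}" for u using assms(3) by simp
 have main: "\<exists>\<rho>. unique_solution T (weak_solution slow k T ?\<kappa> g) \<rho> \<and> hydrodynamic_limit T P \<rho>" if r: "regime slow \<alpha> \<beta> \<gamma>" for slow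
 proof -
  have \<kappa>: "?\<kappa> > 0" by (rule diff_coeff_pos[OF regimeD(1)[OF r]])
  have "\<exists>\<rho>. weak_solution slow k T ?\<kappa> g \<rho>"
   using heat_weak_solution_exists[OF \<kappa> assms(2) g01] neumann_weak_solution_exists[OF \<kappa> assms(2) g01]
   by (cases slow) (auto simp: weak_solution_def)
  then obtain \<rho> where \<rho>: "weak_solution slow k T ?\<kappa> g \<rho>" ..
  show ?thesis
   using weak_solution_unique[OF \<kappa> assms(2) g01 \<rho>]
    weak_solution_hydrodynamic_limit[OF assms(2) g01 assms(4)[rule_format] assms(5) assms(6)[rule_format] r \<rho>] by blast
 qed
 show ?thesis using main[of False] main[of True] by (auto simp: weak_solution_def regime_def)
qed

end
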